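(* Let $\mathfrak g=sl(3,\mathbb O)$, with the vector space decompositions $\mathfrak g=R\oplus B=T_1\oplus T_{(2,3)}=H\oplus H^\perp$ and the complex-linear maps $\phi^*_{(t)},\phi^*_{(2,3)},\phi^*_{(H^\perp)}$ of $\mathfrak g\otimes\mathbb C$ defined in the context. For each map $\phi^*$ below put $g'=\phi^*(\mathfrak g)$ (a real form of the complex Lie algebra $E_6$), $\mathcal P=g'\cap\mathfrak g$, and let $g'_{(c)}=g'\cap(R\oplus\sqrt{-1}\,B)$ be its maximal compact subalgebra. Then $\mathcal P$ and the preimage $(\phi^* )^{-1}(g'_{(c)})$ are subalgebras of $\mathfrak g$, and the signature of $g'$, and the isomorphism types and signatures of $\mathcal P$ and of $(\phi^* )^{-1}(g'_{(c)})\subset\mathfrak g$, are as follows. \begin{enumerate} \item $\phi^*=\mathrm{Id}$: $g'$ has signature $(52,26)$; $\mathcal P=sl(3,\mathbb O)$, $(52,26)$; preimage $su(3,\mathbb O)$, $(52,0)$. \item $\phi^*=\phi^*_{(t)}$: $g'$ $(78,0)$; $\mathcal P=su(3,\mathbb O)$, $(52,0)$; preimage $sl(3,\mathbb O)$, $(52,26)$. \item $\phi^*=\phi^*_{(2,3)}$: $g'$ $(52,26)$; $\mathcal P=sl(2,\mathbb O)\oplus u(1)$, $(36,10)$; preimage $su(2,1,\mathbb O)$, $(36,16)$. \item $\phi^*=\phi^*_{(H^\perp)}$: $g'$ $(36,42)$; $\mathcal P=sl(3,\mathbb H)\oplus su(2,\mathbb C)^C$, $(24,14)$; preimage $su(3,1,\mathbb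 H)_1$, $(24,12)$. \item $\phi^*=\phi^*_{(2,3)}\circ\phi^*_{(t)}$: $g'$ $(46,32)$; $\mathcal P=su(2,1,\mathbb O)$, $(36,16)$; preimage $so(9,1)\oplus u(1)$, $(36,10)$. \item $\phi^*=\phi^*_{(H^\perp)}\circ\phi^*_{(t)}$: $g'$ $(38,40)$; $\mathcal P=su(3,1,\mathbb H)_1$, $(24,12)$; preimage $sl(3,\mathbb H)\oplus su(2,\mathbb C)^C$, $(24,14)$. \item $\phi^*=\phi^*_{(2,3)}\circ\phi^*_{(H^\perp)}$: $g'$ $(36,42)$; $\mathcal P=sl(2,1,\mathbb H)\oplus su(2,\mathbb C)_2$, $(24,14)$; preimage $su(3,1,\mathbb H)_2$, $(24,12)$. \item $\phi^*=\phi^*_{(2,3)}\circ\phi^*_{(H^\perp)}\circ\phi^*_{(t)}$: $g'$ $(38,40)$; $\mathcal P=su(3,1,\mathbb H)_2$, $(24,12)$; preimage $sl(2,1,\mathbb H)\oplus su(2,\mathbb C)_2$, $(24,14)$. \end{enumerate}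
   Context: Octonions: $\mathbb O$ has real basis $1,i,j,k,k\ell,j\ell,i\ell,\ell$; the seven imaginary units square to $-1$ and anticommute, and each ordered triple $(i,j,k),(i,\ell,i\ell),(j,\ell,j\ell),(k,\ell,k\ell),(k\ell,j,i\ell),(i\ell,k,j\ell),(j\ell,i,k\ell)$ is a quaternionic triple $(p,q,r)$: $pq=r,\ qr=p,\ rp=q$. $M_3(\mathbb O)$ is the 27-dimensional real space of $3\times3$ octonionic hermitian matrices $\chi$ (first row $(p,\bar a,c)$, second row $(a,m,\bar b)$, third row $(\bar c,b,n)$, with $p,m,n\in\mathbb R$, $a,b,c\in\mathbb O$), with $\det\chi=pmn-(p|b|^2+m|c|^2+n|a|^2)+2\,\mathrm{Re}(\bar a\bar b\bar c)$. $SL(3,\mathbb O)$ is the group of real-linear maps of $M_3(\mathbb O)$ preserving $\det$ (a real form of $E_6$), and $sl(3,\mathbb O)$ is its Lie algebra. Finite transformations ($\alpha\in\mathbb R$; $q$ an imaginary basis unit; $I_2$ the $2\times2$ identity). With $\mathrm{X}\mapsto M\mathrm{X}M^\dagger$: boosts $B_{tz}$: $M=\mathrm{diag}(e^{\alpha/2},e^{-\alpha/2})$; $B_{tx}$: $M=\begin{pmatrix}\cosh\frac\alpha2&\sinh\frac\alpha2\\ \sinh\frac\alpha2&\cosh\frac\alpha2\end{pmatrix}$; $B_{tq}$: $M=\begin{pmatrix}\cosh\frac\alpha2&q\sinh\frac\alpha2\\-q\sinh\frac\alpha2&\cosh\frac\alpha2\end{pmatrix}$; rotations $R_{xq}$: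 $M=\mathrm{diag}(e^{q\alpha/2},e^{-q\alpha/2})$; $R_{xz}$: $M=\begin{pmatrix}\cos\frac\alpha2&-\sin\frac\alpha2\\ \sin\frac\alpha2&\cos\frac\alpha2\end{pmatrix}$; $R_{zq}$: $M=\begin{pmatrix}\cos\frac\alpha2&q\sin\frac\alpha2\\ q\sin\frac\alpha2&\cos\frac\alpha2\end{pmatrix}$. Transverse rotations $R_{p,q}$ ($p\neq q$ imaginary basis units): $\mathrm X\mapsto M_2(M_1\mathrm XM_1^\dagger)M_2^\dagger$, $M_1=-p\,I_2$, $M_2=(\cos\frac\alpha2\,p+\sin\frac\alpha2\,q)I_2$. For each $q$ choose three pairs $(p_1,p_1'),(p_2,p_2'),(p_3,p_3')$ with product $q$: $i:(j,k),(k\ell,j\ell),(\ell,i\ell)$; $j:(k,i),(i\ell,k\ell),(\ell,j\ell)$; $k:(i,j),(j\ell,i\ell),(\ell,k\ell)$; $k\ell:(j\ell,i),(j,i\ell),(k,\ell)$; $j\ell:(i,k\ell),(i\ell,k),(j,\ell)$; $i\ell:(k\ell,j),(k,j\ell),(i,\ell)$; $\ell:(i\ell,i),(j\ell,j),(k\ell,k)$. Put $A_q(\alpha)=R_{p_1,p_1'}(\alpha)\circ R_{p_2,p_2'}(-\alpha)$, $G_q(\alpha)=R_{p_1,p_1'}(\alpha)\circ R_{p_2,p_2'}(\alpha)\circ R_{p_3,p_3'}(-2\alpha)$, $S_q(\alpha)=R_{p_1,p_1'}(\alpha)\circ R_{p_2,p_2'}(\alpha)\circ R_{p_3,p_3'}(\alpha)$.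 Types: for a $2\times2$ matrix $M$, $M^{(1)}=\mathrm{diag}(M,1)$, $M^{(2)}=\mathrm{diag}(1,M)$ (block diagonal), and $M^{(3)}=\begin{pmatrix} M_{22}&0&M_{21}\\ 0&1&0\\ M_{12}&0&M_{11}\end{pmatrix}$. If $F$ is one of the transformations $B_{tz},B_{tx},B_{tq},R_{xq},R_{xz},R_{zq},R_{p,q},A_q,G_q,S_q$, with successive matrices $M_1,\dots,M_n$, then $F^{(a)}(\alpha)(\chi)=M_n^{(a)}(\cdots(M_1^{(a)}\chi M_1^{(a)\dagger})\cdots)M_n^{(a)\dagger}$, and $\dot F^{(a)}=\frac{d}{d\alpha}F^{(a)}(\alpha)|_{\alpha=0}\in sl(3,\mathbb O)$. One has $\dot A_q^{(1)}=\dot A_q^{(2)}=\dot A_q^{(3)}=:\dot A_q$, likewise $\dot G_q$. A basis of $sl(3,\mathbb O)$ is: $\dot B^{(1)}_{tz},\dot B^{(2)}_{tz}$; $\dot B^{(a)}_{tx},\dot B^{(a)}_{tq},\dot R^{(a)}_{xz},\dot R^{(a)}_{zq}$ ($a=1,2,3$); $\dot R^{(1)}_{xq},\dot A_q,\dot G_q,\dot S^{(1)}_q$ ($q$ over the seven imaginary units). Also $\dot B^{(3)}_{tz}=-\dot B^{(1)}_{tz}-\dot B^{(2)}_{tz}$. Subspaces (spans of basis elements): $B$ = all boosts $\dot B$; $R$ = all other basis elements; $T_{(2,3)}$ = $\dot B^{(a)}_{tx},\dot B^{(a)}_{tq},\dot R^{(a)}_{xz},\dot R^{(a)}_{zq}$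 with $a=2,3$; $T_1$ = all other basis elements; $H^\perp$ = basis elements carrying a label $q\in\{i,j,i\ell,j\ell\}$; $H$ = all other basis elements (labels in $\{k,k\ell,\ell\}$ or no octonionic label). Maps: $\phi^*_{(t)}$ is the complex-linear map of $sl(3,\mathbb O)\otimes\mathbb C$ equal to the identity on $R$ and to multiplication by $\sqrt{-1}$ on $B$; $\phi^*_{(2,3)}$ is the identity on $T_1$ and multiplication by $\sqrt{-1}$ on $T_{(2,3)}$; $\phi^*_{(H^\perp)}$ is the identity on $H$ and multiplication by $\sqrt{-1}$ on $H^\perp$. (The paper calls these involutive automorphisms, as they come from the automorphisms with $-1$ in place of $\sqrt{-1}$.) Signature $(n_-,n_+)$ of a subspace of a real form of $E_6$: numbers of compact and non-compact generators, i.e. the negative and positive indices of the Killing form of that real form restricted to the subspace. Names: $su(3,\mathbb O)$ is the compact real form of $F_4$; $su(2,1,\mathbb O)$ the real form of $F_4$ with signature $(36,16)$; $sl(2,\mathbb O)=so(9,1)$; $u(1)$ is the one-dimensional algebra spanned by $\dot B^{(2)}_{tz}-\dot B^{(3)}_{tz}$; $sl(3,\mathbb H)$ and $sl(2,1,\mathbb H)$ denote (different copies of) the real form of $A_5$ with signature $(21,14)$ (i.e. $su^*(6)$); $su(3,1,\mathbb H)_1,su(3,1,\mathbb H)_2$ are two different copies of the real form $sp(3,1)$ of $C_4$ with signature $(24,12)$; $su(2,\mathbb C)^C=\langle\dot A_k,\dot A_{k\ell},\dot A_\ell\rangle$; $su(2,\mathbb C)_2=\langle\dot G_k+2\dot S^{(1)}_k,\dot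 G_{k\ell}+2\dot S^{(1)}_{k\ell},\dot G_\ell+2\dot S^{(1)}_\ell\rangle$. *)

theory Defs
  imports "HOL-Analysis.Analysis"
begin

section \<open>Octonions\<close>

datatype iunit = Ui | Uj | Uk | Ukl | Ujl | Uil | Ul

lemma UNIV_iunit: "UNIV = {Ui, Uj, Uk, Ukl, Ujl, Uil, Ul}"
  using iunit.exhaust by blast

instance iunit :: finite
  by standard (simp add: UNIV_iunit)

text \<open>An octonion is a pair (real part, imaginary part).  The product on the type
  \<open>oct\<close> is \<open>omult\<close>; the library's product on vectors is componentwise and plays no role.\<close>

type_synonym oct = "real \<times> (real ^ iunit)"

definition quat_triples :: "(iunit \<times> iunit \<times> iunit) set" where
  "quat_triples = {(Ui, Uj, Uk), (Ui, Ul, Uil), (Uj, Ul, Ujl), (Uk, Ul, Ukl),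
                   (Ukl, Uj, Uil), (Uil, Uk, Ujl), (Ujl, Ui, Ukl)}"

definition cyclic_triple :: "iunit \<Rightarrow> iunit \<Rightarrow> iunit \<Rightarrow> bool" where
  "cyclic_triple p q r \<longleftrightarrow>
     (p, q, r) \<in> quat_triples \<or> (q, r, p) \<in> quat_triples \<or> (r, p, q) \<in> quat_triples"

text \<open>\<open>unit_sign p q r\<close> is the coefficient of \<open>r\<close> in the product of distinct imaginary units
  \<open>p\<close>, \<open>q\<close>; it vanishes for \<open>p = q\<close>, whose product is the real number \<open>-1\<close>.\<close>

definition unit_sign :: "iunit \<Rightarrow> iunit \<Rightarrow> iunit \<Rightarrow> real" where
  "unit_sign p q r = (if cyclic_triple p q r then 1 else if cyclic_triple q p r then -1 else 0)"

definition omult :: "oct \<Rightarrow> oct \<Rightarrow> oct" where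
  "omult x y =
     (fst x * fst y - (\<Sum>p\<in>UNIV. snd x $ p * snd y $ p),
      \<chi> r. fst x * snd y $ r + snd x $ r * fst y
           + (\<Sum>p\<in>UNIV. \<Sum>q\<in>UNIV. unit_sign p q r * snd x $ p * snd y $ q))"

definition oconj :: "oct \<Rightarrow> oct" where
  "oconj x = (fst x, - snd x)"

definition oreal :: "real \<Rightarrow> oct" where
  "oreal r = (r, 0)"

definition ounit :: "iunit \<Rightarrow> oct" where
  "ounit q = (0, axis q 1)"

definition onormsq :: "oct \<Rightarrow> real" where
  "onormsq x = fst (omult (oconj x) x)"


section \<open>Hermitian octonionic matrices and \<open>SL(3,O)\<close>\<close>

definition ommult :: "oct ^ 'n ^ 'm \<Rightarrow> oct ^ 'p ^ 'n \<Rightarrow> oct ^ 'p ^ 'm" where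
  "ommult A C = (\<chi> i j. \<Sum>k\<in>UNIV. omult (A $ i $ k) (C $ k $ j))"

definition odagger :: "oct ^ 'n ^ 'm \<Rightarrow> oct ^ 'm ^ 'n" where
  "odagger A = (\<chi> i j. oconj (A $ j $ i))"

text \<open>A hermitian matrix is given by its free entries \<open>(p, m, n, a, b, c)\<close>.\<close>

type_synonym h3o = "real \<times> real \<times> real \<times> oct \<times> oct \<times> oct"

fun h3o_mat :: "h3o \<Rightarrow> oct ^ 3 ^ 3" where
  "h3o_mat (p, m, n, a, b, c) =
     vector [vector [oreal p, oconj a, c],
             vector [a, oreal m, oconj b],
             vector [oconj c, b, oreal n]]"

text \<open>The inverse of \<open>h3o_mat\<close>, meaningful on hermitian matrices only.\<close>

definition mat_h3o :: "oct ^ 3 ^ 3 \<Rightarrow> h3o" where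
  "mat_h3o X = (fst (X $ 1 $ 1), fst (X $ 2 $ 2), fst (X $ 3 $ 3), X $ 2 $ 1, X $ 3 $ 2, X $ 1 $ 3)"

text \<open>The triple product in the determinant is bracketed to the left; its real part does not
  depend on the bracketing.\<close>

fun h3o_det :: "h3o \<Rightarrow> real" where
  "h3o_det (p, m, n, a, b, c) =
     p * m * n - (p * onormsq b + m * onormsq c + n * onormsq a)
     + 2 * fst (omult (omult (oconj a) (oconj b)) (oconj c))"

type_synonym endo = "h3o \<Rightarrow>\<^sub>L h3o"

definition SL3O :: "endo set" where
  "SL3O = {T. \<forall>x. h3o_det (blinfun_apply T x) = h3o_det x}"

text \<open>Lie algebra of a closed group of linear maps, as its tangent space at the identity.\<close>

definition lie_algebra_of :: "('v::real_normed_vector \<Rightarrow>\<^sub>L 'v) set \<Rightarrow> ('v \<Rightarrow>\<^sub>L 'v) set" where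
  "lie_algebra_of G =
     {D. \<exists>\<gamma>. (\<forall>t::real. \<gamma> t \<in> G) \<and> \<gamma> 0 = id_blinfun \<and> (\<gamma> has_vector_derivative D) (at 0)}"

definition sl3O :: "endo set" where
  "sl3O = lie_algebra_of SL3O"


section \<open>The generators of \<open>sl(3,O)\<close>\<close>

datatype slot = One | Two | Three

definition odiag2 :: "oct \<Rightarrow> oct ^ 2 ^ 2" where
  "odiag2 x = vector [vector [x, 0], vector [0, x]]"

fun slot_mat :: "slot \<Rightarrow> oct ^ 2 ^ 2 \<Rightarrow> oct ^ 3 ^ 3" where
  "slot_mat One M =
     vector [vector [M $ 1 $ 1, M $ 1 $ 2, 0],
             vector [M $ 2 $ 1, M $ 2 $ 2, 0],
             vector [0, 0, oreal 1]]"
| "slot_mat Two M =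
     vector [vector [oreal 1, 0, 0],
             vector [0, M $ 1 $ 1, M $ 1 $ 2],
             vector [0, M $ 2 $ 1, M $ 2 $ 2]]"
| "slot_mat Three M =
     vector [vector [M $ 2 $ 2, 0, M $ 2 $ 1],
             vector [0, oreal 1, 0],
             vector [M $ 1 $ 2, 0, M $ 1 $ 1]]"

text \<open>\<open>\<chi> \<mapsto> M \<chi> M\<^sup>\<dagger>\<close>.  For the matrices used below, the entries of \<open>M\<close> lie in one complex
  subalgebra, so the bracketing is immaterial and the result is hermitian.\<close>

definition sandwich :: "oct ^ 3 ^ 3 \<Rightarrow> h3o \<Rightarrow> h3o" where
  "sandwich M x = mat_h3o (ommult (ommult M (h3o_mat x)) (odagger M))"

text \<open>The matrices of a transformation are listed in the order in which they act.\<close>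

definition slot_action :: "slot \<Rightarrow> (oct ^ 2 ^ 2) list \<Rightarrow> h3o \<Rightarrow> h3o" where
  "slot_action a Ms = fold (\<lambda>M. sandwich (slot_mat a M)) Ms"

datatype xform = Btz | Btx | Btq iunit | Rxq iunit | Rxz | Rzq iunit | Aq iunit | Gq iunit | Sq iunit

definition transverse :: "iunit \<times> iunit \<Rightarrow> real \<Rightarrow> (oct ^ 2 ^ 2) list" where
  "transverse = (\<lambda>(p, q) \<alpha>.
     [odiag2 (- ounit p), odiag2 (cos (\<alpha>/2) *\<^sub>R ounit p + sin (\<alpha>/2) *\<^sub>R ounit q)])"

fun pair1 :: "iunit \<Rightarrow> iunit \<times> iunit" where
  "pair1 Ui = (Uj, Uk)"
| "pair1 Uj = (Uk, Ui)"
| "pair1 Uk = (Ui, Uj)"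
| "pair1 Ukl = (Ujl, Ui)"
| "pair1 Ujl = (Ui, Ukl)"
| "pair1 Uil = (Ukl, Uj)"
| "pair1 Ul = (Uil, Ui)"

fun pair2 :: "iunit \<Rightarrow> iunit \<times> iunit" where
  "pair2 Ui = (Ukl, Ujl)"
| "pair2 Uj = (Uil, Ukl)"
| "pair2 Uk = (Ujl, Uil)"
| "pair2 Ukl = (Uj, Uil)"
| "pair2 Ujl = (Uil, Uk)"
| "pair2 Uil = (Uk, Ujl)"
| "pair2 Ul = (Ujl, Uj)"

fun pair3 :: "iunit \<Rightarrow> iunit \<times> iunit" where
  "pair3 Ui = (Ul, Uil)"
| "pair3 Uj = (Ul, Ujl)"
| "pair3 Uk = (Ul, Ukl)"
| "pair3 Ukl = (Uk, Ul)"
| "pair3 Ujl = (Uj, Ul)"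
| "pair3 Uil = (Ui, Ul)"
| "pair3 Ul = (Ukl, Uk)"

fun xform_mats :: "xform \<Rightarrow> real \<Rightarrow> (oct ^ 2 ^ 2) list" where
  "xform_mats Btz \<alpha> =
     [vector [vector [oreal (exp (\<alpha>/2)), 0], vector [0, oreal (exp (-\<alpha>/2))]]]"
| "xform_mats Btx \<alpha> =
     [vector [vector [oreal (cosh (\<alpha>/2)), oreal (sinh (\<alpha>/2))],
              vector [oreal (sinh (\<alpha>/2)), oreal (cosh (\<alpha>/2))]]]"
| "xform_mats (Btq q) \<alpha> =
     [vector [vector [oreal (cosh (\<alpha>/2)), sinh (\<alpha>/2) *\<^sub>R ounit q],
              vector [- (sinh (\<alpha>/2) *\<^sub>R ounit q), oreal (cosh (\<alpha>/2))]]]"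
| "xform_mats (Rxq q) \<alpha> =
     [vector [vector [oreal (cos (\<alpha>/2)) + sin (\<alpha>/2) *\<^sub>R ounit q, 0],
              vector [0, oreal (cos (\<alpha>/2)) - sin (\<alpha>/2) *\<^sub>R ounit q]]]"
| "xform_mats Rxz \<alpha> =
     [vector [vector [oreal (cos (\<alpha>/2)), oreal (- sin (\<alpha>/2))],
              vector [oreal (sin (\<alpha>/2)), oreal (cos (\<alpha>/2))]]]"
| "xform_mats (Rzq q) \<alpha> =
     [vector [vector [oreal (cos (\<alpha>/2)), sin (\<alpha>/2) *\<^sub>R ounit q],
              vector [sin (\<alpha>/2) *\<^sub>R ounit q, oreal (cos (\<alpha>/2))]]]"
| "xform_mats (Aq q) \<alpha> =
     transverse (pair2 q) (-\<alpha>) @ transverse (pair1 q) \<alpha>"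
| "xform_mats (Gq q) \<alpha> =
     transverse (pair3 q) (-2*\<alpha>) @ transverse (pair2 q) \<alpha> @ transverse (pair1 q) \<alpha>"
| "xform_mats (Sq q) \<alpha> =
     transverse (pair3 q) \<alpha> @ transverse (pair2 q) \<alpha> @ transverse (pair1 q) \<alpha>"

definition dot :: "xform \<Rightarrow> slot \<Rightarrow> endo" where
  "dot F a = vector_derivative (\<lambda>\<alpha>. Blinfun (slot_action a (xform_mats F \<alpha>))) (at 0)"

definition basis_labels :: "(xform \<times> slot) set" where
  "basis_labels =
     {Btz} \<times> {One, Two}
     \<union> ({Btx, Rxz} \<union> range Btq \<union> range Rzq) \<times> {One, Two, Three}
     \<union> (range Rxq \<union> range Aq \<union> range Gq \<union> range Sq) \<times> {One}"

definition boost_labels :: "(xform \<times> slot) set" where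
  "boost_labels = basis_labels \<inter> ({Btz, Btx} \<union> range Btq) \<times> UNIV"

definition T23_labels :: "(xform \<times> slot) set" where
  "T23_labels = ({Btx, Rxz} \<union> range Btq \<union> range Rzq) \<times> {Two, Three}"

fun carried_unit :: "xform \<Rightarrow> iunit option" where
  "carried_unit Btz = None"
| "carried_unit Btx = None"
| "carried_unit Rxz = None"
| "carried_unit (Btq q) = Some q"
| "carried_unit (Rxq q) = Some q"
| "carried_unit (Rzq q) = Some q"
| "carried_unit (Aq q) = Some q"
| "carried_unit (Gq q) = Some q"
| "carried_unit (Sq q) = Some q"

definition Hperp_labels :: "(xform \<times> slot) set" where
  "Hperp_labels = {(F, a) \<in> basis_labels. carried_unit F \<in> Some ` {Ui, Uj, Uil, Ujl}}"

definition gen_span :: "(xform \<times> slot) set \<Rightarrow> endo set" where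
  "gen_span \<Lambda> = span ((\<lambda>(F, a). dot F a) ` \<Lambda>)"

definition B_space :: "endo set" where "B_space = gen_span boost_labels"
definition R_space :: "endo set" where "R_space = gen_span (basis_labels - boost_labels)"
definition T23_space :: "endo set" where "T23_space = gen_span T23_labels"
definition T1_space :: "endo set" where "T1_space = gen_span (basis_labels - T23_labels)"
definition Hperp_space :: "endo set" where "Hperp_space = gen_span Hperp_labels"
definition H_space :: "endo set" where "H_space = gen_span (basis_labels - Hperp_labels)"

definition set_sum :: "'a::real_vector set \<Rightarrow> 'a set \<Rightarrow> 'a set" where
  "set_sum U V = {u + v | u v. u \<in> U \<and> v \<in> V}"

definition direct_sum :: "'a::real_vector set \<Rightarrow> 'a set \<Rightarrow> 'a set \<Rightarrow> bool" where
  "direct_sum L U V \<longleftrightarrow> subspace U \<and> subspace V \<and> U \<inter> V = {0} \<and> L = set_sum U V"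


section \<open>Complexification\<close>

text \<open>The complexification of a space of linear maps consists of pairs \<open>(X, Y)\<close>, which stand for
  \<open>X + \<surd>(-1) Y\<close>.\<close>

definition commutator :: "('v::real_normed_vector \<Rightarrow>\<^sub>L 'v) \<Rightarrow> ('v \<Rightarrow>\<^sub>L 'v) \<Rightarrow> ('v \<Rightarrow>\<^sub>L 'v)" where
  "commutator X Y = (X o\<^sub>L Y) - (Y o\<^sub>L X)"

type_synonym 'v cend = "('v \<Rightarrow>\<^sub>L 'v) \<times> ('v \<Rightarrow>\<^sub>L 'v)"

definition cbracket :: "'v::real_normed_vector cend \<Rightarrow> 'v cend \<Rightarrow> 'v cend" where
  "cbracket Z W =
     (commutator (fst Z) (fst W) - commutator (snd Z) (snd W),
      commutator (fst Z) (snd W) + commutator (snd Z) (fst W))"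

definition imul :: "'a::real_vector \<times> 'a \<Rightarrow> 'a \<times> 'a" where
  "imul Z = (- snd Z, fst Z)"

definition real_embed :: "'a::real_vector \<Rightarrow> 'a \<times> 'a" where
  "real_embed X = (X, 0)"

definition g_cx :: "h3o cend set" where
  "g_cx = sl3O \<times> sl3O"

definition g_re :: "h3o cend set" where
  "g_re = real_embed ` sl3O"

definition component :: "'a::real_vector set \<Rightarrow> 'a set \<Rightarrow> 'a \<Rightarrow> 'a" where
  "component U V X = (THE u. u \<in> U \<and> X - u \<in> V)"

text \<open>If \<open>X = u + v\<close> with \<open>u \<in> U\<close>, \<open>v \<in> V\<close> then \<open>X \<mapsto> u + \<surd>(-1) v\<close>, extended complex-linearly.\<close>

definition phi_star :: "'a::real_vector set \<Rightarrow> 'a set \<Rightarrow> 'a \<times> 'a \<Rightarrow> 'a \<times> 'a" where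
  "phi_star U V = (\<lambda>(X, Y).
     (component U V X, component V U X) + imul (component U V Y, component V U Y))"

definition phi_t :: "h3o cend \<Rightarrow> h3o cend" where "phi_t = phi_star R_space B_space"
definition phi_23 :: "h3o cend \<Rightarrow> h3o cend" where "phi_23 = phi_star T1_space T23_space"
definition phi_H :: "h3o cend \<Rightarrow> h3o cend" where "phi_H = phi_star H_space Hperp_space"


section \<open>Lie subalgebras, real forms and signatures\<close>

definition real_subalgebra :: "'v::real_normed_vector cend set \<Rightarrow> bool" where
  "real_subalgebra L \<longleftrightarrow> subspace L \<and> (\<forall>x\<in>L. \<forall>y\<in>L. cbracket x y \<in> L)"

definition complex_subalgebra :: "'v::real_normed_vector cend set \<Rightarrow> bool" where
  "complex_subalgebra K \<longleftrightarrow> real_subalgebra K \<and> imul ` K \<subseteq> K"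

definition lie_direct_sum ::
  "'v::real_normed_vector cend set \<Rightarrow> 'v cend set \<Rightarrow> 'v cend set \<Rightarrow> bool" where
  "lie_direct_sum L U V \<longleftrightarrow>
     direct_sum L U V \<and> real_subalgebra U \<and> real_subalgebra V \<and>
     (\<forall>u\<in>U. \<forall>v\<in>V. cbracket u v = 0)"

definition is_real_form :: "'v::real_normed_vector cend set \<Rightarrow> 'v cend set \<Rightarrow> bool" where
  "is_real_form K L \<longleftrightarrow> real_subalgebra L \<and> direct_sum K L (imul ` L)"

definition trace_on :: "'a::real_vector set \<Rightarrow> ('a \<Rightarrow> 'a) \<Rightarrow> real" where
  "trace_on L f = (let b = (SOME b. independent b \<and> span b = L)
                   in \<Sum>x\<in>b. representation b (f x) x)"

definition killing :: "'v::real_normed_vector cend set \<Rightarrow> 'v cend \<Rightarrow> 'v cend \<Rightarrow> real" where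
  "killing L x y = trace_on L (\<lambda>z. cbracket x (cbracket y z))"

definition neg_index :: "('a::real_vector \<Rightarrow> 'a \<Rightarrow> real) \<Rightarrow> 'a set \<Rightarrow> nat" where
  "neg_index \<beta> U = (GREATEST d. \<exists>W. subspace W \<and> W \<subseteq> U \<and> dim W = d \<and>
                                   (\<forall>x\<in>W. x \<noteq> 0 \<longrightarrow> \<beta> x x < 0))"

definition pos_index :: "('a::real_vector \<Rightarrow> 'a \<Rightarrow> real) \<Rightarrow> 'a set \<Rightarrow> nat" where
  "pos_index \<beta> U = (GREATEST d. \<exists>W. subspace W \<and> W \<subseteq> U \<and> dim W = d \<and>
                                   (\<forall>x\<in>W. x \<noteq> 0 \<longrightarrow> \<beta> x x > 0))"

definition signature :: "'v::real_normed_vector cend set \<Rightarrow> 'v cend set \<Rightarrow> nat \<times> nat" where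
  "signature L U = (neg_index (killing L) U, pos_index (killing L) U)"

text \<open>\<open>K\<close> is compactly embedded in \<open>L\<close>: some inner product on \<open>L\<close> is invariant under \<open>ad K\<close>.\<close>

definition compact_subalgebra :: "'v::real_normed_vector cend set \<Rightarrow> 'v cend set \<Rightarrow> bool" where
  "compact_subalgebra L K \<longleftrightarrow>
     real_subalgebra K \<and> K \<subseteq> L \<and>
     (\<exists>\<beta>::'v cend \<Rightarrow> 'v cend \<Rightarrow> real. bilinear \<beta> \<and>
        (\<forall>x\<in>L. \<forall>y\<in>L. \<beta> x y = \<beta> y x) \<and>
        (\<forall>x\<in>L. x \<noteq> 0 \<longrightarrow> \<beta> x x > 0) \<and>
        (\<forall>k\<in>K. \<forall>x\<in>L. \<forall>y\<in>L. \<beta> (cbracket k x) y + \<beta> x (cbracket k y) = 0))"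

definition maximal_compact_subalgebra ::
  "'v::real_normed_vector cend set \<Rightarrow> 'v cend set \<Rightarrow> bool" where
  "maximal_compact_subalgebra L K \<longleftrightarrow>
     compact_subalgebra L K \<and> (\<forall>K'. compact_subalgebra L K' \<and> K \<subseteq> K' \<longrightarrow> K' = K)"


section \<open>Complex simple Lie algebras by type\<close>

text \<open>A complex Lie algebra has the type of an indecomposable Cartan matrix \<open>A\<close> of finite type if
  it is generated by nonzero \<open>e\<^sub>i\<close>, \<open>f\<^sub>i\<close> subject to the Chevalley--Serre relations
  (Serre's theorem); here \<open>A\<^sub>i\<^sub>j = \<alpha>\<^sub>j(h\<^sub>i)\<close>.\<close>

definition has_cartan_type :: "int list list \<Rightarrow> 'v::real_normed_vector cend set \<Rightarrow> bool" where
  "has_cartan_type A K \<longleftrightarrow> complex_subalgebra K \<and>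
     (\<exists>e f h :: nat \<Rightarrow> 'v cend. let I = {..<length A} in
        (\<forall>i\<in>I. e i \<in> K \<and> f i \<in> K \<and> h i \<in> K \<and> e i \<noteq> 0 \<and> f i \<noteq> 0) \<and>
        (\<forall>i\<in>I. \<forall>j\<in>I.
           cbracket (h i) (h j) = 0 \<and>
           cbracket (h i) (e j) = real_of_int (A ! i ! j) *\<^sub>R e j \<and>
           cbracket (h i) (f j) = - real_of_int (A ! i ! j) *\<^sub>R f j \<and>
           cbracket (e i) (f j) = (if i = j then h i else 0) \<and>
           (i \<noteq> j \<longrightarrow> (cbracket (e i) ^^ nat (1 - A ! i ! j)) (e j) = 0 \<and>
                     (cbracket (f i) ^^ nat (1 - A ! i ! j)) (f j) = 0)) \<and>
        (\<forall>S. complex_subalgebra S \<and> (\<forall>i\<in>I. e i \<in> S \<and> f i \<in> S) \<longrightarrow> K \<subseteq> S))"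

definition cartan_A1 :: "int list list" where
  "cartan_A1 = [[2]]"

definition cartan_A5 :: "int list list" where
  "cartan_A5 = [[ 2, -1,  0,  0,  0],
                [-1,  2, -1,  0,  0],
                [ 0, -1,  2, -1,  0],
                [ 0,  0, -1,  2, -1],
                [ 0,  0,  0, -1,  2]]"

text \<open>The last simple root is the long one.\<close>

definition cartan_C4 :: "int list list" where
  "cartan_C4 = [[ 2, -1,  0,  0],
                [-1,  2, -1,  0],
                [ 0, -1,  2, -2],
                [ 0,  0, -1,  2]]"

definition cartan_F4 :: "int list list" where
  "cartan_F4 = [[ 2, -1,  0,  0],
                [-1,  2, -1,  0],
                [ 0, -2,  2, -1],
                [ 0,  0, -1,  2]]"

definition cartan_E6 :: "int list list" where
  "cartan_E6 = [[ 2,  0, -1,  0,  0,  0],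
                [ 0,  2,  0, -1,  0,  0],
                [-1,  0,  2, -1,  0,  0],
                [ 0, -1, -1,  2, -1,  0],
                [ 0,  0,  0, -1,  2, -1],
                [ 0,  0,  0,  0, -1,  2]]"

text \<open>\<open>L\<close> is a real form of the complex Lie algebra of type \<open>A\<close>: the sum \<open>L + \<surd>(-1) L\<close> is direct,
  hence is the complexification of \<open>L\<close>, and has type \<open>A\<close>.\<close>

definition real_form_of_type :: "int list list \<Rightarrow> 'v::real_normed_vector cend set \<Rightarrow> bool" where
  "real_form_of_type A L \<longleftrightarrow>
     (\<exists>K. has_cartan_type A K \<and> is_real_form K L)"

definition compact_real_form_of_type ::
  "int list list \<Rightarrow> 'v::real_normed_vector cend set \<Rightarrow> bool" where
  "compact_real_form_of_type A L \<longleftrightarrow>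
     real_form_of_type A L \<and> (\<forall>x\<in>L. x \<noteq> 0 \<longrightarrow> killing L x x < 0)"

definition minkowski :: "(real ^ 9) \<times> real \<Rightarrow> (real ^ 9) \<times> real \<Rightarrow> real" where
  "minkowski x y = fst x \<bullet> fst y - snd x * snd y"

definition so91 :: "(((real ^ 9) \<times> real) \<Rightarrow>\<^sub>L ((real ^ 9) \<times> real)) set" where
  "so91 = {X. \<forall>x y. minkowski (blinfun_apply X x) y + minkowski x (blinfun_apply X y) = 0}"

definition iso_so91 :: "'v::real_normed_vector cend set \<Rightarrow> bool" where
  "iso_so91 L \<longleftrightarrow> real_subalgebra L \<and>
     (\<exists>f. linear f \<and> bij_betw f L so91 \<and>
          (\<forall>x\<in>L. \<forall>y\<in>L. f (cbracket x y) = commutator (f x) (f y)))"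


section \<open>The real forms and their subalgebras\<close>

definition g' :: "(h3o cend \<Rightarrow> h3o cend) \<Rightarrow> h3o cend set" where
  "g' \<phi> = \<phi> ` g_re"

definition P_sub :: "(h3o cend \<Rightarrow> h3o cend) \<Rightarrow> h3o cend set" where
  "P_sub \<phi> = g' \<phi> \<inter> g_re"

text \<open>The set \<open>R_space \<times> B_space\<close> is \<open>R \<oplus> \<surd>(-1) B\<close>.\<close>

definition g'_c :: "(h3o cend \<Rightarrow> h3o cend) \<Rightarrow> h3o cend set" where
  "g'_c \<phi> = g' \<phi> \<inter> (R_space \<times> B_space)"

definition preimage_c :: "(h3o cend \<Rightarrow> h3o cend) \<Rightarrow> h3o cend set" where
  "preimage_c \<phi> = {Z \<in> g_cx. \<phi> Z \<in> g'_c \<phi>}"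

definition u1 :: "h3o cend set" where
  "u1 = real_embed ` span {dot Btz Two - dot Btz Three}"

definition su2C :: "h3o cend set" where
  "su2C = real_embed ` span {dot (Aq q) One | q. q \<in> {Uk, Ukl, Ul}}"

definition su2_2 :: "h3o cend set" where
  "su2_2 = real_embed ` span {dot (Gq q) One + 2 *\<^sub>R dot (Sq q) One | q. q \<in> {Uk, Ukl, Ul}}"

end

theory Submission
  imports Defs
begin

text \<open>Everything follows from three commuting involutions of \<open>sl(3,O)\<close>: the Cartan involution
  \<open>\<theta> X = - X\<^sup>*\<close> with respect to the trace form of hermitian matrices, the conjugation \<open>\<sigma>\<close> by
  \<open>diag(1, 1, -1)\<close>, and the map \<open>h\<close> induced by the automorphism of the octonions that fixes
  \<open>1, k, kl, l\<close>.  Each generator is an eigenvector of all three, with signs read off from its label,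
  and the decompositions of the theorem are the eigenspace decompositions (\<open>spaces_eigen\<close>).
  Composing the maps \<open>\<phi>\<^sup>*\<close> composes the involutions, up to signs on common eigenspaces that
  disappear in the image of the real form.  For the product \<open>s\<close> of the involutions involved,
  \<open>g'\<close> is therefore the real form \<open>{X + \<surd>(-1) Y | s X = X, s Y = - Y}\<close>, the intersection
  \<open>\<P>\<close> is the fixed algebra of \<open>s\<close>, and the preimage of the maximal compact subalgebra is the fixed
  algebra of \<open>\<theta> s\<close> (\<open>realized_spaces\<close>).

  The Lie algebra itself is determined by linearizing invariance of the determinant (\<open>sl3O_iff\<close>) and
  by reducing an arbitrary infinitesimal symmetry to zero with explicit generators (\<open>sl3O_span\<close>).
  So the generators span, and the dimension is at most 78.

  Signatures require no Killing form to be computed.  The hermitian trace form \<open>tr (Z W\<^sup>*)\<close> makes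
  \<open>ad (Z\<^sup>*)\<close> the adjoint of \<open>ad Z\<close>, hence the Killing form of a centreless star-closed
  subalgebra is negative on \<open>Z\<^sup>* = - Z\<close> and positive on \<open>Z\<^sup>* = Z\<close> (\<open>killing_dagger\<close>), and the
  former part is a maximal compact subalgebra (\<open>maximal_compact_dagger\<close>).  Signatures become
  numbers of labels.  Centres vanish because an algebra with Serre generators is perfect, and the
  centre of a perfect star-closed algebra is orthogonal to everything (\<open>cartan_type_centreless\<close>).

  The Cartan types \<open>E\<^sub>6, F\<^sub>4, C\<^sub>4, A\<^sub>5, A\<^sub>1\<close> are certified by integer matrices.  In a weight basis of
  the complexified 27-dimensional representation the determinant is a sum of 45 monomials with
  coefficients \<open>\<plusminus>1\<close> and root vectors are sparse.  For given root vectors one checks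
  that they annihilate the cubic form, that they are fixed by the involution in question, that
  they satisfy the Chevalley--Serre relations, and that enough brackets of them are linearly independent
  to fill the dimension known from counting labels (\<open>cartan_typeI\<close>).  For \<open>E\<^sub>6\<close> the same count gives
  the lower bound 78, so the generators are a basis.

  The algebras of type \<open>A\<^sub>5\<close> are the centralizers of the two algebras \<open>su(2)\<close> in the fixed
  algebras of \<open>h\<close> and \<open>\<sigma> h\<close>; the sum is direct since \<open>su(2)\<close> has no centre, and exhausts the
  fixed algebra by dimension (\<open>A5_type\<close>).  Finally, the fixed algebra of \<open>\<sigma>\<close> preserves the upper left
  \<open>2 \<times> 2\<close> block, on which the determinant is the Minkowski form; the elements annihilating the
  third diagonal idempotent act there as \<open>so(9,1)\<close>, and a dilation spans the complement
  (\<open>sl2O_iso\<close>, \<open>sl2O_direct_sum\<close>).\<close>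

section \<open>Dimension, traces and indices of bilinear forms\<close>

lemma independent_family:
  fixes v :: "'i \<Rightarrow> 'a::real_vector"
  assumes fin: "finite I"
    and c0: "\<And>c. (\<Sum>i\<in>I. c i *\<^sub>R v i) = 0 \<Longrightarrow> \<forall>i\<in>I. c i = 0"
  shows "inj_on v I" "independent (v ` I)"
proof -
  show inj: "inj_on v I"
  proof (rule inj_onI, rule ccontr)
    fix i j assume ij: "i \<in> I" "j \<in> I" "v i = v j" "i \<noteq> j"
    let ?c = "\<lambda>k. if k = i then 1 else if k = j then -1 else (0::real)"
    have "(\<Sum>k\<in>I. ?c k *\<^sub>R v k) = (\<Sum>k\<in>{i,j}. ?c k *\<^sub>R v k)"
      by (rule sum.mono_neutral_right) (use ij fin in auto)
    also have "\<dots> = 0" using ij by simp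
    finally have "?c i = 0" using c0[of ?c] ij by blast
    then show False by simp
  qed
  show "independent (v ` I)"
  proof (rule independent_if_scalars_zero)
    show "finite (v ` I)" using fin by simp
    fix f x assume s: "(\<Sum>x\<in>v ` I. f x *\<^sub>R x) = 0" and x: "x \<in> v ` I"
    have "(\<Sum>i\<in>I. f (v i) *\<^sub>R v i) = 0"
      using s by (simp add: sum.reindex[OF inj])
    from c0[OF this] x show "f x = 0" by auto
  qed
qed

lemma finite_basis:
  fixes L :: "'a::real_vector set"
  assumes "subspace L" "finite C" "L \<subseteq> span C"
  obtains b where "independent b" "span b = L" "finite b" "b \<subseteq> L" "card b = dim L"
proof -
  obtain b where b: "b \<subseteq> L" "independent b" "L \<subseteq> span b" "card b = dim L"
    using basis_exists[of L] by blast
  have "finite b"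
    using independent_span_bound[OF assms(2) b(2)] b(1) assms(3) by blast
  moreover have "span b = L" using b assms(1) by (simp add: span_minimal subset_antisym)
  ultimately show thesis using that b by blast
qed

lemma dim_independent_le:
  fixes L :: "'a::real_vector set"
  assumes "finite C" "L \<subseteq> span C" "subspace L" "independent S" "S \<subseteq> L"
  shows "finite S" "card S \<le> dim L"
proof -
  obtain b where b: "independent b" "span b = L" "finite b" "b \<subseteq> L" "card b = dim L"
    using finite_basis[OF assms(3,1,2)] by metis
  show "finite S" "card S \<le> dim L"
    using independent_span_bound[OF b(3) assms(4)] assms(5) b by auto
qed

lemma dim_span_le_card:
  fixes L :: "'a::real_vector set"
  assumes "finite C" "L \<subseteq> span C" "subspace L"
  shows "dim L \<le> card C"
proof -
  obtain b where b: "independent b" "span b = L" "finite b" "b \<subseteq> L" "card b = dim L"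
    using finite_basis[OF assms(3,1,2)] by metis
  then show ?thesis using independent_span_bound[OF assms(1) b(1)] assms(2) by auto
qed

lemma independent_full_span:
  fixes L :: "'a::real_vector set"
  assumes "finite C" "L \<subseteq> span C" "subspace L" "independent S" "S \<subseteq> L" "dim L \<le> card S"
  shows "span S = L"
proof
  show "span S \<subseteq> L" using assms by (simp add: span_minimal)
  show "L \<subseteq> span S"
  proof
    fix x assume x: "x \<in> L"
    show "x \<in> span S"
    proof (rule ccontr)
      assume n: "x \<notin> span S"
      then have i: "independent (insert x S)" using assms(4) by (rule independent_insertI)
      have sub: "insert x S \<subseteq> L" using x assms(5) by simp
      note d = dim_independent_le[OF assms(1-3) i sub]
      have "x \<notin> S" using n by (meson span_base)
      then show False using d assms(6) by simp
    qed
  qed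
qed

lemma dim_linear_image:
  fixes f :: "'a::real_vector \<Rightarrow> 'b::real_vector"
  assumes "linear f" "subspace L" "finite C" "L \<subseteq> span C" "\<And>x. x \<in> L \<Longrightarrow> f x = 0 \<Longrightarrow> x = 0"
  shows "dim (f ` L) = dim L"
proof -
  obtain b where b: "independent b" "span b = L" "finite b" "b \<subseteq> L" "card b = dim L"
    using finite_basis[OF assms(2-4)] by metis
  have inj: "inj_on f (span b)"
    using linear_inj_on_iff_eq_0[OF assms(1,2)] assms(5) b(2) by metis
  have "independent (f ` b)"
    by (rule linear_independent_injective_image[OF assms(1) b(1) inj])
  moreover have "span (f ` b) = f ` L" using linear_span_image[OF assms(1)] b(2) by simp
  moreover have "card (f ` b) = card b"
    by (rule card_image) (rule inj_on_subset[OF inj], simp add: span_superset)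
  ultimately have "dim (f ` L) = card b" by (metis dim_span_eq_card_independent)
  then show ?thesis using b(5) by simp
qed

lemma trace_sum_basis_indep:
  fixes f :: "'a::real_vector \<Rightarrow> 'a"
  assumes b: "independent b" "span b = L" "finite b"
    and b': "independent b'" "span b' = L" "finite b'"
    and f: "linear f" "\<And>x. x \<in> L \<Longrightarrow> f x \<in> L"
  shows "(\<Sum>x\<in>b. representation b (f x) x) = (\<Sum>y\<in>b'. representation b' (f y) y)"
proof -
  have L: "\<And>x. x \<in> b \<Longrightarrow> x \<in> L" "\<And>x. x \<in> b' \<Longrightarrow> x \<in> L"
    using b b' span_base by auto
  have e: "v = (\<Sum>x\<in>b. representation b v x *\<^sub>R x)" if "v \<in> L" for v
    using sum_representation_eq[OF b(1) _ b(3) subset_refl, of v] that b(2) by simp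
  have e': "v = (\<Sum>x\<in>b'. representation b' v x *\<^sub>R x)" if "v \<in> L" for v
    using sum_representation_eq[OF b'(1) _ b'(3) subset_refl, of v] that b'(2) by simp
  have r': "representation b' (\<Sum>i\<in>A. k i *\<^sub>R w i) y = (\<Sum>i\<in>A. k i * representation b' (w i) y)"
    if "\<And>i. i \<in> A \<Longrightarrow> w i \<in> L" for A k y and w :: "'a \<Rightarrow> 'a"
  proof -
    have "w i \<in> span b'" if "i \<in> A" for i using \<open>\<And>i. i \<in> A \<Longrightarrow> w i \<in> L\<close>[OF that] b'(2) by simp
    then show ?thesis
      using representation_sum[OF b'(1), of A "\<lambda>i. k i *\<^sub>R w i"] representation_scale[OF b'(1)]
      by (simp add: span_scale)
  qed
  have r: "representation b (\<Sum>i\<in>A. k i *\<^sub>R w i) y = (\<Sum>i\<in>A. k i * representation b (w i) y)"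
    if "\<And>i. i \<in> A \<Longrightarrow> w i \<in> L" for A k y and w :: "'a \<Rightarrow> 'a"
  proof -
    have "w i \<in> span b" if "i \<in> A" for i using \<open>\<And>i. i \<in> A \<Longrightarrow> w i \<in> L\<close>[OF that] b(2) by simp
    then show ?thesis
      using representation_sum[OF b(1), of A "\<lambda>i. k i *\<^sub>R w i"] representation_scale[OF b(1)]
      by (simp add: span_scale)
  qed
  have "(\<Sum>x\<in>b. representation b (f x) x)
      = (\<Sum>x\<in>b. \<Sum>y\<in>b'. representation b' (f x) y * representation b y x)"
  proof (rule sum.cong[OF refl])
    fix x assume x: "x \<in> b"
    have "representation b (f x) x = representation b (\<Sum>y\<in>b'. representation b' (f x) y *\<^sub>R y) x"
      by (rule arg_cong[OF e'[OF f(2)[OF L(1)[OF x]]], of "\<lambda>v. representation b v x"])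
    also have "\<dots> = (\<Sum>y\<in>b'. representation b' (f x) y * representation b y x)"
      by (rule r) (rule L(2))
    finally show "representation b (f x) x = (\<Sum>y\<in>b'. representation b' (f x) y * representation b y x)" .
  qed
  also have "\<dots> = (\<Sum>y\<in>b'. \<Sum>x\<in>b. representation b y x * representation b' (f x) y)"
    by (subst sum.swap) (simp add: mult.commute)
  also have "\<dots> = (\<Sum>y\<in>b'. representation b' (f y) y)"
  proof (rule sum.cong[OF refl])
    fix y assume y: "y \<in> b'"
    have "f y = f (\<Sum>x\<in>b. representation b y x *\<^sub>R x)"
      by (rule arg_cong[OF e[OF L(2)[OF y]]])
    also have "\<dots> = (\<Sum>x\<in>b. representation b y x *\<^sub>R f x)"
      by (simp add: linear_sum[OF f(1)] linear_scale[OF f(1)])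
    finally have fy: "f y = (\<Sum>x\<in>b. representation b y x *\<^sub>R f x)" .
    show "(\<Sum>x\<in>b. representation b y x * representation b' (f x) y) = representation b' (f y) y"
      using r'[where A = b and w = f and k = "representation b y" and y = y] f(2) L(1) fy by simp
  qed
  finally show ?thesis .
qed

lemma bilinear_lsum:
  assumes "bilinear \<beta>"
  shows "\<beta> (\<Sum>i\<in>S. k i *\<^sub>R w i) y = (\<Sum>i\<in>S. k i *\<^sub>R \<beta> (w i) y)"
proof -
  have l: "linear (\<lambda>x. \<beta> x y)" using assms unfolding bilinear_def by blast
  show ?thesis using linear_sum[OF l, of "\<lambda>i. k i *\<^sub>R w i" S] linear_scale[OF l] by simp
qed

definition inner_on :: "'a::real_vector set \<Rightarrow> ('a \<Rightarrow> 'a \<Rightarrow> real) \<Rightarrow> bool" where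
  "inner_on L \<beta> \<longleftrightarrow> bilinear \<beta> \<and> (\<forall>x\<in>L. \<forall>y\<in>L. \<beta> x y = \<beta> y x) \<and> (\<forall>x\<in>L. x \<noteq> 0 \<longrightarrow> \<beta> x x > 0)"

text \<open>Gram--Schmidt for a form that is only known to be positive on \<open>L\<close>.\<close>

lemma orthonormal_basis_on:
  fixes L :: "'a::real_vector set"
  assumes "inner_on L \<beta>" "subspace L" "finite C" "L \<subseteq> span C"
  obtains b where "finite b" "independent b" "span b = L" "b \<subseteq> L"
    "\<And>x y. x \<in> b \<Longrightarrow> y \<in> b \<Longrightarrow> \<beta> x y = (if x = y then 1 else 0)"
proof -
  have bl: "bilinear \<beta>" and sy: "\<And>x y. x \<in> L \<Longrightarrow> y \<in> L \<Longrightarrow> \<beta> x y = \<beta> y x"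
    and po: "\<And>x. x \<in> L \<Longrightarrow> x \<noteq> 0 \<Longrightarrow> \<beta> x x > 0"
    using assms(1) unfolding inner_on_def by auto
  have gs: "\<exists>b. finite b \<and> span b = span D \<and> b \<subseteq> L \<and>
      (\<forall>x\<in>b. \<forall>y\<in>b. \<beta> x y = (if x = y then 1 else 0))" if "finite D" "D \<subseteq> L" for D
    using that
  proof (induction D rule: finite_induct)
    case empty
    show ?case by (rule exI[of _ "{}"]) simp
  next
    case (insert d D)
    then obtain b where b: "finite b" "span b = span D" "b \<subseteq> L"
      "\<forall>x\<in>b. \<forall>y\<in>b. \<beta> x y = (if x = y then 1 else 0)" by auto
    have dL: "d \<in> L" using insert by auto
    define s where "s = (\<Sum>x\<in>b. \<beta> d x *\<^sub>R x)"
    define e where "e = d - s"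
    have ss: "s \<in> span b" unfolding s_def by (intro span_sum span_scale span_base)
    have sL: "s \<in> L" using ss b(3) assms(2) by (meson span_minimal subsetD)
    have eL: "e \<in> L" unfolding e_def using dL sL assms(2) by (simp add: subspace_diff)
    have eo: "\<beta> e y = 0" if y: "y \<in> b" for y
    proof -
      have "\<beta> s y = (\<Sum>x\<in>b. \<beta> d x * \<beta> x y)"
        unfolding s_def
        by (simp add: bilinear_lsum[OF bl])
      also have "\<dots> = (\<Sum>x\<in>b. if x = y then \<beta> d x else 0)"
        using b(4) y by (intro sum.cong) auto
      also have "\<dots> = \<beta> d y" using b(1) y by simp
      finally show ?thesis unfolding e_def by (simp add: bilinear_lsub[OF bl])
    qed
    have spd: "span (insert d b) = span (insert d D)"
      using b(2) by (simp add: span_insert)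
    show ?case
    proof (cases "e = 0")
      case True
      then have "d \<in> span b" using ss e_def by simp
      then have "span (insert d b) = span b" by (simp add: span_redundant)
      then show ?thesis using b spd by (intro exI[of _ b]) simp
    next
      case False
      define u where "u = (1 / sqrt (\<beta> e e)) *\<^sub>R e"
      have pos: "\<beta> e e > 0" using po[OF eL False] .
      have uL: "u \<in> L" unfolding u_def using eL assms(2) by (simp add: subspace_scale)
      have uu: "\<beta> u u = 1" unfolding u_def
        using pos by (simp add: bilinear_lmul[OF bl] bilinear_rmul[OF bl])
      have uy: "\<beta> u y = 0" "\<beta> y u = 0" if "y \<in> b" for y
        using eo[OF that] sy[OF uL, of y] that b(3) unfolding u_def
        by (auto simp: bilinear_lmul[OF bl])
      have ub: "u \<notin> b" using uu uy by force
      have "span (insert u b) = span (insert d b)"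
      proof (rule span_eq[THEN iffD2], intro conjI)
        have "d = sqrt (\<beta> e e) *\<^sub>R u + s" unfolding u_def e_def[symmetric] using pos
          by (simp add: e_def)
        then show "insert d b \<subseteq> span (insert u b)"
          using ss by (metis (no_types, lifting) insertI1 insert_subset span_add span_base span_mono span_scale
               subset_insertI subset_iff)
        have "d \<in> span (insert d b)" "s \<in> span (insert d b)"
          using ss span_mono[of b "insert d b"] by (auto intro: span_base)
        then have "e \<in> span (insert d b)" unfolding e_def by (simp add: span_diff)
        then show "insert u b \<subseteq> span (insert d b)"
          unfolding u_def by (auto intro: span_base span_scale)
      qed
      then show ?thesis using b spd uL uu uy ub
        by (intro exI[of _ "insert u b"]) auto
    qed
  qed
  obtain D where D: "independent D" "span D = L" "finite D" "D \<subseteq> L"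
    using finite_basis[OF assms(2-4)] by metis
  obtain b where b: "finite b" "span b = L" "b \<subseteq> L"
      "\<forall>x\<in>b. \<forall>y\<in>b. \<beta> x y = (if x = y then 1 else 0)" using gs[OF D(3,4)] D(2) by auto
  have "independent b"
  proof (rule independent_if_scalars_zero[OF b(1)])
    fix f x assume s: "(\<Sum>x\<in>b. f x *\<^sub>R x) = 0" and x: "x \<in> b"
    have "0 = \<beta> (\<Sum>y\<in>b. f y *\<^sub>R y) x" using s by (simp add: bilinear_lzero[OF bl])
    also have "\<dots> = (\<Sum>y\<in>b. f y * \<beta> y x)"
      by (simp add: bilinear_lsum[OF bl])
    also have "\<dots> = (\<Sum>y\<in>b. if y = x then f y else 0)"
      using b(4) x by (intro sum.cong) auto
    also have "\<dots> = f x" using b(1) x by simp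
    finally show "f x = 0" by simp
  qed
  then show thesis using that b by blast
qed

lemma trace_on_orthonormal:
  fixes f :: "'a::real_vector \<Rightarrow> 'a"
  assumes bl: "bilinear \<beta>"
    and b: "finite b" "independent b" "span b = L"
    and on: "\<And>x y. x \<in> b \<Longrightarrow> y \<in> b \<Longrightarrow> \<beta> x y = (if x = y then 1 else 0)"
    and f: "linear f" "\<And>x. x \<in> L \<Longrightarrow> f x \<in> L"
  shows "trace_on L f = (\<Sum>x\<in>b. \<beta> (f x) x)"
proof -
  define c where "c = (SOME b. independent b \<and> span b = L)"
  have c: "independent c \<and> span c = L" unfolding c_def by (rule someI[of _ b]) (use b in simp)
  have fc: "finite c" using independent_span_bound[OF b(1), of c] c b(3)
    by (metis span_superset)
  have "trace_on L f = (\<Sum>x\<in>c. representation c (f x) x)"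
    unfolding trace_on_def Let_def c_def ..
  also have "\<dots> = (\<Sum>x\<in>b. representation b (f x) x)"
    by (rule trace_sum_basis_indep[of c L b f]) (use b c fc f in auto)
  also have "\<dots> = (\<Sum>x\<in>b. \<beta> (f x) x)"
  proof (rule sum.cong[OF refl])
    fix x assume x: "x \<in> b"
    have "f x \<in> span b" using f(2)[of x] x b(3) span_base by blast
    then have "f x = (\<Sum>y\<in>b. representation b (f x) y *\<^sub>R y)"
      using sum_representation_eq[OF b(2) _ b(1) subset_refl] by simp
    then have "\<beta> (f x) x = \<beta> (\<Sum>y\<in>b. representation b (f x) y *\<^sub>R y) x" by simp
    also have "\<dots> = (\<Sum>y\<in>b. representation b (f x) y * \<beta> y x)"
      by (simp add: bilinear_lsum[OF bl])
    also have "\<dots> = (\<Sum>y\<in>b. if y = x then representation b (f x) y else 0)"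
      using on x by (intro sum.cong) auto
    also have "\<dots> = representation b (f x) x" using b(1) x by simp
    finally show "representation b (f x) x = \<beta> (f x) x" ..
  qed
  finally show ?thesis .
qed

lemma trace_on_square:
  fixes f :: "'a::real_vector \<Rightarrow> 'a"
  assumes io: "inner_on L \<beta>" and L: "subspace L" "finite C" "L \<subseteq> span C"
    and f: "linear f" "\<And>x. x \<in> L \<Longrightarrow> f x \<in> L"
    and ad: "\<And>x y. x \<in> L \<Longrightarrow> y \<in> L \<Longrightarrow> \<beta> (f x) y = s * \<beta> x (f y)"
  shows "\<exists>t\<ge>0. trace_on L (\<lambda>x. f (f x)) = s * t \<and> (t = 0 \<longrightarrow> (\<forall>x\<in>L. f x = 0))"
proof -
  obtain b where b: "finite b" "independent b" "span b = L" "b \<subseteq> L"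
    and on: "\<And>x y. x \<in> b \<Longrightarrow> y \<in> b \<Longrightarrow> \<beta> x y = (if x = y then 1 else 0)"
    using orthonormal_basis_on[OF io L] by metis
  have bl: "bilinear \<beta>" and po: "\<And>x. x \<in> L \<Longrightarrow> x \<noteq> 0 \<Longrightarrow> \<beta> x x > 0"
    using io unfolding inner_on_def by auto
  have nn: "\<beta> x x \<ge> 0" if "x \<in> L" for x
    using po[OF that] bilinear_lzero[OF bl] by (cases "x = 0") (auto simp: less_imp_le)
  have lf2: "linear (\<lambda>x. f (f x))" using linear_compose[OF f(1) f(1)] by (simp add: o_def)
  define t where "t = (\<Sum>x\<in>b. \<beta> (f x) (f x))"
  have "trace_on L (\<lambda>x. f (f x)) = (\<Sum>x\<in>b. \<beta> (f (f x)) x)"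
    by (rule trace_on_orthonormal[OF bl b(1-3) on lf2]) (use f in auto)
  also have "\<dots> = s * t" unfolding t_def sum_distrib_left
    using ad f(2) b(4) by (intro sum.cong) auto
  finally have "trace_on L (\<lambda>x. f (f x)) = s * t" .
  moreover have "t \<ge> 0" unfolding t_def using nn f(2) b(4) by (intro sum_nonneg) auto
  moreover have "\<forall>x\<in>L. f x = 0" if "t = 0"
  proof -
    have "\<beta> (f x) (f x) = 0" if "x \<in> b" for x
      using \<open>t = 0\<close> that sum_nonneg_0[OF b(1), of "\<lambda>x. \<beta> (f x) (f x)"] nn f(2) b(4)
      unfolding t_def by blast
    then have "\<forall>x\<in>b. f x = 0" using po f(2) b(4) by (metis less_irrefl subsetD)
    then show ?thesis using linear_eq_0_on_span[OF f(1), of b] b(3) by blast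
  qed
  ultimately show ?thesis by blast
qed

text \<open>Sylvester's law of inertia: a subspace of a larger dimension than \<open>N\<close> on which the form is negative
  would meet the nonnegative part \<open>P\<close>, since \<open>U\<close> is covered by \<open>N + P\<close>.\<close>

lemma neg_index_eq:
  fixes \<kappa> :: "'a::real_vector \<Rightarrow> 'a \<Rightarrow> real"
  assumes N: "subspace N" "N \<subseteq> U" "finite C" "U \<subseteq> span C" and P: "subspace P"
    and U: "\<And>u. u \<in> U \<Longrightarrow> \<exists>n\<in>N. u - n \<in> P"
    and neg: "\<And>x. x \<in> N \<Longrightarrow> x \<noteq> 0 \<Longrightarrow> \<kappa> x x < 0"
    and nonneg: "\<And>x. x \<in> P \<Longrightarrow> \<kappa> x x \<ge> 0"
  shows "neg_index \<kappa> U = dim N"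
  unfolding neg_index_def
proof (rule Greatest_equality)
  show "\<exists>W. subspace W \<and> W \<subseteq> U \<and> dim W = dim N \<and> (\<forall>x\<in>W. x \<noteq> 0 \<longrightarrow> \<kappa> x x < 0)"
    using N neg by blast
  fix d assume "\<exists>W. subspace W \<and> W \<subseteq> U \<and> dim W = d \<and> (\<forall>x\<in>W. x \<noteq> 0 \<longrightarrow> \<kappa> x x < 0)"
  then obtain W where W: "subspace W" "W \<subseteq> U" "dim W = d" "\<And>x. x \<in> W \<Longrightarrow> x \<noteq> 0 \<Longrightarrow> \<kappa> x x < 0"
    by blast
  obtain b where b: "independent b" "span b = W" "finite b" "b \<subseteq> W" "card b = dim W"
    using finite_basis[OF W(1) N(3)] N(4) W(2) by (metis dual_order.trans)
  obtain n where n: "\<And>u. u \<in> U \<Longrightarrow> n u \<in> N \<and> u - n u \<in> P" using U by metis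
  have z: "\<forall>i\<in>b. c i = 0" if s: "(\<Sum>i\<in>b. c i *\<^sub>R n i) = 0" for c
  proof -
    let ?w = "\<Sum>i\<in>b. c i *\<^sub>R i"
    have "?w = (\<Sum>i\<in>b. c i *\<^sub>R (i - n i))" using s by (simp add: scaleR_diff_right sum_subtractf)
    also have "\<dots> \<in> P" using n b(4) W(2) P by (intro subspace_sum subspace_scale) auto
    finally have wP: "?w \<in> P" .
    have wW: "?w \<in> W" using b(4) W(1) by (intro subspace_sum subspace_scale) auto
    have "?w = 0" using nonneg[OF wP] W(4)[OF wW] by force
    then show ?thesis using b(1,3) independentD by blast
  qed
  have "inj_on n b" "independent (n ` b)" using independent_family[OF b(3) z] by auto
  moreover have "n ` b \<subseteq> N" using n b(4) W(2) by auto
  ultimately have "card b \<le> dim N"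
    using dim_independent_le(2)[OF N(3) _ N(1), of "n ` b"] N by (metis card_image dual_order.trans)
  then show "d \<le> dim N" using b W by simp
qed

lemma pos_index_eq:
  fixes \<kappa> :: "'a::real_vector \<Rightarrow> 'a \<Rightarrow> real"
  assumes "subspace N" "N \<subseteq> U" "finite C" "U \<subseteq> span C" "subspace P"
    and "\<And>u. u \<in> U \<Longrightarrow> \<exists>n\<in>N. u - n \<in> P"
    and "\<And>x. x \<in> N \<Longrightarrow> x \<noteq> 0 \<Longrightarrow> \<kappa> x x > 0"
    and "\<And>x. x \<in> P \<Longrightarrow> \<kappa> x x \<le> 0"
  shows "pos_index \<kappa> U = dim N"
proof -
  have "pos_index \<kappa> U = neg_index (\<lambda>x y. - \<kappa> x y) U"
    unfolding pos_index_def neg_index_def by simp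
  also have "\<dots> = dim N" by (rule neg_index_eq[OF assms(1-6)]) (use assms(7,8) in auto)
  finally show ?thesis .
qed

section \<open>Lie algebras with a Cartan involution\<close>

lemma commutator_simps:
  "commutator (X + Y) Z = commutator X Z + commutator Y Z"
  "commutator X (Y + Z) = commutator X Y + commutator X Z"
  "commutator (X - Y) Z = commutator X Z - commutator Y Z"
  "commutator X (Y - Z) = commutator X Y - commutator X Z"
  "commutator (- X) Z = - commutator X Z"
  "commutator X (- Z) = - commutator X Z"
  "commutator (c *\<^sub>R X) Z = c *\<^sub>R commutator X Z"
  "commutator X (c *\<^sub>R Z) = c *\<^sub>R commutator X Z"
  "commutator 0 Z = 0" "commutator X 0 = 0"
  by (auto simp: commutator_def intro!: blinfun_eqI simp: blinfun.bilinear_simps algebra_simps)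

lemma commutator_anti: "commutator X Y = - commutator Y X"
  by (simp add: commutator_def)

lemma commutator_jacobi:
  "commutator X (commutator Y Z) = commutator (commutator X Y) Z + commutator Y (commutator X Z)"
  by (auto simp: commutator_def intro!: blinfun_eqI simp: blinfun.bilinear_simps algebra_simps)

lemma cbracket_linear: "linear (\<lambda>Z. cbracket Z W)" "linear (cbracket Z)"
  by (auto simp: linear_iff cbracket_def commutator_simps algebra_simps)

lemmas cbracket_simps =
  linear_add[OF cbracket_linear(1)] linear_add[OF cbracket_linear(2)]
  linear_diff[OF cbracket_linear(1)] linear_diff[OF cbracket_linear(2)]
  linear_neg[OF cbracket_linear(1)] linear_neg[OF cbracket_linear(2)]
  linear_scale[OF cbracket_linear(1)] linear_scale[OF cbracket_linear(2)]
  linear_0[OF cbracket_linear(1)] linear_0[OF cbracket_linear(2)]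

lemma cbracket_anti: "cbracket Z W = - cbracket W Z"
  by (simp add: cbracket_def commutator_anti[of "fst W"] commutator_anti[of "snd W"])

lemma cbracket_imul: "cbracket (imul Z) W = imul (cbracket Z W)" "cbracket Z (imul W) = imul (cbracket Z W)"
  by (auto simp: cbracket_def imul_def commutator_simps)

lemma imul_linear: "linear imul"
  by (auto simp: linear_iff imul_def)

lemma imul_imul [simp]: "imul (imul Z) = - Z"
  by (simp add: imul_def prod_eq_iff)

lemma cbracket_jacobi: "cbracket X (cbracket Y Z) = cbracket (cbracket X Y) Z + cbracket Y (cbracket X Z)"
  by (auto simp: cbracket_def prod_eq_iff commutator_simps commutator_jacobi[of "fst X"] commutator_jacobi[of "snd X"])

definition centreless :: "'v::real_normed_vector cend set \<Rightarrow> bool" where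
  "centreless L \<longleftrightarrow> (\<forall>Z\<in>L. (\<forall>W\<in>L. cbracket Z W = 0) \<longrightarrow> Z = 0)"

text \<open>For an inner product in which \<open>ad Z\<close> is \<open>s\<close> times its adjoint, \<open>(ad Z)\<^sup>2\<close> is \<open>s\<close> times the product of
  the adjoint and \<open>ad Z\<close>, which has positive trace unless \<open>Z\<close> is central.\<close>

lemma killing_sign:
  assumes L: "real_subalgebra L" "finite C" "L \<subseteq> span C" "centreless L"
    and io: "inner_on L \<beta>"
    and ad: "\<And>W V. W \<in> L \<Longrightarrow> V \<in> L \<Longrightarrow> \<beta> (cbracket Z W) V = s * \<beta> W (cbracket Z V)"
    and Z: "Z \<in> L" "Z \<noteq> 0"
  shows "\<exists>t>0. killing L Z Z = s * t"
proof -
  have sL: "subspace L" and cl: "\<And>W. W \<in> L \<Longrightarrow> cbracket Z W \<in> L"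
    using L(1) Z unfolding real_subalgebra_def by auto
  obtain t where t: "t \<ge> 0" "trace_on L (\<lambda>x. cbracket Z (cbracket Z x)) = s * t"
    "t = 0 \<longrightarrow> (\<forall>x\<in>L. cbracket Z x = 0)"
    using trace_on_square[OF io sL L(2,3) cbracket_linear(2) cl ad] by metis
  have "t \<noteq> 0" using t(3) L(4) Z unfolding centreless_def by blast
  then show ?thesis using t unfolding killing_def by (intro exI[of _ t]) auto
qed

text \<open>A compactly embedded subalgebra meets the symmetric part trivially: there, \<open>ad Z\<close> would have
  a square of positive trace, while invariance of an inner product makes that trace nonpositive.\<close>

lemma compact_no_symmetric:
  fixes L :: "'a::real_normed_vector cend set"
  assumes L: "real_subalgebra L" "finite C" "L \<subseteq> span C" "centreless L"
    and io: "inner_on L \<beta>"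
    and ad: "\<And>W V. W \<in> L \<Longrightarrow> V \<in> L \<Longrightarrow> \<beta> (cbracket Z W) V = \<beta> W (cbracket Z V)"
    and K: "compact_subalgebra L K" "Z \<in> K"
  shows "Z = 0"
proof (rule ccontr)
  assume nz: "Z \<noteq> 0"
  have ZL: "Z \<in> L" using K unfolding compact_subalgebra_def by blast
  have sL: "subspace L" and cl: "\<And>W. W \<in> L \<Longrightarrow> cbracket Z W \<in> L"
    using L(1) ZL unfolding real_subalgebra_def by auto
  obtain t where t: "t > 0" "killing L Z Z = 1 * t"
    using killing_sign[OF L io, of Z 1] ad ZL nz by auto
  obtain \<gamma> :: "'a cend \<Rightarrow> 'a cend \<Rightarrow> real" where g: "bilinear \<gamma>" "\<forall>x\<in>L. \<forall>y\<in>L. \<gamma> x y = \<gamma> y x" "\<forall>x\<in>L. x \<noteq> 0 \<longrightarrow> \<gamma> x x > 0"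
    "\<forall>k\<in>K. \<forall>x\<in>L. \<forall>y\<in>L. \<gamma> (cbracket k x) y + \<gamma> x (cbracket k y) = 0"
    using K(1) unfolding compact_subalgebra_def by blast
  have "inner_on L \<gamma>" using g(1-3) unfolding inner_on_def by blast
  moreover have "\<gamma> (cbracket Z W) V = (-1) * \<gamma> W (cbracket Z V)" if "W \<in> L" "V \<in> L" for W V
    using g(4) K(2) that by force
  ultimately obtain r where "r > 0" "killing L Z Z = (-1) * r"
    using killing_sign[OF L, of \<gamma> Z "-1"] ZL nz by blast
  with t show False by simp
qed

text \<open>The bracket span of a Chevalley system contains its generators, so an algebra with a Cartan
  type is perfect; adjointness then makes its centre orthogonal to everything.\<close>

lemma cartan_type_centreless:
  fixes K :: "'a::real_normed_vector cend set"
  assumes ct: "has_cartan_type A K" and diag: "\<And>i. i < length A \<Longrightarrow> A ! i ! i = 2"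
    and io: "inner_on K \<beta>"
    and ad: "\<And>Z W V. Z \<in> K \<Longrightarrow> W \<in> K \<Longrightarrow> V \<in> K \<Longrightarrow> \<beta> (cbracket Z W) V = \<beta> W (cbracket (st Z) V)"
    and st: "\<And>Z. Z \<in> K \<Longrightarrow> st Z \<in> K"
  shows "centreless K"
proof -
  have cK: "complex_subalgebra K" using ct unfolding has_cartan_type_def by blast
  then have sK: "subspace K" and cl: "\<And>x y. x \<in> K \<Longrightarrow> y \<in> K \<Longrightarrow> cbracket x y \<in> K"
    and iK: "\<And>x. x \<in> K \<Longrightarrow> imul x \<in> K"
    unfolding complex_subalgebra_def real_subalgebra_def by auto
  define D where "D = span {cbracket x y | x y. x \<in> K \<and> y \<in> K}"
  have DK: "D \<subseteq> K" unfolding D_def using cl sK by (intro span_minimal) auto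
  have base: "cbracket x y \<in> D" if "x \<in> K" "y \<in> K" for x y
    unfolding D_def using that by (intro span_base) blast
  have "imul ` D \<subseteq> D"
    unfolding D_def linear_span_image[OF imul_linear, symmetric]
  proof (rule span_mono, rule image_subsetI)
    fix z assume "z \<in> {cbracket x y | x y. x \<in> K \<and> y \<in> K}"
    then obtain x y where z: "z = cbracket x y" "x \<in> K" "y \<in> K" by blast
    then have "imul z = cbracket (imul x) y" "imul x \<in> K" using iK by (simp_all add: cbracket_imul)
    with z show "imul z \<in> {cbracket x y | x y. x \<in> K \<and> y \<in> K}" by blast
  qed
  moreover have "subspace D" unfolding D_def by simp
  moreover have "cbracket x y \<in> D" if "x \<in> D" "y \<in> D" for x y using base[of x y] that DK by auto
  ultimately have cD: "complex_subalgebra D" unfolding complex_subalgebra_def real_subalgebra_def by simp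
  have "\<exists>e f h :: nat \<Rightarrow> 'a cend.
        (\<forall>i\<in>{..<length A}. e i \<in> K \<and> f i \<in> K \<and> h i \<in> K \<and> e i \<noteq> 0 \<and> f i \<noteq> 0) \<and>
        (\<forall>i\<in>{..<length A}. \<forall>j\<in>{..<length A}.
           cbracket (h i) (h j) = 0 \<and>
           cbracket (h i) (e j) = real_of_int (A ! i ! j) *\<^sub>R e j \<and>
           cbracket (h i) (f j) = - real_of_int (A ! i ! j) *\<^sub>R f j \<and>
           cbracket (e i) (f j) = (if i = j then h i else 0) \<and>
           (i \<noteq> j \<longrightarrow> (cbracket (e i) ^^ nat (1 - A ! i ! j)) (e j) = 0 \<and>
                     (cbracket (f i) ^^ nat (1 - A ! i ! j)) (f j) = 0)) \<and>
        (\<forall>S. complex_subalgebra S \<and> (\<forall>i\<in>{..<length A}. e i \<in> S \<and> f i \<in> S) \<longrightarrow> K \<subseteq> S)"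
    (is "\<exists>e f h. ?Q e f h")
    using ct unfolding has_cartan_type_def Let_def by (rule conjunct2)
  then obtain e f h where Q: "?Q e f h" by (elim exE)
  note efh = Q[THEN conjunct1] Q[THEN conjunct2, THEN conjunct1] and gen = Q[THEN conjunct2, THEN conjunct2]
  have "e i \<in> D \<and> f i \<in> D" if i: "i < length A" for i
  proof -
    have he: "cbracket (h i) (e i) = 2 *\<^sub>R e i" "cbracket (h i) (f i) = - 2 *\<^sub>R f i"
      using efh(2) i diag[OF i] by simp_all
    have K: "h i \<in> K" "e i \<in> K" "f i \<in> K" using efh(1) i by simp_all
    have "(1/2) *\<^sub>R cbracket (h i) (e i) \<in> D" "(-1/2) *\<^sub>R cbracket (h i) (f i) \<in> D"
      using subspace_scale[OF \<open>subspace D\<close> base[OF K(1,2)]] subspace_scale[OF \<open>subspace D\<close> base[OF K(1,3)]]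
      by blast+
    then show ?thesis using he by simp
  qed
  then have KD: "K \<subseteq> D" using gen cD by simp
  have bl: "bilinear \<beta>" using io unfolding inner_on_def by blast
  show ?thesis unfolding centreless_def
  proof (intro ballI impI)
    fix Z assume Z: "Z \<in> K" and c: "\<forall>W\<in>K. cbracket Z W = 0"
    have "\<beta> v Z = 0" if "v \<in> D" for v
      using that unfolding D_def
    proof (induction rule: span_induct_alt)
      case base
      then show ?case by (simp add: bilinear_lzero[OF bl])
    next
      case (step a u v)
      from step(1) obtain x y where xy: "u = cbracket x y" "x \<in> K" "y \<in> K" by blast
      have "\<beta> u Z = \<beta> y (cbracket (st x) Z)" using ad xy Z by simp
      also have "cbracket (st x) Z = 0" using c st[OF xy(2)] cbracket_anti[of "st x" Z] by simp
      finally show ?case using step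
        by (simp add: bilinear_ladd[OF bl] bilinear_lmul[OF bl] bilinear_rzero[OF bl])
    qed
    then have "\<beta> Z Z = 0" using KD Z by blast
    then show "Z = 0" using io Z unfolding inner_on_def by (metis less_irrefl)
  qed
qed

section \<open>Octonion arithmetic\<close>

lemma sum_iunit: "(\<Sum>q\<in>UNIV. f q) = f Ui + f Uj + f Uk + f Ukl + f Ujl + f Uil + f Ul"
  by (simp add: UNIV_iunit add.assoc)

lemma all_iunit: "(\<forall>q. P q) \<longleftrightarrow> P Ui \<and> P Uj \<and> P Uk \<and> P Ukl \<and> P Ujl \<and> P Uil \<and> P Ul"
  by (metis iunit.exhaust)

lemma oct_eq_iff: "x = y \<longleftrightarrow> fst x = fst y \<and> snd x $ Ui = snd y $ Ui \<and> snd x $ Uj = snd y $ Uj \<and>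
    snd x $ Uk = snd y $ Uk \<and> snd x $ Ukl = snd y $ Ukl \<and> snd x $ Ujl = snd y $ Ujl \<and>
    snd x $ Uil = snd y $ Uil \<and> snd x $ Ul = snd (y::oct) $ Ul"
  by (auto simp: prod_eq_iff vec_eq_iff all_iunit)

lemma omult_components:
  "fst (omult x y) =
    fst x * fst y - snd x $ Ui * snd y $ Ui - snd x $ Uj * snd y $ Uj - snd x $ Uk * snd y $ Uk - snd x $ Ukl * snd y $ Ukl - snd x $ Ujl * snd y $ Ujl - snd x $ Uil * snd y $ Uil - snd x $ Ul * snd y $ Ul"
  "snd (omult x y) $ Ui =
    fst x * snd y $ Ui + snd x $ Ui * fst y + snd x $ Uj * snd y $ Uk + snd x $ Ukl * snd y $ Ujl + snd x $ Ul * snd y $ Uil - snd x $ Uk * snd y $ Uj - snd x $ Ujl * snd y $ Ukl - snd x $ Uil * snd y $ Ul"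
  "snd (omult x y) $ Uj =
    fst x * snd y $ Uj + snd x $ Uj * fst y + snd x $ Uk * snd y $ Ui + snd x $ Uil * snd y $ Ukl + snd x $ Ul * snd y $ Ujl - snd x $ Ui * snd y $ Uk - snd x $ Ukl * snd y $ Uil - snd x $ Ujl * snd y $ Ul"
  "snd (omult x y) $ Uk =
    fst x * snd y $ Uk + snd x $ Ui * snd y $ Uj + snd x $ Uk * fst y + snd x $ Ujl * snd y $ Uil + snd x $ Ul * snd y $ Ukl - snd x $ Uj * snd y $ Ui - snd x $ Ukl * snd y $ Ul - snd x $ Uil * snd y $ Ujl"
  "snd (omult x y) $ Ukl =
    fst x * snd y $ Ukl + snd x $ Uj * snd y $ Uil + snd x $ Uk * snd y $ Ul + snd x $ Ukl * fst y + snd x $ Ujl * snd y $ Ui - snd x $ Ui * snd y $ Ujl - snd x $ Uil * snd y $ Uj - snd x $ Ul * snd y $ Uk"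
  "snd (omult x y) $ Ujl =
    fst x * snd y $ Ujl + snd x $ Ui * snd y $ Ukl + snd x $ Uj * snd y $ Ul + snd x $ Ujl * fst y + snd x $ Uil * snd y $ Uk - snd x $ Uk * snd y $ Uil - snd x $ Ukl * snd y $ Ui - snd x $ Ul * snd y $ Uj"
  "snd (omult x y) $ Uil =
    fst x * snd y $ Uil + snd x $ Ui * snd y $ Ul + snd x $ Uk * snd y $ Ujl + snd x $ Ukl * snd y $ Uj + snd x $ Uil * fst y - snd x $ Uj * snd y $ Ukl - snd x $ Ujl * snd y $ Uk - snd x $ Ul * snd y $ Ui"
  "snd (omult x y) $ Ul =
    fst x * snd y $ Ul + snd x $ Ukl * snd y $ Uk + snd x $ Ujl * snd y $ Uj + snd x $ Uil * snd y $ Ui + snd x $ Ul * fst y - snd x $ Ui * snd y $ Uil - snd x $ Uj * snd y $ Ujl - snd x $ Uk * snd y $ Ukl"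

  by (simp_all add: omult_def sum_iunit unit_sign_def cyclic_triple_def quat_triples_def)

lemma oct_inner: "x \<bullet> y = fst x * fst y + snd x $ Ui * snd y $ Ui + snd x $ Uj * snd y $ Uj +
    snd x $ Uk * snd y $ Uk + snd x $ Ukl * snd y $ Ukl + snd x $ Ujl * snd y $ Ujl +
    snd x $ Uil * snd y $ Uil + snd x $ Ul * snd (y::oct) $ Ul"
  by (simp add: inner_prod_def inner_vec_def sum_iunit)

lemma oconj_components: "fst (oconj x) = fst x" "snd (oconj x) $ q = - snd x $ q"
  by (simp_all add: oconj_def)

lemma oreal_components: "fst (oreal r) = r" "snd (oreal r) $ q = 0"
  by (simp_all add: oreal_def)

lemma ounit_components: "fst (ounit p) = 0" "snd (ounit p) $ q = (if p = q then 1 else 0)"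
  by (auto simp: ounit_def axis_def)

lemmas oct_comp = omult_components oconj_components oreal_components ounit_components

lemma oconj_linear: "linear oconj"
  by (simp add: linear_iff oconj_def)

lemma oconj_oconj [simp]: "oconj (oconj x) = x"
  by (simp add: oconj_def)

lemma oconj_simps [simp]: "oconj 0 = 0" "oconj (x + y) = oconj x + oconj y" "oconj (x - y) = oconj x - oconj y"
  "oconj (- x) = - oconj x" "oconj (r *\<^sub>R x) = r *\<^sub>R oconj x" "oconj (oreal s) = oreal s"
  "oconj (ounit q) = - ounit q" "oconj x \<bullet> oconj y = x \<bullet> y"
  by (simp_all add: oconj_def oreal_def ounit_def inner_prod_def zero_prod_def)

lemma omult_bilinear: "bilinear omult"
  unfolding bilinear_def linear_iff by (simp add: oct_eq_iff omult_components algebra_simps)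

lemma omult_bb: "bounded_bilinear omult"
  using omult_bilinear by (simp add: bilinear_conv_bounded_bilinear)

lemmas omult_simps [simp] =
  bilinear_ladd[OF omult_bilinear] bilinear_radd[OF omult_bilinear]
  bilinear_lsub[OF omult_bilinear] bilinear_rsub[OF omult_bilinear]
  bilinear_lmul[OF omult_bilinear] bilinear_rmul[OF omult_bilinear]
  bilinear_lneg[OF omult_bilinear] bilinear_rneg[OF omult_bilinear]
  bilinear_lzero[OF omult_bilinear] bilinear_rzero[OF omult_bilinear]

lemma omult_oreal [simp]: "omult (oreal r) x = r *\<^sub>R x" "omult x (oreal r) = r *\<^sub>R x"
  by (simp_all add: oct_eq_iff oct_comp)

lemma oreal_simps [simp]: "oreal 0 = 0" "oreal r + oreal s = oreal (r + s)" "r *\<^sub>R oreal s = oreal (r * s)"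
  "- oreal r = oreal (- r)"
  by (simp_all add: oreal_def prod_eq_iff)

lemma oconj_omult [simp]: "oconj (omult x y) = omult (oconj y) (oconj x)"
  by (simp add: oct_eq_iff oct_comp algebra_simps)

lemma onormsq_inner: "onormsq x = x \<bullet> x"
  by (simp add: onormsq_def oct_comp oct_inner)

text \<open>The trace form \<open>Re (x y z)\<close> is invariant under cyclic shifts and independent of bracketing.\<close>

definition tri_re :: "oct \<Rightarrow> oct \<Rightarrow> oct \<Rightarrow> real" where
  "tri_re x y z = fst (omult (omult x y) z)"

lemma tri_re_cyclic: "tri_re x y z = tri_re y z x"
  by (simp add: tri_re_def omult_components algebra_simps)

lemma tri_re_inner: "tri_re x y z = oconj x \<bullet> omult y z"
  by (simp add: tri_re_def omult_components oconj_components oct_inner algebra_simps)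

lemma omult_cancel: "omult (oconj b) (omult b c) = (b \<bullet> b) *\<^sub>R c" "omult (omult a b) (oconj b) = (b \<bullet> b) *\<^sub>R a"
  by (simp_all add: oct_eq_iff oct_comp oct_inner algebra_simps)

lemma omult_adjoint: "omult a b \<bullet> c = b \<bullet> omult (oconj a) c" "omult a b \<bullet> c = a \<bullet> omult c (oconj b)"
  by (simp_all add: oct_comp oct_inner algebra_simps)

section \<open>The cubic form and its infinitesimal symmetries\<close>

abbreviation (input) hp :: "h3o \<Rightarrow> real" where "hp x \<equiv> fst x"
abbreviation (input) hm :: "h3o \<Rightarrow> real" where "hm x \<equiv> fst (snd x)"
abbreviation (input) hn :: "h3o \<Rightarrow> real" where "hn x \<equiv> fst (snd (snd x))"
abbreviation (input) ha :: "h3o \<Rightarrow> oct" where "ha x \<equiv> fst (snd (snd (snd x)))"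
abbreviation (input) hb :: "h3o \<Rightarrow> oct" where "hb x \<equiv> fst (snd (snd (snd (snd x))))"
abbreviation (input) hc :: "h3o \<Rightarrow> oct" where "hc x \<equiv> snd (snd (snd (snd (snd x))))"

definition tau :: "h3o \<Rightarrow> h3o \<Rightarrow> h3o \<Rightarrow> real" where
  "tau x y z = hp x * hm y * hn z - (hp x * (hb y \<bullet> hb z) + hm x * (hc y \<bullet> hc z) + hn x * (ha y \<bullet> ha z))
     + 2 * tri_re (oconj (ha x)) (oconj (hb y)) (oconj (hc z))"

lemma det_tau: "h3o_det x = tau x x x"
  by (cases x) (simp add: tau_def onormsq_inner tri_re_def)

lemma tau_linear: "linear (\<lambda>x. tau x y z)" "linear (\<lambda>y. tau x y z)" "linear (\<lambda>z. tau x y z)"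
  by (simp_all add: linear_iff tau_def tri_re_def inner_add_left inner_add_right algebra_simps)

lemmas tau_simps =
  linear_add[OF tau_linear(1)] linear_add[OF tau_linear(2)] linear_add[OF tau_linear(3)]
  linear_diff[OF tau_linear(1)] linear_diff[OF tau_linear(2)] linear_diff[OF tau_linear(3)]
  linear_scale[OF tau_linear(1)] linear_scale[OF tau_linear(2)] linear_scale[OF tau_linear(3)]
  linear_0[OF tau_linear(1)] linear_0[OF tau_linear(2)] linear_0[OF tau_linear(3)]
  linear_neg[OF tau_linear(1)] linear_neg[OF tau_linear(2)] linear_neg[OF tau_linear(3)]

definition dtau :: "h3o \<Rightarrow> h3o \<Rightarrow> real" where
  "dtau x y = tau y x x + tau x y x + tau x x y"

definition tau_sym :: "h3o \<Rightarrow> h3o \<Rightarrow> h3o \<Rightarrow> real" where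
  "tau_sym x y z = tau x y z + tau x z y + tau y x z + tau y z x + tau z x y + tau z y x"

definition preserves_tau :: "endo \<Rightarrow> bool" where
  "preserves_tau X \<longleftrightarrow> (\<forall>x. dtau x (blinfun_apply X x) = 0)"

lemma preserves_tau_polar:
  assumes "preserves_tau X"
  shows "tau_sym (X x) y z + tau_sym x (X y) z + tau_sym x y (X z) = 0"
proof -
  have f: "dtau v (X v) = 0" for v using assms unfolding preserves_tau_def by blast
  show ?thesis
    using f[of "x + y + z"] f[of "x + y"] f[of "y + z"] f[of "x + z"] f[of x] f[of y] f[of z]
    unfolding dtau_def tau_sym_def blinfun.add_right tau_simps by linarith
qed

lemma dtau_simps: "dtau x (y + z) = dtau x y + dtau x z" "dtau x (c *\<^sub>R y) = c * dtau x y" "dtau x 0 = 0"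
  by (simp_all add: dtau_def tau_simps algebra_simps)

lemma preserves_tau_subspace: "subspace {X. preserves_tau X}"
  by (simp add: subspace_def preserves_tau_def dtau_simps blinfun.bilinear_simps)

lemma preserves_tau_commutator:
  assumes "preserves_tau X" "preserves_tau Y"
  shows "preserves_tau (commutator X Y)"
  unfolding preserves_tau_def
proof
  fix x
  note p = preserves_tau_polar[OF assms(1)] and q = preserves_tau_polar[OF assms(2)]
  have s: "tau_sym u v w = tau_sym v u w" "tau_sym u v w = tau_sym u w v" for u v w
    by (simp_all add: tau_sym_def)
  have d: "dtau v w = tau_sym w v v / 2" for v w by (simp add: dtau_def tau_sym_def)
  have "tau_sym (X (Y x)) x x + 2 * tau_sym (Y x) (X x) x = 0"
    using p[of "Y x" x x] s[of "X x" "Y x" x] s(2)[of "Y x" x "X x"] by simp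
  moreover have "tau_sym (Y (X x)) x x + 2 * tau_sym (Y x) (X x) x = 0"
    using q[of "X x" x x] s(2)[of "X x" x "Y x"] s(1)[of "X x" "Y x" x] by simp
  ultimately have "tau_sym (commutator X Y x) x x = 0"
    by (simp add: commutator_def blinfun.bilinear_simps tau_sym_def tau_simps)
  then show "dtau x (commutator X Y x) = 0" by (simp add: d)
qed

lemma det_has_derivative:
  assumes f: "(f has_vector_derivative D) (at t)"
  shows "((\<lambda>t. h3o_det (f t)) has_vector_derivative dtau (f t) D) (at t)"
proof -
  define B where "B x y = Blinfun (\<lambda>z. tau x y z)" for x y
  have Bz: "B x y z = tau x y z" for x y z
    unfolding B_def using tau_linear(3) by (simp add: bounded_linear_Blinfun_apply linear_conv_bounded_linear)
  have "bilinear B" unfolding bilinear_def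
    unfolding linear_iff by (intro conjI allI blinfun_eqI; simp add: Bz tau_simps blinfun.bilinear_simps)
  then have bb: "bounded_bilinear B" by (simp add: bilinear_conv_bounded_bilinear)
  have "((\<lambda>t. B (f t) (f t)) has_vector_derivative (B (f t) D + B D (f t))) (at t)"
    by (rule bounded_bilinear.has_vector_derivative[OF bb f f])
  then have "((\<lambda>t. B (f t) (f t) (f t)) has_vector_derivative
      (B (f t) (f t) D + (B (f t) D + B D (f t)) (f t))) (at t)"
    by (rule bounded_bilinear.has_vector_derivative[OF bounded_bilinear_blinfun_apply _ f])
  then show ?thesis by (simp add: Bz det_tau dtau_def blinfun.bilinear_simps algebra_simps)
qed

subsection \<open>One-parameter groups\<close>

lemma blinfun_funpow_norm:
  fixes X :: "'a::real_normed_vector \<Rightarrow>\<^sub>L 'a"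
  shows "norm ((blinfun_apply X ^^ n) x) \<le> norm X ^ n * norm x"
proof (induction n)
  case (Suc n)
  have "norm ((blinfun_apply X ^^ Suc n) x) \<le> norm X * norm ((blinfun_apply X ^^ n) x)"
    by (simp add: norm_blinfun)
  also have "\<dots> \<le> norm X * (norm X ^ n * norm x)" by (intro mult_left_mono Suc) simp
  finally show ?case by (simp add: mult.assoc)
qed simp

lemma blinfun_funpow_linear:
  fixes X :: "'a::real_normed_vector \<Rightarrow>\<^sub>L 'a"
  shows "linear (blinfun_apply X ^^ n)"
proof (induction n)
  case (Suc n)
  then show ?case by (auto simp: linear_iff blinfun.bilinear_simps)
qed (simp add: linear_iff)

definition flow :: "('a::euclidean_space \<Rightarrow>\<^sub>L 'a) \<Rightarrow> real \<Rightarrow> 'a \<Rightarrow> 'a" where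
  "flow X t x = (\<Sum>n. (t ^ n / fact n) *\<^sub>R (blinfun_apply X ^^ n) x)"

lemma flow_summable:
  fixes X :: "'a::euclidean_space \<Rightarrow>\<^sub>L 'a"
  shows "summable (\<lambda>n. (t ^ n / fact n) *\<^sub>R (blinfun_apply X ^^ n) (x))"
proof (rule summable_norm_cancel, rule summable_comparison_test')
  show "summable (\<lambda>n. norm x * (inverse (fact n) * (\<bar>t\<bar> * norm X) ^ n))"
    by (intro summable_mult summable_exp)
  fix n :: nat
  have "norm ((t ^ n / fact n) *\<^sub>R (blinfun_apply X ^^ n) x) \<le> (\<bar>t\<bar> ^ n / fact n) * (norm X ^ n * norm x)"
    by (simp add: power_abs divide_right_mono mult_left_mono blinfun_funpow_norm)
  then show "norm (norm ((t ^ n / fact n) *\<^sub>R (blinfun_apply X ^^ n) x)) \<le> norm x * (inverse (fact n) * (\<bar>t\<bar> * norm X) ^ n)"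
    by (simp add: power_mult_distrib field_simps)
qed

lemma flow_linear: "linear (flow X t)"
  unfolding flow_def linear_iff
  using flow_summable[of t X] linear_add[OF blinfun_funpow_linear[of _ X]] linear_scale[OF blinfun_funpow_linear[of _ X]]
  by (auto simp: suminf_add suminf_scaleR_right scaleR_add_right mult.commute)

lemma flow_0: "flow X 0 x = x"
  unfolding flow_def using suminf_finite[of "{0}" "\<lambda>n. (0 ^ n / fact n) *\<^sub>R (blinfun_apply X ^^ n) x"] by simp

lemma flow_deriv: "((\<lambda>t. flow X t x) has_vector_derivative X (flow X t x)) (at t)"
proof -
  have comp: "flow X t x \<bullet> b = (\<Sum>n. ((blinfun_apply X ^^ n) x \<bullet> b / fact n) * t ^ n)" for t x b
    unfolding flow_def using bounded_linear.suminf[OF bounded_linear_inner_left flow_summable, of t X x b]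
    by (simp add: field_simps)
  have sm: "summable (\<lambda>n. ((blinfun_apply X ^^ n) x \<bullet> b / fact n) * t ^ n)" for t x b
    using bounded_linear.summable[OF bounded_linear_inner_left flow_summable, of t X x b]
    by (simp add: field_simps)
  have Xf: "X (flow X t x) = flow X t (X x)"
    unfolding flow_def
    by (simp add: bounded_linear.suminf[OF blinfun.bounded_linear_right flow_summable] blinfun.scaleR_right funpow_swap1)
  have "((\<lambda>t. flow X t x \<bullet> b) has_real_derivative (flow X t (X x) \<bullet> b)) (at t)" for b
  proof -
    have "((\<lambda>t. \<Sum>n. ((blinfun_apply X ^^ n) x \<bullet> b / fact n) * t ^ n) has_real_derivative
       (\<Sum>n. diffs (\<lambda>n. (blinfun_apply X ^^ n) x \<bullet> b / fact n) n * t ^ n)) (at t)"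
      by (rule termdiffs_strong_converges_everywhere) (rule sm)
    moreover have "diffs (\<lambda>n. (blinfun_apply X ^^ n) x \<bullet> b / fact n) n = (blinfun_apply X ^^ n) (X x) \<bullet> b / fact n" for n
      by (simp add: diffs_def funpow_swap1 field_simps del: of_nat_Suc)
    ultimately show ?thesis by (simp add: comp)
  qed
  then have "((\<lambda>t. flow X t x) has_derivative (\<lambda>h. h *\<^sub>R flow X t (X x))) (at t)"
    by (subst has_derivative_componentwise_within)
       (auto simp: has_field_derivative_def mult_commute_abs)
  then show ?thesis by (simp add: has_vector_derivative_def Xf)
qed

lemma blinfun_has_vector_derivative:
  fixes F :: "real \<Rightarrow> 'a::euclidean_space \<Rightarrow> 'b::euclidean_space"
  assumes lin: "\<And>t. linear (F t)"
    and der: "\<And>x. ((\<lambda>t. F t x) has_vector_derivative D x) (at t0)"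
  shows "linear D" "((\<lambda>t. Blinfun (F t)) has_vector_derivative Blinfun D) (at t0)"
proof -
  have bl: "bounded_linear (F t)" for t using lin by (simp add: linear_conv_bounded_linear)
  have r: "F t x = (\<Sum>b\<in>Basis. (x \<bullet> b) *\<^sub>R F t b)" for t x
    using linear_sum[OF lin[of t], of "\<lambda>b. (x \<bullet> b) *\<^sub>R b" Basis] linear_scale[OF lin[of t]]
    by (simp add: euclidean_representation)
  have d: "D x = (\<Sum>b\<in>Basis. (x \<bullet> b) *\<^sub>R D b)" for x
  proof (rule vector_derivative_unique_at[OF der])
    show "((\<lambda>t. F t x) has_vector_derivative (\<Sum>b\<in>Basis. (x \<bullet> b) *\<^sub>R D b)) (at t0)"
      unfolding r[of _ x]
      by (intro has_vector_derivative_sum bounded_linear.has_vector_derivative[OF bounded_linear_scaleR_right] der)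
  qed
  show ld: "linear D"
    unfolding linear_iff
  proof (intro conjI allI)
    show "D (x + y) = D x + D y" for x y
      by (subst (1 2 3) d) (simp add: inner_add_left scaleR_add_left sum.distrib)
    show "D (c *\<^sub>R x) = c *\<^sub>R D x" for c x
      by (subst (1 2) d) (simp add: scaleR_sum_right)
  qed
  define E :: "'a \<Rightarrow> 'b \<Rightarrow> ('a \<Rightarrow>\<^sub>L 'b)" where "E b v = Blinfun (\<lambda>x. (x \<bullet> b) *\<^sub>R v)" for b v
  have Ea: "E b v x = (x \<bullet> b) *\<^sub>R v" for b v x
    unfolding E_def by (rule bounded_linear_Blinfun_apply[THEN fun_cong]) (auto intro!: bounded_linear_intros)
  have En: "bounded_linear (E b)" for b
  proof (rule bounded_linear_intro[where K = "norm b"])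
    fix v show "norm (E b v) \<le> norm v * norm b"
    proof (rule norm_blinfun_bound)
      show "norm (E b v x) \<le> norm v * norm b * norm x" for x
        using mult_right_mono[OF Cauchy_Schwarz_ineq2[of x b], of "norm v"] by (simp add: Ea mult_ac)
    qed simp
  qed (auto intro!: blinfun_eqI simp: Ea blinfun.bilinear_simps scaleR_add_right mult.commute)
  have rep: "Blinfun G = (\<Sum>b\<in>Basis. E b (G b))" if "linear G" for G
  proof (rule blinfun_eqI)
    fix x
    have "Blinfun G x = G (\<Sum>b\<in>Basis. (x \<bullet> b) *\<^sub>R b)"
      using that by (simp add: bounded_linear_Blinfun_apply linear_conv_bounded_linear euclidean_representation)
    also have "\<dots> = (\<Sum>b\<in>Basis. E b (G b)) x"
      by (simp add: linear_sum[OF that] linear_scale[OF that] blinfun.sum_left Ea)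
    finally show "Blinfun G x = (\<Sum>b\<in>Basis. E b (G b)) x" .
  qed
  show "((\<lambda>t. Blinfun (F t)) has_vector_derivative Blinfun D) (at t0)"
    unfolding rep[OF lin] rep[OF ld]
    by (intro has_vector_derivative_sum bounded_linear.has_vector_derivative[OF En] der)
qed

lemma Blinfun_linear_apply:
  fixes f :: "'a::euclidean_space \<Rightarrow> 'b::real_normed_vector"
  shows "linear f \<Longrightarrow> blinfun_apply (Blinfun f) = f"
  by (simp add: bounded_linear_Blinfun_apply linear_conv_bounded_linear)

text \<open>For a curve in the group, differentiate the determinant at \<open>0\<close>; conversely the determinant is
  constant along the flow of a map that annihilates it.\<close>

lemma sl3O_iff: "X \<in> sl3O \<longleftrightarrow> preserves_tau X"
proof
  assume "X \<in> sl3O"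
  then obtain g where g: "\<forall>t::real. g t \<in> SL3O" "g 0 = id_blinfun" "(g has_vector_derivative X) (at 0)"
    unfolding sl3O_def lie_algebra_of_def by blast
  show "preserves_tau X" unfolding preserves_tau_def
  proof
    fix x
    have "((\<lambda>t. g t x) has_vector_derivative X x) (at 0)"
      using bounded_linear.has_vector_derivative[OF blinfun.bounded_linear_left g(3)] .
    then have "((\<lambda>t. h3o_det (g t x)) has_vector_derivative dtau (g 0 x) (X x)) (at 0)"
      by (rule det_has_derivative)
    moreover have "(\<lambda>t. h3o_det (g t x)) = (\<lambda>t. h3o_det x)"
    proof (rule ext)
      show "h3o_det (g t x) = h3o_det x" for t using g(1) unfolding SL3O_def by blast
    qed
    ultimately have "((\<lambda>t. h3o_det x) has_vector_derivative dtau x (X x)) (at (0::real))" using g(2) by simp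
    then show "dtau x (X x) = 0" using vector_derivative_unique_at has_vector_derivative_const by blast
  qed
next
  assume p: "preserves_tau X"
  define g where "g t = Blinfun (flow X t)" for t
  have ga: "g t x = flow X t x" for t x unfolding g_def by (simp add: Blinfun_linear_apply flow_linear)
  have "h3o_det (g t x) = h3o_det x" for t x
  proof -
    have "((\<lambda>t. h3o_det (flow X t x)) has_vector_derivative 0) (at s within UNIV)" for s
      using det_has_derivative[OF flow_deriv[of X x s]] p unfolding preserves_tau_def by simp
    then obtain c where "\<And>s. s \<in> UNIV \<Longrightarrow> h3o_det (flow X s x) = c"
      using has_vector_derivative_zero_constant[of UNIV "\<lambda>t. h3o_det (flow X t x)"] convex_UNIV by metis
    note c = this[OF UNIV_I]
    show ?thesis using c[of t] c[of 0] by (simp only: ga flow_0)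
  qed
  then have "\<forall>t. g t \<in> SL3O" unfolding SL3O_def by blast
  moreover have "g 0 = id_blinfun" by (rule blinfun_eqI) (simp add: ga flow_0)
  moreover have "(g has_vector_derivative X) (at 0)"
  proof -
    have "((\<lambda>t. Blinfun (flow X t)) has_vector_derivative Blinfun (\<lambda>x. X (flow X 0 x))) (at 0)"
      by (rule blinfun_has_vector_derivative(2)[OF flow_linear flow_deriv])
    then show ?thesis unfolding g_def by (simp add: flow_0 blinfun_apply_inverse)
  qed
  ultimately show "X \<in> sl3O" unfolding sl3O_def lie_algebra_of_def by blast
qed

section \<open>Elementary operators and the generators\<close>

definition mat_elem :: "3 \<Rightarrow> 3 \<Rightarrow> oct \<Rightarrow> oct ^ 3 ^ 3" where
  "mat_elem i j u = (\<chi> r s. if r = i \<and> s = j then u else 0)"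

definition sandwich2 :: "oct ^ 3 ^ 3 \<Rightarrow> oct ^ 3 ^ 3 \<Rightarrow> h3o \<Rightarrow> h3o" where
  "sandwich2 M N x = mat_h3o (ommult (ommult M (h3o_mat x)) (odagger N))"

definition mat_one :: "oct ^ 3 ^ 3" where
  "mat_one = mat_elem 1 1 (oreal 1) + mat_elem 2 2 (oreal 1) + mat_elem 3 3 (oreal 1)"

text \<open>The derivative of \<open>M \<mapsto> M \<chi> M\<^sup>\<dagger>\<close> at the identity.\<close>

definition mat_act :: "oct ^ 3 ^ 3 \<Rightarrow> h3o \<Rightarrow> h3o" where
  "mat_act A x = sandwich2 A mat_one x + sandwich2 mat_one A x"

lemma h3o_mat_proj: "h3o_mat x = vector [vector [oreal (hp x), oconj (ha x), hc x],
    vector [ha x, oreal (hm x), oconj (hb x)], vector [oconj (hc x), hb x, oreal (hn x)]]"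
  by (cases x) simp

lemma oreal_linear [simp]: "oreal (r + s) = oreal r + oreal s" "oreal (c * r) = c *\<^sub>R oreal r"
  by (simp_all add: oreal_def)

declare oreal_simps(2,3)[simp del]

lemma mat_elem_linear: "linear (mat_elem i j)"
  by (auto simp: linear_iff mat_elem_def vec_eq_iff)

lemma sandwich2_expand:
  "sandwich2 M N x = (
    fst (\<Sum>l\<in>UNIV. omult (\<Sum>k\<in>UNIV. omult (M$1$k) (h3o_mat x$k$l)) (oconj (N$1$l))),
    fst (\<Sum>l\<in>UNIV. omult (\<Sum>k\<in>UNIV. omult (M$2$k) (h3o_mat x$k$l)) (oconj (N$2$l))),
    fst (\<Sum>l\<in>UNIV. omult (\<Sum>k\<in>UNIV. omult (M$3$k) (h3o_mat x$k$l)) (oconj (N$3$l))),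
    (\<Sum>l\<in>UNIV. omult (\<Sum>k\<in>UNIV. omult (M$2$k) (h3o_mat x$k$l)) (oconj (N$1$l))),
    (\<Sum>l\<in>UNIV. omult (\<Sum>k\<in>UNIV. omult (M$3$k) (h3o_mat x$k$l)) (oconj (N$2$l))),
    (\<Sum>l\<in>UNIV. omult (\<Sum>k\<in>UNIV. omult (M$1$k) (h3o_mat x$k$l)) (oconj (N$3$l))))"
  by (simp add: sandwich2_def mat_h3o_def ommult_def odagger_def)

lemma sandwich2_bilinear: "bilinear (\<lambda>M N. sandwich2 M N x)"
  unfolding bilinear_def linear_iff sandwich2_expand
  by (simp add: sum_3 scaleR_add_right algebra_simps)

lemma sandwich2_linear: "linear (sandwich2 M N)"
  unfolding linear_iff sandwich2_expand h3o_mat_proj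
  by (simp add: sum_3 vector_3 scaleR_add_right algebra_simps)

lemma mat_act_linear: "linear (\<lambda>A. mat_act A x)" "linear (mat_act A)"
  using sandwich2_bilinear[of x] sandwich2_linear
  unfolding mat_act_def bilinear_def by (auto simp: linear_iff algebra_simps)

fun slot_row slot_col slot_rest :: "slot \<Rightarrow> 3" where
  "slot_row One = 1" | "slot_row Two = 2" | "slot_row Three = 3"
| "slot_col One = 2" | "slot_col Two = 3" | "slot_col Three = 1"
| "slot_rest One = 3" | "slot_rest Two = 1" | "slot_rest Three = 2"

lemma slot_mat_elem: "slot_mat s M = mat_elem (slot_row s) (slot_row s) (M$1$1)
    + mat_elem (slot_row s) (slot_col s) (M$1$2) + mat_elem (slot_col s) (slot_row s) (M$2$1)
    + mat_elem (slot_col s) (slot_col s) (M$2$2) + mat_elem (slot_rest s) (slot_rest s) (oreal 1)"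
  by (cases s) (simp_all add: mat_elem_def vec_eq_iff forall_3 vector_3)

lemma mat_one_slot: "mat_elem (slot_row s) (slot_row s) (oreal 1) + mat_elem (slot_col s) (slot_col s) (oreal 1)
    + mat_elem (slot_rest s) (slot_rest s) (oreal 1) = mat_one"
  by (cases s) (simp_all add: mat_one_def)

lemma dot_single:
  assumes M: "\<And>\<alpha>. xform_mats F \<alpha> = [vector [vector [u11 \<alpha>, u12 \<alpha>], vector [u21 \<alpha>, u22 \<alpha>]]]"
    and d: "(u11 has_vector_derivative d11) (at 0)" "(u12 has_vector_derivative d12) (at 0)"
      "(u21 has_vector_derivative d21) (at 0)" "(u22 has_vector_derivative d22) (at 0)"
    and z: "u11 0 = oreal 1" "u12 0 = 0" "u21 0 = 0" "u22 0 = oreal 1"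
  shows "blinfun_apply (dot F s) = mat_act (mat_elem (slot_row s) (slot_row s) d11
    + mat_elem (slot_row s) (slot_col s) d12 + mat_elem (slot_col s) (slot_row s) d21
    + mat_elem (slot_col s) (slot_col s) d22)"
proof -
  define N where "N \<alpha> = slot_mat s (vector [vector [u11 \<alpha>, u12 \<alpha>], vector [u21 \<alpha>, u22 \<alpha>]])" for \<alpha>
  define A where "A = mat_elem (slot_row s) (slot_row s) d11
    + mat_elem (slot_row s) (slot_col s) d12 + mat_elem (slot_col s) (slot_row s) d21
    + mat_elem (slot_col s) (slot_col s) d22"
  have el: "((\<lambda>\<alpha>. mat_elem i j (u \<alpha>)) has_vector_derivative mat_elem i j u') (at 0)"
    if "(u has_vector_derivative u') (at 0)" for i j u u'
    by (rule bounded_linear.has_vector_derivative[OF _ that])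
       (simp add: linear_conv_bounded_linear[symmetric] mat_elem_linear)
  have "(N has_vector_derivative (mat_elem (slot_row s) (slot_row s) d11
    + mat_elem (slot_row s) (slot_col s) d12 + mat_elem (slot_col s) (slot_row s) d21
    + mat_elem (slot_col s) (slot_col s) d22 + 0)) (at 0)"
    unfolding N_def slot_mat_elem vector_2
    by (intro has_vector_derivative_add el d has_vector_derivative_const)
  then have dN: "(N has_vector_derivative A) (at 0)" by (simp add: A_def)
  have N0: "N 0 = mat_one"
    unfolding N_def slot_mat_elem mat_one_slot[of s, symmetric]
    using linear_0[OF mat_elem_linear] by (simp add: vector_2 z)
  have bb: "bounded_bilinear (\<lambda>M N. sandwich2 M N x)" for x
    using sandwich2_bilinear by (simp add: bilinear_conv_bounded_bilinear)
  have "((\<lambda>\<alpha>. sandwich2 (N \<alpha>) (N \<alpha>) x) has_vector_derivative mat_act A x) (at 0)" for x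
    using bounded_bilinear.has_vector_derivative[OF bb dN dN, of x]
    by (simp add: N0 mat_act_def add.commute)
  then have v: "((\<lambda>\<alpha>. slot_action s (xform_mats F \<alpha>) x) has_vector_derivative mat_act A x) (at 0)" for x
    by (simp add: slot_action_def M sandwich_def sandwich2_def N_def)
  have "linear (slot_action s (xform_mats F \<alpha>))" for \<alpha>
    using sandwich2_linear by (simp add: slot_action_def M sandwich_def[abs_def] sandwich2_def[abs_def])
  then have "((\<lambda>\<alpha>. Blinfun (slot_action s (xform_mats F \<alpha>))) has_vector_derivative Blinfun (mat_act A)) (at 0)"
    by (rule blinfun_has_vector_derivative(2)[OF _ v])
  then have "dot F s = Blinfun (mat_act A)"
    unfolding dot_def by (rule vector_derivative_at)
  then show ?thesis by (simp add: Blinfun_linear_apply mat_act_linear A_def)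
qed

fun up :: "slot \<Rightarrow> oct \<Rightarrow> h3o \<Rightarrow> h3o" where
  "up One \<beta> x = (2 * (oconj \<beta> \<bullet> ha x), 0, 0, hm x *\<^sub>R oconj \<beta>, 0, omult \<beta> (oconj (hb x)))"
| "up Two \<beta> x = (0, 2 * (oconj \<beta> \<bullet> hb x), 0, omult \<beta> (oconj (hc x)), hn x *\<^sub>R oconj \<beta>, 0)"
| "up Three \<beta> x = (0, 0, 2 * (oconj \<beta> \<bullet> hc x), 0, omult \<beta> (oconj (ha x)), hp x *\<^sub>R oconj \<beta>)"

fun dn :: "slot \<Rightarrow> oct \<Rightarrow> h3o \<Rightarrow> h3o" where
  "dn One \<gamma> x = (0, 2 * (\<gamma> \<bullet> ha x), 0, hp x *\<^sub>R \<gamma>, omult (oconj (hc x)) (oconj \<gamma>), 0)"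
| "dn Two \<gamma> x = (0, 0, 2 * (\<gamma> \<bullet> hb x), 0, hm x *\<^sub>R \<gamma>, omult (oconj (ha x)) (oconj \<gamma>))"
| "dn Three \<gamma> x = (2 * (\<gamma> \<bullet> hc x), 0, 0, omult (oconj (hb x)) (oconj \<gamma>), 0, hn x *\<^sub>R \<gamma>)"

definition scal :: "real \<Rightarrow> real \<Rightarrow> real \<Rightarrow> h3o \<Rightarrow> h3o" where
  "scal r s t x = (2 * r * hp x, 2 * s * hm x, 2 * t * hn x, (r + s) *\<^sub>R ha x, (s + t) *\<^sub>R hb x, (r + t) *\<^sub>R hc x)"

lemma fst_omult_conj: "fst (omult x (oconj y)) = x \<bullet> y" "fst (omult (oconj x) y) = x \<bullet> y"
  "fst (omult x y) = oconj x \<bullet> y"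
  by (simp_all add: oct_comp oct_inner)

lemma mat_act_up: "mat_act (mat_elem (slot_row s) (slot_col s) \<beta>) x = up s \<beta> x"
  by (cases s) (simp_all add: mat_act_def sandwich2_expand h3o_mat_proj mat_elem_def mat_one_def sum_3 vector_3 fst_omult_conj inner_commute)

lemma mat_act_dn: "mat_act (mat_elem (slot_col s) (slot_row s) \<gamma>) x = dn s \<gamma> x"
  by (cases s) (simp_all add: mat_act_def sandwich2_expand h3o_mat_proj mat_elem_def mat_one_def sum_3 vector_3 fst_omult_conj inner_commute)

lemma mat_act_diag: "mat_act (mat_elem 1 1 (oreal r) + mat_elem 2 2 (oreal s) + mat_elem 3 3 (oreal t)) x = scal r s t x"
  by (simp add: scal_def mat_act_def sandwich2_expand h3o_mat_proj mat_elem_def mat_one_def sum_3 vector_3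
      fst_omult_conj oreal_components algebra_simps)

lemma up_linear: "linear (up s \<beta>)" "linear (\<lambda>\<beta>. up s \<beta> x)"
  by (cases s; simp add: linear_iff inner_add_right inner_add_left algebra_simps)+

lemma dn_linear: "linear (dn s \<beta>)" "linear (\<lambda>\<beta>. dn s \<beta> x)"
  by (cases s; simp add: linear_iff inner_add_right inner_add_left algebra_simps)+

lemma scal_linear: "linear (scal r s t)"
  by (simp add: linear_iff scal_def algebra_simps)

definition Up :: "slot \<Rightarrow> oct \<Rightarrow> endo" where "Up s \<beta> = Blinfun (up s \<beta>)"
definition Dn :: "slot \<Rightarrow> oct \<Rightarrow> endo" where "Dn s \<beta> = Blinfun (dn s \<beta>)"
definition Scal :: "real \<Rightarrow> real \<Rightarrow> real \<Rightarrow> endo" where "Scal r s t = Blinfun (scal r s t)"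

text \<open>If \<open>q\<close> is orthogonal to the conjugate of \<open>p\<close>, this bracket fixes the diagonal and rotates \<open>a\<close> in the
  plane of these two octonions, so such brackets span a copy of \<open>so(8)\<close>.\<close>

definition Rot :: "oct \<Rightarrow> oct \<Rightarrow> endo" where "Rot p q = (1/2) *\<^sub>R commutator (Up One p) (Dn One q)"

lemma Up_apply [simp]: "blinfun_apply (Up s \<beta>) = up s \<beta>"
  by (simp add: Up_def Blinfun_linear_apply up_linear)
lemma Dn_apply [simp]: "blinfun_apply (Dn s \<beta>) = dn s \<beta>"
  by (simp add: Dn_def Blinfun_linear_apply dn_linear)
lemma Scal_apply [simp]: "blinfun_apply (Scal r s t) = scal r s t"
  by (simp add: Scal_def Blinfun_linear_apply scal_linear)

lemma Rot_apply: "blinfun_apply (Rot p q) x = (hp x * (oconj p \<bullet> q), - (hm x * (oconj p \<bullet> q)), 0,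
    (q \<bullet> ha x) *\<^sub>R oconj p - (oconj p \<bullet> ha x) *\<^sub>R q,
    - ((1/2) *\<^sub>R omult (omult (hb x) (oconj p)) (oconj q)), (1/2) *\<^sub>R omult p (omult q (hc x)))"
  by (simp add: Rot_def commutator_def blinfun.bilinear_simps algebra_simps inner_commute)

lemma Up_linear: "linear (Up s)"
  using up_linear(2) unfolding linear_iff by (auto intro!: blinfun_eqI simp: blinfun.bilinear_simps)
lemma Dn_linear: "linear (Dn s)"
  using dn_linear(2) unfolding linear_iff by (auto intro!: blinfun_eqI simp: blinfun.bilinear_simps)

text \<open>The cyclic symmetry of the three slots reduces invariance to slot one.\<close>

definition cyc :: "h3o \<Rightarrow> h3o" where "cyc x = (hn x, hp x, hm x, hc x, ha x, hb x)"

lemma dtau_cyc: "dtau (cyc x) (cyc y) = dtau x y"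
  unfolding dtau_def tau_def cyc_def
  by (simp add: tri_re_cyclic[of "oconj (hc _)"] algebra_simps)

lemma up_dn_cyc: "up Two \<beta> (cyc x) = cyc (up One \<beta> x)" "up Three \<beta> (cyc x) = cyc (up Two \<beta> x)"
   "dn Two \<beta> (cyc x) = cyc (dn One \<beta> x)" "dn Three \<beta> (cyc x) = cyc (dn Two \<beta> x)"
  by (simp_all add: cyc_def)

lemma cyc_surj: "\<exists>y. x = cyc y"
  by (rule exI[of _ "(hm x, hn x, hp x, hb x, hc x, ha x)"]) (simp add: cyc_def)

lemma Up_preserves: "preserves_tau (Up s \<beta>)"
proof -
  have 1: "dtau x (up One \<beta> x) = 0" for x
  proof -
    have "tri_re \<beta> (oconj (hb x)) (oconj (hc x)) = omult \<beta> (oconj (hb x)) \<bullet> hc x"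
      by (simp only: tri_re_def fst_omult_conj(1))
    moreover have "tri_re (oconj (ha x)) (oconj (hb x)) (omult (hb x) (oconj \<beta>)) = (hb x \<bullet> hb x) * (oconj \<beta> \<bullet> ha x)"
    proof -
      have "tri_re (oconj (ha x)) (oconj (hb x)) (omult (hb x) (oconj \<beta>))
          = omult (oconj (ha x)) (oconj (hb x)) \<bullet> omult \<beta> (oconj (hb x))"
        using fst_omult_conj(1)[of "omult (oconj (ha x)) (oconj (hb x))" "omult \<beta> (oconj (hb x))"]
        by (simp add: tri_re_def)
      also have "\<dots> = oconj (ha x) \<bullet> omult (omult \<beta> (oconj (hb x))) (oconj (oconj (hb x)))"
        by (rule omult_adjoint)
      also have "\<dots> = (hb x \<bullet> hb x) * (oconj (ha x) \<bullet> \<beta>)"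
        using omult_cancel(2)[of \<beta> "oconj (hb x)"] by simp
      also have "oconj (ha x) \<bullet> \<beta> = oconj \<beta> \<bullet> ha x"
        using oconj_simps(8)[of "ha x" "oconj \<beta>"] by (simp add: inner_commute)
      finally show ?thesis .
    qed
    moreover have "omult (hb x) (oconj \<beta>) \<bullet> oconj (hc x) = omult \<beta> (oconj (hb x)) \<bullet> hc x"
      using oconj_simps(8)[of "omult \<beta> (oconj (hb x))" "hc x"] by (simp only: oconj_omult oconj_oconj)
    ultimately have "dtau x (up One \<beta> x) = 2 * (hm x * (tri_re \<beta> (oconj (hb x)) (oconj (hc x)) - omult \<beta> (oconj (hb x)) \<bullet> hc x))"
      by (simp add: dtau_def tau_def inner_commute algebra_simps tri_re_def)
    then show ?thesis by (simp add: tri_re_def fst_omult_conj(1))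
  qed
  have 2: "dtau x (up Two \<beta> x) = 0" for x
    using cyc_surj[of x] by (auto simp: up_dn_cyc dtau_cyc 1 simp del: up.simps)
  have 3: "dtau x (up Three \<beta> x) = 0" for x
    using cyc_surj[of x] by (auto simp: up_dn_cyc dtau_cyc 2 simp del: up.simps)
  show ?thesis unfolding preserves_tau_def using 1 2 3 by (cases s) (simp_all del: up.simps)
qed

lemma Dn_preserves: "preserves_tau (Dn s \<gamma>)"
proof -
  have 1: "dtau x (dn One \<gamma> x) = 0" for x
  proof -
    have "tri_re (oconj \<gamma>) (oconj (hb x)) (oconj (hc x)) = hb x \<bullet> omult (oconj (hc x)) (oconj \<gamma>)"
      by (subst tri_re_cyclic) (simp add: tri_re_inner)
    moreover have "tri_re (oconj (ha x)) (omult \<gamma> (hc x)) (oconj (hc x)) = (hc x \<bullet> hc x) * (\<gamma> \<bullet> ha x)"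
      by (subst tri_re_cyclic) (simp add: tri_re_def omult_cancel fst_omult_conj)
    ultimately show ?thesis
      by (simp add: dtau_def tau_def inner_commute algebra_simps tri_re_def)
  qed
  have 2: "dtau x (dn Two \<gamma> x) = 0" for x
    using cyc_surj[of x] by (auto simp: up_dn_cyc dtau_cyc 1 simp del: dn.simps)
  have 3: "dtau x (dn Three \<gamma> x) = 0" for x
    using cyc_surj[of x] by (auto simp: up_dn_cyc dtau_cyc 2 simp del: dn.simps)
  show ?thesis unfolding preserves_tau_def using 1 2 3 by (cases s) (simp_all del: dn.simps)
qed

lemma Scal_preserves: "r + s + t = 0 \<Longrightarrow> preserves_tau (Scal r s t)"
proof -
  assume "r + s + t = 0"
  then have t: "t = - r - s" by simp
  show ?thesis unfolding preserves_tau_def t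
    by (simp add: scal_def dtau_def tau_def tri_re_def algebra_simps)
qed

lemma sl3O_subspace: "subspace sl3O"
proof -
  have "sl3O = {X. preserves_tau X}" by (simp add: set_eq_iff sl3O_iff)
  then show ?thesis using preserves_tau_subspace by simp
qed

lemma sl3O_commutator: "X \<in> sl3O \<Longrightarrow> Y \<in> sl3O \<Longrightarrow> commutator X Y \<in> sl3O"
  by (simp add: sl3O_iff preserves_tau_commutator)

lemma elementary_sl3O: "Up s \<beta> \<in> sl3O" "Dn s \<beta> \<in> sl3O" "Rot p q \<in> sl3O" "r + s' + t = 0 \<Longrightarrow> Scal r s' t \<in> sl3O"
  unfolding Rot_def
  by (auto simp: sl3O_iff Up_preserves Dn_preserves Scal_preserves
      intro!: preserves_tau_commutator subspace_scale[OF preserves_tau_subspace, simplified])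

subsection \<open>The generators in terms of the elementary operators\<close>

lemma mat_elem_0 [simp]: "mat_elem i j 0 = 0"
  by (rule linear_0[OF mat_elem_linear])

lemma mat_act_simps:
  "mat_act (A + B) x = mat_act A x + mat_act B x" "mat_act 0 x = 0"
  using linear_add[OF mat_act_linear(1)[of x]] linear_0[OF mat_act_linear(1)[of x]] by auto

lemma oreal_deriv: "(f has_real_derivative d) (at t) \<Longrightarrow> ((\<lambda>t. oreal (f t)) has_vector_derivative oreal d) (at t)"
  unfolding oreal_def has_real_derivative_iff_has_vector_derivative
  by (intro has_vector_derivative_Pair has_vector_derivative_const)

lemma ounit_deriv: "(f has_real_derivative d) (at t) \<Longrightarrow> ((\<lambda>t. f t *\<^sub>R (u::oct)) has_vector_derivative d *\<^sub>R u) (at t)"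
  by (rule has_vector_derivative_eq_rhs, rule has_vector_derivative_scaleR) auto

lemma trig_derivs:
  "((\<lambda>t. cosh (t / 2)) has_real_derivative 0) (at (0::real))" "((\<lambda>t. sinh (t / 2)) has_real_derivative 1/2) (at (0::real))"
  "((\<lambda>t. cos (t / 2)) has_real_derivative 0) (at (0::real))" "((\<lambda>t. sin (t / 2)) has_real_derivative 1/2) (at (0::real))"
  "((\<lambda>t. - sin (t / 2)) has_real_derivative -1/2) (at (0::real))"
  "((\<lambda>t. exp (t / 2)) has_real_derivative 1/2) (at (0::real))" "((\<lambda>t. exp (- t / 2)) has_real_derivative -1/2) (at (0::real))"
  by (auto intro!: derivative_eq_intros)

lemma zero_deriv: "((\<lambda>t. 0) has_vector_derivative 0) F"
  by (rule has_vector_derivative_const)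

lemmas entry_derivs = trig_derivs[THEN oreal_deriv] trig_derivs[THEN ounit_deriv] zero_deriv
  trig_derivs(2)[THEN ounit_deriv, THEN has_vector_derivative_minus]

lemma oreal_half: "oreal (1/2) = (1/2) *\<^sub>R oreal 1" "oreal (-1/2) = - ((1/2) *\<^sub>R oreal 1)"
  by (simp_all add: oreal_def)

lemma mat_act_scale: "mat_act (mat_elem i j (r *\<^sub>R u)) x = r *\<^sub>R mat_act (mat_elem i j u) x"
    "mat_act (mat_elem i j (- u)) x = - mat_act (mat_elem i j u) x"
  using linear_scale[OF mat_elem_linear[of i j], of r u] linear_scale[OF mat_act_linear(1)[of x]]
    linear_neg[OF mat_elem_linear[of i j], of u] linear_neg[OF mat_act_linear(1)[of x]] by auto

lemma dot_Btx: "dot Btx s = (1/2) *\<^sub>R (Up s (oreal 1) + Dn s (oreal 1))"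
proof -
  have "blinfun_apply (dot Btx s) = mat_act (mat_elem (slot_row s) (slot_row s) (oreal 0)
    + mat_elem (slot_row s) (slot_col s) (oreal (1/2)) + mat_elem (slot_col s) (slot_row s) (oreal (1/2))
    + mat_elem (slot_col s) (slot_col s) (oreal 0))"
    by (rule dot_single, rule xform_mats.simps) (rule entry_derivs | simp)+
  then show ?thesis unfolding oreal_half
    by (auto intro!: blinfun_eqI simp: mat_act_simps mat_act_scale mat_act_up mat_act_dn blinfun.bilinear_simps
        scaleR_add_right simp del: up.simps dn.simps)
qed

lemma dot_Rxz: "dot Rxz s = (1/2) *\<^sub>R (Dn s (oreal 1) - Up s (oreal 1))"
proof -
  have "blinfun_apply (dot Rxz s) = mat_act (mat_elem (slot_row s) (slot_row s) (oreal 0)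
    + mat_elem (slot_row s) (slot_col s) (oreal (-1/2)) + mat_elem (slot_col s) (slot_row s) (oreal (1/2))
    + mat_elem (slot_col s) (slot_col s) (oreal 0))"
    by (rule dot_single, rule xform_mats.simps) (rule entry_derivs | simp)+
  then show ?thesis unfolding oreal_half
    by (auto intro!: blinfun_eqI simp: mat_act_simps mat_act_scale mat_act_up mat_act_dn blinfun.bilinear_simps
        scaleR_diff_right simp del: up.simps dn.simps)
qed

lemma dot_Btq: "dot (Btq q) s = (1/2) *\<^sub>R (Up s (ounit q) - Dn s (ounit q))"
proof -
  have "blinfun_apply (dot (Btq q) s) = mat_act (mat_elem (slot_row s) (slot_row s) (oreal 0)
    + mat_elem (slot_row s) (slot_col s) ((1/2) *\<^sub>R ounit q) + mat_elem (slot_col s) (slot_row s) (- ((1/2) *\<^sub>R ounit q))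
    + mat_elem (slot_col s) (slot_col s) (oreal 0))"
    by (rule dot_single, rule xform_mats.simps) (rule entry_derivs | simp)+
  then show ?thesis
    by (auto intro!: blinfun_eqI simp: mat_act_simps mat_act_scale mat_act_up mat_act_dn blinfun.bilinear_simps
        scaleR_diff_right simp del: up.simps dn.simps)
qed

lemma dot_Rzq: "dot (Rzq q) s = (1/2) *\<^sub>R (Up s (ounit q) + Dn s (ounit q))"
proof -
  have "blinfun_apply (dot (Rzq q) s) = mat_act (mat_elem (slot_row s) (slot_row s) (oreal 0)
    + mat_elem (slot_row s) (slot_col s) ((1/2) *\<^sub>R ounit q) + mat_elem (slot_col s) (slot_row s) ((1/2) *\<^sub>R ounit q)
    + mat_elem (slot_col s) (slot_col s) (oreal 0))"
    by (rule dot_single, rule xform_mats.simps) (rule entry_derivs | simp)+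
  then show ?thesis
    by (auto intro!: blinfun_eqI simp: mat_act_simps mat_act_scale mat_act_up mat_act_dn blinfun.bilinear_simps
        scaleR_add_right simp del: up.simps dn.simps)
qed

lemma dot_Btz: "dot Btz One = Scal (1/2) (-1/2) 0" "dot Btz Two = Scal 0 (1/2) (-1/2)" "dot Btz Three = Scal (-1/2) 0 (1/2)"
proof -
  have d: "blinfun_apply (dot Btz s) = mat_act (mat_elem (slot_row s) (slot_row s) (oreal (1/2))
    + mat_elem (slot_row s) (slot_col s) 0 + mat_elem (slot_col s) (slot_row s) 0
    + mat_elem (slot_col s) (slot_col s) (oreal (-1/2)))" for s
    by (rule dot_single, rule xform_mats.simps) (rule entry_derivs | simp)+
  show "dot Btz One = Scal (1/2) (-1/2) 0" "dot Btz Two = Scal 0 (1/2) (-1/2)" "dot Btz Three = Scal (-1/2) 0 (1/2)"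
    using d[of One] d[of Two] d[of Three] mat_act_diag[of "1/2" "-1/2" 0] mat_act_diag[of 0 "1/2" "-1/2"]
      mat_act_diag[of "-1/2" 0 "1/2"]
    by (auto intro!: blinfun_eqI simp: add.commute)
qed

lemma dot_Rxq: "dot (Rxq q) One = Rot (oreal 1) (ounit q)"
proof -
  have "blinfun_apply (dot (Rxq q) One) = mat_act (mat_elem (slot_row One) (slot_row One) (oreal 0 + (1/2) *\<^sub>R ounit q)
    + mat_elem (slot_row One) (slot_col One) 0 + mat_elem (slot_col One) (slot_row One) 0
    + mat_elem (slot_col One) (slot_col One) (oreal 0 - (1/2) *\<^sub>R ounit q))"
    by (rule dot_single, rule xform_mats.simps)
       (rule entry_derivs has_vector_derivative_add has_vector_derivative_diff | simp)+
  then have d: "blinfun_apply (dot (Rxq q) One) = mat_act (mat_elem 1 1 ((1/2) *\<^sub>R ounit q) + mat_elem 2 2 (- ((1/2) *\<^sub>R ounit q)))"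
    by simp
  show ?thesis
  proof (rule blinfun_eqI)
    fix x
    show "blinfun_apply (dot (Rxq q) One) x = blinfun_apply (Rot (oreal 1) (ounit q)) x"
      unfolding d Rot_apply
      by (cases q; simp add: mat_act_def sandwich2_expand h3o_mat_proj mat_elem_def mat_one_def sum_3 vector_3
         oct_eq_iff oct_comp oct_inner)
  qed
qed

lemma h3o_eq_iff: "x = y \<longleftrightarrow> hp x = hp y \<and> hm x = hm y \<and> hn x = hn y \<and> ha x = ha y \<and> hb x = hb y \<and> hc x = hc y"
  by (auto simp: prod_eq_iff)

lemma unit_anticommute: "p \<noteq> q \<Longrightarrow> omult (ounit p) (omult (ounit q) x) = - omult (ounit q) (omult (ounit p) x)"
  by (cases p; cases q; simp add: oct_eq_iff oct_comp)

lemma unit_orthogonal: "p \<noteq> q \<Longrightarrow> ounit p \<bullet> ounit q = 0" "ounit p \<bullet> ounit p = 1"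
  by (auto simp: ounit_def inner_prod_def inner_axis_axis)

lemma unit_conj: "omult (omult (ounit p) x) (ounit p) = x - (2 * (x \<bullet> ounit p)) *\<^sub>R ounit p - (2 * fst x) *\<^sub>R oreal 1"
  by (cases p; simp add: oct_eq_iff oct_comp oct_inner)

lemma unit_double: "p \<noteq> q \<Longrightarrow> omult (omult (ounit p) x) (ounit q) + omult (omult (ounit q) x) (ounit p) =
   - (2 * (x \<bullet> ounit p)) *\<^sub>R ounit q - (2 * (x \<bullet> ounit q)) *\<^sub>R ounit p"
  by (cases p; cases q; simp add: oct_eq_iff oct_comp oct_inner)

text \<open>A transverse rotation conjugates by two imaginary units in turn.\<close>

definition unit_act :: "oct \<Rightarrow> h3o \<Rightarrow> h3o" where
  "unit_act u x = (hp x * (u \<bullet> u), hm x * (u \<bullet> u), hn x, omult (omult u (ha x)) (oconj u),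
     omult (hb x) (oconj u), omult u (hc x))"

lemma sandwich_odiag2: "sandwich (slot_mat One (odiag2 u)) x = unit_act u x"
  unfolding sandwich2_def[symmetric] sandwich_def unit_act_def
  by (simp add: sandwich2_expand odiag2_def h3o_mat_proj sum_3 vector_3 vector_2 fst_omult_conj oreal_components)

lemma slot_action_linear: "linear (slot_action s Ms)"
proof (induction Ms)
  case Nil
  then show ?case by (simp add: slot_action_def linear_iff)
next
  case (Cons M Ms)
  have "linear (sandwich (slot_mat s M))"
    using sandwich2_linear by (simp add: sandwich_def[abs_def] sandwich2_def[abs_def])
  from linear_compose[OF this Cons] show ?case by (simp add: slot_action_def o_def)
qed

definition trans_curve :: "iunit \<times> iunit \<Rightarrow> real \<Rightarrow> endo" where
  "trans_curve pq \<alpha> = Blinfun (slot_action One (transverse pq \<alpha>))"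

abbreviation URot :: "iunit \<times> iunit \<Rightarrow> endo" where "URot pq \<equiv> Rot (ounit (fst pq)) (ounit (snd pq))"

lemma trans_curve_apply: "trans_curve (p,q) \<alpha> x =
    unit_act (cos (\<alpha>/2) *\<^sub>R ounit p + sin (\<alpha>/2) *\<^sub>R ounit q) (unit_act (- ounit p) x)"
  unfolding trans_curve_def Blinfun_linear_apply[OF slot_action_linear]
  by (simp add: slot_action_def transverse_def sandwich_odiag2 del: slot_mat.simps)

lemma trans_curve_0: "trans_curve pq 0 = id_blinfun"
proof (cases pq)
  case (Pair p q)
  show ?thesis unfolding Pair
  proof (rule blinfun_eqI)
    fix x
    have r: "omult (omult (ounit p) (omult (omult (ounit p) v) (ounit p))) (ounit p) = v" for v
      unfolding unit_conj[of p "omult (omult (ounit p) v) (ounit p)"] unfolding unit_conj[of p v]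
      by (simp add: inner_diff_left unit_orthogonal) (cases p; simp add: oct_eq_iff oct_comp oct_inner)
    have "- omult (ounit p) (omult (ounit p) v) = v" "- omult (omult v (ounit p)) (ounit p) = v" for v
      using omult_cancel(1)[of "ounit p" v] omult_cancel(2)[of v "ounit p"] by (simp_all add: unit_orthogonal)
    then have l: "omult (ounit p) (omult (ounit p) v) = - v" "omult (omult v (ounit p)) (ounit p) = - v" for v
      by (metis minus_minus)+
    show "trans_curve (p, q) 0 x = id_blinfun x"
      by (simp add: trans_curve_apply unit_act_def unit_orthogonal r l)
  qed
qed

lemma trans_curve_deriv:
  assumes "fst pq \<noteq> snd pq"
  shows "(trans_curve pq has_vector_derivative URot pq) (at 0)"
proof -
  obtain p q where pq: "pq = (p,q)" "p \<noteq> q" using assms by (cases pq) auto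
  define P Q where "P = ounit p" and "Q = ounit q"
  define u where "u \<alpha> = cos (\<alpha>/2) *\<^sub>R P + sin (\<alpha>/2) *\<^sub>R Q" for \<alpha>
  have du: "(u has_vector_derivative (1/2) *\<^sub>R Q) (at 0)"
    unfolding u_def
    using has_vector_derivative_add[OF trig_derivs(3)[THEN ounit_deriv, of P] trig_derivs(4)[THEN ounit_deriv, of Q]] by simp
  have dc: "((\<lambda>\<alpha>. oconj (u \<alpha>)) has_vector_derivative oconj ((1/2) *\<^sub>R Q)) (at 0)"
    by (rule bounded_linear.has_vector_derivative[OF _ du]) (simp add: linear_conv_bounded_linear[symmetric] oconj_linear)
  have u0: "u 0 = P" by (simp add: u_def)
  note om = bounded_bilinear.has_vector_derivative[OF omult_bb]
  have d: "((\<lambda>\<alpha>. trans_curve pq \<alpha> x) has_vector_derivative URot pq x) (at 0)" for x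
  proof -
    define y where "y = unit_act (- P) x"
    have "((\<lambda>\<alpha>. unit_act (u \<alpha>) y) has_vector_derivative
       (hp y * (u 0 \<bullet> ((1/2) *\<^sub>R Q) + ((1/2) *\<^sub>R Q) \<bullet> u 0), hm y * (u 0 \<bullet> ((1/2) *\<^sub>R Q) + ((1/2) *\<^sub>R Q) \<bullet> u 0), 0,
        omult (omult (u 0) (ha y)) (oconj ((1/2) *\<^sub>R Q)) + omult (omult (u 0) 0 + omult ((1/2) *\<^sub>R Q) (ha y)) (oconj (u 0)),
        omult (hb y) (oconj ((1/2) *\<^sub>R Q)) + omult 0 (oconj (u 0)),
        omult (u 0) 0 + omult ((1/2) *\<^sub>R Q) (hc y))) (at 0)"
      unfolding unit_act_def
      by (intro has_vector_derivative_Pair om du dc has_vector_derivative_const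
         bounded_linear.has_vector_derivative[OF bounded_linear_mult_right]
         bounded_bilinear.has_vector_derivative[OF bounded_bilinear_inner])
    also have "(hp y * (u 0 \<bullet> ((1/2) *\<^sub>R Q) + ((1/2) *\<^sub>R Q) \<bullet> u 0), hm y * (u 0 \<bullet> ((1/2) *\<^sub>R Q) + ((1/2) *\<^sub>R Q) \<bullet> u 0), 0,
        omult (omult (u 0) (ha y)) (oconj ((1/2) *\<^sub>R Q)) + omult (omult (u 0) 0 + omult ((1/2) *\<^sub>R Q) (ha y)) (oconj (u 0)),
        omult (hb y) (oconj ((1/2) *\<^sub>R Q)) + omult 0 (oconj (u 0)),
        omult (u 0) 0 + omult ((1/2) *\<^sub>R Q) (hc y)) = URot pq x"
    proof -
      have o: "P \<bullet> Q = 0" "Q \<bullet> P = 0" "P \<bullet> P = 1" unfolding P_def Q_def using pq(2) by (simp_all add: unit_orthogonal)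
      have cj: "oconj P = - P" "oconj Q = - Q" by (simp_all add: P_def Q_def)
      have ya: "ha y = - omult (omult P (ha x)) P" and yb: "hb y = omult (hb x) P" and yc: "hc y = - omult P (hc x)"
        and yn: "hp y = hp x" "hm y = hm x"
        using o by (simp_all add: y_def unit_act_def cj)
      have f: "oreal 1 \<bullet> P = 0" "oreal 1 \<bullet> Q = 0" by (simp_all add: P_def Q_def oct_inner oct_comp)
      have v: "ha y = (2 * (ha x \<bullet> P)) *\<^sub>R P + (2 * fst (ha x)) *\<^sub>R oreal 1 - ha x"
        unfolding ya unfolding P_def unit_conj by simp
      have "ha y \<bullet> P = ha x \<bullet> P" "ha y \<bullet> Q = - (ha x \<bullet> Q)"
        unfolding v by (simp_all add: inner_add_left inner_diff_left o f)
      then have "omult (omult P (ha y)) Q + omult (omult Q (ha y)) P = 2 *\<^sub>R ((ha x \<bullet> Q) *\<^sub>R P - (ha x \<bullet> P) *\<^sub>R Q)"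
        using unit_double[OF pq(2), of "ha y"] unfolding P_def Q_def by (simp add: algebra_simps)
      then have "(1/2) *\<^sub>R (omult (omult P (ha y)) Q + omult (omult Q (ha y)) P) = (1/2) *\<^sub>R 2 *\<^sub>R ((ha x \<bullet> Q) *\<^sub>R P - (ha x \<bullet> P) *\<^sub>R Q)"
        by (rule arg_cong)
      then have "(1/2) *\<^sub>R omult (omult P (ha y)) Q + (1/2) *\<^sub>R omult (omult Q (ha y)) P = (ha x \<bullet> Q) *\<^sub>R P - (ha x \<bullet> P) *\<^sub>R Q"
        by (simp add: scaleR_add_right)
      moreover have "omult P (omult Q (hc x)) = - omult Q (omult P (hc x))"
        unfolding P_def Q_def by (rule unit_anticommute[OF pq(2)])
      ultimately show ?thesis
        unfolding u0 pq(1) fst_conv snd_conv Rot_apply prod.inject P_def[symmetric] Q_def[symmetric]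
        by (simp add: o cj yb yc yn inner_commute scaleR_add_right algebra_simps)
    qed
    finally show ?thesis by (simp add: pq(1) trans_curve_apply u_def y_def P_def Q_def)
  qed
  have "(trans_curve pq has_vector_derivative Blinfun (URot pq)) (at 0)"
    unfolding trans_curve_def
    by (rule blinfun_has_vector_derivative(2)[OF slot_action_linear])
       (use d in \<open>simp add: trans_curve_def Blinfun_linear_apply slot_action_linear\<close>)
  then show ?thesis by (simp add: blinfun_apply_inverse)
qed

lemma slot_action_append: "Blinfun (slot_action s (Ms @ Ns)) = Blinfun (slot_action s Ns) o\<^sub>L Blinfun (slot_action s Ms)"
  by (rule blinfun_eqI) (simp add: Blinfun_linear_apply slot_action_linear, simp add: slot_action_def)

lemma trans_curve_scaled:
  assumes "fst pq \<noteq> snd pq"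
  shows "((\<lambda>\<alpha>. trans_curve pq (c * \<alpha>)) has_vector_derivative c *\<^sub>R URot pq) (at 0)"
proof -
  have "((\<lambda>\<alpha>::real. c * \<alpha>) has_vector_derivative c) (at 0)"
    by (rule has_vector_derivative_eq_rhs[OF bounded_linear.has_vector_derivative[OF bounded_linear_mult_right has_vector_derivative_id]]) simp
  from vector_diff_chain_at[OF this, of "trans_curve pq" "URot pq"] trans_curve_deriv[OF assms]
  show ?thesis by (simp add: o_def)
qed

lemma curve_product_deriv:
  fixes g h :: "real \<Rightarrow> endo"
  assumes "(g has_vector_derivative X) (at 0)" "(h has_vector_derivative Y) (at 0)" "g 0 = id_blinfun" "h 0 = id_blinfun"
  shows "((\<lambda>t. g t o\<^sub>L h t) has_vector_derivative X + Y) (at 0)" "g 0 o\<^sub>L h 0 = id_blinfun"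
proof -
  have "(g 0 o\<^sub>L Y) + (X o\<^sub>L h 0) = X + Y" by (rule blinfun_eqI) (simp add: assms blinfun.bilinear_simps)
  then show "((\<lambda>t. g t o\<^sub>L h t) has_vector_derivative X + Y) (at 0)"
    using bounded_bilinear.has_vector_derivative[OF bounded_bilinear_blinfun_compose assms(1,2)] by (simp only:)
  show "g 0 o\<^sub>L h 0 = id_blinfun" by (rule blinfun_eqI) (simp add: assms)
qed

lemma pairs_distinct: "fst (pair1 q) \<noteq> snd (pair1 q)" "fst (pair2 q) \<noteq> snd (pair2 q)" "fst (pair3 q) \<noteq> snd (pair3 q)"
  by (cases q; simp)+

lemma dot_Aq: "dot (Aq q) One = URot (pair1 q) - URot (pair2 q)"
proof -
  note c1 = trans_curve_scaled[OF pairs_distinct(1), of q 1, simplified]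
  note c2 = trans_curve_scaled[OF pairs_distinct(2), of q "-1", simplified]
  have "(\<lambda>\<alpha>. Blinfun (slot_action One (xform_mats (Aq q) \<alpha>))) = (\<lambda>\<alpha>. trans_curve (pair1 q) \<alpha> o\<^sub>L trans_curve (pair2 q) (- \<alpha>))"
    by (simp add: slot_action_append trans_curve_def)
  then show ?thesis unfolding dot_def
    using vector_derivative_at[OF curve_product_deriv(1)[OF c1 c2 trans_curve_0]] by (simp add: trans_curve_0)
qed

lemma dot_Gq: "dot (Gq q) One = URot (pair1 q) + URot (pair2 q) - 2 *\<^sub>R URot (pair3 q)"
proof -
  note c1 = trans_curve_scaled[OF pairs_distinct(1), of q 1, simplified]
  note c2 = trans_curve_scaled[OF pairs_distinct(2), of q "1", simplified]
  note c3 = trans_curve_scaled[OF pairs_distinct(3), of q "-2", simplified]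
  have "(\<lambda>\<alpha>. Blinfun (slot_action One (xform_mats (Gq q) \<alpha>))) =
      (\<lambda>\<alpha>. (trans_curve (pair1 q) \<alpha> o\<^sub>L trans_curve (pair2 q) \<alpha>) o\<^sub>L trans_curve (pair3 q) (-2 * \<alpha>))"
    by (simp add: slot_action_append trans_curve_def)
  then show ?thesis unfolding dot_def
    using vector_derivative_at[OF curve_product_deriv(1)[OF curve_product_deriv(1)[OF c1 c2 trans_curve_0 trans_curve_0] c3
        curve_product_deriv(2)[OF c1 c2 trans_curve_0 trans_curve_0]]]
    by (simp add: trans_curve_0)
qed

lemma dot_Sq: "dot (Sq q) One = URot (pair1 q) + URot (pair2 q) + URot (pair3 q)"
proof -
  note c1 = trans_curve_scaled[OF pairs_distinct(1), of q 1, simplified]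
  note c2 = trans_curve_scaled[OF pairs_distinct(2), of q "1", simplified]
  note c3 = trans_curve_scaled[OF pairs_distinct(3), of q "1", simplified]
  have "(\<lambda>\<alpha>. Blinfun (slot_action One (xform_mats (Sq q) \<alpha>))) =
      (\<lambda>\<alpha>. (trans_curve (pair1 q) \<alpha> o\<^sub>L trans_curve (pair2 q) \<alpha>) o\<^sub>L trans_curve (pair3 q) \<alpha>)"
    by (simp add: slot_action_append trans_curve_def)
  then show ?thesis unfolding dot_def
    using vector_derivative_at[OF curve_product_deriv(1)[OF curve_product_deriv(1)[OF c1 c2 trans_curve_0 trans_curve_0] c3
        curve_product_deriv(2)[OF c1 c2 trans_curve_0 trans_curve_0]]]
    by (simp add: trans_curve_0)
qed

section \<open>The generators span the Lie algebra\<close>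

abbreviation e1 :: h3o where "e1 \<equiv> (1, 0, 0, 0, 0, 0)"
abbreviation e2 :: h3o where "e2 \<equiv> (0, 1, 0, 0, 0, 0)"
abbreviation e3 :: h3o where "e3 \<equiv> (0, 0, 1, 0, 0, 0)"
abbreviation ea :: "oct \<Rightarrow> h3o" where "ea a \<equiv> (0, 0, 0, a, 0, 0)"
abbreviation eb :: "oct \<Rightarrow> h3o" where "eb b \<equiv> (0, 0, 0, 0, b, 0)"
abbreviation ec :: "oct \<Rightarrow> h3o" where "ec c \<equiv> (0, 0, 0, 0, 0, c)"

lemma tri_re_0 [simp]: "tri_re 0 y z = 0" "tri_re x 0 z = 0" "tri_re x y 0 = 0"
  by (simp_all add: tri_re_def)

lemma inner_all_0: "(\<And>y. x \<bullet> y = 0) \<Longrightarrow> x = (0::oct)"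
  using inner_eq_zero_iff by blast

context
  fixes X assumes X: "X \<in> sl3O"
begin

lemma polar: "tau_sym (X x) y z + tau_sym x (X y) z + tau_sym x y (X z) = 0"
  using preserves_tau_polar X unfolding sl3O_iff by blast

lemma sl3O_idem:
  shows "hm (X e1) = 0" "hn (X e1) = 0" "hb (X e1) = 0"
    "hp (X e2) = 0" "hn (X e2) = 0" "hc (X e2) = 0"
    "hp (X e3) = 0" "hm (X e3) = 0" "ha (X e3) = 0"
    "hp (X e1) + hm (X e2) + hn (X e3) = 0"
proof -
  note s = tau_sym_def tau_def
  show "hm (X e1) = 0" using polar[of e1 e1 e3] by (simp add: s)
  show "hn (X e1) = 0" using polar[of e1 e1 e2] by (simp add: s)
  show "hb (X e1) = 0" using polar[of e1 e1 "eb _"] by (intro inner_all_0) (simp add: s inner_commute)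
  show "hp (X e2) = 0" using polar[of e2 e2 e3] by (simp add: s)
  show "hn (X e2) = 0" using polar[of e2 e2 e1] by (simp add: s)
  show "hc (X e2) = 0" using polar[of e2 e2 "ec _"] by (intro inner_all_0) (simp add: s inner_commute)
  show "hp (X e3) = 0" using polar[of e3 e3 e2] by (simp add: s)
  show "hm (X e3) = 0" using polar[of e3 e3 e1] by (simp add: s)
  show "ha (X e3) = 0" using polar[of e3 e3 "ea _"] by (intro inner_all_0) (simp add: s inner_commute)
  show "hp (X e1) + hm (X e2) + hn (X e3) = 0" using polar[of e1 e2 e3] by (simp add: s)
qed

text \<open>A symmetry that kills the idempotents acts on \<open>a\<close>, \<open>b\<close>, \<open>c\<close> separately, by maps in triality.
  If the first of them vanishes, the second is multiplication by an element of the nucleus of the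
  octonions that is orthogonal to \<open>1\<close>, so all three vanish.\<close>

lemma sl3O_kernel:
  assumes k: "X e1 = 0" "X e2 = 0" "X e3 = 0" and a: "\<And>a. ha (X (ea a)) = 0"
  shows "X = 0"
proof -
  note s = tau_sym_def tau_def
  note H = polar[of e1, unfolded k] polar[of e2, unfolded k] polar[of e3, unfolded k]
  have A: "X (ea v) = 0" for v
  proof -
    have "hp (X (ea v)) = 0" "hm (X (ea v)) = 0" "hn (X (ea v)) = 0"
      using polar[of e2 e3 "ea v"] polar[of e1 e3 "ea v"] polar[of e1 e2 "ea v"] by (simp_all add: s k)
    moreover have "hb (X (ea v)) = 0"
      using polar[of e1 "ea v" "eb _"] by (intro inner_all_0) (simp add: s k inner_commute)
    moreover have "hc (X (ea v)) = 0"
      using polar[of e2 "ea v" "ec _"] by (intro inner_all_0) (simp add: s k inner_commute)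
    ultimately show ?thesis using a by (simp add: prod_eq_iff)
  qed
  define g where "g v = hb (X (eb v))" for v
  define h where "h v = hc (X (ec v))" for v
  have B: "X (eb v) = eb (g v)" for v
  proof -
    have "hp (X (eb v)) = 0" "hm (X (eb v)) = 0" "hn (X (eb v)) = 0"
      using polar[of e2 e3 "eb v"] polar[of e1 e3 "eb v"] polar[of e1 e2 "eb v"] by (simp_all add: s k)
    moreover have "ha (X (eb v)) = 0"
      using polar[of e3 "eb v" "ea _"] by (intro inner_all_0) (simp add: s k inner_commute)
    moreover have "hc (X (eb v)) = 0"
      using polar[of e2 "eb v" "ec _"] by (intro inner_all_0) (simp add: s k inner_commute)
    ultimately show ?thesis unfolding g_def by (simp add: prod_eq_iff)
  qed
  have C: "X (ec v) = ec (h v)" for v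
  proof -
    have "hp (X (ec v)) = 0" "hm (X (ec v)) = 0" "hn (X (ec v)) = 0"
      using polar[of e2 e3 "ec v"] polar[of e1 e3 "ec v"] polar[of e1 e2 "ec v"] by (simp_all add: s k)
    moreover have "ha (X (ec v)) = 0"
      using polar[of e3 "ec v" "ea _"] by (intro inner_all_0) (simp add: s k inner_commute)
    moreover have "hb (X (ec v)) = 0"
      using polar[of e1 "ec v" "eb _"] by (intro inner_all_0) (simp add: s k inner_commute)
    ultimately show ?thesis unfolding h_def by (simp add: prod_eq_iff)
  qed
  have skew: "g v \<bullet> v = 0" for v
    using polar[of e1 "eb v" "eb v"] by (simp add: s k B inner_commute)
  have tr: "omult (oconj (g x)) (oconj y) = - omult (oconj x) (oconj (h y))" for x y
  proof -
    have "(omult (oconj (g x)) (oconj y) + omult (oconj x) (oconj (h y))) \<bullet> z = 0" for z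
      using polar[of "ea z" "eb x" "ec y"]
      by (simp add: s A B C tri_re_inner inner_add_left inner_add_right inner_commute)
    then have "omult (oconj (g x)) (oconj y) + omult (oconj x) (oconj (h y)) = 0" by (rule inner_all_0)
    then show ?thesis by (simp add: eq_neg_iff_add_eq_0)
  qed
  define v where "v = oconj (g (oreal 1))"
  have h1: "oconj (h y) = - omult v (oconj y)" for y using tr[of "oreal 1" y] by (simp add: v_def)
  have g1: "oconj (g x) = omult (oconj x) v" for x using tr[of x "oreal 1"] h1[of "oreal 1"] by simp
  have nuc: "omult (omult x v) y = omult x (omult v y)" for x y
    using tr[of "oconj x" "oconj y"] by (simp add: h1 g1)
  \<comment> \<open>The nucleus of the octonions is real, as associating with \<open>i\<close>, \<open>j\<close> and \<open>l\<close> already shows.\<close>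
  have "fst v = 0" using skew[of "oreal 1"] by (simp add: v_def oct_inner oct_comp)
  then have v0: "v = 0"
    using nuc[of "ounit Ui" "ounit Uj"] nuc[of "ounit Ui" "ounit Ul"] nuc[of "ounit Uj" "ounit Ul"]
    by (simp add: oct_eq_iff oct_comp)
  have "g x = 0" "h x = 0" for x
    using g1[of x] h1[of x] v0 oconj_oconj[of "g x"] oconj_oconj[of "h x"] by auto
  then have BC: "X (eb v) = 0" "X (ec v) = 0" for v by (simp_all add: B C h3o_eq_iff)
  show "X = 0"
  proof (rule blinfun_eqI)
    fix x :: h3o
    have x: "x = hp x *\<^sub>R e1 + hm x *\<^sub>R e2 + hn x *\<^sub>R e3 + ea (ha x) + eb (hb x) + ec (hc x)"
      by (simp add: prod_eq_iff)
    show "X x = blinfun_apply 0 x"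
      by (subst x) (simp only: blinfun.bilinear_simps k A BC, simp)
  qed
qed

end

text \<open>Every skew map of the octonions is the action on \<open>a\<close> of a combination of the 28 rotations.\<close>

definition rot_of :: "(oct \<Rightarrow> oct) \<Rightarrow> endo" where
  "rot_of f = (\<Sum>q\<in>UNIV. (f (ounit (fst (pair1 q))) \<bullet> ounit (snd (pair1 q))) *\<^sub>R URot (pair1 q)
     + (f (ounit (fst (pair2 q))) \<bullet> ounit (snd (pair2 q))) *\<^sub>R URot (pair2 q)
     + (f (ounit (fst (pair3 q))) \<bullet> ounit (snd (pair3 q))) *\<^sub>R URot (pair3 q)
     - (f (oreal 1) \<bullet> ounit q) *\<^sub>R Rot (oreal 1) (ounit q))"

lemma inner_ounit: "x \<bullet> ounit q = snd x $ q" "ounit q \<bullet> x = snd x $ q" "x \<bullet> oreal r = fst x * r" "oreal r \<bullet> x = r * fst x"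
  by (simp_all add: ounit_def oreal_def inner_prod_def inner_axis inner_axis')

lemma oct_expand: "x = fst x *\<^sub>R oreal 1 + (\<Sum>q\<in>UNIV. snd x $ q *\<^sub>R ounit q)"
  by (simp add: oct_eq_iff sum_iunit oct_comp)

lemma rot_of:
  assumes f: "linear f" and skew: "\<And>x y. f x \<bullet> y = - (x \<bullet> f y)"
  shows "ha (rot_of f x) = f (ha x)" "rot_of f e1 = 0" "rot_of f e2 = 0" "rot_of f e3 = 0"
proof -
  have s0: "fst (f (oreal 1)) = 0" using skew[of "oreal 1" "oreal 1"] by (simp add: inner_ounit)
  have s1: "fst (f (ounit p)) = - snd (f (oreal 1)) $ p" for p
    using skew[of "oreal 1" "ounit p"] by (simp add: inner_ounit)
  have sk: "snd (f (ounit p)) $ q = - snd (f (ounit q)) $ p" for p q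
    using skew[of "ounit p" "ounit q"] by (simp add: inner_ounit)
  have sp: "snd (f (ounit p)) $ p = 0" for p using sk[of p p] by simp
  note or = sk[of Uk Uj] sk[of Ujl Ukl] sk[of Uil Ul] sk[of Ui Uk] sk[of Ukl Uil] sk[of Ujl Ul] sk[of Uj Ui] sk[of Uil Ujl] sk[of Ukl Ul] sk[of Ui Ujl] sk[of Uil Uj] sk[of Ul Uk] sk[of Ukl Ui] sk[of Uk Uil] sk[of Ul Uj] sk[of Uj Ukl] sk[of Ujl Uk] sk[of Ul Ui] sk[of Ui Uil] sk[of Uj Ujl] sk[of Uk Ukl]
  have fa: "f a = fst a *\<^sub>R f (oreal 1) + (\<Sum>q\<in>UNIV. snd a $ q *\<^sub>R f (ounit q))" for a
    by (subst oct_expand[of a]) (simp add: linear_add[OF f] linear_scale[OF f] linear_sum[OF f])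
  show "ha (rot_of f x) = f (ha x)"
    unfolding fa[of "ha x"] rot_of_def sum_iunit
    by (simp add: blinfun.bilinear_simps Rot_apply inner_ounit oct_eq_iff oct_comp s0 s1 sp or algebra_simps)
  have z: "URot (pair1 q) y = 0" "URot (pair2 q) y = 0" "URot (pair3 q) y = 0" "Rot (oreal 1) (ounit q) y = 0"
    if "y = e1 \<or> y = e2 \<or> y = e3" for y q
    using that pairs_distinct[of q] by (auto simp: Rot_apply h3o_eq_iff unit_orthogonal inner_ounit oct_comp)
  show "rot_of f e1 = 0" "rot_of f e2 = 0" "rot_of f e3 = 0"
    unfolding rot_of_def by (simp_all add: blinfun.sum_left blinfun.bilinear_simps z)
qed

lemma finite_basis_labels: "finite basis_labels"
  unfolding basis_labels_def by simp

lemma dot_in_span: "(F, s) \<in> basis_labels \<Longrightarrow> dot F s \<in> gen_span basis_labels"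
  unfolding gen_span_def by (force intro: span_base)

lemma gen_span_subspace: "subspace (gen_span A)"
  unfolding gen_span_def by simp

lemma slot_labels: "(Btx, s) \<in> basis_labels" "(Rxz, s) \<in> basis_labels" "(Btq q, s) \<in> basis_labels" "(Rzq q, s) \<in> basis_labels"
  "(Btz, One) \<in> basis_labels" "(Btz, Two) \<in> basis_labels" "(Rxq q, One) \<in> basis_labels"
  "(Aq q, One) \<in> basis_labels" "(Gq q, One) \<in> basis_labels" "(Sq q, One) \<in> basis_labels"
  by (cases s; simp add: basis_labels_def)+

lemma elementary_in_span:
  shows "Up s \<beta> \<in> gen_span basis_labels" "Dn s \<beta> \<in> gen_span basis_labels"
    "Rot (oreal 1) (ounit q) \<in> gen_span basis_labels"
    "URot (pair1 q) \<in> gen_span basis_labels" "URot (pair2 q) \<in> gen_span basis_labels" "URot (pair3 q) \<in> gen_span basis_labels"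
    "r + s' + t = 0 \<Longrightarrow> Scal r s' t \<in> gen_span basis_labels"
proof -
  note V = gen_span_subspace[of basis_labels]
  note d = slot_labels[THEN dot_in_span]
  note vs = subspace_add[OF V] subspace_diff[OF V] subspace_scale[OF V]
  have 1: "Up s (oreal 1) = dot Btx s - dot Rxz s" "Dn s (oreal 1) = dot Btx s + dot Rxz s"
     "Up s (ounit q) = dot (Btq q) s + dot (Rzq q) s" "Dn s (ounit q) = dot (Rzq q) s - dot (Btq q) s" for q
    unfolding dot_Btx dot_Rxz dot_Btq dot_Rzq
    by (simp_all add: algebra_simps scaleR_add_left[symmetric])
  have u: "Up s (oreal 1) \<in> gen_span basis_labels" "Dn s (oreal 1) \<in> gen_span basis_labels"
    "Up s (ounit q) \<in> gen_span basis_labels" "Dn s (ounit q) \<in> gen_span basis_labels" for q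
    unfolding 1 by (intro vs d)+
  show "Up s \<beta> \<in> gen_span basis_labels"
    by (subst oct_expand[of \<beta>])
       (simp only: linear_add[OF Up_linear] linear_scale[OF Up_linear] linear_sum[OF Up_linear];
        intro vs subspace_sum[OF V] u)
  show "Dn s \<beta> \<in> gen_span basis_labels"
    by (subst oct_expand[of \<beta>])
       (simp only: linear_add[OF Dn_linear] linear_scale[OF Dn_linear] linear_sum[OF Dn_linear];
        intro vs subspace_sum[OF V] u)
  show "Rot (oreal 1) (ounit q) \<in> gen_span basis_labels" using d(7)[of q] by (simp add: dot_Rxq)
  have 3: "URot (pair3 q) = (1/3) *\<^sub>R (dot (Sq q) One - dot (Gq q) One)"
    unfolding dot_Sq dot_Gq by (simp add: algebra_simps scaleR_add_left[symmetric])
  have 2: "URot (pair2 q) = (1/2) *\<^sub>R (dot (Sq q) One - URot (pair3 q) - dot (Aq q) One)"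
    unfolding dot_Sq dot_Aq by (simp add: algebra_simps scaleR_add_left[symmetric])
  have 1: "URot (pair1 q) = dot (Aq q) One + URot (pair2 q)"
    unfolding dot_Aq by simp
  show 3: "URot (pair3 q) \<in> gen_span basis_labels" unfolding 3 by (intro vs d)
  show 2: "URot (pair2 q) \<in> gen_span basis_labels" unfolding 2 by (intro vs d 3)
  show 1: "URot (pair1 q) \<in> gen_span basis_labels" unfolding 1 by (intro vs d 2)
  show "Scal r s' t \<in> gen_span basis_labels" if "r + s' + t = 0"
  proof -
    have t: "t = - r - s'" using that by simp
    have "Scal r s' t = (2 * r) *\<^sub>R dot Btz One + (2 * (r + s')) *\<^sub>R dot Btz Two"
      unfolding dot_Btz t by (rule blinfun_eqI) (simp add: blinfun.bilinear_simps scal_def algebra_simps)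
    then show ?thesis by (simp only:) (intro vs d)
  qed
qed

lemma dot_in_sl3O: "(F, s) \<in> basis_labels \<Longrightarrow> dot F s \<in> sl3O"
  unfolding basis_labels_def
  by (auto simp: dot_Btx dot_Rxz dot_Btq dot_Rzq dot_Btz dot_Rxq dot_Aq dot_Gq dot_Sq
      intro!: subspace_add[OF sl3O_subspace] subspace_diff[OF sl3O_subspace] subspace_scale[OF sl3O_subspace] elementary_sl3O)

lemma rot_of_in_span: "rot_of f \<in> gen_span basis_labels"
  unfolding rot_of_def
  by (intro subspace_sum[OF gen_span_subspace] subspace_add[OF gen_span_subspace]
      subspace_diff[OF gen_span_subspace] subspace_scale[OF gen_span_subspace] elementary_in_span)

lemma gen_span_sl3O: "gen_span basis_labels \<subseteq> sl3O"
  unfolding gen_span_def using dot_in_sl3O by (intro span_minimal sl3O_subspace) auto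

text \<open>Modulo elementary operators, an infinitesimal symmetry kills the three diagonal idempotents; it
  is then skew on \<open>a\<close>, and subtracting the rotation with the same action on \<open>a\<close> leaves zero.\<close>

lemma sl3O_span: "sl3O = gen_span basis_labels"
proof
  show "gen_span basis_labels \<subseteq> sl3O" by (rule gen_span_sl3O)
  show "sl3O \<subseteq> gen_span basis_labels"
  proof
    fix X assume X: "X \<in> sl3O"
    note i = sl3O_idem[OF X]
    define Y where "Y = Dn One (ha (X e1)) + Up Three (oconj (hc (X e1))) + Up One (oconj (ha (X e2)))
       + Dn Two (hb (X e2)) + Up Two (oconj (hb (X e3))) + Dn Three (hc (X e3))
       + Scal (hp (X e1) / 2) (hm (X e2) / 2) (hn (X e3) / 2)"
    have Y: "Y \<in> gen_span basis_labels" unfolding Y_def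
      using i(10) by (intro subspace_add[OF gen_span_subspace] elementary_in_span) simp
    define D where "D = X - Y"
    have D: "D \<in> sl3O" unfolding D_def using X Y gen_span_sl3O by (intro subspace_diff[OF sl3O_subspace]) auto
    have De: "D e1 = 0" "D e2 = 0" "D e3 = 0"
      unfolding D_def Y_def using i by (simp_all add: blinfun.bilinear_simps prod_eq_iff scal_def)
    define f where "f a = ha (D (ea a))" for a
    have f: "linear f"
    proof -
      have "ea (x + y) = ea x + ea y" "ea (c *\<^sub>R x) = c *\<^sub>R ea x" for x y c by simp_all
      then show ?thesis unfolding linear_iff f_def by (simp add: blinfun.bilinear_simps del: add_Pair scaleR_Pair)
    qed
    have sk: "f x \<bullet> y = - (x \<bullet> f y)" for x y
      using polar[OF D, of e3 "ea x" "ea y"] by (simp add: tau_sym_def tau_def De f_def inner_commute)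
    define Z where "Z = rot_of f"
    have Z: "Z \<in> gen_span basis_labels" unfolding Z_def by (rule rot_of_in_span)
    have "D - Z = 0"
    proof (rule sl3O_kernel)
      show "D - Z \<in> sl3O" using D Z gen_span_sl3O by (intro subspace_diff[OF sl3O_subspace]) auto
      show "(D - Z) e1 = 0" "(D - Z) e2 = 0" "(D - Z) e3 = 0"
        using De rot_of[OF f sk] by (simp_all add: Z_def blinfun.bilinear_simps)
      show "ha ((D - Z) (ea a)) = 0" for a
        using rot_of(1)[OF f sk, of "ea a"] f_def[of a] by (simp add: Z_def blinfun.bilinear_simps)
    qed
    then have "X = Y + Z" unfolding D_def by (simp add: algebra_simps)
    then show "X \<in> gen_span basis_labels" using Y Z by (simp add: subspace_add[OF gen_span_subspace])
  qed
qed

section \<open>Three commuting involutions\<close>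

definition wgt :: "h3o \<Rightarrow> h3o" where
  "wgt x = (hp x, hm x, hn x, 2 *\<^sub>R ha x, 2 *\<^sub>R hb x, 2 *\<^sub>R hc x)"
definition wgt_inv :: "h3o \<Rightarrow> h3o" where
  "wgt_inv x = (hp x, hm x, hn x, (1/2) *\<^sub>R ha x, (1/2) *\<^sub>R hb x, (1/2) *\<^sub>R hc x)"

lemma h3o_inner: "x \<bullet> y = hp x * hp y + hm x * hm y + hn x * hn y + ha x \<bullet> ha y + hb x \<bullet> hb y + hc x \<bullet> hc y"
  by (simp add: inner_prod_def)

text \<open>The trace form \<open>tr (\<chi> \<circ> \<chi>')\<close> of hermitian matrices counts the off-diagonal entries twice.\<close>

definition ip :: "h3o \<Rightarrow> h3o \<Rightarrow> real" where "ip x y = x \<bullet> wgt y"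

lemma ip_expand: "ip x y = hp x * hp y + hm x * hm y + hn x * hn y + 2 * (ha x \<bullet> ha y) + 2 * (hb x \<bullet> hb y) + 2 * (hc x \<bullet> hc y)"
  by (simp add: ip_def wgt_def h3o_inner)

lemma wgt_simps [simp]: "wgt (wgt_inv x) = x" "wgt_inv (wgt x) = x" "linear wgt" "linear wgt_inv"
  by (simp_all add: wgt_def wgt_inv_def linear_iff scaleR_add_right)

lemma wgt_sym: "wgt x \<bullet> y = x \<bullet> wgt y" "wgt_inv x \<bullet> y = x \<bullet> wgt_inv y"
  by (simp_all add: wgt_def wgt_inv_def h3o_inner)

lemma ip_sym: "ip x y = ip y x" by (simp add: ip_expand inner_commute mult.commute)

lemma ip_nondeg: "(\<And>x. ip x y = ip x z) \<Longrightarrow> y = z"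
proof -
  assume "\<And>x. ip x y = ip x z"
  then have "x \<bullet> (wgt y - wgt z) = 0" for x unfolding ip_def by (simp add: inner_diff_right)
  then have "wgt y = wgt z" using inner_eq_zero_iff[of "wgt y - wgt z"] by simp
  then show "y = z" using wgt_simps(2) by metis
qed

text \<open>The adjoint with respect to the trace form.\<close>

definition star :: "endo \<Rightarrow> endo" where
  "star X = Blinfun (\<lambda>x. wgt_inv (adjoint (blinfun_apply X) (wgt x)))"

lemma blinfun_linear: "linear (blinfun_apply X)"
  by (simp add: linear_iff blinfun.bilinear_simps)

lemma star_apply: "blinfun_apply (star X) x = wgt_inv (adjoint (blinfun_apply X) (wgt x))"
proof -
  have "linear (\<lambda>x. wgt_inv (adjoint (blinfun_apply X) (wgt x)))"
    using linear_compose[OF linear_compose[OF wgt_simps(3) adjoint_linear[OF blinfun_linear[of X]]] wgt_simps(4)]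
    by (simp add: o_def)
  then show ?thesis unfolding star_def by (simp add: Blinfun_linear_apply)
qed

lemma ip_star: "ip (blinfun_apply X x) y = ip x (blinfun_apply (star X) y)"
  by (simp add: ip_def star_apply adjoint_works[OF blinfun_linear])

lemma star_unique: "(\<And>x y. ip (blinfun_apply X x) y = ip x (blinfun_apply Y y)) \<Longrightarrow> star X = Y"
  by (rule blinfun_eqI, rule ip_nondeg) (simp add: ip_star)

lemma ip_linear: "ip (x + y) z = ip x z + ip y z" "ip x (y + z) = ip x y + ip x z" "ip (c *\<^sub>R x) y = c * ip x y" "ip x (c *\<^sub>R y) = c * ip x y"
  "ip (x - y) z = ip x z - ip y z" "ip x (y - z) = ip x y - ip x z" "ip (- x) y = - ip x y" "ip x (- y) = - ip x y"
  by (simp_all add: ip_expand inner_add_left inner_add_right inner_diff_left inner_diff_right algebra_simps)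

lemma star_star [simp]: "star (star X) = X"
  by (rule star_unique) (metis ip_star ip_sym)

lemma star_linear: "linear star"
  unfolding linear_iff
  by (intro conjI allI; rule star_unique; simp add: blinfun.bilinear_simps ip_linear ip_star)

lemmas star_simps = linear_add[OF star_linear] linear_diff[OF star_linear] linear_scale[OF star_linear] linear_neg[OF star_linear] linear_0[OF star_linear]

lemma star_compose: "star (X o\<^sub>L Y) = star Y o\<^sub>L star X"
  by (rule star_unique) (simp add: ip_star)

lemma star_commutator: "star (commutator X Y) = commutator (star Y) (star X)"
  by (simp add: commutator_def star_simps star_compose)

definition theta :: "endo \<Rightarrow> endo" where "theta X = - star X"

definition flip_sign :: "iunit \<Rightarrow> real" where
  "flip_sign q = (if q \<in> {Ui, Uj, Uil, Ujl} then -1 else 1)"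

text \<open>The automorphism of the octonions that fixes the quaternion algebra spanned by \<open>1, k, kl, l\<close>.\<close>

definition flip_oct :: "oct \<Rightarrow> oct" where
  "flip_oct x = (fst x, \<chi> q. flip_sign q * snd x $ q)"

definition sigma_map :: "h3o \<Rightarrow> h3o" where "sigma_map x = (hp x, hm x, hn x, ha x, - hb x, - hc x)"
definition flip_map :: "h3o \<Rightarrow> h3o" where "flip_map x = (hp x, hm x, hn x, flip_oct (ha x), flip_oct (hb x), flip_oct (hc x))"

definition conj_by :: "(h3o \<Rightarrow> h3o) \<Rightarrow> endo \<Rightarrow> endo" where
  "conj_by S X = Blinfun S o\<^sub>L X o\<^sub>L Blinfun S"

abbreviation sigma :: "endo \<Rightarrow> endo" where "sigma \<equiv> conj_by sigma_map"
abbreviation hflip :: "endo \<Rightarrow> endo" where "hflip \<equiv> conj_by flip_map"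

lemma flip_oct_comp: "fst (flip_oct x) = fst x" "snd (flip_oct x) $ q = flip_sign q * snd x $ q"
  by (simp_all add: flip_oct_def)

lemma flip_sign_values: "flip_sign Ui = -1" "flip_sign Uj = -1" "flip_sign Uil = -1" "flip_sign Ujl = -1"
  "flip_sign Uk = 1" "flip_sign Ukl = 1" "flip_sign Ul = 1"
  by (simp_all add: flip_sign_def)

lemma flip_oct_mult: "flip_oct (omult x y) = omult (flip_oct x) (flip_oct y)"
  by (simp add: oct_eq_iff flip_oct_comp omult_components flip_sign_values)

lemma flip_oct_simps: "flip_oct (flip_oct x) = x" "flip_oct (oconj x) = oconj (flip_oct x)"
  "flip_oct x \<bullet> flip_oct y = x \<bullet> y" "flip_oct (oreal r) = oreal r" "flip_oct (ounit q) = flip_sign q *\<^sub>R ounit q"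
  by (auto simp: oct_eq_iff flip_oct_comp oct_comp flip_sign_values oct_inner)

lemma flip_oct_linear: "linear flip_oct"
  by (simp add: linear_iff oct_eq_iff flip_oct_comp algebra_simps)

lemmas flip_lin = linear_add[OF flip_oct_linear] linear_scale[OF flip_oct_linear] linear_0[OF flip_oct_linear] linear_neg[OF flip_oct_linear]

lemma sigma_map_props: "linear sigma_map" "sigma_map (sigma_map x) = x" "ip (sigma_map x) y = ip x (sigma_map y)"
  by (simp_all add: linear_iff sigma_map_def ip_expand)

lemma flip_map_props: "linear flip_map" "flip_map (flip_map x) = x" "ip (flip_map x) y = ip x (flip_map y)"
proof -
  have "flip_oct u \<bullet> v = u \<bullet> flip_oct v" for u v using flip_oct_simps(3)[of u "flip_oct v"] by (simp add: flip_oct_simps)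
  then show "ip (flip_map x) y = ip x (flip_map y)" by (simp add: flip_map_def ip_expand)
qed (simp_all add: linear_iff flip_map_def flip_lin flip_oct_simps)

lemma sigma_flip_commute: "sigma_map (flip_map x) = flip_map (sigma_map x)"
  by (simp add: sigma_map_def flip_map_def flip_lin)

lemma conj_by_apply: "linear S \<Longrightarrow> blinfun_apply (conj_by S X) x = S (blinfun_apply X (S x))"
  by (simp add: conj_by_def Blinfun_linear_apply)

definition lie_involution :: "(endo \<Rightarrow> endo) \<Rightarrow> bool" where
  "lie_involution s \<longleftrightarrow> linear s \<and> (\<forall>X. s (s X) = X) \<and>
     (\<forall>X Y. s (commutator X Y) = commutator (s X) (s Y)) \<and> (\<forall>X. s (star X) = star (s X))"

lemma lie_involutionD:
  assumes "lie_involution s"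
  shows "linear s" "s (s X) = X" "s (commutator X Y) = commutator (s X) (s Y)" "s (star X) = star (s X)" "s (theta X) = theta (s X)"
  using assms by (auto simp: lie_involution_def theta_def linear_neg)

lemma lie_involution_id: "lie_involution id"
  by (simp add: lie_involution_def linear_id[unfolded id_def] linear_iff)

lemma lie_involution_theta: "lie_involution theta"
proof -
  have "star (commutator X Y) = - commutator (star X) (star Y)" for X Y
    unfolding star_commutator by (rule commutator_anti)
  then show ?thesis
    unfolding lie_involution_def theta_def by (simp add: linear_iff star_simps commutator_simps)
qed

lemma lie_involution_conj:
  assumes S: "linear S" "\<And>x. S (S x) = x" "\<And>x y. ip (S x) y = ip x (S y)"
  shows "lie_involution (conj_by S)"
proof -
  note a = conj_by_apply[OF S(1)]
  note l = linear_add[OF S(1)] linear_scale[OF S(1)] linear_diff[OF S(1)]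
  have "conj_by S (star X) = star (conj_by S X)" for X
    by (rule star_unique[symmetric]) (simp only: a S(3) ip_star)
  moreover have "linear (conj_by S)"
    unfolding linear_iff by (intro conjI allI; rule blinfun_eqI; simp add: a blinfun.bilinear_simps l)
  moreover have "conj_by S (conj_by S X) = X" for X by (rule blinfun_eqI) (simp add: a S(2))
  moreover have "conj_by S (commutator X Y) = commutator (conj_by S X) (conj_by S Y)" for X Y
    by (rule blinfun_eqI) (simp add: a S(2) commutator_def blinfun.bilinear_simps l)
  ultimately show ?thesis unfolding lie_involution_def by blast
qed

lemma lie_involution_compose:
  assumes "lie_involution s" "lie_involution t" "\<And>X. s (t X) = t (s X)"
  shows "lie_involution (s \<circ> t)"
  using assms linear_compose[of t s] unfolding lie_involution_def by (simp add: o_def)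

lemma lie_involution_sigma: "lie_involution sigma"
  by (rule lie_involution_conj[OF sigma_map_props])

lemma lie_involution_flip: "lie_involution hflip"
  by (rule lie_involution_conj[OF flip_map_props])

lemma sigma_hflip_commute: "sigma (hflip X) = hflip (sigma X)"
  by (rule blinfun_eqI) (simp add: conj_by_apply sigma_map_props flip_map_props sigma_flip_commute)

subsection \<open>Every generator is a common eigenvector\<close>

lemma star_Up: "star (Up s \<beta>) = Dn s (oconj \<beta>)"
proof (rule star_unique)
  have e: "oconj u \<bullet> v = u \<bullet> oconj v" for u v using oconj_simps(8)[of u "oconj v"] by simp
  have c1: "omult \<beta> (oconj b) \<bullet> c = b \<bullet> omult (oconj c) (oconj (oconj \<beta>))" for b c
    using omult_adjoint(1)[of \<beta> "oconj b" c] e[of b "omult (oconj \<beta>) c"] by simp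
  show "ip (Up s \<beta> x) y = ip x (Dn s (oconj \<beta>) y)" for x y
    using c1[of "hb x" "hc y"] c1[of "hc x" "ha y"] c1[of "ha x" "hb y"]
    by (cases s) (simp_all add: ip_expand inner_commute algebra_simps)
qed

lemma star_Dn: "star (Dn s \<beta>) = Up s (oconj \<beta>)"
  using star_Up[of s "oconj \<beta>"] star_star[of "Up s (oconj \<beta>)"] by simp

lemma star_Scal: "star (Scal r s t) = Scal r s t"
  by (rule star_unique) (simp add: scal_def ip_expand algebra_simps)

lemma star_Rot: "star (Rot p q) = Rot (oconj q) (oconj p)"
  unfolding Rot_def by (simp add: star_simps star_commutator star_Up star_Dn)

lemma Rot_antisym:
  assumes "p \<noteq> q" shows "Rot (ounit q) (ounit p) = - Rot (ounit p) (ounit q)"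
proof (rule blinfun_eqI)
  fix x
  have r: "omult (omult v (ounit p)) (ounit q) = - omult (omult v (ounit q)) (ounit p)" for v
    using arg_cong[OF unit_anticommute[OF assms, of "oconj v"], of oconj] by simp
  show "Rot (ounit q) (ounit p) x = (- Rot (ounit p) (ounit q)) x"
    using assms by (simp add: Rot_apply blinfun.bilinear_simps unit_orthogonal r[of "hb x"] unit_anticommute[OF assms] inner_commute)
qed

lemma Rot_one: "Rot (ounit q) (oreal 1) = Rot (oreal 1) (ounit q)"
  by (rule blinfun_eqI) (simp add: Rot_apply inner_ounit oct_comp)

lemma theta_URot: "fst pq \<noteq> snd pq \<Longrightarrow> theta (URot pq) = URot pq"
proof -
  assume n: "fst pq \<noteq> snd pq"
  have "Rot (- x) (- y) = Rot x y" for x y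
    by (simp add: Rot_def linear_neg[OF Up_linear] linear_neg[OF Dn_linear] commutator_simps)
  then show ?thesis unfolding theta_def star_Rot using Rot_antisym[OF n] by simp
qed

lemma theta_Rot_one: "theta (Rot (oreal 1) (ounit q)) = Rot (oreal 1) (ounit q)"
proof -
  have "Rot (- x) y = - Rot x y" for x y
    by (simp add: Rot_def linear_neg[OF Up_linear] commutator_simps)
  then show ?thesis unfolding theta_def star_Rot by (simp add: Rot_one)
qed

lemma theta_linear: "linear theta" using lie_involution_theta by (simp add: lie_involutionD)

lemma basis_label_iff: "(Btz, s) \<in> basis_labels \<longleftrightarrow> s \<noteq> Three" "(Btx, s) \<in> basis_labels" "(Rxz, s) \<in> basis_labels"
  "(Btq q, s) \<in> basis_labels" "(Rzq q, s) \<in> basis_labels" "(Rxq q, s) \<in> basis_labels \<longleftrightarrow> s = One"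
  "(Aq q, s) \<in> basis_labels \<longleftrightarrow> s = One" "(Gq q, s) \<in> basis_labels \<longleftrightarrow> s = One" "(Sq q, s) \<in> basis_labels \<longleftrightarrow> s = One"
  by (cases s; auto simp: basis_labels_def)+

lemma boost_label_iff: "(Btz, s) \<in> boost_labels \<longleftrightarrow> s \<noteq> Three" "(Btx, s) \<in> boost_labels" "(Rxz, s) \<notin> boost_labels"
  "(Btq q, s) \<in> boost_labels" "(Rzq q, s) \<notin> boost_labels" "(Rxq q, s) \<notin> boost_labels"
  "(Aq q, s) \<notin> boost_labels" "(Gq q, s) \<notin> boost_labels" "(Sq q, s) \<notin> boost_labels"
  by (auto simp: boost_labels_def basis_label_iff)

lemma T23_label_iff: "(Btz, s) \<notin> T23_labels" "(Btx, s) \<in> T23_labels \<longleftrightarrow> s \<noteq> One" "(Rxz, s) \<in> T23_labels \<longleftrightarrow> s \<noteq> One"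
  "(Btq q, s) \<in> T23_labels \<longleftrightarrow> s \<noteq> One" "(Rzq q, s) \<in> T23_labels \<longleftrightarrow> s \<noteq> One" "(Rxq q, s) \<notin> T23_labels"
  "(Aq q, s) \<notin> T23_labels" "(Gq q, s) \<notin> T23_labels" "(Sq q, s) \<notin> T23_labels"
  by (cases s; auto simp: T23_labels_def)+

lemmas dot_simps = dot_Btx dot_Rxz dot_Btq dot_Rzq dot_Btz dot_Rxq dot_Aq dot_Gq dot_Sq

lemma theta_dot:
  assumes "(F, s) \<in> basis_labels"
  shows "theta (dot F s) = (if (F, s) \<in> boost_labels then -1 else 1) *\<^sub>R dot F s"
proof -
  have *: "theta (Up s \<beta>) = - Dn s (oconj \<beta>)" "theta (Dn s \<beta>) = - Up s (oconj \<beta>)" "theta (Scal x y z) = - Scal x y z" for s \<beta> x y z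
    by (simp_all add: theta_def star_Up star_Dn star_Scal)
  note th = linear_add[OF theta_linear] linear_diff[OF theta_linear] linear_scale[OF theta_linear]
  note ud = linear_neg[OF Up_linear] linear_neg[OF Dn_linear]
  show ?thesis
    using assms pairs_distinct
    by (cases F; cases s; simp add: basis_label_iff boost_label_iff dot_simps * th ud theta_URot theta_Rot_one scaleR_diff_right scaleR_add_right)
qed

lemma sigma_Up: "sigma (Up s \<beta>) = (if s = One then 1 else -1) *\<^sub>R Up s \<beta>"
  by (rule blinfun_eqI, cases s) (simp_all add: conj_by_apply sigma_map_props, simp_all add: sigma_map_def blinfun.bilinear_simps)

lemma sigma_Dn: "sigma (Dn s \<beta>) = (if s = One then 1 else -1) *\<^sub>R Dn s \<beta>"
  by (rule blinfun_eqI, cases s) (simp_all add: conj_by_apply sigma_map_props, simp_all add: sigma_map_def blinfun.bilinear_simps)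

lemma sigma_Scal: "sigma (Scal x y z) = Scal x y z"
  by (rule blinfun_eqI) (simp add: conj_by_apply sigma_map_props, simp add: sigma_map_def scal_def)

lemma sigma_linear: "linear sigma" using lie_involution_sigma by (simp add: lie_involutionD)

lemma sigma_Rot: "sigma (Rot p q) = Rot p q"
  unfolding Rot_def
  by (simp add: linear_scale[OF sigma_linear] lie_involutionD(3)[OF lie_involution_sigma] sigma_Up sigma_Dn)

lemma sigma_dot:
  assumes "(F, s) \<in> basis_labels"
  shows "sigma (dot F s) = (if (F, s) \<in> T23_labels then -1 else 1) *\<^sub>R dot F s"
proof -
  note th = linear_add[OF sigma_linear] linear_diff[OF sigma_linear] linear_scale[OF sigma_linear]
  show ?thesis
    using assms
    by (cases F; cases s; simp add: basis_label_iff T23_label_iff dot_simps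
        th sigma_Up sigma_Dn sigma_Scal sigma_Rot scaleR_diff_right scaleR_add_right)
qed

lemma flip_Up: "hflip (Up s \<beta>) = Up s (flip_oct \<beta>)"
proof -
  have e: "flip_oct u \<bullet> v = u \<bullet> flip_oct v" for u v using flip_oct_simps(3)[of u "flip_oct v"] by (simp add: flip_oct_simps)
  have e2: "oconj \<beta> \<bullet> flip_oct v = oconj (flip_oct \<beta>) \<bullet> v" for v using e[of "oconj \<beta>" v] by (simp add: flip_oct_simps(2))
  show ?thesis
    by (rule blinfun_eqI, cases s)
      (simp_all add: conj_by_apply flip_map_props, simp_all add: flip_map_def flip_lin flip_oct_mult flip_oct_simps(1,2) e2)
qed

lemma flip_Dn: "hflip (Dn s \<beta>) = Dn s (flip_oct \<beta>)"
proof -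
  have e: "flip_oct u \<bullet> v = u \<bullet> flip_oct v" for u v using flip_oct_simps(3)[of u "flip_oct v"] by (simp add: flip_oct_simps)
  show ?thesis
    by (rule blinfun_eqI, cases s)
      (simp_all add: conj_by_apply flip_map_props, simp_all add: flip_map_def flip_lin flip_oct_mult flip_oct_simps(1,2) e)
qed

lemma flip_Scal: "hflip (Scal x y z) = Scal x y z"
  by (rule blinfun_eqI) (simp add: conj_by_apply flip_map_props, simp add: flip_map_def scal_def flip_lin flip_oct_simps)

lemma hflip_linear: "linear hflip" using lie_involution_flip by (simp add: lie_involutionD)

lemma flip_Rot: "hflip (Rot p q) = Rot (flip_oct p) (flip_oct q)"
  unfolding Rot_def
  by (simp add: linear_scale[OF hflip_linear] lie_involutionD(3)[OF lie_involution_flip] flip_Up flip_Dn)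

lemma Rot_scale: "Rot (c *\<^sub>R p) (d *\<^sub>R q) = (c * d) *\<^sub>R Rot p q"
  unfolding Rot_def by (simp add: linear_scale[OF Up_linear] linear_scale[OF Dn_linear] commutator_simps)

lemma flip_Rot_one: "hflip (Rot (oreal 1) (ounit q)) = flip_sign q *\<^sub>R Rot (oreal 1) (ounit q)"
  using Rot_scale[of 1 "oreal 1" "flip_sign q" "ounit q"] by (simp add: flip_Rot flip_oct_simps)

lemma flip_sign_pairs: "flip_sign (fst (pair1 q)) * flip_sign (snd (pair1 q)) = flip_sign q"
    "flip_sign (fst (pair2 q)) * flip_sign (snd (pair2 q)) = flip_sign q"
    "flip_sign (fst (pair3 q)) * flip_sign (snd (pair3 q)) = flip_sign q"
  by (cases q; simp add: flip_sign_values)+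

lemma flip_URot: "hflip (URot (pair1 q)) = flip_sign q *\<^sub>R URot (pair1 q)" "hflip (URot (pair2 q)) = flip_sign q *\<^sub>R URot (pair2 q)"
    "hflip (URot (pair3 q)) = flip_sign q *\<^sub>R URot (pair3 q)"
  by (simp_all only: flip_Rot flip_oct_simps Rot_scale flip_sign_pairs)

lemma hflip_dot:
  assumes "(F, s) \<in> basis_labels"
  shows "hflip (dot F s) = (if (F, s) \<in> Hperp_labels then -1 else 1) *\<^sub>R dot F s"
proof -
  note th = linear_add[OF hflip_linear] linear_diff[OF hflip_linear] linear_scale[OF hflip_linear]
  note ud = linear_scale[OF Up_linear] linear_scale[OF Dn_linear]
  have "hflip (dot F s) = (case carried_unit F of None \<Rightarrow> 1 | Some q \<Rightarrow> flip_sign q) *\<^sub>R dot F s"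
    using assms
    by (cases F; cases s; simp add: basis_label_iff dot_simps
        th ud flip_Up flip_Dn flip_Scal flip_Rot_one flip_URot flip_oct_simps scaleR_diff_right scaleR_add_right mult.commute)
  also have "(case carried_unit F of None \<Rightarrow> 1 | Some q \<Rightarrow> flip_sign q) = (if (F, s) \<in> Hperp_labels then -1 else 1)"
    using assms unfolding Hperp_labels_def by (cases "carried_unit F") (auto simp: flip_sign_def)
  finally show ?thesis .
qed

subsection \<open>Eigenspaces\<close>

definition eigen :: "(endo \<Rightarrow> endo) \<Rightarrow> (xform \<times> slot \<Rightarrow> real) \<Rightarrow> bool" where
  "eigen s \<epsilon> \<longleftrightarrow> linear s \<and> (\<forall>l\<in>basis_labels. s (case_prod dot l) = \<epsilon> l *\<^sub>R case_prod dot l \<and> (\<epsilon> l = 1 \<or> \<epsilon> l = -1))"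

definition sgn_of :: "(xform \<times> slot) set \<Rightarrow> xform \<times> slot \<Rightarrow> real" where
  "sgn_of A l = (if l \<in> A then -1 else 1)"

lemma eigen_basic: "eigen theta (sgn_of boost_labels)" "eigen sigma (sgn_of T23_labels)" "eigen hflip (sgn_of Hperp_labels)"
  "eigen id (sgn_of {})"
  unfolding eigen_def sgn_of_def
  by (intro conjI ballI theta_linear sigma_linear hflip_linear; auto simp: theta_dot sigma_dot hflip_dot linear_iff)+

lemma eigen_compose:
  assumes "eigen s \<epsilon>" "eigen t \<delta>" shows "eigen (s \<circ> t) (\<lambda>l. \<epsilon> l * \<delta> l)"
  unfolding eigen_def
proof (intro conjI ballI)
  show "linear (s \<circ> t)" using assms linear_compose unfolding eigen_def by blast
  fix l assume l: "l \<in> basis_labels"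
  note e = assms[unfolded eigen_def, THEN conjunct2, rule_format, OF l]
  show "(s \<circ> t) (case_prod dot l) = (\<epsilon> l * \<delta> l) *\<^sub>R case_prod dot l"
    using e linear_scale[of s] assms(1) unfolding eigen_def by simp
  show "\<epsilon> l * \<delta> l = 1 \<or> \<epsilon> l * \<delta> l = -1" using e by auto
qed

lemma gen_span_alt: "gen_span A = span (case_prod dot ` A)"
  by (simp add: gen_span_def)

lemma eigen_preserves:
  assumes "eigen s \<epsilon>" "X \<in> sl3O" shows "s X \<in> sl3O"
proof -
  have s: "linear s" using assms eigen_def by blast
  have "s v \<in> gen_span basis_labels" if v: "v \<in> case_prod dot ` basis_labels" for v
  proof -
    obtain l where l: "l \<in> basis_labels" "v = case_prod dot l" using v by blast
    then have "s v = \<epsilon> l *\<^sub>R v" using assms(1) unfolding eigen_def by blast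
    then show ?thesis unfolding gen_span_alt using v by (simp add: span_scale span_base)
  qed
  then have "s ` gen_span basis_labels \<subseteq> gen_span basis_labels"
    unfolding gen_span_alt[of basis_labels] linear_span_image[OF s, symmetric]
    by (intro span_minimal) (auto simp: gen_span_alt)
  then show ?thesis using assms(2) unfolding sl3O_span by blast
qed

lemma eigen_space:
  assumes e: "eigen s \<epsilon>" and d: "d = 1 \<or> d = -1" and sub: "\<Lambda> \<subseteq> basis_labels"
  shows "{X \<in> gen_span \<Lambda>. s X = d *\<^sub>R X} = gen_span {l \<in> \<Lambda>. \<epsilon> l = d}"
proof
  have s: "linear s" and ev: "\<And>l. l \<in> \<Lambda> \<Longrightarrow> s (case_prod dot l) = \<epsilon> l *\<^sub>R case_prod dot l"
    and ev1: "\<And>l. l \<in> \<Lambda> \<Longrightarrow> \<epsilon> l = 1 \<or> \<epsilon> l = -1" using e sub unfolding eigen_def by blast+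
  define P where "P X = (1/2) *\<^sub>R (X + d *\<^sub>R s X)" for X
  have P: "linear P" unfolding P_def using s by (simp add: linear_iff algebra_simps)
  have half: "(1/2) *\<^sub>R (X + X) = X" for X :: endo by (simp flip: scaleR_2)
  have "P v \<in> gen_span {l \<in> \<Lambda>. \<epsilon> l = d}" if v: "v \<in> case_prod dot ` \<Lambda>" for v
  proof -
    obtain l where l: "l \<in> \<Lambda>" "v = case_prod dot l" using v by blast
    have Pv: "P v = (1/2) *\<^sub>R (v + (d * \<epsilon> l) *\<^sub>R v)" unfolding P_def l(2) ev[OF l(1)] by simp
    show ?thesis
    proof (cases "\<epsilon> l = d")
      case True
      then have "d * \<epsilon> l = 1" using d by auto
      then have "P v = v" unfolding Pv by (simp add: half)
      then show ?thesis unfolding gen_span_alt using True l by (auto intro: span_base)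
    next
      case False
      then have "d * \<epsilon> l = -1" using d ev1[OF l(1)] by auto
      then have "P v = 0" unfolding Pv by simp
      then show ?thesis by (simp add: subspace_0[OF gen_span_subspace])
    qed
  qed
  then have 1: "P ` gen_span \<Lambda> \<subseteq> gen_span {l \<in> \<Lambda>. \<epsilon> l = d}"
    unfolding gen_span_alt[of \<Lambda>] linear_span_image[OF P, symmetric]
    by (intro span_minimal gen_span_subspace) blast
  have 2: "P X = X" if "s X = d *\<^sub>R X" for X
  proof -
    have "d * d = 1" using d by auto
    then show ?thesis unfolding P_def that by (simp add: half)
  qed
  show "{X \<in> gen_span \<Lambda>. s X = d *\<^sub>R X} \<subseteq> gen_span {l \<in> \<Lambda>. \<epsilon> l = d}"
  proof clarify
    fix X assume X: "X \<in> gen_span \<Lambda>" "s X = d *\<^sub>R X"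
    have "P X \<in> gen_span {l \<in> \<Lambda>. \<epsilon> l = d}"
      using image_subset_iff[THEN iffD1, OF 1, rule_format, of X] X(1) .
    then show "X \<in> gen_span {l \<in> \<Lambda>. \<epsilon> l = d}" unfolding 2[OF X(2)] .
  qed
  have "subspace {X \<in> gen_span \<Lambda>. s X = d *\<^sub>R X}"
    using gen_span_subspace[of \<Lambda>] by (simp add: subspace_def linear_add[OF s] linear_scale[OF s] linear_0[OF s] algebra_simps)
  moreover have "case_prod dot ` {l \<in> \<Lambda>. \<epsilon> l = d} \<subseteq> {X \<in> gen_span \<Lambda>. s X = d *\<^sub>R X}"
    using ev unfolding gen_span_alt by (auto intro: span_base)
  ultimately show "gen_span {l \<in> \<Lambda>. \<epsilon> l = d} \<subseteq> {X \<in> gen_span \<Lambda>. s X = d *\<^sub>R X}"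
    unfolding gen_span_alt[of "{l \<in> \<Lambda>. \<epsilon> l = d}"] by (intro span_minimal)
qed

lemma direct_sum_eigen:
  assumes e: "eigen s \<epsilon>" and i: "\<And>X. s (s X) = X"
  shows "direct_sum sl3O {X \<in> sl3O. s X = X} {X \<in> sl3O. s X = - X}"
proof -
  have s: "linear s" using e eigen_def by blast
  note l = linear_add[OF s] linear_diff[OF s] linear_scale[OF s] linear_0[OF s] linear_neg[OF s]
  have "X = (1/2) *\<^sub>R (X + s X) + (1/2) *\<^sub>R (X - s X)" for X by (simp add: algebra_simps scaleR_add_left[symmetric])
  moreover have "(1/2) *\<^sub>R (X + s X) \<in> sl3O" "(1/2) *\<^sub>R (X - s X) \<in> sl3O" if "X \<in> sl3O" for X
    using that eigen_preserves[OF e] by (simp_all add: subspace_scale[OF sl3O_subspace] subspace_add[OF sl3O_subspace] subspace_diff[OF sl3O_subspace])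
  moreover have "s ((1/2) *\<^sub>R (X + s X)) = (1/2) *\<^sub>R (X + s X)" "s ((1/2) *\<^sub>R (X - s X)) = - ((1/2) *\<^sub>R (X - s X))" for X
    by (simp_all add: l i algebra_simps)
  ultimately have "sl3O \<subseteq> set_sum {X \<in> sl3O. s X = X} {X \<in> sl3O. s X = - X}"
    unfolding set_sum_def by blast
  moreover have "set_sum {X \<in> sl3O. s X = X} {X \<in> sl3O. s X = - X} \<subseteq> sl3O"
    unfolding set_sum_def using subspace_add[OF sl3O_subspace] by auto
  moreover have "subspace {X \<in> sl3O. s X = X}" "subspace {X \<in> sl3O. s X = - X}"
    using sl3O_subspace by (auto simp: subspace_def l)
  moreover have "{X \<in> sl3O. s X = X} \<inter> {X \<in> sl3O. s X = - X} = {0}"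
  proof -
    have "X = 0" if "X = - X" for X :: endo
    proof -
      have "2 *\<^sub>R X = 0" using that by (metis add.right_inverse scaleR_2)
      then show ?thesis by simp
    qed
    then show ?thesis using subspace_0[OF sl3O_subspace] by (auto simp: l)
  qed
  ultimately show ?thesis unfolding direct_sum_def by blast
qed

lemma spaces_eigen:
  "R_space = {X \<in> sl3O. theta X = X}" "B_space = {X \<in> sl3O. theta X = - X}"
  "T1_space = {X \<in> sl3O. sigma X = X}" "T23_space = {X \<in> sl3O. sigma X = - X}"
  "H_space = {X \<in> sl3O. hflip X = X}" "Hperp_space = {X \<in> sl3O. hflip X = - X}"
proof -
  have eq: "{l \<in> basis_labels. sgn_of A l = 1} = basis_labels - A" for A by (auto simp: sgn_of_def)
  have eq': "A \<subseteq> basis_labels \<Longrightarrow> {l \<in> basis_labels. sgn_of A l = -1} = A" for A by (auto simp: sgn_of_def)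
  have sub: "boost_labels \<subseteq> basis_labels" "T23_labels \<subseteq> basis_labels" "Hperp_labels \<subseteq> basis_labels"
    unfolding boost_labels_def T23_labels_def Hperp_labels_def by (auto simp: basis_label_iff)
  have p: "{X \<in> sl3O. s X = X} = gen_span (basis_labels - A)" if "eigen s (sgn_of A)" for s A
    using eigen_space[OF that _ subset_refl, of 1, folded sl3O_span] eq[of A] by simp
  have m: "{X \<in> sl3O. s X = - X} = gen_span {l \<in> basis_labels. sgn_of A l = -1}" if "eigen s (sgn_of A)" for s A
    using eigen_space[OF that _ subset_refl, of "-1", folded sl3O_span] by simp
  show "R_space = {X \<in> sl3O. theta X = X}" "T1_space = {X \<in> sl3O. sigma X = X}" "H_space = {X \<in> sl3O. hflip X = X}"
    unfolding R_space_def T1_space_def H_space_def using eigen_basic[THEN p] by simp_all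
  show "B_space = {X \<in> sl3O. theta X = - X}" "T23_space = {X \<in> sl3O. sigma X = - X}" "Hperp_space = {X \<in> sl3O. hflip X = - X}"
    unfolding B_space_def T23_space_def Hperp_space_def using eigen_basic(1-3)[THEN m] sub[THEN eq'] by simp_all
qed

section \<open>The hermitian form on the complexification\<close>

definition tr :: "endo \<Rightarrow> real" where "tr X = (\<Sum>b\<in>Basis. X b \<bullet> b)"

lemma tr_commute: "tr (X o\<^sub>L Y) = tr (Y o\<^sub>L X)"
proof -
  have e: "tr (X o\<^sub>L Y) = (\<Sum>b\<in>Basis. \<Sum>c\<in>Basis. (Y b \<bullet> c) * (X c \<bullet> b))" for X Y :: endo
  proof -
    have "X (Y b) \<bullet> b = (\<Sum>c\<in>Basis. (Y b \<bullet> c) * (X c \<bullet> b))" for b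
    proof -
      have "X (Y b) = X (\<Sum>c\<in>Basis. (Y b \<bullet> c) *\<^sub>R c)" by (simp add: euclidean_representation)
      also have "\<dots> = (\<Sum>c\<in>Basis. (Y b \<bullet> c) *\<^sub>R X c)" by (simp add: linear_sum[OF blinfun_linear] blinfun.bilinear_simps)
      finally show ?thesis by (simp add: inner_sum_left)
    qed
    then show ?thesis by (simp add: tr_def)
  qed
  show ?thesis unfolding e by (subst sum.swap) (simp add: mult.commute)
qed

lemma tr_linear: "tr (X + Y) = tr X + tr Y" "tr (X - Y) = tr X - tr Y" "tr (c *\<^sub>R X) = c * tr X" "tr (- X) = - tr X"
  by (simp_all add: tr_def blinfun.bilinear_simps inner_add_left inner_diff_left sum.distrib sum_subtractf sum_distrib_left sum_negf)

lemma wgt_Basis: "b \<in> Basis \<Longrightarrow> \<exists>w>0. wgt b = w *\<^sub>R b \<and> wgt_inv b = (1/w) *\<^sub>R b"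
proof -
  assume "b \<in> (Basis :: h3o set)"
  then have "(ha b = 0 \<and> hb b = 0 \<and> hc b = 0) \<or> (hp b = 0 \<and> hm b = 0 \<and> hn b = 0)"
    by (auto simp: Basis_prod_def)
  then show ?thesis
  proof
    assume "ha b = 0 \<and> hb b = 0 \<and> hc b = 0"
    then show ?thesis by (intro exI[of _ 1]) (simp add: wgt_def wgt_inv_def h3o_eq_iff)
  next
    assume "hp b = 0 \<and> hm b = 0 \<and> hn b = 0"
    then show ?thesis by (intro exI[of _ 2]) (simp add: wgt_def wgt_inv_def h3o_eq_iff)
  qed
qed

lemma wgt_inv_pos: "v \<noteq> 0 \<Longrightarrow> wgt_inv v \<bullet> v > 0"
proof -
  assume "v \<noteq> 0"
  then have "v \<bullet> v > 0" by simp
  moreover have "wgt_inv v \<bullet> v \<ge> (1/2) * (v \<bullet> v)"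
    using zero_le_square[of "hp v"] zero_le_square[of "hm v"] zero_le_square[of "hn v"]
    unfolding h3o_inner wgt_inv_def by simp
  ultimately show ?thesis by linarith
qed

lemma wgt_inv_nonneg: "wgt_inv v \<bullet> v \<ge> 0"
  using wgt_inv_pos[of v] by (cases "v = 0") auto

lemma tr_star: "tr (star X) = tr X"
proof -
  have "star X b \<bullet> b = X b \<bullet> b" if bB: "b \<in> Basis" for b
  proof -
    obtain w where w: "w > 0" "wgt b = w *\<^sub>R b" "wgt_inv b = (1/w) *\<^sub>R b" using wgt_Basis[OF bB] by blast
    have "star X b \<bullet> b = adjoint (blinfun_apply X) (w *\<^sub>R b) \<bullet> (1/w) *\<^sub>R b"
      unfolding star_apply wgt_sym w ..
    also have "\<dots> = adjoint (blinfun_apply X) b \<bullet> b"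
      using w(1) by (simp add: linear_scale[OF adjoint_linear[OF blinfun_linear]])
    also have "\<dots> = X b \<bullet> b" using adjoint_works[OF blinfun_linear, of b X b] by (simp add: inner_commute)
    finally show ?thesis .
  qed
  then show ?thesis by (simp add: tr_def)
qed

definition tform :: "endo \<Rightarrow> endo \<Rightarrow> real" where "tform X Y = tr (X o\<^sub>L star Y)"

lemma compose_linear: "(X + Y) o\<^sub>L Z = (X o\<^sub>L Z) + (Y o\<^sub>L Z)" "Z o\<^sub>L (X + Y) = (Z o\<^sub>L X) + (Z o\<^sub>L Y)"
  "(X - Y) o\<^sub>L Z = (X o\<^sub>L Z) - (Y o\<^sub>L Z)" "Z o\<^sub>L (X - Y) = (Z o\<^sub>L X) - (Z o\<^sub>L Y)"
  "(c *\<^sub>R X) o\<^sub>L Z = c *\<^sub>R (X o\<^sub>L Z)" "Z o\<^sub>L (c *\<^sub>R X) = c *\<^sub>R (Z o\<^sub>L X)" for X Y Z :: endo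
  by (rule blinfun_eqI, simp add: blinfun.bilinear_simps)+

lemma tform_linear: "tform (X + Y) Z = tform X Z + tform Y Z" "tform Z (X + Y) = tform Z X + tform Z Y"
  "tform (X - Y) Z = tform X Z - tform Y Z" "tform Z (X - Y) = tform Z X - tform Z Y"
  "tform (c *\<^sub>R X) Z = c * tform X Z" "tform Z (c *\<^sub>R X) = c * tform Z X"
  by (simp_all add: tform_def star_simps compose_linear tr_linear)

lemma tform_sym: "tform X Y = tform Y X"
  using tr_star[of "X o\<^sub>L star Y"] by (simp add: tform_def star_compose)

lemma tform_pos: "X \<noteq> 0 \<Longrightarrow> tform X X > 0"
proof -
  assume nz: "X \<noteq> 0"
  let ?A = "adjoint (blinfun_apply X)"
  have tm: "\<exists>w>0. X (star X b) \<bullet> b = w * (wgt_inv (?A b) \<bullet> ?A b)" if bB: "b \<in> Basis" for b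
  proof -
    obtain w where w: "w > 0" "wgt b = w *\<^sub>R b" using wgt_Basis[OF bB] by blast
    have "X (star X b) \<bullet> b = star X b \<bullet> ?A b"
      using adjoint_works[OF blinfun_linear, of "star X b" X b] by simp
    also have "\<dots> = w * (wgt_inv (?A b) \<bullet> ?A b)"
      unfolding star_apply w(2) linear_scale[OF adjoint_linear[OF blinfun_linear]] linear_scale[OF wgt_simps(4)] by simp
    finally show ?thesis using w(1) by blast
  qed
  have nn: "X (star X b) \<bullet> b \<ge> 0" if "b \<in> Basis" for b
    using tm[OF that] wgt_inv_nonneg[of "?A b"] by auto
  have "\<exists>b\<in>Basis. ?A b \<noteq> 0"
  proof (rule ccontr)
    assume "\<not> ?thesis"
    then have "?A y = 0" for y
      using linear_eq_0_on_span[OF adjoint_linear[OF blinfun_linear[of X]], of Basis y] by simp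
    then have "X x \<bullet> y = 0" for x y using adjoint_works[OF blinfun_linear, of x X y] by simp
    then have "X x = 0" for x using inner_eq_zero_iff by blast
    then have "X = 0" by (intro blinfun_eqI) simp
    then show False using nz by simp
  qed
  then obtain b where b: "b \<in> Basis" "?A b \<noteq> 0" by blast
  have "0 < X (star X b) \<bullet> b" using tm[OF b(1)] wgt_inv_pos[OF b(2)] by auto
  then have "0 < (\<Sum>b\<in>Basis. X (star X b) \<bullet> b)"
    using sum_pos2[of Basis b "\<lambda>b. X (star X b) \<bullet> b"] b(1) nn by simp
  then show ?thesis by (simp add: tform_def tr_def)
qed

lemma compose_assoc: "(X o\<^sub>L Y) o\<^sub>L Z = X o\<^sub>L (Y o\<^sub>L Z)" for X Y Z :: endo
  by (rule blinfun_eqI) simp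

lemma tform_commutator: "tform (commutator X Y) Z = tform Y (commutator (star X) Z)"
proof -
  have "tr (Y o\<^sub>L (X o\<^sub>L star Z)) = tr (X o\<^sub>L (star Z o\<^sub>L Y))" "tr (X o\<^sub>L (Y o\<^sub>L star Z)) = tr (Y o\<^sub>L (star Z o\<^sub>L X))"
    using tr_commute[of Y "X o\<^sub>L star Z"] tr_commute[of X "Y o\<^sub>L star Z"] by (simp_all add: compose_assoc)
  moreover have "tr (X o\<^sub>L (star Z o\<^sub>L Y)) = tr (Y o\<^sub>L (X o\<^sub>L star Z))" using calculation by simp
  ultimately show ?thesis
    unfolding tform_def star_commutator star_star
    by (simp add: commutator_def compose_linear tr_linear compose_assoc)
qed

definition herm :: "h3o cend \<Rightarrow> h3o cend \<Rightarrow> real" where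
  "herm Z W = tform (fst Z) (fst W) + tform (snd Z) (snd W)"

definition dagger :: "h3o cend \<Rightarrow> h3o cend" where "dagger Z = (star (fst Z), - star (snd Z))"

lemma dagger_linear: "linear dagger"
  by (simp add: linear_iff dagger_def star_simps)

lemma dagger_dagger [simp]: "dagger (dagger Z) = Z"
  by (simp add: dagger_def star_simps)

lemma dagger_bracket: "dagger (cbracket Z W) = - cbracket (dagger Z) (dagger W)"
proof -
  have s: "star (commutator X Y) = - commutator (star X) (star Y)" for X Y
    unfolding star_commutator by (rule commutator_anti)
  show ?thesis by (simp add: dagger_def cbracket_def star_simps s commutator_simps prod_eq_iff)
qed

lemma herm_inner: "inner_on L herm"
proof -
  have "bilinear herm" unfolding bilinear_def linear_iff by (simp add: herm_def tform_linear algebra_simps)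
  moreover have "herm Z Z > 0" if "Z \<noteq> 0" for Z
  proof -
    have nn: "tform X X \<ge> 0" for X using tform_pos[of X] tform_linear(5)[of 0 0 0] by (cases "X = 0") auto
    show ?thesis using that tform_pos[of "fst Z"] tform_pos[of "snd Z"] nn[of "fst Z"] nn[of "snd Z"]
      unfolding herm_def prod_eq_iff by (auto intro: add_pos_nonneg add_nonneg_pos)
  qed
  ultimately show ?thesis unfolding inner_on_def by (auto simp: herm_def tform_sym)
qed

lemma herm_bracket: "herm (cbracket Z W) V = herm W (cbracket (dagger Z) V)"
  by (simp add: herm_def cbracket_def dagger_def tform_linear tform_commutator commutator_simps)

lemma g_cx_finite: "\<exists>C. finite C \<and> g_cx \<subseteq> span C"
proof -
  let ?D = "case_prod dot ` basis_labels"
  let ?C = "(\<lambda>X. (X, 0)) ` ?D \<union> (\<lambda>X. (0, X)) ` ?D"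
  have l: "linear (\<lambda>X::endo. (X, 0::endo))" "linear (\<lambda>X::endo. (0::endo, X))" by (simp_all add: linear_iff)
  have "g_cx \<subseteq> span ?C"
  proof
    fix Z assume "Z \<in> g_cx"
    then have "fst Z \<in> span ?D" "snd Z \<in> span ?D" unfolding g_cx_def sl3O_span gen_span_alt by auto
    then have "(fst Z, 0::endo) \<in> (\<lambda>X. (X, 0)) ` span ?D" "(0::endo, snd Z) \<in> (\<lambda>X. (0, X)) ` span ?D" by blast+
    then have "(fst Z, 0::endo) \<in> span ((\<lambda>X. (X, 0)) ` ?D)" "(0::endo, snd Z) \<in> span ((\<lambda>X. (0, X)) ` ?D)"
      by (simp_all only: linear_span_image[OF l(1)] linear_span_image[OF l(2)])
    then have "(fst Z, 0) \<in> span ?C" "(0, snd Z) \<in> span ?C"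
      using span_mono[of "(\<lambda>X. (X, 0)) ` ?D" ?C] span_mono[of "(\<lambda>X. (0, X)) ` ?D" ?C] by blast+
    then have "(fst Z, 0) + (0, snd Z) \<in> span ?C" by (rule span_add)
    then show "Z \<in> span ?C" by simp
  qed
  then show ?thesis using finite_basis_labels by (intro exI[of _ ?C]) simp
qed

section \<open>Signatures and maximal compact subalgebras\<close>

definition dag_closed :: "h3o cend set \<Rightarrow> bool" where
  "dag_closed U \<longleftrightarrow> subspace U \<and> U \<subseteq> g_cx \<and> dagger ` U \<subseteq> U"

lemma dag_parts:
  assumes "dag_closed U" "Z \<in> U"
  shows "(1/2) *\<^sub>R (Z - dagger Z) \<in> {Z \<in> U. dagger Z = - Z}" "Z - (1/2) *\<^sub>R (Z - dagger Z) \<in> {Z \<in> U. dagger Z = Z}"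
proof -
  have U: "subspace U" "dagger Z \<in> U" using assms unfolding dag_closed_def by auto
  note l = linear_add[OF dagger_linear] linear_diff[OF dagger_linear] linear_scale[OF dagger_linear]
  show "(1/2) *\<^sub>R (Z - dagger Z) \<in> {Z \<in> U. dagger Z = - Z}"
    using U assms(2) by (simp add: subspace_diff subspace_scale l algebra_simps)
  have "(1/2) *\<^sub>R (Z + dagger Z) + (1/2) *\<^sub>R (Z - dagger Z) = Z"
    by (simp add: scaleR_add_right scaleR_diff_right flip: scaleR_add_left)
  then have e: "Z - (1/2) *\<^sub>R (Z - dagger Z) = (1/2) *\<^sub>R (Z + dagger Z)"
    by (metis add_diff_cancel_right')
  show "Z - (1/2) *\<^sub>R (Z - dagger Z) \<in> {Z \<in> U. dagger Z = Z}"
    unfolding e using U assms(2) by (simp add: subspace_add subspace_scale l algebra_simps)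
qed

lemma dagger_eigenspaces: "subspace U \<Longrightarrow> subspace {Z \<in> U. dagger Z = - Z}" "subspace U \<Longrightarrow> subspace {Z \<in> U. dagger Z = Z}"
  by (simp_all add: subspace_def linear_add[OF dagger_linear] linear_scale[OF dagger_linear] linear_0[OF dagger_linear])

text \<open>By \<open>herm_bracket\<close>, \<open>ad Z\<close> is skew for the inner product \<open>herm\<close> if \<open>Z\<^sup>* = - Z\<close>, and symmetric if
  \<open>Z\<^sup>* = Z\<close>.\<close>

lemma killing_dagger:
  assumes L: "real_subalgebra L" "centreless L" "dag_closed L" and Z: "Z \<in> L" "Z \<noteq> 0"
  shows "dagger Z = - Z \<Longrightarrow> killing L Z Z < 0" "dagger Z = Z \<Longrightarrow> killing L Z Z > 0"
proof -
  obtain C where C: "finite C" "g_cx \<subseteq> span C" using g_cx_finite by blast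
  have LC: "L \<subseteq> span C" using C L(3) unfolding dag_closed_def by blast
  have bl: "bilinear herm" using herm_inner[of UNIV] unfolding inner_on_def by blast
  note k = killing_sign[OF L(1) C(1) LC L(2) herm_inner _ Z]
  show "killing L Z Z < 0" if "dagger Z = - Z"
    using k[of "-1"] by (auto simp: herm_bracket that cbracket_simps bilinear_rneg[OF bl])
  show "killing L Z Z > 0" if "dagger Z = Z"
    using k[of 1] by (auto simp: herm_bracket that)
qed

lemma killing_0: "killing L 0 0 = 0"
  unfolding killing_def trace_on_def Let_def by (simp add: cbracket_simps representation_zero)

lemma signature_dagger:
  assumes L: "real_subalgebra L" "centreless L" "dag_closed L" and U: "dag_closed U" "U \<subseteq> L"
  shows "signature L U = (dim {Z \<in> U. dagger Z = - Z}, dim {Z \<in> U. dagger Z = Z})"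
proof -
  obtain C where C: "finite C" "g_cx \<subseteq> span C" using g_cx_finite by blast
  have UC: "U \<subseteq> span C" and sU: "subspace U" using C U(1) unfolding dag_closed_def by blast+
  note k = killing_dagger[OF L]
  have "neg_index (killing L) U = dim {Z \<in> U. dagger Z = - Z}"
  proof (rule neg_index_eq[OF _ _ C(1) UC])
    show "subspace {Z \<in> U. dagger Z = - Z}" "subspace {Z \<in> U. dagger Z = Z}" using dagger_eigenspaces[OF sU] by auto
    show "\<exists>n\<in>{Z \<in> U. dagger Z = - Z}. u - n \<in> {Z \<in> U. dagger Z = Z}" if "u \<in> U" for u
      using dag_parts[OF U(1) that] by blast
    show "killing L x x < 0" if "x \<in> {Z \<in> U. dagger Z = - Z}" "x \<noteq> 0" for x using k(1)[of x] that U(2) by blast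
    show "killing L x x \<ge> 0" if "x \<in> {Z \<in> U. dagger Z = Z}" for x
      using k(2)[of x] subsetD[OF U(2), of x] that killing_0[of L] by (cases "x = 0") (simp_all add: less_imp_le)
  qed blast
  moreover have "pos_index (killing L) U = dim {Z \<in> U. dagger Z = Z}"
  proof (rule pos_index_eq[OF _ _ C(1) UC])
    show "subspace {Z \<in> U. dagger Z = - Z}" "subspace {Z \<in> U. dagger Z = Z}" using dagger_eigenspaces[OF sU] by auto
    show "\<exists>n\<in>{Z \<in> U. dagger Z = Z}. u - n \<in> {Z \<in> U. dagger Z = - Z}" if "u \<in> U" for u
      using dag_parts[OF U(1) that] by (intro bexI[of _ "u - (1/2) *\<^sub>R (u - dagger u)"]) auto
    show "killing L x x > 0" if "x \<in> {Z \<in> U. dagger Z = Z}" "x \<noteq> 0" for x using k(2)[of x] that U(2) by blast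
    show "killing L x x \<le> 0" if "x \<in> {Z \<in> U. dagger Z = - Z}" for x
      using k(1)[of x] subsetD[OF U(2), of x] that killing_0[of L] by (cases "x = 0") (simp_all add: less_imp_le)
  qed blast
  ultimately show ?thesis unfolding signature_def by simp
qed

text \<open>A larger compact subalgebra would contain the symmetric part of one of its elements.\<close>

lemma maximal_compact_dagger:
  assumes L: "real_subalgebra L" "centreless L" "dag_closed L"
  shows "maximal_compact_subalgebra L {Z \<in> L. dagger Z = - Z}"
proof -
  let ?K = "{Z \<in> L. dagger Z = - Z}"
  obtain C where C: "finite C" "g_cx \<subseteq> span C" using g_cx_finite by blast
  have LC: "L \<subseteq> span C" and sL: "subspace L" using C L(3) unfolding dag_closed_def by blast+
  have bl: "bilinear herm" using herm_inner[of UNIV] unfolding inner_on_def by blast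
  have "cbracket x y \<in> ?K" if xy: "x \<in> ?K" "y \<in> ?K" for x y
  proof -
    have "dagger (cbracket x y) = - cbracket x y" unfolding dagger_bracket using xy by (simp add: cbracket_simps)
    then show ?thesis using L(1) xy unfolding real_subalgebra_def by blast
  qed
  then have "real_subalgebra ?K"
    using dagger_eigenspaces(1)[OF sL] unfolding real_subalgebra_def by blast
  moreover have "herm (cbracket k x) y + herm x (cbracket k y) = 0" if "k \<in> ?K" for k x y
    using that bilinear_rneg[OF bl, of x "cbracket k y"] by (simp add: herm_bracket cbracket_simps bilinear_rneg[OF bl])
  moreover have "bilinear herm \<and> (\<forall>x\<in>L. \<forall>y\<in>L. herm x y = herm y x) \<and> (\<forall>x\<in>L. x \<noteq> 0 \<longrightarrow> herm x x > 0)"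
    using herm_inner[of L] unfolding inner_on_def .
  ultimately have "compact_subalgebra L ?K"
    unfolding compact_subalgebra_def by (intro conjI exI[of _ herm]) simp_all
  moreover have "K' = ?K" if K': "compact_subalgebra L K'" "?K \<subseteq> K'" for K'
  proof
    show "K' \<subseteq> ?K"
    proof
      fix Z assume Z: "Z \<in> K'"
      have KL: "K' \<subseteq> L" "subspace K'" using K' unfolding compact_subalgebra_def real_subalgebra_def by auto
      define W where "W = (1/2) *\<^sub>R (Z - dagger Z)"
      have W: "W \<in> ?K" "Z - W \<in> {Z \<in> L. dagger Z = Z}" using dag_parts[OF L(3), of Z] KL Z unfolding W_def by blast+
      have "Z - W \<in> K'" using W(1) K'(2) Z KL(2) by (blast intro: subspace_diff)
      moreover have "herm (cbracket (Z - W) V) V' = herm V (cbracket (Z - W) V')" for V V'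
        using W(2) herm_bracket[of "Z - W" V V'] by simp
      ultimately have "Z - W = 0"
        using compact_no_symmetric[OF L(1) C(1) LC L(2) herm_inner _ K'(1), of "Z - W"] by blast
      then show "Z \<in> ?K" using W(1) by simp
    qed
  qed (use K' in blast)
  ultimately show ?thesis unfolding maximal_compact_subalgebra_def by blast
qed

section \<open>Real forms from involutions\<close>

definition good_inv :: "(endo \<Rightarrow> endo) \<Rightarrow> bool" where
  "good_inv s \<longleftrightarrow> lie_involution s \<and> (\<forall>X\<in>sl3O. s X \<in> sl3O)"

definition fixed :: "(endo \<Rightarrow> endo) \<Rightarrow> endo set" where "fixed s = {X \<in> sl3O. s X = X}"

text \<open>The image of \<open>fixed + odd\<close> under multiplication of the odd part by \<open>\<surd>(-1)\<close>.\<close>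

definition twisted :: "(endo \<Rightarrow> endo) \<Rightarrow> h3o cend set" where
  "twisted s = {Z \<in> g_cx. s (fst Z) = fst Z \<and> s (snd Z) = - snd Z}"

lemma good_invD:
  assumes "good_inv s"
  shows "linear s" "s (s X) = X" "s (commutator X Y) = commutator (s X) (s Y)" "s (star X) = star (s X)" "s (theta X) = theta (s X)"
    "X \<in> sl3O \<Longrightarrow> s X \<in> sl3O" "s (X + Y) = s X + s Y" "s (X - Y) = s X - s Y" "s (c *\<^sub>R X) = c *\<^sub>R s X" "s (- X) = - s X" "s 0 = 0"
proof -
  have l: "lie_involution s" using assms good_inv_def by blast
  show "linear s" "s (s X) = X" "s (commutator X Y) = commutator (s X) (s Y)" "s (star X) = star (s X)" "s (theta X) = theta (s X)"
    using lie_involutionD[OF l] by blast+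
  show "X \<in> sl3O \<Longrightarrow> s X \<in> sl3O" using assms good_inv_def by blast
  show "s (X + Y) = s X + s Y" "s (X - Y) = s X - s Y" "s (c *\<^sub>R X) = c *\<^sub>R s X" "s (- X) = - s X" "s 0 = 0"
    using linear_add[OF \<open>linear s\<close>] linear_diff[OF \<open>linear s\<close>] linear_scale[OF \<open>linear s\<close>] linear_neg[OF \<open>linear s\<close>] linear_0[OF \<open>linear s\<close>] by blast+
qed

lemma good_inv_theta: "good_inv theta"
  unfolding good_inv_def using lie_involution_theta eigen_preserves[OF eigen_basic(1)] by blast

lemma sl3O_star: "X \<in> sl3O \<Longrightarrow> star X \<in> sl3O"
  using good_invD(6)[OF good_inv_theta, of X] subspace_neg[OF sl3O_subspace, of "theta X"] by (simp add: theta_def)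

lemma sl3O_closed: "X \<in> sl3O \<Longrightarrow> Y \<in> sl3O \<Longrightarrow> X + Y \<in> sl3O" "X \<in> sl3O \<Longrightarrow> Y \<in> sl3O \<Longrightarrow> X - Y \<in> sl3O"
   "X \<in> sl3O \<Longrightarrow> c *\<^sub>R X \<in> sl3O" "X \<in> sl3O \<Longrightarrow> - X \<in> sl3O" "0 \<in> sl3O"
  by (simp_all add: subspace_add[OF sl3O_subspace] subspace_diff[OF sl3O_subspace] subspace_scale[OF sl3O_subspace]
      subspace_neg[OF sl3O_subspace] subspace_0[OF sl3O_subspace])

lemma complexify_real_form:
  assumes "subspace F" "\<And>X Y. X \<in> F \<Longrightarrow> Y \<in> F \<Longrightarrow> commutator X Y \<in> F"
  shows "real_subalgebra (real_embed ` F)" "is_real_form (F \<times> F) (real_embed ` F)" "complex_subalgebra (F \<times> F)"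
proof -
  have l: "linear real_embed" by (simp add: linear_iff real_embed_def)
  have sub: "subspace (real_embed ` F)" by (rule linear_subspace_image[OF l assms(1)])
  have "cbracket (real_embed X) (real_embed Y) = real_embed (commutator X Y)" for X Y :: "'a \<Rightarrow>\<^sub>L 'a"
    by (simp add: real_embed_def cbracket_def commutator_simps)
  then show ra: "real_subalgebra (real_embed ` F)"
    unfolding real_subalgebra_def using sub assms(2) by auto
  have "subspace (F \<times> F)" by (rule subspace_Times[OF assms(1) assms(1)])
  moreover have "cbracket Z W \<in> F \<times> F" if "Z \<in> F \<times> F" "W \<in> F \<times> F" for Z W
    using that assms unfolding cbracket_def by (simp add: mem_Times_iff subspace_diff subspace_add)
  moreover have "imul Z \<in> F \<times> F" if "Z \<in> F \<times> F" for Z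
    using that assms(1) unfolding imul_def by (simp add: mem_Times_iff subspace_neg)
  ultimately show "complex_subalgebra (F \<times> F)" unfolding complex_subalgebra_def real_subalgebra_def by blast
  have "(X, Y) = real_embed X + imul (real_embed Y)" for X Y :: "'a \<Rightarrow>\<^sub>L 'a" by (simp add: real_embed_def imul_def)
  then have "F \<times> F = set_sum (real_embed ` F) (imul ` real_embed ` F)"
    unfolding set_sum_def by (fastforce simp: real_embed_def imul_def)
  moreover have "real_embed ` F \<inter> imul ` real_embed ` F = {0}"
  proof -
    have "real_embed 0 = 0" "imul 0 = 0" using linear_0[OF l] linear_0[OF imul_linear] by auto
    then have "0 \<in> real_embed ` F" "0 \<in> imul ` real_embed ` F" using subspace_0[OF assms(1)] by (metis image_eqI)+
    moreover have "Z = 0" if "Z \<in> real_embed ` F" "Z \<in> imul ` real_embed ` F" for Z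
      using that by (auto simp: real_embed_def imul_def prod_eq_iff)
    ultimately show ?thesis by blast
  qed
  ultimately show "is_real_form (F \<times> F) (real_embed ` F)"
    unfolding is_real_form_def direct_sum_def using ra sub linear_subspace_image[OF imul_linear sub] by blast
qed

lemma g_cx_iff: "Z \<in> g_cx \<longleftrightarrow> fst Z \<in> sl3O \<and> snd Z \<in> sl3O"
  by (cases Z) (simp add: g_cx_def)

lemma twisted_facts:
  assumes "good_inv s"
  shows "real_subalgebra (twisted s)" "dag_closed (twisted s)" "is_real_form g_cx (twisted s)"
proof -
  note s = good_invD[OF assms]
  have sub: "subspace (twisted s)"
    by (simp add: twisted_def subspace_def g_cx_iff sl3O_closed s)
  show ra: "real_subalgebra (twisted s)"
    unfolding real_subalgebra_def using sub
    by (simp add: twisted_def g_cx_iff cbracket_def sl3O_closed sl3O_commutator s commutator_simps)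
  show "dag_closed (twisted s)"
    unfolding dag_closed_def using sub
    by (auto simp: twisted_def g_cx_iff dagger_def sl3O_closed sl3O_star s star_simps)
  have "Z \<in> set_sum (twisted s) (imul ` twisted s)" if "Z \<in> g_cx" for Z
  proof -
    define U where "U = ((1/2) *\<^sub>R (fst Z + s (fst Z)), (1/2) *\<^sub>R (snd Z - s (snd Z)))"
    define V where "V = ((1/2) *\<^sub>R (snd Z + s (snd Z)), - ((1/2) *\<^sub>R (fst Z - s (fst Z))))"
    have "U \<in> twisted s" "V \<in> twisted s"
      using that unfolding U_def V_def twisted_def g_cx_iff by (simp_all add: sl3O_closed s algebra_simps)
    moreover have "Z = U + imul V"
      unfolding U_def V_def imul_def prod_eq_iff by (simp add: algebra_simps flip: scaleR_add_left)
    ultimately show ?thesis unfolding set_sum_def by blast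
  qed
  moreover have "set_sum (twisted s) (imul ` twisted s) \<subseteq> g_cx"
    unfolding set_sum_def twisted_def imul_def by (auto simp: g_cx_iff sl3O_closed)
  moreover have "twisted s \<inter> imul ` twisted s = {0}"
  proof -
    have n: "X = - X \<Longrightarrow> X = 0" for X :: endo
      by (metis add.right_inverse scaleR_2 scaleR_eq_0_iff zero_neq_numeral)
    have "Z = 0" if Z: "Z \<in> twisted s" "Z \<in> imul ` twisted s" for Z
    proof -
      obtain W where W: "W \<in> twisted s" "Z = imul W" using Z(2) by blast
      have "s (fst Z) = - fst Z" "s (snd Z) = snd Z" using W unfolding twisted_def imul_def by (auto simp: s)
      moreover have "s (fst Z) = fst Z" "s (snd Z) = - snd Z" using Z(1) unfolding twisted_def by auto
      ultimately show ?thesis using n[of "fst Z"] n[of "snd Z"] by (simp add: prod_eq_iff)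
    qed
    moreover have "0 \<in> twisted s" "0 \<in> imul ` twisted s"
      using subspace_0[OF sub] linear_0[OF imul_linear] by (auto intro: image_eqI[of _ _ 0])
    ultimately show ?thesis by blast
  qed
  ultimately show "is_real_form g_cx (twisted s)"
    unfolding is_real_form_def direct_sum_def using ra sub linear_subspace_image[OF imul_linear sub] by blast
qed

text \<open>By bilinearity, what commutes with a real form commutes with its complexification.\<close>

lemma real_form_centreless:
  assumes "is_real_form K L" "centreless K"
  shows "centreless L"
  unfolding centreless_def
proof (intro ballI impI)
  fix Z assume Z: "Z \<in> L" "\<forall>W\<in>L. cbracket Z W = 0"
  have K: "K = set_sum L (imul ` L)" using assms(1) unfolding is_real_form_def direct_sum_def by blast
  have i0: "imul 0 = 0" by (rule linear_0[OF imul_linear])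
  have "subspace L" using assms(1) unfolding is_real_form_def direct_sum_def by blast
  then have "Z + imul 0 \<in> K" unfolding K set_sum_def using Z(1) subspace_0[of L] by blast
  then have "Z \<in> K" by (simp add: i0)
  moreover have "cbracket Z W = 0" if W: "W \<in> K" for W
  proof -
    obtain u v where "W = u + imul v" "u \<in> L" "v \<in> L" using W unfolding K set_sum_def by blast
    then show ?thesis using Z(2) by (simp add: cbracket_simps cbracket_imul i0)
  qed
  ultimately show "Z = 0" using assms(2) unfolding centreless_def by blast
qed

section \<open>Sparse integer matrices\<close>

text \<open>A sparse matrix lists its entries as \<open>((row, column), coefficient)\<close>; a cubic polynomial lists
  its monomials as \<open>(sorted exponent triple, coefficient)\<close>.\<close>

type_synonym smat = "((int \<times> int) \<times> int) list"

fun add_entry :: "'k \<Rightarrow> int \<Rightarrow> ('k \<times> int) list \<Rightarrow> ('k \<times> int) list" where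
  "add_entry k c [] = [(k, c)]"
| "add_entry k c ((k', c') # L) = (if k = k' then (k', c + c') # L else (k', c') # add_entry k c L)"

definition collect :: "('k \<times> int) list \<Rightarrow> ('k \<times> int) list" where
  "collect L = filter (\<lambda>(k, c). c \<noteq> 0) (foldr (\<lambda>(k, c). add_entry k c) L [])"

definition neg_list :: "('k \<times> int) list \<Rightarrow> ('k \<times> int) list" where
  "neg_list = map (\<lambda>(k, c). (k, - c))"

fun row_times :: "int \<Rightarrow> int \<Rightarrow> int \<Rightarrow> smat \<Rightarrow> smat \<Rightarrow> smat" where
  "row_times i j a [] acc = acc"
| "row_times i j a (((j', k), b) # M) acc = row_times i j a M (if j = j' then add_entry (i, k) (a * b) acc else acc)"

fun add_product :: "int \<Rightarrow> smat \<Rightarrow> smat \<Rightarrow> smat \<Rightarrow> smat" where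
  "add_product r [] M acc = acc"
| "add_product r (((i, j), a) # L) M acc = add_product r L M (row_times i j (r * a) M acc)"

definition smat_bracket :: "smat \<Rightarrow> smat \<Rightarrow> smat" where
  "smat_bracket L M = filter (\<lambda>(k, c). c \<noteq> 0) (add_product (-1) M L (add_product 1 L M []))"

definition list_equiv :: "('k \<times> int) list \<Rightarrow> ('k \<times> int) list \<Rightarrow> bool" where
  "list_equiv L M \<longleftrightarrow> collect (L @ neg_list M) = []"

definition smat_scale :: "int \<Rightarrow> smat \<Rightarrow> smat" where
  "smat_scale r = map (\<lambda>(k, c). (k, r * c))"

fun entry :: "smat \<Rightarrow> int \<times> int \<Rightarrow> int" where
  "entry [] p = 0"
| "entry ((k, c) # L) p = (if k = p then c + entry L p else entry L p)"

fun int_nth :: "'a list \<Rightarrow> int \<Rightarrow> 'a option" where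
  "int_nth [] i = None"
| "int_nth (x # xs) i = (if i = 0 then Some x else int_nth xs (i - 1))"

text \<open>A pair \<open>(g, d)\<close> is an instruction: prepend the bracket of generator number \<open>g\<close> with the entry that
  lies \<open>d\<close> places behind the latest one.  Counting from the latest entry keeps the list a stack.\<close>

fun bracket_closure :: "smat list \<Rightarrow> (int \<times> int) list \<Rightarrow> smat list \<Rightarrow> smat list" where
  "bracket_closure gens [] acc = acc"
| "bracket_closure gens ((g, d) # ws) acc = bracket_closure gens ws
     (case int_nth gens g of None \<Rightarrow> acc | Some X \<Rightarrow>
       (case int_nth acc d of None \<Rightarrow> acc | Some Y \<Rightarrow> smat_bracket X Y # acc))"

text \<open>Each matrix has a nonzero entry in a place where all later ones vanish.\<close>

fun echelon :: "smat list \<Rightarrow> (int \<times> int) list \<Rightarrow> bool" where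
  "echelon [] ps \<longleftrightarrow> ps = []"
| "echelon (M # Ms) [] = False"
| "echelon (M # Ms) (p # ps) \<longleftrightarrow> entry M p \<noteq> 0 \<and> list_all (\<lambda>N. entry N p = 0) Ms \<and> echelon Ms ps"

definition spans_ok :: "smat list \<Rightarrow> (int \<times> int) list \<Rightarrow> (int \<times> int) list \<Rightarrow> bool" where
  "spans_ok gens ws ps \<longleftrightarrow> echelon (rev (bracket_closure gens ws (rev gens))) ps"

definition serre_power :: "smat \<Rightarrow> int \<Rightarrow> smat \<Rightarrow> smat" where
  "serre_power X a Y = (smat_bracket X ^^ nat (1 - a)) Y"

definition rel_ok :: "int \<Rightarrow> smat \<Rightarrow> smat \<Rightarrow> smat \<Rightarrow> smat \<Rightarrow> smat \<Rightarrow> smat \<Rightarrow> bool \<Rightarrow> bool" where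
  "rel_ok a ei fi hi ej fj hj same \<longleftrightarrow> list_all (\<lambda>((i, j), c). i = j) hi \<and>
     list_equiv (smat_bracket hi ej) (smat_scale a ej) \<and>
     list_equiv (smat_bracket hi fj) (smat_scale (- a) fj) \<and>
     (if same then list_equiv (smat_bracket ei fj) hi else smat_bracket ei fj = [] \<and>
        serre_power ei a ej = [] \<and> serre_power fi a fj = [])"

definition chevalley_ok :: "int list list \<Rightarrow> smat list \<Rightarrow> smat list \<Rightarrow> smat list \<Rightarrow> bool" where
  "chevalley_ok A es fs hs \<longleftrightarrow> length es = length A \<and> length fs = length A \<and> length hs = length A \<and>
     list_all (\<lambda>i. list_all (\<lambda>j. rel_ok (A ! i ! j) (es ! i) (fs ! i) (hs ! i) (es ! j) (fs ! j) (hs ! j) (i = j))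
       [0..<length A]) [0..<length A]"

text \<open>The 45 monomials of the cubic form in weight coordinates, with their signs.\<close>

definition cubic_monomials :: "(int \<times> int \<times> int \<times> int) list" where
  "cubic_monomials = [(0,1,2,1), (0,11,12,-1), (0,13,14,-1), (0,15,16,-1), (0,17,18,-1), (1,19,20,-1), (1,21,22,-1), (1,23,24,-1), (1,25,26,-1), (2,3,4,-1), (2,5,6,-1), (2,7,8,-1), (2,9,10,-1), (3,11,19,1), (3,13,22,-1), (3,15,24,-1), (3,17,26,-1), (4,12,20,1), (4,14,21,-1), (4,16,23,-1), (4,18,25,-1), (5,12,22,-1), (5,14,19,-1), (5,15,25,1), (5,17,23,-1), (6,11,21,-1), (6,13,20,-1), (6,16,26,1), (6,18,24,-1), (7,12,24,-1), (7,13,25,-1), (7,16,19,-1), (7,17,21,1), (8,11,23,-1), (8,14,26,-1), (8,15,20,-1), (8,18,22,1), (9,12,26,-1), (9,13,23,1), (9,15,21,-1), (9,18,19,-1), (10,11,25,-1), (10,14,24,1), (10,16,22,-1), (10,17,20,-1)]"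

definition sort3 :: "int \<Rightarrow> int \<Rightarrow> int \<Rightarrow> int \<times> int \<times> int" where
  "sort3 a b c = (if a \<le> b then (if b \<le> c then (a,b,c) else if a \<le> c then (a,c,b) else (c,a,b))
     else (if a \<le> c then (b,a,c) else if b \<le> c then (b,c,a) else (c,b,a)))"

text \<open>The matrix entry \<open>((l, m), r)\<close> sends coordinate number \<open>l\<close> to \<open>r\<close> times coordinate number \<open>m\<close>; by the Leibniz
  rule each occurrence of \<open>l\<close> in a monomial contributes the monomial with \<open>m\<close> in its place.\<close>

fun cubic_deriv_entry :: "int \<Rightarrow> int \<Rightarrow> int \<Rightarrow> (int \<times> int \<times> int \<times> int) list
    \<Rightarrow> ((int \<times> int \<times> int) \<times> int) list \<Rightarrow> ((int \<times> int \<times> int) \<times> int) list" where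
  "cubic_deriv_entry l m r [] acc = acc"
| "cubic_deriv_entry l m r ((a, b, d, e) # T) acc = cubic_deriv_entry l m r T
     (let acc1 = (if a = l then add_entry (sort3 m b d) (r * e) acc else acc);
          acc2 = (if b = l then add_entry (sort3 a m d) (r * e) acc1 else acc1)
      in if d = l then add_entry (sort3 a b m) (r * e) acc2 else acc2)"

fun cubic_deriv :: "smat \<Rightarrow> ((int \<times> int \<times> int) \<times> int) list \<Rightarrow> ((int \<times> int \<times> int) \<times> int) list" where
  "cubic_deriv [] acc = acc"
| "cubic_deriv (((l, m), r) # L) acc = cubic_deriv L (cubic_deriv_entry l m r cubic_monomials acc)"

definition cubic_ok :: "smat \<Rightarrow> bool" where
  "cubic_ok L \<longleftrightarrow> list_all (\<lambda>((i, j), c). 0 \<le> i \<and> i < 27 \<and> 0 \<le> j \<and> j < 27) L \<and> list_all (\<lambda>(k, c). c = 0) (cubic_deriv L [])"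

text \<open>The trace form pairs weight vector number \<open>j\<close> with number \<open>bar j\<close>, its complex conjugate, so the adjoint
  of a matrix transposes it up to this permutation.\<close>

definition bar :: "int \<Rightarrow> int" where
  "bar j = (if j < 3 then j else if j mod 2 = 1 then j + 1 else j - 1)"

definition sigma_weight :: "int \<Rightarrow> int" where "sigma_weight j = (if j < 11 then 1 else -1)"

definition flip_weight :: "int \<Rightarrow> int" where
  "flip_weight j = (if j < 3 then 1 else if 2 \<le> (j - 3) mod 8 \<and> (j - 3) mod 8 < 6 then -1 else 1)"

definition theta_list :: "smat \<Rightarrow> smat" where
  "theta_list = map (\<lambda>((j, k), c). ((bar k, bar j), - c))"

definition sign_list :: "(int \<Rightarrow> int) \<Rightarrow> smat \<Rightarrow> smat" where
  "sign_list s = map (\<lambda>((j, k), c). ((j, k), s j * s k * c))"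

text \<open>For each algebra, the root vectors of a system of simple roots and their negatives, an instruction
  list that produces a basis from them, and for each basis element the place of an entry that
  proves linear independence.  The names are those of the types; \<open>h\<close> and \<open>s\<close> indicate that the
  involutions \<open>h\<close> and \<open>\<sigma>\<close> enter into the fixed algebra.  The root vectors come from a root decomposition
  of the fixed algebra; the lemmas verify all properties of them that matter.\<close>

definition E6_e :: "smat list" where
  "E6_e = [[((0,4),1), ((3,1),1), ((20,11),1), ((21,13),-1), ((23,15),-1), ((25,17),-1)],
     [((8,9),1), ((10,7),-1), ((12,14),-1), ((13,11),1), ((19,22),1), ((21,20),-1)],
     [((1,6),1), ((5,0),1), ((11,22),-1), ((13,19),-1), ((16,25),1), ((18,23),-1)],
     [((6,8),1), ((7,5),-1), ((14,16),1), ((15,13),-1), ((22,24),1), ((23,21),-1)],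
     [((8,10),1), ((9,7),-1), ((16,18),1), ((17,15),-1), ((24,26),1), ((25,23),-1)],
     [((0,25),1), ((4,17),-1), ((5,16),1), ((7,14),-1), ((10,12),-1), ((26,2),1)]]"

definition E6_f :: "smat list" where
  "E6_f = [[((1,3),1), ((4,0),1), ((11,20),1), ((13,21),-1), ((15,23),-1), ((17,25),-1)],
     [((7,10),-1), ((9,8),1), ((11,13),1), ((14,12),-1), ((20,21),-1), ((22,19),1)],
     [((0,5),1), ((6,1),1), ((19,13),-1), ((22,11),-1), ((23,18),-1), ((25,16),1)],
     [((5,7),-1), ((8,6),1), ((13,15),-1), ((16,14),1), ((21,23),-1), ((24,22),1)],
     [((7,9),-1), ((10,8),1), ((15,17),-1), ((18,16),1), ((23,25),-1), ((26,24),1)],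
     [((2,26),1), ((12,10),-1), ((14,7),-1), ((16,5),1), ((17,4),-1), ((25,0),1)]]"

definition E6_h :: "smat list" where
  "E6_h = [[((0,0),1), ((1,1),-1), ((3,3),1), ((4,4),-1), ((11,11),-1), ((13,13),-1), ((15,15),-1), ((17,17),-1), ((20,20),1), ((21,21),1), ((23,23),1), ((25,25),1)],
     [((7,7),-1), ((8,8),1), ((9,9),-1), ((10,10),1), ((11,11),-1), ((12,12),1), ((13,13),1), ((14,14),-1), ((19,19),1), ((20,20),-1), ((21,21),1), ((22,22),-1)],
     [((0,0),-1), ((1,1),1), ((5,5),1), ((6,6),-1), ((11,11),1), ((13,13),1), ((16,16),1), ((18,18),1), ((19,19),-1), ((22,22),-1), ((23,23),-1), ((25,25),-1)],
     [((5,5),-1), ((6,6),1), ((7,7),1), ((8,8),-1), ((13,13),-1), ((14,14),1), ((15,15),1), ((16,16),-1), ((21,21),-1), ((22,22),1), ((23,23),1), ((24,24),-1)],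
     [((7,7),-1), ((8,8),1), ((9,9),1), ((10,10),-1), ((15,15),-1), ((16,16),1), ((17,17),1), ((18,18),-1), ((23,23),-1), ((24,24),1), ((25,25),1), ((26,26),-1)],
     [((0,0),1), ((2,2),-1), ((4,4),1), ((5,5),1), ((7,7),1), ((10,10),1), ((12,12),-1), ((14,14),-1), ((16,16),-1), ((17,17),-1), ((25,25),-1), ((26,26),1)]]"

definition E6_words :: "(int \<times> int) list" where
  "E6_words = [(2, 11), (3, 11), (3, 11), (4, 11), (5, 11), (3, 4), (2, 4), (4, 5), (4, 5), (5, 5), (1, 4), (4, 5), (4, 5), (5, 5), (5, 5), (4, 4), (5, 4), (3, 4), (5, 5), (3, 3), (5, 4), (5, 3), (2, 2), (5, 3), (4, 2), (5, 2), (4, 2), (4, 1), (3, 0), (1, 0), (8, 35), (9, 35), (9, 35), (10, 35), (11, 35), (9, 4), (8, 4), (10, 5), (10, 5), (11, 5), (7, 4), (10, 5), (10, 5), (11, 5), (11, 5), (10, 4), (11, 4), (9, 4), (11, 5), (9, 3), (11, 4), (11, 3), (8, 2), (11, 3), (10, 2), (11, 2), (10, 2), (10, 1), (9, 0), (7, 0), (0, 65), (1, 65), (2, 65), (3, 65), (4, 65), (5, 65)]"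

definition E6_pivots :: "(int \<times> int) list" where
  "E6_pivots = [(0, 4), (8, 9), (1, 6), (6, 8), (8, 10), (0, 25), (1, 3), (7, 10), (0, 5), (5, 7), (7, 9), (2, 26), (3, 6), (6, 9), (1, 8), (6, 10), (0, 23), (3, 8), (1, 9), (6, 7), (1, 10), (0, 21), (3, 9), (3, 10), (1, 7), (0, 20), (1, 12), (3, 7), (0, 19), (1, 5), (1, 14), (3, 5), (0, 22), (1, 16), (1, 4), (0, 24), (1, 18), (1, 17), (0, 26), (1, 15), (1, 13), (1, 11), (4, 5), (5, 10), (0, 7), (5, 9), (2, 24), (4, 7), (0, 10), (5, 8), (0, 9), (2, 22), (4, 10), (4, 9), (0, 8), (2, 19), (2, 11), (4, 8), (2, 20), (0, 6), (2, 13), (4, 6), (2, 21), (2, 15), (0, 3), (2, 23), (2, 17), (2, 18), (2, 25), (2, 16), (2, 14), (2, 12), (3, 3), (20, 20), (1, 1), (6, 6), (8, 8), (0, 0)]"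

lemma E6_chevalley: "chevalley_ok cartan_E6 E6_e E6_f E6_h"
  by code_simp

lemma E6_spans: "spans_ok (E6_e @ E6_f) E6_words E6_pivots"
  by code_simp

lemma E6_cubic: "list_all cubic_ok (E6_e @ E6_f)"
  by code_simp

definition F4_e :: "smat list" where
  "F4_e = [[((6,8),1), ((7,5),-1), ((14,16),1), ((15,13),-1), ((22,24),1), ((23,21),-1)],
     [((8,10),1), ((9,7),-1), ((16,18),1), ((17,15),-1), ((24,26),1), ((25,23),-1)],
     [((0,9),1), ((1,9),-1), ((10,0),-1), ((10,1),1), ((12,25),1), ((13,24),-1), ((15,22),1), ((18,20),1), ((19,17),-1), ((21,16),-1), ((23,14),1), ((26,11),-1)],
     [((0,19),1), ((2,19),-1), ((3,12),1), ((5,13),-1), ((7,15),-1), ((9,17),-1), ((11,4),-1), ((14,6),1), ((16,8),1), ((18,10),1), ((20,0),-1), ((20,2),1)]]"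

definition F4_f :: "smat list" where
  "F4_f = [[((5,7),-1), ((8,6),1), ((13,15),-1), ((16,14),1), ((21,23),-1), ((24,22),1)],
     [((7,9),-1), ((10,8),1), ((15,17),-1), ((18,16),1), ((23,25),-1), ((26,24),1)],
     [((0,10),-1), ((1,10),1), ((9,0),1), ((9,1),-1), ((11,26),-1), ((14,23),1), ((16,21),-1), ((17,19),-1), ((20,18),1), ((22,15),1), ((24,13),-1), ((25,12),1)],
     [((0,20),-1), ((2,20),1), ((4,11),-1), ((6,14),1), ((8,16),1), ((10,18),1), ((12,3),1), ((13,5),-1), ((15,7),-1), ((17,9),-1), ((19,0),1), ((19,2),-1)]]"

definition F4_h :: "smat list" where
  "F4_h = [[((5,5),-1), ((6,6),1), ((7,7),1), ((8,8),-1), ((13,13),-1), ((14,14),1), ((15,15),1), ((16,16),-1), ((21,21),-1), ((22,22),1), ((23,23),1), ((24,24),-1)],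
     [((7,7),-1), ((8,8),1), ((9,9),1), ((10,10),-1), ((15,15),-1), ((16,16),1), ((17,17),1), ((18,18),-1), ((23,23),-1), ((24,24),1), ((25,25),1), ((26,26),-1)],
     [((9,9),-2), ((10,10),2), ((11,11),-1), ((12,12),1), ((13,13),1), ((14,14),-1), ((15,15),1), ((16,16),-1), ((17,17),-1), ((18,18),1), ((19,19),1), ((20,20),-1), ((21,21),1), ((22,22),-1), ((23,23),1), ((24,24),-1), ((25,25),-1), ((26,26),1)],
     [((3,3),1), ((4,4),-1), ((5,5),1), ((6,6),-1), ((7,7),1), ((8,8),-1), ((9,9),1), ((10,10),-1), ((11,11),1), ((12,12),-1), ((13,13),-1), ((14,14),1), ((15,15),-1), ((16,16),1), ((17,17),-1), ((18,18),1), ((19,19),-2), ((20,20),2)]]"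

definition F4_words :: "(int \<times> int) list" where
  "F4_words = [(1, 7), (2, 7), (3, 7), (2, 2), (2, 2), (3, 3), (2, 2), (3, 3), (3, 3), (1, 2), (3, 3), (3, 2), (3, 2), (3, 2), (2, 1), (3, 2), (3, 1), (2, 0), (1, 0), (0, 0), (5, 23), (6, 23), (7, 23), (6, 2), (6, 2), (7, 3), (6, 2), (7, 3), (7, 3), (5, 2), (7, 3), (7, 2), (7, 2), (7, 2), (6, 1), (7, 2), (7, 1), (6, 0), (5, 0), (4, 0), (3, 40), (0, 44), (1, 44), (2, 44)]"

definition F4_pivots :: "(int \<times> int) list" where
  "F4_pivots = [(6, 8), (8, 10), (0, 9), (0, 19), (5, 7), (7, 9), (0, 10), (0, 20), (6, 10), (0, 7), (1, 17), (0, 5), (8, 9), (1, 15), (6, 9), (1, 13), (0, 22), (6, 7), (0, 24), (3, 6), (0, 26), (3, 8), (1, 11), (3, 10), (0, 4), (3, 9), (3, 7), (3, 5), (5, 9), (0, 8), (1, 18), (0, 6), (7, 10), (1, 16), (5, 10), (1, 14), (0, 21), (5, 8), (0, 23), (4, 5), (0, 25), (4, 7), (1, 12), (4, 9), (0, 3), (4, 10), (4, 8), (4, 6), (3, 3), (5, 5), (7, 7), (9, 9)]"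

lemma F4_chevalley: "chevalley_ok cartan_F4 F4_e F4_f F4_h"
  by code_simp

lemma F4_spans: "spans_ok (F4_e @ F4_f) F4_words F4_pivots"
  by code_simp

lemma F4_cubic: "list_all cubic_ok (F4_e @ F4_f)"
  by code_simp

lemma F4_fixed: "list_all (\<lambda>L. list_equiv (theta_list L) L) (F4_e @ F4_f)"
  by code_simp

definition F4s_e :: "smat list" where
  "F4s_e = [[((6,8),1), ((7,5),-1), ((14,16),1), ((15,13),-1), ((22,24),1), ((23,21),-1)],
     [((8,10),1), ((9,7),-1), ((16,18),1), ((17,15),-1), ((24,26),1), ((25,23),-1)],
     [((0,9),1), ((1,9),-1), ((10,0),-1), ((10,1),1), ((12,25),1), ((13,24),-1), ((15,22),1), ((18,20),1), ((19,17),-1), ((21,16),-1), ((23,14),1), ((26,11),-1)],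
     [((0,19),1), ((2,19),1), ((3,12),1), ((5,13),-1), ((7,15),-1), ((9,17),-1), ((11,4),1), ((14,6),-1), ((16,8),-1), ((18,10),-1), ((20,0),1), ((20,2),1)]]"

definition F4s_f :: "smat list" where
  "F4s_f = [[((5,7),-1), ((8,6),1), ((13,15),-1), ((16,14),1), ((21,23),-1), ((24,22),1)],
     [((7,9),-1), ((10,8),1), ((15,17),-1), ((18,16),1), ((23,25),-1), ((26,24),1)],
     [((0,10),-1), ((1,10),1), ((9,0),1), ((9,1),-1), ((11,26),-1), ((14,23),1), ((16,21),-1), ((17,19),-1), ((20,18),1), ((22,15),1), ((24,13),-1), ((25,12),1)],
     [((0,20),1), ((2,20),1), ((4,11),1), ((6,14),-1), ((8,16),-1), ((10,18),-1), ((12,3),1), ((13,5),-1), ((15,7),-1), ((17,9),-1), ((19,0),1), ((19,2),1)]]"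

definition F4s_h :: "smat list" where
  "F4s_h = [[((5,5),-1), ((6,6),1), ((7,7),1), ((8,8),-1), ((13,13),-1), ((14,14),1), ((15,15),1), ((16,16),-1), ((21,21),-1), ((22,22),1), ((23,23),1), ((24,24),-1)],
     [((7,7),-1), ((8,8),1), ((9,9),1), ((10,10),-1), ((15,15),-1), ((16,16),1), ((17,17),1), ((18,18),-1), ((23,23),-1), ((24,24),1), ((25,25),1), ((26,26),-1)],
     [((9,9),-2), ((10,10),2), ((11,11),-1), ((12,12),1), ((13,13),1), ((14,14),-1), ((15,15),1), ((16,16),-1), ((17,17),-1), ((18,18),1), ((19,19),1), ((20,20),-1), ((21,21),1), ((22,22),-1), ((23,23),1), ((24,24),-1), ((25,25),-1), ((26,26),1)],
     [((3,3),1), ((4,4),-1), ((5,5),1), ((6,6),-1), ((7,7),1), ((8,8),-1), ((9,9),1), ((10,10),-1), ((11,11),1), ((12,12),-1), ((13,13),-1), ((14,14),1), ((15,15),-1), ((16,16),1), ((17,17),-1), ((18,18),1), ((19,19),-2), ((20,20),2)]]"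

definition F4s_words :: "(int \<times> int) list" where
  "F4s_words = [(1, 7), (2, 7), (3, 7), (2, 2), (2, 2), (3, 3), (2, 2), (3, 3), (3, 3), (1, 2), (3, 3), (3, 2), (3, 2), (3, 2), (2, 1), (3, 2), (3, 1), (2, 0), (1, 0), (0, 0), (5, 23), (6, 23), (7, 23), (6, 2), (6, 2), (7, 3), (6, 2), (7, 3), (7, 3), (5, 2), (7, 3), (7, 2), (7, 2), (7, 2), (6, 1), (7, 2), (7, 1), (6, 0), (5, 0), (4, 0), (3, 40), (0, 44), (1, 44), (2, 44)]"

definition F4s_pivots :: "(int \<times> int) list" where
  "F4s_pivots = [(6, 8), (8, 10), (0, 9), (0, 19), (5, 7), (7, 9), (0, 10), (0, 20), (6, 10), (0, 7), (1, 17), (0, 5), (8, 9), (1, 15), (6, 9), (1, 13), (0, 22), (6, 7), (0, 24), (3, 6), (0, 26), (3, 8), (1, 11), (3, 10), (0, 4), (3, 9), (3, 7), (3, 5), (5, 9), (0, 8), (1, 18), (0, 6), (7, 10), (1, 16), (5, 10), (1, 14), (0, 21), (5, 8), (0, 23), (4, 5), (0, 25), (4, 7), (1, 12), (4, 9), (0, 3), (4, 10), (4, 8), (4, 6), (3, 3), (5, 5), (7, 7), (9, 9)]"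

lemma F4s_chevalley: "chevalley_ok cartan_F4 F4s_e F4s_f F4s_h"
  by code_simp

lemma F4s_spans: "spans_ok (F4s_e @ F4s_f) F4s_words F4s_pivots"
  by code_simp

lemma F4s_cubic: "list_all cubic_ok (F4s_e @ F4s_f)"
  by code_simp

lemma F4s_fixed: "list_all (\<lambda>L. list_equiv (theta_list (sign_list sigma_weight L)) L) (F4s_e @ F4s_f)"
  by code_simp

definition C4h_e :: "smat list" where
  "C4h_e = [[((0,9),1), ((1,9),-1), ((10,0),-1), ((10,1),1), ((12,25),1), ((13,24),-1), ((15,22),1), ((18,20),1), ((19,17),-1), ((21,16),-1), ((23,14),1), ((26,11),-1)],
     [((0,19),1), ((2,19),-1), ((3,12),1), ((5,13),-1), ((7,15),-1), ((9,17),-1), ((11,4),-1), ((14,6),1), ((16,8),1), ((18,10),1), ((20,0),-1), ((20,2),1)],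
     [((0,7),1), ((1,7),1), ((8,0),1), ((8,1),1), ((12,23),-1), ((13,26),-1), ((16,20),-1), ((17,22),1), ((19,15),-1), ((21,18),1), ((24,11),-1), ((25,14),-1)],
     [((6,8),1), ((7,5),-1), ((14,16),1), ((15,13),-1), ((22,24),1), ((23,21),-1)]]"

definition C4h_f :: "smat list" where
  "C4h_f = [[((0,10),-1), ((1,10),1), ((9,0),1), ((9,1),-1), ((11,26),-1), ((14,23),1), ((16,21),-1), ((17,19),-1), ((20,18),1), ((22,15),1), ((24,13),-1), ((25,12),1)],
     [((0,20),-1), ((2,20),1), ((4,11),-1), ((6,14),1), ((8,16),1), ((10,18),1), ((12,3),1), ((13,5),-1), ((15,7),-1), ((17,9),-1), ((19,0),1), ((19,2),-1)],
     [((0,8),1), ((1,8),1), ((7,0),1), ((7,1),1), ((11,24),-1), ((14,25),-1), ((15,19),-1), ((18,21),1), ((20,16),-1), ((22,17),1), ((23,12),-1), ((26,13),-1)],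
     [((5,7),-1), ((8,6),1), ((13,15),-1), ((16,14),1), ((21,23),-1), ((24,22),1)]]"

definition C4h_h :: "smat list" where
  "C4h_h = [[((9,9),-2), ((10,10),2), ((11,11),-1), ((12,12),1), ((13,13),1), ((14,14),-1), ((15,15),1), ((16,16),-1), ((17,17),-1), ((18,18),1), ((19,19),1), ((20,20),-1), ((21,21),1), ((22,22),-1), ((23,23),1), ((24,24),-1), ((25,25),-1), ((26,26),1)],
     [((3,3),1), ((4,4),-1), ((5,5),1), ((6,6),-1), ((7,7),1), ((8,8),-1), ((9,9),1), ((10,10),-1), ((11,11),1), ((12,12),-1), ((13,13),-1), ((14,14),1), ((15,15),-1), ((16,16),1), ((17,17),-1), ((18,18),1), ((19,19),-2), ((20,20),2)],
     [((7,7),-2), ((8,8),2), ((11,11),-1), ((12,12),1), ((13,13),1), ((14,14),-1), ((15,15),-1), ((16,16),1), ((17,17),1), ((18,18),-1), ((19,19),1), ((20,20),-1), ((21,21),1), ((22,22),-1), ((23,23),-1), ((24,24),1), ((25,25),1), ((26,26),-1)],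
     [((5,5),-1), ((6,6),1), ((7,7),1), ((8,8),-1), ((13,13),-1), ((14,14),1), ((15,15),1), ((16,16),-1), ((21,21),-1), ((22,22),1), ((23,23),1), ((24,24),-1)]]"

definition C4h_words :: "(int \<times> int) list" where
  "C4h_words = [(1, 7), (2, 7), (3, 7), (2, 2), (3, 2), (2, 2), (3, 2), (2, 2), (2, 1), (1, 1), (1, 1), (0, 0), (5, 15), (6, 15), (7, 15), (6, 2), (7, 2), (6, 2), (7, 2), (6, 2), (6, 1), (5, 1), (5, 1), (4, 0), (1, 26), (0, 28), (2, 27), (3, 27)]"

definition C4h_pivots :: "(int \<times> int) list" where
  "C4h_pivots = [(0, 9), (0, 19), (0, 7), (6, 8), (0, 10), (0, 20), (0, 8), (5, 7), (1, 17), (1, 15), (0, 5), (0, 22), (1, 13), (6, 7), (0, 24), (0, 26), (1, 11), (3, 10), (0, 4), (3, 9), (1, 18), (1, 16), (0, 6), (0, 21), (1, 14), (5, 8), (0, 23), (0, 25), (1, 12), (4, 9), (0, 3), (4, 10), (3, 3), (9, 9), (11, 11), (5, 5)]"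

lemma C4h_chevalley: "chevalley_ok cartan_C4 C4h_e C4h_f C4h_h"
  by code_simp

lemma C4h_spans: "spans_ok (C4h_e @ C4h_f) C4h_words C4h_pivots"
  by code_simp

lemma C4h_cubic: "list_all cubic_ok (C4h_e @ C4h_f)"
  by code_simp

lemma C4h_fixed: "list_all (\<lambda>L. list_equiv (theta_list (sign_list flip_weight L)) L) (C4h_e @ C4h_f)"
  by code_simp

definition C4hs_e :: "smat list" where
  "C4hs_e = [[((0,9),1), ((1,9),-1), ((10,0),-1), ((10,1),1), ((12,25),1), ((13,24),-1), ((15,22),1), ((18,20),1), ((19,17),-1), ((21,16),-1), ((23,14),1), ((26,11),-1)],
     [((0,19),1), ((2,19),1), ((3,12),1), ((5,13),-1), ((7,15),-1), ((9,17),-1), ((11,4),1), ((14,6),-1), ((16,8),-1), ((18,10),-1), ((20,0),1), ((20,2),1)],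
     [((0,7),1), ((1,7),1), ((8,0),1), ((8,1),1), ((12,23),-1), ((13,26),-1), ((16,20),-1), ((17,22),1), ((19,15),-1), ((21,18),1), ((24,11),-1), ((25,14),-1)],
     [((6,8),1), ((7,5),-1), ((14,16),1), ((15,13),-1), ((22,24),1), ((23,21),-1)]]"

definition C4hs_f :: "smat list" where
  "C4hs_f = [[((0,10),-1), ((1,10),1), ((9,0),1), ((9,1),-1), ((11,26),-1), ((14,23),1), ((16,21),-1), ((17,19),-1), ((20,18),1), ((22,15),1), ((24,13),-1), ((25,12),1)],
     [((0,20),1), ((2,20),1), ((4,11),1), ((6,14),-1), ((8,16),-1), ((10,18),-1), ((12,3),1), ((13,5),-1), ((15,7),-1), ((17,9),-1), ((19,0),1), ((19,2),1)],
     [((0,8),1), ((1,8),1), ((7,0),1), ((7,1),1), ((11,24),-1), ((14,25),-1), ((15,19),-1), ((18,21),1), ((20,16),-1), ((22,17),1), ((23,12),-1), ((26,13),-1)],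
     [((5,7),-1), ((8,6),1), ((13,15),-1), ((16,14),1), ((21,23),-1), ((24,22),1)]]"

definition C4hs_h :: "smat list" where
  "C4hs_h = [[((9,9),-2), ((10,10),2), ((11,11),-1), ((12,12),1), ((13,13),1), ((14,14),-1), ((15,15),1), ((16,16),-1), ((17,17),-1), ((18,18),1), ((19,19),1), ((20,20),-1), ((21,21),1), ((22,22),-1), ((23,23),1), ((24,24),-1), ((25,25),-1), ((26,26),1)],
     [((3,3),1), ((4,4),-1), ((5,5),1), ((6,6),-1), ((7,7),1), ((8,8),-1), ((9,9),1), ((10,10),-1), ((11,11),1), ((12,12),-1), ((13,13),-1), ((14,14),1), ((15,15),-1), ((16,16),1), ((17,17),-1), ((18,18),1), ((19,19),-2), ((20,20),2)],
     [((7,7),-2), ((8,8),2), ((11,11),-1), ((12,12),1), ((13,13),1), ((14,14),-1), ((15,15),-1), ((16,16),1), ((17,17),1), ((18,18),-1), ((19,19),1), ((20,20),-1), ((21,21),1), ((22,22),-1), ((23,23),-1), ((24,24),1), ((25,25),1), ((26,26),-1)],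
     [((5,5),-1), ((6,6),1), ((7,7),1), ((8,8),-1), ((13,13),-1), ((14,14),1), ((15,15),1), ((16,16),-1), ((21,21),-1), ((22,22),1), ((23,23),1), ((24,24),-1)]]"

definition C4hs_words :: "(int \<times> int) list" where
  "C4hs_words = [(1, 7), (2, 7), (3, 7), (2, 2), (3, 2), (2, 2), (3, 2), (2, 2), (2, 1), (1, 1), (1, 1), (0, 0), (5, 15), (6, 15), (7, 15), (6, 2), (7, 2), (6, 2), (7, 2), (6, 2), (6, 1), (5, 1), (5, 1), (4, 0), (1, 26), (0, 28), (2, 27), (3, 27)]"

definition C4hs_pivots :: "(int \<times> int) list" where
  "C4hs_pivots = [(0, 9), (0, 19), (0, 7), (6, 8), (0, 10), (0, 20), (0, 8), (5, 7), (1, 17), (1, 15), (0, 5), (0, 22), (1, 13), (6, 7), (0, 24), (0, 26), (1, 11), (3, 10), (0, 4), (3, 9), (1, 18), (1, 16), (0, 6), (0, 21), (1, 14), (5, 8), (0, 23), (0, 25), (1, 12), (4, 9), (0, 3), (4, 10), (3, 3), (9, 9), (11, 11), (5, 5)]"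

lemma C4hs_chevalley: "chevalley_ok cartan_C4 C4hs_e C4hs_f C4hs_h"
  by code_simp

lemma C4hs_spans: "spans_ok (C4hs_e @ C4hs_f) C4hs_words C4hs_pivots"
  by code_simp

lemma C4hs_cubic: "list_all cubic_ok (C4hs_e @ C4hs_f)"
  by code_simp

lemma C4hs_fixed: "list_all (\<lambda>L. list_equiv (theta_list (sign_list sigma_weight (sign_list flip_weight L))) L) (C4hs_e @ C4hs_f)"
  by code_simp

definition A5h_e :: "smat list" where
  "A5h_e = [[((1,9),1), ((10,0),1), ((12,25),-1), ((13,24),1), ((15,22),-1), ((18,20),-1)],
     [((0,4),1), ((3,1),1), ((20,11),1), ((21,13),-1), ((23,15),-1), ((25,17),-1)],
     [((1,10),1), ((9,0),1), ((11,26),-1), ((14,23),1), ((16,21),-1), ((17,19),-1)],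
     [((0,25),1), ((4,17),-1), ((5,16),1), ((7,14),-1), ((10,12),-1), ((26,2),1)],
     [((6,7),1), ((8,5),-1), ((12,18),-1), ((17,11),1), ((19,26),1), ((25,20),-1)]]"

definition A5h_f :: "smat list" where
  "A5h_f = [[((0,10),1), ((9,1),1), ((20,18),-1), ((22,15),-1), ((24,13),1), ((25,12),-1)],
     [((1,3),1), ((4,0),1), ((11,20),1), ((13,21),-1), ((15,23),-1), ((17,25),-1)],
     [((0,9),1), ((10,1),1), ((19,17),-1), ((21,16),-1), ((23,14),1), ((26,11),-1)],
     [((2,26),1), ((12,10),-1), ((14,7),-1), ((16,5),1), ((17,4),-1), ((25,0),1)],
     [((5,8),-1), ((7,6),1), ((11,17),1), ((18,12),-1), ((20,25),-1), ((26,19),1)]]"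

definition A5h_h :: "smat list" where
  "A5h_h = [[((0,0),-1), ((1,1),1), ((9,9),-1), ((10,10),1), ((12,12),1), ((13,13),1), ((15,15),1), ((18,18),1), ((20,20),-1), ((22,22),-1), ((24,24),-1), ((25,25),-1)],
     [((0,0),1), ((1,1),-1), ((3,3),1), ((4,4),-1), ((11,11),-1), ((13,13),-1), ((15,15),-1), ((17,17),-1), ((20,20),1), ((21,21),1), ((23,23),1), ((25,25),1)],
     [((0,0),-1), ((1,1),1), ((9,9),1), ((10,10),-1), ((11,11),1), ((14,14),1), ((16,16),1), ((17,17),1), ((19,19),-1), ((21,21),-1), ((23,23),-1), ((26,26),-1)],
     [((0,0),1), ((2,2),-1), ((4,4),1), ((5,5),1), ((7,7),1), ((10,10),1), ((12,12),-1), ((14,14),-1), ((16,16),-1), ((17,17),-1), ((25,25),-1), ((26,26),1)],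
     [((5,5),-1), ((6,6),1), ((7,7),-1), ((8,8),1), ((11,11),-1), ((12,12),1), ((17,17),1), ((18,18),-1), ((19,19),1), ((20,20),-1), ((25,25),1), ((26,26),-1)]]"

definition A5h_words :: "(int \<times> int) list" where
  "A5h_words = [(1, 9), (2, 9), (3, 9), (4, 9), (2, 3), (3, 3), (4, 3), (3, 2), (4, 2), (4, 1), (6, 14), (7, 14), (8, 14), (9, 14), (7, 3), (8, 3), (9, 3), (8, 2), (9, 2), (9, 1), (0, 24), (1, 24), (2, 24), (3, 24), (4, 24)]"

definition A5h_pivots :: "(int \<times> int) list" where
  "A5h_pivots = [(1, 9), (0, 4), (1, 10), (0, 25), (6, 7), (0, 10), (1, 3), (0, 9), (2, 26), (5, 8), (3, 9), (3, 10), (1, 12), (0, 20), (1, 4), (0, 19), (1, 18), (1, 17), (0, 26), (1, 11), (4, 10), (4, 9), (2, 11), (2, 19), (0, 3), (2, 20), (2, 17), (2, 18), (2, 25), (2, 12), (22, 22), (3, 3), (1, 1), (0, 0), (5, 5)]"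

lemma A5h_chevalley: "chevalley_ok cartan_A5 A5h_e A5h_f A5h_h"
  by code_simp

lemma A5h_spans: "spans_ok (A5h_e @ A5h_f) A5h_words A5h_pivots"
  by code_simp

lemma A5h_cubic: "list_all cubic_ok (A5h_e @ A5h_f)"
  by code_simp

lemma A5h_fixed: "list_all (\<lambda>L. list_equiv (sign_list flip_weight L) L) (A5h_e @ A5h_f)"
  by code_simp

definition A5hs_e :: "smat list" where
  "A5hs_e = [[((1,10),1), ((9,0),1), ((11,26),-1), ((14,23),1), ((16,21),-1), ((17,19),-1)],
     [((0,4),1), ((3,1),1), ((20,11),1), ((21,13),-1), ((23,15),-1), ((25,17),-1)],
     [((1,9),1), ((10,0),1), ((12,25),-1), ((13,24),1), ((15,22),-1), ((18,20),-1)],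
     [((0,23),1), ((4,15),-1), ((5,18),-1), ((8,12),-1), ((9,14),1), ((24,2),1)],
     [((6,8),1), ((7,5),-1), ((14,16),1), ((15,13),-1), ((22,24),1), ((23,21),-1)]]"

definition A5hs_f :: "smat list" where
  "A5hs_f = [[((0,9),1), ((10,1),1), ((19,17),-1), ((21,16),-1), ((23,14),1), ((26,11),-1)],
     [((1,3),1), ((4,0),1), ((11,20),1), ((13,21),-1), ((15,23),-1), ((17,25),-1)],
     [((0,10),1), ((9,1),1), ((20,18),-1), ((22,15),-1), ((24,13),1), ((25,12),-1)],
     [((2,24),1), ((12,8),-1), ((14,9),1), ((15,4),-1), ((18,5),-1), ((23,0),1)],
     [((5,7),-1), ((8,6),1), ((13,15),-1), ((16,14),1), ((21,23),-1), ((24,22),1)]]"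

definition A5hs_h :: "smat list" where
  "A5hs_h = [[((0,0),-1), ((1,1),1), ((9,9),1), ((10,10),-1), ((11,11),1), ((14,14),1), ((16,16),1), ((17,17),1), ((19,19),-1), ((21,21),-1), ((23,23),-1), ((26,26),-1)],
     [((0,0),1), ((1,1),-1), ((3,3),1), ((4,4),-1), ((11,11),-1), ((13,13),-1), ((15,15),-1), ((17,17),-1), ((20,20),1), ((21,21),1), ((23,23),1), ((25,25),1)],
     [((0,0),-1), ((1,1),1), ((9,9),-1), ((10,10),1), ((12,12),1), ((13,13),1), ((15,15),1), ((18,18),1), ((20,20),-1), ((22,22),-1), ((24,24),-1), ((25,25),-1)],
     [((0,0),1), ((2,2),-1), ((4,4),1), ((5,5),1), ((8,8),1), ((9,9),1), ((12,12),-1), ((14,14),-1), ((15,15),-1), ((18,18),-1), ((23,23),-1), ((24,24),1)],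
     [((5,5),-1), ((6,6),1), ((7,7),1), ((8,8),-1), ((13,13),-1), ((14,14),1), ((15,15),1), ((16,16),-1), ((21,21),-1), ((22,22),1), ((23,23),1), ((24,24),-1)]]"

definition A5hs_words :: "(int \<times> int) list" where
  "A5hs_words = [(1, 9), (2, 9), (3, 9), (4, 9), (2, 3), (3, 3), (4, 3), (3, 2), (4, 2), (4, 1), (6, 14), (7, 14), (8, 14), (9, 14), (7, 3), (8, 3), (9, 3), (8, 2), (9, 2), (9, 1), (0, 24), (1, 24), (2, 24), (3, 24), (4, 24)]"

definition A5hs_pivots :: "(int \<times> int) list" where
  "A5hs_pivots = [(1, 10), (0, 4), (1, 9), (0, 23), (6, 8), (0, 9), (1, 3), (0, 10), (2, 24), (5, 7), (3, 10), (3, 9), (1, 14), (0, 21), (1, 4), (0, 22), (1, 16), (1, 15), (0, 24), (1, 13), (4, 9), (4, 10), (2, 13), (2, 22), (0, 3), (2, 21), (2, 15), (2, 16), (2, 23), (2, 14), (19, 19), (3, 3), (1, 1), (0, 0), (5, 5)]"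

lemma A5hs_chevalley: "chevalley_ok cartan_A5 A5hs_e A5hs_f A5hs_h"
  by code_simp

lemma A5hs_spans: "spans_ok (A5hs_e @ A5hs_f) A5hs_words A5hs_pivots"
  by code_simp

lemma A5hs_cubic: "list_all cubic_ok (A5hs_e @ A5hs_f)"
  by code_simp

lemma A5hs_fixed: "list_all (\<lambda>L. list_equiv (sign_list sigma_weight (sign_list flip_weight L)) L) (A5hs_e @ A5hs_f)"
  by code_simp

definition A1h_e :: "smat list" where
  "A1h_e = [[((6,8),1), ((7,5),-1), ((14,16),1), ((15,13),-1), ((22,24),1), ((23,21),-1)]]"

definition A1h_f :: "smat list" where
  "A1h_f = [[((5,7),-1), ((8,6),1), ((13,15),-1), ((16,14),1), ((21,23),-1), ((24,22),1)]]"

definition A1h_h :: "smat list" where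
  "A1h_h = [[((5,5),-1), ((6,6),1), ((7,7),1), ((8,8),-1), ((13,13),-1), ((14,14),1), ((15,15),1), ((16,16),-1), ((21,21),-1), ((22,22),1), ((23,23),1), ((24,24),-1)]]"

definition A1h_words :: "(int \<times> int) list" where
  "A1h_words = [(0, 0)]"

definition A1h_pivots :: "(int \<times> int) list" where
  "A1h_pivots = [(6, 8), (5, 7), (5, 5)]"

lemma A1h_chevalley: "chevalley_ok cartan_A1 A1h_e A1h_f A1h_h"
  by code_simp

lemma A1h_spans: "spans_ok (A1h_e @ A1h_f) A1h_words A1h_pivots"
  by code_simp

lemma A1h_cubic: "list_all cubic_ok (A1h_e @ A1h_f)"
  by code_simp

definition A1hs_e :: "smat list" where
  "A1hs_e = [[((6,7),1), ((8,5),-1), ((12,18),-1), ((17,11),1), ((19,26),1), ((25,20),-1)]]"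

definition A1hs_f :: "smat list" where
  "A1hs_f = [[((5,8),-1), ((7,6),1), ((11,17),1), ((18,12),-1), ((20,25),-1), ((26,19),1)]]"

definition A1hs_h :: "smat list" where
  "A1hs_h = [[((5,5),-1), ((6,6),1), ((7,7),-1), ((8,8),1), ((11,11),-1), ((12,12),1), ((17,17),1), ((18,18),-1), ((19,19),1), ((20,20),-1), ((25,25),1), ((26,26),-1)]]"

definition A1hs_words :: "(int \<times> int) list" where
  "A1hs_words = [(0, 0)]"

definition A1hs_pivots :: "(int \<times> int) list" where
  "A1hs_pivots = [(6, 7), (5, 8), (5, 5)]"

lemma A1hs_chevalley: "chevalley_ok cartan_A1 A1hs_e A1hs_f A1hs_h"
  by code_simp

lemma A1hs_spans: "spans_ok (A1hs_e @ A1hs_f) A1hs_words A1hs_pivots"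
  by code_simp

lemma A1hs_cubic: "list_all cubic_ok (A1hs_e @ A1hs_f)"
  by code_simp

lemma A5h_commute: "list_all (\<lambda>L. list_all (\<lambda>M. smat_bracket M L = []) (A1h_e @ A1h_f)) (A5h_e @ A5h_f)"
  by code_simp

lemma A5hs_commute: "list_all (\<lambda>L. list_all (\<lambda>M. smat_bracket M L = []) (A1hs_e @ A1hs_f)) (A5hs_e @ A5hs_f)"
  by code_simp

section \<open>Weight vectors of the complexified representation\<close>

text \<open>Pairing \<open>1\<close> with \<open>l\<close>, \<open>i\<close> with \<open>il\<close> and so on gives a basis of isotropic vectors
  \<open>(u \<plusminus> \<surd>(-1) v) / 2\<close> of the complexified octonions, in which the roots are sparse.\<close>

definition planes :: "(oct \<times> oct) list" where
  "planes = [(oreal 1, ounit Ul), (ounit Ui, ounit Uil), (ounit Uj, ounit Ujl), (ounit Uk, ounit Ukl)]"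

definition slot_part :: "int \<Rightarrow> h3o \<Rightarrow> oct" where
  "slot_part s x = (if s = 0 then ha x else if s = 1 then hb x else hc x)"
definition slot_vec :: "int \<Rightarrow> oct \<Rightarrow> h3o" where
  "slot_vec s a = (if s = 0 then ea a else if s = 1 then eb a else ec a)"
definition plane_of :: "int \<Rightarrow> oct \<times> oct" where "plane_of k = planes ! nat ((k - 3) mod 8 div 2)"
definition side :: "int \<Rightarrow> real" where "side k = (if k mod 2 = 1 then 1 else -1)"

definition wcoord :: "int \<Rightarrow> h3o \<Rightarrow> complex" where
  "wcoord k x = (if k = 0 then of_real (hp x) else if k = 1 then of_real (hm x) else if k = 2 then of_real (hn x)
     else Complex (fst (plane_of k) \<bullet> slot_part ((k - 3) div 8) x) (- side k * (snd (plane_of k) \<bullet> slot_part ((k - 3) div 8) x)))"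

definition wvec :: "int \<Rightarrow> h3o \<times> h3o" where
  "wvec k = (if k = 0 then (e1, 0) else if k = 1 then (e2, 0) else if k = 2 then (e3, 0)
     else (slot_vec ((k - 3) div 8) ((1/2) *\<^sub>R fst (plane_of k)), slot_vec ((k - 3) div 8) ((side k / 2) *\<^sub>R snd (plane_of k))))"

lemmas wcoord_nums = wcoord_def[of 0] wcoord_def[of 1] wcoord_def[of 2] wcoord_def[of 3] wcoord_def[of 4] wcoord_def[of 5] wcoord_def[of 6] wcoord_def[of 7] wcoord_def[of 8] wcoord_def[of 9] wcoord_def[of 10] wcoord_def[of 11] wcoord_def[of 12] wcoord_def[of 13] wcoord_def[of 14] wcoord_def[of 15] wcoord_def[of 16] wcoord_def[of 17] wcoord_def[of 18] wcoord_def[of 19] wcoord_def[of 20] wcoord_def[of 21] wcoord_def[of 22] wcoord_def[of 23] wcoord_def[of 24] wcoord_def[of 25] wcoord_def[of 26]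
lemmas wvec_nums = wvec_def[of 0] wvec_def[of 1] wvec_def[of 2] wvec_def[of 3] wvec_def[of 4] wvec_def[of 5] wvec_def[of 6] wvec_def[of 7] wvec_def[of 8] wvec_def[of 9] wvec_def[of 10] wvec_def[of 11] wvec_def[of 12] wvec_def[of 13] wvec_def[of 14] wvec_def[of 15] wvec_def[of 16] wvec_def[of 17] wvec_def[of 18] wvec_def[of 19] wvec_def[of 20] wvec_def[of 21] wvec_def[of 22] wvec_def[of 23] wvec_def[of 24] wvec_def[of 25] wvec_def[of 26]
lemmas wcoord_simps = wcoord_nums[unfolded plane_of_def planes_def side_def slot_part_def, simplified, simplified inner_ounit, simplified]
lemmas wvec_simps = wvec_nums[unfolded plane_of_def planes_def side_def slot_vec_def, simplified]

definition wC :: "int \<Rightarrow> h3o \<times> h3o \<Rightarrow> complex" where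
  "wC k v = wcoord k (fst v) + \<i> * wcoord k (snd v)"

definition in_idx :: "int \<Rightarrow> bool" where "in_idx k \<longleftrightarrow> 0 \<le> k \<and> k < 27"

lemma all_idx: "(\<forall>k. in_idx k \<longrightarrow> P k) \<longleftrightarrow> P 0 \<and> P 1 \<and> P 2 \<and> P 3 \<and> P 4 \<and> P 5 \<and> P 6 \<and> P 7 \<and> P 8 \<and> P 9 \<and> P 10 \<and> P 11 \<and> P 12 \<and> P 13 \<and> P 14 \<and> P 15 \<and> P 16 \<and> P 17 \<and> P 18 \<and> P 19 \<and> P 20 \<and> P 21 \<and> P 22 \<and> P 23 \<and> P 24 \<and> P 25 \<and> P 26"
proof -
  have eq: "in_idx k \<longleftrightarrow> k \<in> set [0..26]" for k by (auto simp: in_idx_def)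
  have l: "[0..26] = [0,1,2,3,4,5,6,7,8,9,10,11,12,13,14,15,16,17,18,19,20,21,22,23,24,25,26::int]" by (simp add: upto_rec1)
  have b: "(\<forall>k. k \<in> S \<longrightarrow> P k) \<longleftrightarrow> (\<forall>k\<in>S. P k)" for S by blast
  show ?thesis unfolding eq l b by simp
qed

lemma wC_wvec_all: "\<forall>j. in_idx j \<longrightarrow> (\<forall>k. in_idx k \<longrightarrow> wC k (wvec j) = (if k = j then 1 else 0))"
  unfolding all_idx wC_def
  by (simp only: wcoord_simps wvec_simps) (simp add: oct_comp complex_eq_iff)

lemma wC_wvec: "in_idx j \<Longrightarrow> in_idx k \<Longrightarrow> wC k (wvec j) = (if k = j then 1 else 0)"
  using wC_wvec_all by blast

lemma wcoord_linear: "linear (wcoord k)"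
  unfolding linear_iff wcoord_def slot_part_def
  by (intro conjI allI; simp add: inner_add_right complex_eq_iff algebra_simps)

lemmas wcoord_lin = linear_add[OF wcoord_linear] linear_diff[OF wcoord_linear] linear_scale[OF wcoord_linear]
  linear_0[OF wcoord_linear] linear_neg[OF wcoord_linear]

definition cscale :: "complex \<Rightarrow> 'a::real_vector \<times> 'a \<Rightarrow> 'a \<times> 'a" where
  "cscale z v = (Re z *\<^sub>R fst v - Im z *\<^sub>R snd v, Re z *\<^sub>R snd v + Im z *\<^sub>R fst v)"

lemma cscale_simps: "cscale (y + z) v = cscale y v + cscale z v" "cscale (r *\<^sub>R z) v = r *\<^sub>R cscale z v"
  "cscale 0 v = 0" "cscale 1 v = v"
  by (simp_all add: cscale_def prod_eq_iff algebra_simps)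

lemma wC_simps: "wC k (v + w) = wC k v + wC k w" "wC k (v - w) = wC k v - wC k w" "wC k (r *\<^sub>R v) = r *\<^sub>R wC k v"
  "wC k 0 = 0" "wC k (cscale z v) = z * wC k v"
  by (simp_all add: wC_def cscale_def wcoord_lin complex_eq_iff algebra_simps)

definition cact :: "h3o cend \<Rightarrow> h3o \<times> h3o \<Rightarrow> h3o \<times> h3o" where
  "cact Z v = (fst Z (fst v) - snd Z (snd v), fst Z (snd v) + snd Z (fst v))"

lemma cact_simps: "cact (Z + W) v = cact Z v + cact W v" "cact (Z - W) v = cact Z v - cact W v" "cact (r *\<^sub>R Z) v = r *\<^sub>R cact Z v" "cact 0 v = 0"
  "cact Z (v + w) = cact Z v + cact Z w" "cact Z (v - w) = cact Z v - cact Z w" "cact Z (r *\<^sub>R v) = r *\<^sub>R cact Z v" "cact Z 0 = 0"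
  by (simp_all add: cact_def prod_eq_iff blinfun.bilinear_simps algebra_simps)

lemma cact_eqI: "(\<And>v. cact Z v = cact W v) \<Longrightarrow> Z = W"
proof -
  assume a: "\<And>v. cact Z v = cact W v"
  have "fst Z x = fst W x \<and> snd Z x = snd W x" for x
    using a[of "(x, 0)"] by (simp add: cact_def blinfun.bilinear_simps)
  then show "Z = W" by (simp add: prod_eq_iff blinfun_eqI)
qed

definition ccomp :: "h3o cend \<Rightarrow> h3o cend \<Rightarrow> h3o cend" where
  "ccomp Z W = ((fst Z o\<^sub>L fst W) - (snd Z o\<^sub>L snd W), (fst Z o\<^sub>L snd W) + (snd Z o\<^sub>L fst W))"

lemma cact_ccomp: "cact (ccomp Z W) v = cact Z (cact W v)"
  by (simp add: ccomp_def cact_def blinfun.bilinear_simps algebra_simps)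

lemma ccomp_simps: "ccomp (Z + W) V = ccomp Z V + ccomp W V" "ccomp V (Z + W) = ccomp V Z + ccomp V W"
  "ccomp (r *\<^sub>R Z) V = r *\<^sub>R ccomp Z V" "ccomp V (r *\<^sub>R Z) = r *\<^sub>R ccomp V Z" "ccomp 0 V = 0" "ccomp V 0 = 0"
  by (rule cact_eqI; simp add: cact_ccomp cact_simps)+

lemma cbracket_ccomp: "cbracket Z W = ccomp Z W - ccomp W Z"
  by (simp add: cbracket_def ccomp_def commutator_def algebra_simps)

text \<open>The matrix unit at row \<open>j\<close> and column \<open>k\<close> with respect to the weight basis.\<close>

definition EU :: "int \<Rightarrow> int \<Rightarrow> h3o cend" where
  "EU j k = (Blinfun (\<lambda>x. fst (cscale (wcoord k x) (wvec j))), Blinfun (\<lambda>x. snd (cscale (wcoord k x) (wvec j))))"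

lemma EU_apply: "blinfun_apply (fst (EU j k)) x = fst (cscale (wcoord k x) (wvec j))"
  "blinfun_apply (snd (EU j k)) x = snd (cscale (wcoord k x) (wvec j))"
proof -
  have "linear (\<lambda>x. fst (cscale (wcoord k x) (wvec j)))" "linear (\<lambda>x. snd (cscale (wcoord k x) (wvec j)))"
    by (simp_all add: linear_iff wcoord_lin cscale_simps)
  then show "blinfun_apply (fst (EU j k)) x = fst (cscale (wcoord k x) (wvec j))"
    "blinfun_apply (snd (EU j k)) x = snd (cscale (wcoord k x) (wvec j))"
    by (simp_all add: EU_def Blinfun_linear_apply)
qed

lemma cact_EU: "cact (EU j k) v = cscale (wC k v) (wvec j)"
  by (simp add: cact_def EU_apply cscale_def wC_def prod_eq_iff algebra_simps)

lemma ccomp_EU: "in_idx k \<Longrightarrow> in_idx l \<Longrightarrow> ccomp (EU j k) (EU l m) = (if k = l then EU j m else 0)"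
  by (rule cact_eqI) (simp add: cact_ccomp cact_EU wC_simps wC_wvec cact_simps cscale_simps)

section \<open>Operators given by sparse matrices\<close>

fun list_val :: "('k \<Rightarrow> 'a::real_vector) \<Rightarrow> ('k \<times> int) list \<Rightarrow> 'a" where
  "list_val f [] = 0"
| "list_val f ((k, c) # L) = real_of_int c *\<^sub>R f k + list_val f L"

lemma list_val_append: "list_val f (L @ M) = list_val f L + list_val f M"
  by (induction L) auto

lemma list_val_add_entry: "list_val f (add_entry k c L) = real_of_int c *\<^sub>R f k + list_val f L"
  by (induction k c L rule: add_entry.induct) (auto simp: algebra_simps)

lemma list_val_filter: "list_val f (filter (\<lambda>(k, c). c \<noteq> 0) L) = list_val f L"
  by (induction L) auto

lemma list_val_zero: "list_all (\<lambda>(k, c). c = 0) L \<Longrightarrow> list_val f L = 0"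
  by (induction L) auto

lemma list_val_neg: "list_val f (neg_list L) = - list_val f L"
  by (induction L) (auto simp: neg_list_def)

lemma list_val_collect: "list_val f (collect L) = list_val f L"
proof -
  have "list_val f (foldr (\<lambda>(k, c). add_entry k c) L []) = list_val f L"
    by (induction L) (auto simp: list_val_add_entry)
  then show ?thesis by (simp add: collect_def list_val_filter)
qed

lemma list_val_equiv: "list_equiv L M \<Longrightarrow> list_val f L = list_val f M"
  using list_val_collect[of f "L @ neg_list M"] by (simp add: list_equiv_def list_val_append list_val_neg)

lemma list_val_scale: "list_val f (smat_scale r L) = real_of_int r *\<^sub>R list_val f L"
  by (induction L) (auto simp: smat_scale_def algebra_simps)

abbreviation op_of :: "smat \<Rightarrow> h3o cend" where "op_of \<equiv> list_val (case_prod EU)"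

definition in_range :: "smat \<Rightarrow> bool" where
  "in_range L \<longleftrightarrow> list_all (\<lambda>((i, j), c). in_idx i \<and> in_idx j) L"

lemma in_range_simps: "in_range []" "in_range (((i, j), c) # L) \<longleftrightarrow> in_idx i \<and> in_idx j \<and> in_range L"
  by (simp_all add: in_range_def)

lemma in_range_add_entry: "in_idx i \<Longrightarrow> in_idx j \<Longrightarrow> in_range L \<Longrightarrow> in_range (add_entry (i, j) c L)"
proof (induction L)
  case (Cons x L)
  obtain k l d where "x = ((k, l), d)" by (metis prod.collapse)
  then show ?case using Cons by (auto simp: in_range_simps)
qed (simp add: in_range_simps)

lemma row_times_val:
  assumes "in_idx i" "in_idx j" "in_range M"
  shows "op_of (row_times i j a M acc) = op_of acc + real_of_int a *\<^sub>R ccomp (EU i j) (op_of M)"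
    "in_range acc \<Longrightarrow> in_range (row_times i j a M acc)"
  using assms
  by (induction i j a M acc rule: row_times.induct)
     (auto simp: in_range_simps list_val_add_entry ccomp_simps ccomp_EU in_range_add_entry algebra_simps)

lemma add_product_val:
  assumes "in_range L" "in_range M"
  shows "op_of (add_product r L M acc) = op_of acc + real_of_int r *\<^sub>R ccomp (op_of L) (op_of M)"
    "in_range acc \<Longrightarrow> in_range (add_product r L M acc)"
  using assms
  by (induction r L M acc rule: add_product.induct)
     (auto simp: in_range_simps row_times_val ccomp_simps algebra_simps)

lemma smat_bracket_val:
  assumes "in_range L" "in_range M"
  shows "op_of (smat_bracket L M) = cbracket (op_of L) (op_of M)" "in_range (smat_bracket L M)"
proof -
  show "op_of (smat_bracket L M) = cbracket (op_of L) (op_of M)"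
    unfolding smat_bracket_def list_val_filter using assms by (simp add: add_product_val cbracket_ccomp)
  have "in_range (add_product (-1) M L (add_product 1 L M []))" using assms by (simp add: add_product_val in_range_simps)
  then show "in_range (smat_bracket L M)" unfolding smat_bracket_def in_range_def by (auto simp: list_all_iff)
qed

text \<open>Matrix entries are complex-linear functionals, which certify linear independence.\<close>

definition mat_entry :: "int \<times> int \<Rightarrow> h3o cend \<Rightarrow> complex" where
  "mat_entry p Z = wC (fst p) (cact Z (wvec (snd p)))"

lemma mat_entry_linear: "linear (mat_entry p)"
  by (simp add: linear_iff mat_entry_def cact_simps wC_simps)

lemma mat_entry_imul: "mat_entry p (imul Z) = \<i> * mat_entry p Z"
proof -
  have "cact (imul Z) v = cscale \<i> (cact Z v)" for v
    by (simp add: imul_def cact_def cscale_def blinfun.bilinear_simps)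
  then show ?thesis by (simp add: mat_entry_def wC_simps)
qed

lemma mat_entry_op:
  assumes "in_range L" "in_idx (fst p)" "in_idx (snd p)"
  shows "mat_entry p (op_of L) = of_int (entry L p)"
  using assms(1)
proof (induction L)
  case Nil
  then show ?case by (simp add: linear_0[OF mat_entry_linear])
next
  case (Cons x L)
  obtain k l d where x: "x = ((k, l), d)" by (metis prod.collapse)
  have "mat_entry p (EU k l) = (if (k, l) = p then 1 else 0)"
    using Cons.prems assms(2,3) unfolding x
    by (cases p) (auto simp: in_range_simps mat_entry_def cact_EU wC_simps wC_wvec)
  then show ?case using Cons unfolding x
    by (auto simp: in_range_simps linear_add[OF mat_entry_linear] linear_scale[OF mat_entry_linear] scaleR_conv_of_real)
qed

lemma entry_in_range: "in_range L \<Longrightarrow> entry L p \<noteq> 0 \<Longrightarrow> in_idx (fst p) \<and> in_idx (snd p)"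
  by (induction L p rule: entry.induct) (auto simp: in_range_def split: if_splits)

definition complex_gens :: "smat list \<Rightarrow> h3o cend set" where
  "complex_gens Ms = op_of ` set Ms \<union> imul ` op_of ` set Ms"

lemma echelon_length: "echelon Ms ps \<Longrightarrow> length Ms = length ps"
  by (induction Ms ps rule: echelon.induct) auto

lemma echelon_independent:
  assumes "echelon Ms ps" "list_all in_range Ms"
  shows "independent (complex_gens Ms) \<and> card (complex_gens Ms) = 2 * length Ms"
  using assms
proof (induction Ms ps rule: echelon.induct)
  case (1 ps)
  show ?case by (simp add: complex_gens_def independent_empty)
next
  case (2 M Ms)
  then show ?case by simp
next
  case (3 M Ms p ps)
  have IH: "independent (complex_gens Ms)" "card (complex_gens Ms) = 2 * length Ms" using 3 by auto
  have p: "in_idx (fst p)" "in_idx (snd p)" using entry_in_range[of M p] 3(2,3) by auto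
  let ?m = "mat_entry p"
  have M: "?m (op_of M) \<noteq> 0" using mat_entry_op[OF _ p, of M] 3(2,3) by simp
  have "?m (op_of N) = 0" if "N \<in> set Ms" for N
    using mat_entry_op[OF _ p, of N] 3(2,3) that by (simp add: list_all_iff)
  then have z0: "?m z = 0" if "z \<in> complex_gens Ms" for z
    using that by (auto simp: complex_gens_def mat_entry_imul)
  have z: "?m z = 0" if "z \<in> span (complex_gens Ms)" for z
    using linear_eq_0_on_span[OF mat_entry_linear z0 that] by blast
  have 1: "op_of M \<notin> span (complex_gens Ms)" using z M by blast
  have 2: "imul (op_of M) \<notin> span (insert (op_of M) (complex_gens Ms))"
  proof
    assume "imul (op_of M) \<in> span (insert (op_of M) (complex_gens Ms))"
    then obtain k where "imul (op_of M) - k *\<^sub>R op_of M \<in> span (complex_gens Ms)" using span_breakdown_eq by blast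
    then have "?m (imul (op_of M) - k *\<^sub>R op_of M) = 0" by (rule z)
    then have "(\<i> - of_real k) * ?m (op_of M) = 0"
      by (simp add: linear_diff[OF mat_entry_linear] linear_scale[OF mat_entry_linear] mat_entry_imul scaleR_conv_of_real algebra_simps)
    then have "\<i> = of_real k" using M by simp
    then show False by (simp add: complex_eq_iff)
  qed
  have e: "complex_gens (M # Ms) = insert (imul (op_of M)) (insert (op_of M) (complex_gens Ms))"
    unfolding complex_gens_def by auto
  have fin: "finite (complex_gens Ms)" unfolding complex_gens_def by simp
  have n: "op_of M \<notin> complex_gens Ms" "imul (op_of M) \<notin> insert (op_of M) (complex_gens Ms)"
    using 1 2 span_base[of "op_of M" "complex_gens Ms"]
      span_base[of "imul (op_of M)" "insert (op_of M) (complex_gens Ms)"] by argo+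
  show ?case unfolding e
    using independent_insertI[OF 2 independent_insertI[OF 1 IH(1)]] IH(2) n fin by simp
qed

lemma int_nth_in: "int_nth xs i = Some x \<Longrightarrow> x \<in> set xs"
  by (induction xs i rule: int_nth.induct) (auto split: if_splits)

lemma bracket_closure_in:
  assumes S: "\<And>x y. x \<in> S \<Longrightarrow> y \<in> S \<Longrightarrow> cbracket x y \<in> S"
    and g: "\<forall>X\<in>set gens. op_of X \<in> S \<and> in_range X" and a: "\<forall>X\<in>set acc. op_of X \<in> S \<and> in_range X"
  shows "\<forall>X\<in>set (bracket_closure gens ws acc). op_of X \<in> S \<and> in_range X"
  using g a
proof (induction gens ws acc rule: bracket_closure.induct)
  case (2 gens g d ws acc)
  have st: "\<forall>X\<in>set (case int_nth gens g of None \<Rightarrow> acc | Some X \<Rightarrow>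
       (case int_nth acc d of None \<Rightarrow> acc | Some Y \<Rightarrow> smat_bracket X Y # acc)). op_of X \<in> S \<and> in_range X"
  proof (cases "int_nth gens g")
    case (Some X)
    then have X: "op_of X \<in> S" "in_range X" using int_nth_in[OF Some] 2(2) by auto
    show ?thesis
    proof (cases "int_nth acc d")
      case Y: (Some Y)
      then have "op_of Y \<in> S" "in_range Y" using int_nth_in[OF Y] 2(3) by auto
      then have "op_of (smat_bracket X Y) \<in> S \<and> in_range (smat_bracket X Y)"
        using X by (simp add: smat_bracket_val S)
      then show ?thesis using Some Y 2(3) by simp
    qed (use Some 2(3) in simp)
  qed (use 2(3) in simp)
  show ?case unfolding bracket_closure.simps by (rule 2(1)[OF 2(2) st])
qed simp

lemma bracket_closure_superset: "set acc \<subseteq> set (bracket_closure gens ws acc)"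
proof (induction gens ws acc rule: bracket_closure.induct)
  case (2 gens g d ws acc)
  show ?case
  proof (cases "int_nth gens g")
    case None
    then show ?thesis using 2 by simp
  next
    case X: (Some X)
    show ?thesis using 2 X by (cases "int_nth acc d") simp_all
  qed
qed simp

lemma dim_square:
  fixes F :: "endo set"
  assumes "subspace F" "finite C" "F \<subseteq> span C"
  shows "dim (F \<times> F) \<le> 2 * dim F" "\<exists>D. finite D \<and> F \<times> F \<subseteq> span D"
proof -
  obtain b where b: "independent b" "span b = F" "finite b" "b \<subseteq> F" "card b = dim F"
    using finite_basis[OF assms] by metis
  let ?l = "\<lambda>X. (X, 0::endo)" and ?r = "\<lambda>X. (0::endo, X)"
  have l: "linear ?l" "linear ?r" by (simp_all add: linear_iff)
  let ?D = "?l ` b \<union> ?r ` b"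
  have sub: "F \<times> F \<subseteq> span ?D"
  proof
    fix Z assume "Z \<in> F \<times> F"
    then have "?l (fst Z) \<in> ?l ` span b" "?r (snd Z) \<in> ?r ` span b" using b(2) by auto
    then have "?l (fst Z) \<in> span (?l ` b)" "?r (snd Z) \<in> span (?r ` b)"
      by (simp_all only: linear_span_image[OF l(1)] linear_span_image[OF l(2)])
    then have "?l (fst Z) \<in> span ?D" "?r (snd Z) \<in> span ?D"
      using span_mono[of "?l ` b" ?D] span_mono[of "?r ` b" ?D] by blast+
    then have "?l (fst Z) + ?r (snd Z) \<in> span ?D" by (rule span_add)
    then show "Z \<in> span ?D" by simp
  qed
  have "dim (F \<times> F) \<le> card ?D"
    by (rule dim_span_le_card) (use b sub subspace_Times[OF assms(1) assms(1)] in auto)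
  also have "\<dots> \<le> card (?l ` b) + card (?r ` b)" by (rule card_Un_le)
  also have "\<dots> \<le> 2 * dim F" using card_image_le[OF b(3), of ?l] card_image_le[OF b(3), of ?r] b(5) by linarith
  finally show "dim (F \<times> F) \<le> 2 * dim F" .
  show "\<exists>D. finite D \<and> F \<times> F \<subseteq> span D" using sub b(3) by (intro exI[of _ ?D]) simp
qed

text \<open>The listed brackets and their products with \<open>\<surd>(-1)\<close> are independent, and there are as many of them as
  \<open>F \<times> F\<close> has dimensions at most.  So they are a basis, and the bound on the dimension is attained.\<close>

lemma chevalley_span:
  assumes F: "subspace F" "\<forall>X\<in>F. \<forall>Y\<in>F. commutator X Y \<in> F" "F \<subseteq> sl3O"
    and ok: "spans_ok gens ws ps" and gens: "list_all (\<lambda>L. in_range L \<and> op_of L \<in> F \<times> F) gens"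
    and d: "dim F \<le> length ps"
  shows "dim F = length ps"
    "complex_subalgebra S \<Longrightarrow> \<forall>L\<in>set gens. op_of L \<in> S \<Longrightarrow> F \<times> F \<subseteq> S"
    "\<forall>L\<in>set gens. op_of L \<noteq> 0"
proof -
  let ?Ms = "rev (bracket_closure gens ws (rev gens))"
  have len: "length ?Ms = length ps" using ok unfolding spans_ok_def by (rule echelon_length)
  have cl: "complex_subalgebra (F \<times> F)" using complexify_real_form(3)[OF F(1)] F(2) by blast
  have inF: "\<forall>X\<in>set ?Ms. op_of X \<in> S \<and> in_range X" if "complex_subalgebra S" "\<forall>L\<in>set gens. op_of L \<in> S" for S
    using bracket_closure_in[of S gens "rev gens" ws] that gens
    unfolding complex_subalgebra_def real_subalgebra_def by (auto simp: list_all_iff)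
  have inFF: "\<forall>X\<in>set ?Ms. op_of X \<in> F \<times> F \<and> in_range X" using inF[OF cl] gens by (simp add: list_all_iff)
  have sub: "complex_gens ?Ms \<subseteq> S" if "complex_subalgebra S" "\<forall>L\<in>set gens. op_of L \<in> S" for S
    using inF[OF that] that(1) unfolding complex_gens_def complex_subalgebra_def by blast
  have ind: "independent (complex_gens ?Ms)" "card (complex_gens ?Ms) = 2 * length ?Ms"
    using echelon_independent[of ?Ms ps] ok inFF by (simp_all add: spans_ok_def list_all_iff)
  obtain C where C: "finite C" "F \<subseteq> span C"
    using F(3) finite_basis_labels unfolding sl3O_span gen_span_alt by blast
  obtain D where D: "finite D" "F \<times> F \<subseteq> span D" using dim_square(2)[OF F(1) C] by blast
  have sF: "subspace (F \<times> F)" by (rule subspace_Times[OF F(1) F(1)])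
  have subF: "complex_gens ?Ms \<subseteq> F \<times> F" using sub[OF cl] gens by (simp add: list_all_iff)
  have "2 * length ?Ms \<le> dim (F \<times> F)"
    using dim_independent_le(2)[OF D sF ind(1) subF] ind(2) by simp
  then show dF: "dim F = length ps" using dim_square(1)[OF F(1) C] d len by simp
  have "span (complex_gens ?Ms) = F \<times> F"
    by (rule independent_full_span[OF D sF ind(1) subF]) (use dim_square(1)[OF F(1) C] ind(2) len d in simp)
  then show "F \<times> F \<subseteq> S" if "complex_subalgebra S" "\<forall>L\<in>set gens. op_of L \<in> S"
    using span_minimal[OF sub[OF that]] that(1) unfolding complex_subalgebra_def real_subalgebra_def by simp
  have "set gens \<subseteq> set ?Ms" using bracket_closure_superset[of "rev gens" gens ws] by simp
  then have "op_of ` set gens \<subseteq> complex_gens ?Ms" unfolding complex_gens_def by blast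
  moreover have "0 \<notin> complex_gens ?Ms" using ind(1) dependent_zero by blast
  ultimately show "\<forall>L\<in>set gens. op_of L \<noteq> 0" by fastforce
qed

lemma serre_power_val:
  assumes "in_range X" "in_range Y"
  shows "op_of ((smat_bracket X ^^ n) Y) = (cbracket (op_of X) ^^ n) (op_of Y) \<and> in_range ((smat_bracket X ^^ n) Y)"
  by (induction n) (use assms in \<open>auto simp: smat_bracket_val\<close>)

lemma diagonal_commute:
  assumes "list_all (\<lambda>((i, j), c). i = j) L" "list_all (\<lambda>((i, j), c). i = j) M" "in_range L" "in_range M"
  shows "cbracket (op_of L) (op_of M) = 0"
proof -
  have c: "cbracket (EU i i) (EU j j) = 0" if "in_idx i" "in_idx j" for i j
    using that by (simp add: cbracket_ccomp ccomp_EU)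
  have d: "cbracket (EU i i) (op_of M) = 0" if "in_idx i" for i
    using assms(2,4) by (induction M) (auto simp: cbracket_simps c[OF that] in_range_simps)
  show ?thesis
    using assms(1,3) by (induction L) (auto simp: cbracket_simps d in_range_simps)
qed

text \<open>The relations are checked on integer matrices, generation follows from \<open>chevalley_span\<close>.\<close>

lemma cartan_typeI:
  assumes ch: "chevalley_ok A es fs hs" and hr: "list_all in_range hs"
    and F: "subspace F" "\<forall>X\<in>F. \<forall>Y\<in>F. commutator X Y \<in> F" "F \<subseteq> sl3O"
    and ok: "spans_ok (es @ fs) ws ps" and gens: "list_all (\<lambda>L. in_range L \<and> op_of L \<in> F \<times> F) (es @ fs)"
    and d: "dim F \<le> length ps"
  shows "has_cartan_type A (F \<times> F)" "dim F = length ps"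
proof -
  note sp = chevalley_span[OF F ok gens d]
  show "dim F = length ps" by (rule sp(1))
  have cK: "complex_subalgebra (F \<times> F)" using complexify_real_form(3)[OF F(1)] F(2) by blast
  have L: "length es = length A" "length fs = length A" "length hs = length A"
    using ch unfolding chevalley_ok_def by auto
  let ?e = "\<lambda>i. op_of (es ! i)" and ?f = "\<lambda>i. op_of (fs ! i)" and ?h = "\<lambda>i. op_of (hs ! i)"
  have g: "in_range (es ! i)" "?e i \<in> F \<times> F" "in_range (fs ! i)" "?f i \<in> F \<times> F" "in_range (hs ! i)" if "i < length A" for i
    using gens hr nth_mem[of i es] nth_mem[of i fs] nth_mem[of i hs] that L unfolding list_all_iff set_append by auto
  have rel: "rel_ok (A ! i ! j) (es ! i) (fs ! i) (hs ! i) (es ! j) (fs ! j) (hs ! j) (i = j)"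
    if "i < length A" "j < length A" for i j
    using ch that unfolding chevalley_ok_def by (simp add: list_all_iff)
  have R: "cbracket (?h i) (?h j) = 0" "cbracket (?h i) (?e j) = real_of_int (A ! i ! j) *\<^sub>R ?e j"
     "cbracket (?h i) (?f j) = - real_of_int (A ! i ! j) *\<^sub>R ?f j"
     "cbracket (?e i) (?f j) = (if i = j then ?h i else 0)"
     "i \<noteq> j \<Longrightarrow> (cbracket (?e i) ^^ nat (1 - A ! i ! j)) (?e j) = 0"
     "i \<noteq> j \<Longrightarrow> (cbracket (?f i) ^^ nat (1 - A ! i ! j)) (?f j) = 0"
    if i: "i < length A" and j: "j < length A" for i j
  proof -
    note r = rel[OF i j, unfolded rel_ok_def serre_power_def] and gi = g[OF i] and gj = g[OF j]
    have "list_all (\<lambda>((i, j), c). i = j) (hs ! i)" "list_all (\<lambda>((i, j), c). i = j) (hs ! j)"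
      using rel[OF i j] rel[OF j i] unfolding rel_ok_def by blast+
    then show "cbracket (?h i) (?h j) = 0" using diagonal_commute gi gj by blast
    show "cbracket (?h i) (?e j) = real_of_int (A ! i ! j) *\<^sub>R ?e j"
      using r list_val_equiv[of "smat_bracket (hs ! i) (es ! j)" "smat_scale (A ! i ! j) (es ! j)" "case_prod EU"] gi gj
      by (simp add: smat_bracket_val list_val_scale)
    show "cbracket (?h i) (?f j) = - real_of_int (A ! i ! j) *\<^sub>R ?f j"
      using r list_val_equiv[of "smat_bracket (hs ! i) (fs ! j)" "smat_scale (- A ! i ! j) (fs ! j)" "case_prod EU"] gi gj
      by (simp add: smat_bracket_val list_val_scale)
    show "cbracket (?e i) (?f j) = (if i = j then ?h i else 0)"
    proof (cases "i = j")
      case True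
      then have "list_equiv (smat_bracket (es ! i) (fs ! j)) (hs ! i)" using r by simp
      from list_val_equiv[OF this, of "case_prod EU"] True gi gj show ?thesis by (simp add: smat_bracket_val)
    next
      case False
      then have "smat_bracket (es ! i) (fs ! j) = []" using r by simp
      then show ?thesis using False smat_bracket_val(1)[of "es ! i" "fs ! j"] gi gj by simp
    qed
    show "(cbracket (?e i) ^^ nat (1 - A ! i ! j)) (?e j) = 0" if "i \<noteq> j"
      using r that serre_power_val[of "es ! i" "es ! j" "nat (1 - A ! i ! j)"] gi gj by simp
    show "(cbracket (?f i) ^^ nat (1 - A ! i ! j)) (?f j) = 0" if "i \<noteq> j"
      using r that serre_power_val[of "fs ! i" "fs ! j" "nat (1 - A ! i ! j)"] gi gj by simp
  qed
  have hK: "?h i \<in> F \<times> F" if "i < length A" for i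
    using R(4)[OF that that] g(2,4)[OF that] cK unfolding complex_subalgebra_def real_subalgebra_def by metis
  have gen: "F \<times> F \<subseteq> S" if S: "complex_subalgebra S" "\<forall>i\<in>{..<length A}. ?e i \<in> S \<and> ?f i \<in> S" for S
  proof (rule sp(2)[OF S(1)])
    show "\<forall>L\<in>set (es @ fs). op_of L \<in> S"
      using S(2) L by (auto simp: in_set_conv_nth)
  qed
  have nz: "?e i \<noteq> 0" "?f i \<noteq> 0" if "i < length A" for i
    using sp(3) that L by simp_all
  show "has_cartan_type A (F \<times> F)"
    unfolding has_cartan_type_def Let_def
    by (intro conjI cK, rule exI[of _ ?e], rule exI[of _ ?f], rule exI[of _ ?h], intro conjI ballI allI impI)
       (simp_all add: g hK nz R gen)
qed

section \<open>The involutions and the cubic form in weight coordinates\<close>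

definition on_pairs :: "(endo \<Rightarrow> endo) \<Rightarrow> h3o cend \<Rightarrow> h3o cend" where
  "on_pairs s Z = (s (fst Z), s (snd Z))"

lemma on_pairs_linear: "linear s \<Longrightarrow> linear (on_pairs s)"
  by (simp add: linear_iff on_pairs_def)

lemma bar_idx: "in_idx j \<Longrightarrow> in_idx (bar j)"
  unfolding in_idx_def bar_def by presburger

lemma ip_wvec_all: "\<forall>j. in_idx j \<longrightarrow> Complex (ip (fst (wvec j)) y) (ip (snd (wvec j)) y) = wcoord (bar j) y"
  unfolding all_idx bar_def
  by (simp add: wvec_simps wcoord_simps ip_expand inner_ounit complex_eq_iff)

lemma ip_cscale:
  assumes "in_idx j"
  shows "ip (fst (cscale z (wvec j))) y = Re (z * wcoord (bar j) y)" "ip (snd (cscale z (wvec j))) y = Im (z * wcoord (bar j) y)"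
proof -
  have "wcoord (bar j) y = Complex (ip (fst (wvec j)) y) (ip (snd (wvec j)) y)" using ip_wvec_all assms by simp
  then show "ip (fst (cscale z (wvec j))) y = Re (z * wcoord (bar j) y)" "ip (snd (cscale z (wvec j))) y = Im (z * wcoord (bar j) y)"
    by (simp_all add: cscale_def ip_linear)
qed

lemma bar_bar: "in_idx j \<Longrightarrow> bar (bar j) = j"
  unfolding in_idx_def bar_def by presburger

lemma theta_EU: "in_idx j \<Longrightarrow> in_idx k \<Longrightarrow> on_pairs theta (EU j k) = - EU (bar k) (bar j)"
proof -
  assume j: "in_idx j" and k: "in_idx k"
  have "star (fst (EU j k)) = fst (EU (bar k) (bar j))"
    by (rule star_unique)
       (simp add: EU_apply ip_cscale[OF j] ip_sym[of _ "fst (cscale _ (wvec (bar k)))"] ip_cscale[OF bar_idx[OF k]] bar_bar[OF k] mult.commute)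
  moreover have "star (snd (EU j k)) = snd (EU (bar k) (bar j))"
    by (rule star_unique)
       (simp add: EU_apply ip_cscale[OF j] ip_sym[of _ "snd (cscale _ (wvec (bar k)))"] ip_cscale[OF bar_idx[OF k]] bar_bar[OF k] mult.commute)
  ultimately show ?thesis by (simp add: on_pairs_def theta_def prod_eq_iff)
qed

lemma conj_EU:
  assumes S: "linear S" and c: "\<And>x. wcoord k (S x) = real_of_int (w k) *\<^sub>R wcoord k x"
    and v: "S (fst (wvec j)) = real_of_int (w j) *\<^sub>R fst (wvec j)" "S (snd (wvec j)) = real_of_int (w j) *\<^sub>R snd (wvec j)"
  shows "on_pairs (conj_by S) (EU j k) = real_of_int (w j * w k) *\<^sub>R EU j k"
proof -
  have "fst (on_pairs (conj_by S) (EU j k)) = fst (real_of_int (w j * w k) *\<^sub>R EU j k)"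
    by (rule blinfun_eqI)
       (simp add: on_pairs_def conj_by_apply[OF S] EU_apply c cscale_def linear_diff[OF S] linear_scale[OF S] v blinfun.bilinear_simps algebra_simps)
  moreover have "snd (on_pairs (conj_by S) (EU j k)) = snd (real_of_int (w j * w k) *\<^sub>R EU j k)"
    by (rule blinfun_eqI)
       (simp add: on_pairs_def conj_by_apply[OF S] EU_apply c cscale_def linear_add[OF S] linear_scale[OF S] v blinfun.bilinear_simps algebra_simps)
  ultimately show ?thesis by (simp add: prod_eq_iff)
qed

lemma slot_zero: "(0, 0, 0, 0, 0, 0) = (0 :: h3o)" by (simp add: zero_prod_def)

lemma sigma_weights: "\<forall>k. in_idx k \<longrightarrow> wcoord k (sigma_map x) = real_of_int (sigma_weight k) *\<^sub>R wcoord k x \<and>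
    sigma_map (fst (wvec k)) = real_of_int (sigma_weight k) *\<^sub>R fst (wvec k) \<and>
    sigma_map (snd (wvec k)) = real_of_int (sigma_weight k) *\<^sub>R snd (wvec k)"
  unfolding all_idx
  by (simp add: wcoord_simps wvec_simps sigma_map_def sigma_weight_def inner_ounit complex_eq_iff slot_zero)

lemma flip_weights: "\<forall>k. in_idx k \<longrightarrow> wcoord k (flip_map x) = real_of_int (flip_weight k) *\<^sub>R wcoord k x \<and>
    flip_map (fst (wvec k)) = real_of_int (flip_weight k) *\<^sub>R fst (wvec k) \<and>
    flip_map (snd (wvec k)) = real_of_int (flip_weight k) *\<^sub>R snd (wvec k)"
  unfolding all_idx
  by (simp add: wcoord_simps wvec_simps flip_map_def flip_weight_def inner_ounit complex_eq_iff flip_oct_comp flip_sign_values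
      flip_oct_simps flip_lin slot_zero)

lemma sigma_EU: "in_idx j \<Longrightarrow> in_idx k \<Longrightarrow> on_pairs sigma (EU j k) = real_of_int (sigma_weight j * sigma_weight k) *\<^sub>R EU j k"
  by (rule conj_EU[OF sigma_map_props(1)]) (use sigma_weights in blast)+

lemma flip_EU: "in_idx j \<Longrightarrow> in_idx k \<Longrightarrow> on_pairs hflip (EU j k) = real_of_int (flip_weight j * flip_weight k) *\<^sub>R EU j k"
  by (rule conj_EU[OF flip_map_props(1)]) (use flip_weights in blast)+

lemma theta_op: "in_range L \<Longrightarrow> on_pairs theta (op_of L) = op_of (theta_list L)"
proof (induction L)
  case (Cons x L)
  obtain k l d where x: "x = ((k, l), d)" by (metis prod.collapse)
  note l = on_pairs_linear[OF theta_linear]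
  show ?case using Cons unfolding x by (simp add: theta_list_def in_range_simps linear_add[OF l] linear_scale[OF l] theta_EU)
qed (simp add: theta_list_def linear_0[OF on_pairs_linear[OF theta_linear]])

lemma sign_op:
  assumes "linear s" "\<And>j k. in_idx j \<Longrightarrow> in_idx k \<Longrightarrow> on_pairs s (EU j k) = real_of_int (w j * w k) *\<^sub>R EU j k"
  shows "in_range L \<Longrightarrow> on_pairs s (op_of L) = op_of (sign_list w L)"
proof (induction L)
  case (Cons x L)
  obtain k l d where x: "x = ((k, l), d)" by (metis prod.collapse)
  note l = on_pairs_linear[OF assms(1)]
  show ?case using Cons unfolding x by (simp add: sign_list_def in_range_simps linear_add[OF l] linear_scale[OF l] assms(2) mult.commute)
qed (simp add: sign_list_def linear_0[OF on_pairs_linear[OF assms(1)]])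

lemmas sigma_op = sign_op[OF sigma_linear sigma_EU] and flip_op = sign_op[OF hflip_linear flip_EU]

lemma sign_list_range: "in_range L \<Longrightarrow> in_range (sign_list w L)"
  by (induction L) (auto simp: sign_list_def in_range_simps)

fun cubic_val :: "(int \<times> int \<times> int \<times> int) list \<Rightarrow> (int \<Rightarrow> complex) \<Rightarrow> complex" where
  "cubic_val [] X = 0"
| "cubic_val ((a, b, d, e) # T) X = of_int e * X a * X b * X d + cubic_val T X"

text \<open>The derivative of \<open>cubic_val T\<close> at \<open>X\<close> in direction \<open>Y\<close>.\<close>

fun dcubic_val :: "(int \<times> int \<times> int \<times> int) list \<Rightarrow> (int \<Rightarrow> complex) \<Rightarrow> (int \<Rightarrow> complex) \<Rightarrow> complex" where
  "dcubic_val [] X Y = 0"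
| "dcubic_val ((a, b, d, e) # T) X Y = of_int e * (Y a * X b * X d + X a * Y b * X d + X a * X b * Y d) + dcubic_val T X Y"

lemma det_cubic: "of_real (h3o_det x) = cubic_val cubic_monomials (\<lambda>k. wcoord k x)"
  unfolding det_tau tau_def cubic_monomials_def
  by (simp add: wcoord_simps complex_eq_iff tri_re_def oct_comp oct_inner algebra_simps)

lemma dtau_cubic: "of_real (dtau x y) = dcubic_val cubic_monomials (\<lambda>k. wcoord k x) (\<lambda>k. wcoord k y)"
proof -
  have c: "cubic_val T (\<lambda>k. X k + Y k) - cubic_val T (\<lambda>k. X k - Y k) - 2 * cubic_val T Y = 2 * dcubic_val T X Y" for T X Y
    by (induction T Y rule: cubic_val.induct) (auto simp: algebra_simps)
  have "h3o_det (x + y) - h3o_det (x - y) - 2 * h3o_det y = 2 * dtau x y"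
    by (simp add: det_tau tau_simps dtau_def)
  then have "complex_of_real (2 * dtau x y) = of_real (h3o_det (x + y)) - of_real (h3o_det (x - y)) - 2 * of_real (h3o_det y)"
    by (metis of_real_diff of_real_mult of_real_numeral)
  also have "\<dots> = 2 * dcubic_val cubic_monomials (\<lambda>k. wcoord k x) (\<lambda>k. wcoord k y)"
    unfolding det_cubic wcoord_lin by (rule c)
  finally show ?thesis by simp
qed

lemma dcubic_linear: "dcubic_val T X (\<lambda>k. Y k + Z k) = dcubic_val T X Y + dcubic_val T X Z"
  "dcubic_val T X (\<lambda>k. z * Y k) = z * dcubic_val T X Y" "dcubic_val T X (\<lambda>k. 0) = 0"
  by (induction T X Y rule: dcubic_val.induct) (auto simp: algebra_simps)

lemma dcubic_cong: "list_all (\<lambda>(a, b, d, e). Y a = Z a \<and> Y b = Z b \<and> Y d = Z d) T \<Longrightarrow> dcubic_val T X Y = dcubic_val T X Z"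
  by (induction T X Y rule: dcubic_val.induct) auto

lemma sort3_val: "(case sort3 a b c of (a', b', c') \<Rightarrow> X a' * X b' * X c') = X a * X b * (X c :: complex)"
  by (simp add: sort3_def)

definition monomial_val :: "(int \<Rightarrow> complex) \<Rightarrow> int \<times> int \<times> int \<Rightarrow> complex" where
  "monomial_val X = (\<lambda>(a, b, c). X a * X b * X c)"

lemma add_sort3: "list_val (monomial_val X) (add_entry (sort3 a b c) r acc) = of_int r * (X a * X b * X c) + list_val (monomial_val X) acc"
  unfolding list_val_add_entry by (simp add: monomial_val_def sort3_val scaleR_conv_of_real)

lemma cubic_deriv_entry_val: "list_val (monomial_val X) (cubic_deriv_entry l m r T acc) =
    list_val (monomial_val X) acc + of_int r * dcubic_val T X (\<lambda>k. if k = l then X m else 0)"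
  by (induction l m r T acc rule: cubic_deriv_entry.induct)
     (auto simp: Let_def add_sort3 algebra_simps)

lemma cubic_deriv_val: "list_val (monomial_val X) (cubic_deriv L acc) =
    list_val (monomial_val X) acc + dcubic_val cubic_monomials X (\<lambda>k. list_val (\<lambda>(l, m). if k = l then X m else 0) L)"
  by (induction L acc rule: cubic_deriv.induct)
     (auto simp: dcubic_linear cubic_deriv_entry_val scaleR_conv_of_real)

lemma op_coord:
  assumes "in_range L" "in_idx k"
  shows "wC k (cact (op_of L) (x, 0)) = list_val (\<lambda>(l, m). if k = l then wcoord m x else 0) L"
  using assms(1)
proof (induction L)
  case (Cons y L)
  obtain i j d where y: "y = ((i, j), d)" by (metis prod.collapse)
  have "wC k (cact (EU i j) (x, 0)) = (if k = i then wcoord j x else 0)"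
    using Cons.prems assms(2) unfolding y
    by (auto simp: in_range_simps cact_EU wC_simps wC_wvec) (simp_all add: wC_def wcoord_lin)
  then show ?case using Cons unfolding y by (simp add: in_range_simps cact_simps wC_simps)
qed (simp add: cact_simps wC_simps)

text \<open>The real and the imaginary part of a complex operator that annihilates the cubic form do so
  separately, since the form is real on the hermitian matrices.\<close>

lemma cubic_ok_g_cx:
  assumes "cubic_ok L"
  shows "in_range L" "op_of L \<in> g_cx"
proof -
  show r: "in_range L" using assms unfolding cubic_ok_def in_range_def in_idx_def by (auto simp: list_all_iff)
  obtain X Y where Z: "op_of L = (X, Y)" by (cases "op_of L")
  have idx: "list_all (\<lambda>(a, b, d, e). in_idx a \<and> in_idx b \<and> in_idx d) cubic_monomials"
    unfolding cubic_monomials_def in_idx_def by simp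
  have "dtau x (X x) = 0 \<and> dtau x (Y x) = 0" for x
  proof -
    let ?W = "\<lambda>k. wcoord k x"
    have "0 = list_val (monomial_val ?W) (cubic_deriv L [])"
      using assms list_val_zero[of "cubic_deriv L []" "monomial_val ?W"] unfolding cubic_ok_def by simp
    also have "\<dots> = dcubic_val cubic_monomials ?W (\<lambda>k. list_val (\<lambda>(l, m). if k = l then ?W m else 0) L)"
      by (simp add: cubic_deriv_val)
    also have "\<dots> = dcubic_val cubic_monomials ?W (\<lambda>k. wC k (cact (op_of L) (x, 0)))"
      using idx by (intro dcubic_cong) (auto simp: list_all_iff op_coord[OF r])
    also have "(\<lambda>k. wC k (cact (op_of L) (x, 0))) = (\<lambda>k. wcoord k (X x) + \<i> * wcoord k (Y x))"
      by (simp add: Z wC_def cact_def blinfun.bilinear_simps)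
    also have "dcubic_val cubic_monomials ?W \<dots> = of_real (dtau x (X x)) + \<i> * of_real (dtau x (Y x))"
      by (simp add: dcubic_linear dtau_cubic)
    finally show ?thesis by (simp add: complex_eq_iff)
  qed
  then show "op_of L \<in> g_cx" unfolding Z g_cx_iff sl3O_iff preserves_tau_def by simp
qed

section \<open>Dimensions\<close>

definition label_list :: "(xform \<times> slot) list" where
  "label_list = [(Btz, One), (Btz, Two)]
     @ concat (map (\<lambda>s. (Btx, s) # (Rxz, s) # concat (map (\<lambda>q. [(Btq q, s), (Rzq q, s)]) [Ui, Uj, Uk, Ukl, Ujl, Uil, Ul])) [One, Two, Three])
     @ concat (map (\<lambda>q. [(Rxq q, One), (Aq q, One), (Gq q, One), (Sq q, One)]) [Ui, Uj, Uk, Ukl, Ujl, Uil, Ul])"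

lemma label_list_all: "set label_list = basis_labels"
proof -
  have s: "UNIV = {One, Two, Three}" using slot.exhaust by blast
  show ?thesis unfolding label_list_def basis_labels_def UNIV_iunit s by auto
qed

lemma label_list_distinct: "distinct label_list" "length label_list = 78"
  by (simp_all add: label_list_def)

lemma card_labels: "card {l \<in> basis_labels. P l} = length (filter P label_list)"
proof -
  have "{l \<in> basis_labels. P l} = set (filter P label_list)" by (simp add: label_list_all[symmetric])
  also have "card \<dots> = length (filter P label_list)" by (rule distinct_card) (simp add: label_list_distinct)
  finally show ?thesis .
qed

lemma card_basis_labels: "card basis_labels = 78"
  using card_labels[of "\<lambda>_. True"] by (simp add: label_list_distinct)

lemma sl3O_finite: "finite (case_prod dot ` basis_labels)" "sl3O \<subseteq> span (case_prod dot ` basis_labels)"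
  using finite_basis_labels by (simp_all add: sl3O_span gen_span_alt)

lemma g_cx_square: "g_cx = sl3O \<times> sl3O" by (simp add: g_cx_def)

text \<open>The generators bound the dimension by 78 from above, the root vectors from below.\<close>

lemma E6_type: "has_cartan_type cartan_E6 g_cx" and dim_sl3O: "dim sl3O = 78"
proof -
  have "dim sl3O \<le> card (case_prod dot ` basis_labels)"
    by (rule dim_span_le_card[OF sl3O_finite sl3O_subspace])
  also have "\<dots> \<le> 78" using card_image_le[OF finite_basis_labels, of "case_prod dot"] card_basis_labels by simp
  finally have d: "dim sl3O \<le> length E6_pivots" by (simp add: E6_pivots_def)
  have h: "list_all in_range E6_h" by (simp add: E6_h_def in_range_def in_idx_def)
  have g: "list_all (\<lambda>L. in_range L \<and> op_of L \<in> sl3O \<times> sl3O) (E6_e @ E6_f)"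
    using E6_cubic cubic_ok_g_cx unfolding g_cx_square list_all_iff by blast
  have cl: "\<forall>X\<in>sl3O. \<forall>Y\<in>sl3O. commutator X Y \<in> sl3O" using sl3O_commutator by blast
  note t = cartan_typeI[OF E6_chevalley h sl3O_subspace cl subset_refl E6_spans g d]
  show "has_cartan_type cartan_E6 g_cx" unfolding g_cx_square by (rule t(1))
  show "dim sl3O = 78" using t(2) by (simp add: E6_pivots_def)
qed

text \<open>Spanning and of the right number, the generators are a basis.\<close>

lemma generators_independent: "inj_on (case_prod dot) basis_labels" "independent (case_prod dot ` basis_labels)"
proof -
  let ?D = "case_prod dot ` basis_labels"
  obtain b where b: "b \<subseteq> ?D" "independent b" "?D \<subseteq> span b"
    using maximal_independent_subset[of ?D] by blast
  have "span b = sl3O" unfolding sl3O_span gen_span_alt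
    by (rule subset_antisym[OF span_mono[OF b(1)] span_minimal[OF b(3) subspace_span]])
  then have "card b = 78" using dim_sl3O dim_span_eq_card_independent[OF b(2)] by simp
  have fin: "finite ?D" by (rule sl3O_finite)
  have "card ?D \<le> 78" using card_image_le[OF finite_basis_labels, of "case_prod dot"] card_basis_labels by simp
  then have bD: "b = ?D" using card_subset_eq[OF fin b(1)] card_mono[OF fin b(1)] \<open>card b = 78\<close> by simp
  show "independent ?D" using b(2) bD by simp
  show "inj_on (case_prod dot) basis_labels"
    by (rule eq_card_imp_inj_on[OF finite_basis_labels]) (use bD \<open>card b = 78\<close> card_basis_labels in simp)
qed

lemma dim_gen_span: "A \<subseteq> basis_labels \<Longrightarrow> dim (gen_span A) = card A"
proof -
  assume A: "A \<subseteq> basis_labels"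
  have "independent (case_prod dot ` A)"
    by (rule independent_mono[OF generators_independent(2)]) (use A in blast)
  then have "dim (gen_span A) = card (case_prod dot ` A)"
    unfolding gen_span_alt by (rule dim_span_eq_card_independent)
  also have "\<dots> = card A" by (rule card_image[OF inj_on_subset[OF generators_independent(1) A]])
  finally show ?thesis .
qed

section \<open>The group of eight involutions\<close>

text \<open>The group generated by the three involutions, indexed by the exponents of \<open>\<theta>\<close>, \<open>\<sigma>\<close> and \<open>h\<close>; \<open>eps8\<close> lists
  the eigenvalues on the generators.\<close>

definition inv8 :: "bool \<Rightarrow> bool \<Rightarrow> bool \<Rightarrow> endo \<Rightarrow> endo" where
  "inv8 a b c = (if a then theta else id) \<circ> ((if b then sigma else id) \<circ> (if c then hflip else id))"

definition eps8 :: "bool \<Rightarrow> bool \<Rightarrow> bool \<Rightarrow> xform \<times> slot \<Rightarrow> real" where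
  "eps8 a b c l = (if a then sgn_of boost_labels l else 1) * ((if b then sgn_of T23_labels l else 1) * (if c then sgn_of Hperp_labels l else 1))"

lemma theta_commutes: "sigma (theta X) = theta (sigma X)" "hflip (theta X) = theta (hflip X)"
  using lie_involutionD(5)[OF lie_involution_sigma] lie_involutionD(5)[OF lie_involution_flip] by auto

lemma involutive: "theta (theta X) = X" "sigma (sigma X) = X" "hflip (hflip X) = X"
  using lie_involutionD(2) lie_involution_theta lie_involution_sigma lie_involution_flip by blast+

lemma inv8_compose: "inv8 a b c (inv8 a' b' c' X) = inv8 (a \<noteq> a') (b \<noteq> b') (c \<noteq> c') X"
  by (cases a; cases b; cases c; cases a'; cases b'; cases c')
     (simp_all add: inv8_def theta_commutes sigma_hflip_commute[symmetric] involutive)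

lemma inv8_commute: "inv8 a b c (inv8 a' b' c' X) = inv8 a' b' c' (inv8 a b c X)"
  by (simp add: inv8_compose eq_commute)

lemma inv8_eigen: "eigen (inv8 a b c) (eps8 a b c)"
proof -
  have i: "eigen id (\<lambda>_. 1)" by (simp add: eigen_def linear_iff)
  have "eigen (if a then theta else id) (\<lambda>l. if a then sgn_of boost_labels l else 1)"
    "eigen (if b then sigma else id) (\<lambda>l. if b then sgn_of T23_labels l else 1)"
    "eigen (if c then hflip else id) (\<lambda>l. if c then sgn_of Hperp_labels l else 1)"
    using eigen_basic i by auto
  from eigen_compose[OF this(1) eigen_compose[OF this(2,3)]]
  show ?thesis unfolding inv8_def eps8_def .
qed

lemma inv8_good: "good_inv (inv8 a b c)"
proof -
  have l: "lie_involution (if a then theta else id)" "lie_involution (if b then sigma else id)" "lie_involution (if c then hflip else id)"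
    using lie_involution_theta lie_involution_sigma lie_involution_flip lie_involution_id by auto
  have "lie_involution (inv8 a b c)" unfolding inv8_def
    by (intro lie_involution_compose l) (auto simp: theta_commutes sigma_hflip_commute)
  then show ?thesis unfolding good_inv_def using eigen_preserves[OF inv8_eigen] by blast
qed

lemma inv8_values: "inv8 False False False = id" "inv8 True False False = theta" "inv8 False True False = sigma" "inv8 False False True = hflip"
  by (simp_all add: inv8_def)

lemma fixed_inv8: "fixed (inv8 a b c) = gen_span {l \<in> basis_labels. eps8 a b c l = 1}"
  using eigen_space[OF inv8_eigen disjI1[OF refl] subset_refl, of a b c] unfolding fixed_def sl3O_span by simp

lemma fixed_theta_parts:
  "{X \<in> fixed (inv8 a b c). theta X = X} = gen_span {l \<in> basis_labels. eps8 a b c l = 1 \<and> sgn_of boost_labels l = 1}"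
  "{X \<in> fixed (inv8 a b c). theta X = - X} = gen_span {l \<in> basis_labels. eps8 a b c l = 1 \<and> sgn_of boost_labels l = -1}"
proof -
  have sub: "{l \<in> basis_labels. eps8 a b c l = 1} \<subseteq> basis_labels" by blast
  have e: "{l \<in> {l \<in> basis_labels. eps8 a b c l = 1}. sgn_of boost_labels l = d} = {l \<in> basis_labels. eps8 a b c l = 1 \<and> sgn_of boost_labels l = d}" for d
    by blast
  show "{X \<in> fixed (inv8 a b c). theta X = X} = gen_span {l \<in> basis_labels. eps8 a b c l = 1 \<and> sgn_of boost_labels l = 1}"
    using eigen_space[OF eigen_basic(1) disjI1[OF refl] sub] unfolding fixed_inv8 e by simp
  show "{X \<in> fixed (inv8 a b c). theta X = - X} = gen_span {l \<in> basis_labels. eps8 a b c l = 1 \<and> sgn_of boost_labels l = -1}"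
    using eigen_space[OF eigen_basic(1) disjI2[OF refl] sub] unfolding fixed_inv8 e by simp
qed

definition count_rot :: "bool \<Rightarrow> bool \<Rightarrow> bool \<Rightarrow> nat" where
  "count_rot a b c = length (filter (\<lambda>l. eps8 a b c l = 1 \<and> sgn_of boost_labels l = 1) label_list)"
definition count_boost :: "bool \<Rightarrow> bool \<Rightarrow> bool \<Rightarrow> nat" where
  "count_boost a b c = length (filter (\<lambda>l. eps8 a b c l = 1 \<and> sgn_of boost_labels l = -1) label_list)"

lemma dim_theta_parts: "dim {X \<in> fixed (inv8 a b c). theta X = X} = count_rot a b c"
    "dim {X \<in> fixed (inv8 a b c). theta X = - X} = count_boost a b c"
  unfolding fixed_theta_parts count_rot_def count_boost_def card_labels[symmetric]
  by (rule dim_gen_span, blast)+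

lemma Hperp_label_iff: "(F, s) \<in> Hperp_labels \<longleftrightarrow> (F, s) \<in> basis_labels \<and> carried_unit F \<in> Some ` {Ui, Uj, Uil, Ujl}"
  by (simp add: Hperp_labels_def)

lemma counts:
  "count_rot False False False = 52" "count_boost False False False = 26"
  "count_rot True False False = 52" "count_boost True False False = 0"
  "count_rot False True False = 36" "count_boost False True False = 10"
  "count_rot False False True = 24" "count_boost False False True = 14"
  "count_rot True True False = 36" "count_boost True True False = 16"
  "count_rot True False True = 24" "count_boost True False True = 12"
  "count_rot False True True = 24" "count_boost False True True = 14"
  "count_rot True True True = 24" "count_boost True True True = 12"
  by (simp_all add: count_rot_def count_boost_def label_list_def eps8_def sgn_of_def
      boost_label_iff T23_label_iff Hperp_label_iff basis_label_iff)

lemma dim_fixed: "dim (fixed (inv8 a b c)) = count_rot a b c + count_boost a b c"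
proof -
  have "length (filter (\<lambda>l. eps8 a b c l = 1) L) = length (filter (\<lambda>l. eps8 a b c l = 1 \<and> sgn_of boost_labels l = 1) L)
     + length (filter (\<lambda>l. eps8 a b c l = 1 \<and> sgn_of boost_labels l = -1) L)" for L
    by (induction L) (auto simp: sgn_of_def)
  moreover have "dim (fixed (inv8 a b c)) = length (filter (\<lambda>l. eps8 a b c l = 1) label_list)"
    unfolding fixed_inv8 card_labels[symmetric] by (rule dim_gen_span) blast
  ultimately show ?thesis unfolding count_rot_def count_boost_def by simp
qed

lemma fixed_facts:
  assumes "good_inv s"
  shows "subspace (fixed s)" "\<forall>X\<in>fixed s. \<forall>Y\<in>fixed s. commutator X Y \<in> fixed s" "fixed s \<subseteq> sl3O" "X \<in> fixed s \<Longrightarrow> star X \<in> fixed s"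
  using good_invD[OF assms] by (auto simp: fixed_def subspace_def sl3O_closed sl3O_commutator sl3O_star)

section \<open>Killing signatures of the subalgebras\<close>

lemma real_embed_linear: "linear real_embed" by (simp add: linear_iff real_embed_def)

lemma real_embed_eq_0: "real_embed X = 0 \<longleftrightarrow> X = 0" by (simp add: real_embed_def zero_prod_def)

lemma dim_real_embed:
  assumes "subspace U" "U \<subseteq> sl3O"
  shows "dim (real_embed ` U) = dim U"
  by (rule dim_linear_image[OF real_embed_linear assms(1) sl3O_finite(1)]) (use assms sl3O_finite real_embed_eq_0 in auto)

lemma dagger_embed: "dagger (real_embed X) = - real_embed X \<longleftrightarrow> theta X = X" "dagger (real_embed X) = real_embed X \<longleftrightarrow> theta X = - X"
  by (auto simp: dagger_def real_embed_def theta_def star_simps minus_equation_iff)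

lemma embed_dag_closed:
  assumes "subspace U" "U \<subseteq> sl3O" "\<And>X. X \<in> U \<Longrightarrow> star X \<in> U"
  shows "dag_closed (real_embed ` U)"
  unfolding dag_closed_def
proof (intro conjI)
  show "subspace (real_embed ` U)" by (rule linear_subspace_image[OF real_embed_linear assms(1)])
  show "real_embed ` U \<subseteq> g_cx" using assms(2) by (auto simp: real_embed_def g_cx_iff sl3O_closed)
  have "dagger (real_embed X) = real_embed (star X)" for X by (simp add: dagger_def real_embed_def star_simps)
  then show "dagger ` real_embed ` U \<subseteq> real_embed ` U" using assms(3) by auto
qed

lemma embed_parts: "{Z \<in> real_embed ` U. dagger Z = - Z} = real_embed ` {X \<in> U. theta X = X}"
  "{Z \<in> real_embed ` U. dagger Z = Z} = real_embed ` {X \<in> U. theta X = - X}"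
  using dagger_embed by blast+

lemma theta_eigen_subspace: "subspace U \<Longrightarrow> subspace {X \<in> U. theta X = X}" "subspace U \<Longrightarrow> subspace {X \<in> U. theta X = - X}"
  by (simp_all add: subspace_def linear_add[OF theta_linear] linear_scale[OF theta_linear] linear_0[OF theta_linear])

lemma signature_embed:
  assumes L: "real_subalgebra L" "centreless L" "dag_closed L"
    and U: "subspace U" "U \<subseteq> sl3O" "\<And>X. X \<in> U \<Longrightarrow> star X \<in> U" "real_embed ` U \<subseteq> L"
  shows "signature L (real_embed ` U) = (dim {X \<in> U. theta X = X}, dim {X \<in> U. theta X = - X})"
proof -
  have "dim (real_embed ` {X \<in> U. theta X = X}) = dim {X \<in> U. theta X = X}"
    "dim (real_embed ` {X \<in> U. theta X = - X}) = dim {X \<in> U. theta X = - X}"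
    by (rule dim_real_embed; use theta_eigen_subspace[OF U(1)] U(2) in auto)+
  then show ?thesis
    using signature_dagger[OF L embed_dag_closed[OF U(1-3)] U(4)] unfolding embed_parts by simp
qed

lemma type_centreless:
  assumes "has_cartan_type A (F \<times> F)" "\<And>i. i < length A \<Longrightarrow> A ! i ! i = 2"
    and F: "subspace F" "\<forall>X\<in>F. \<forall>Y\<in>F. commutator X Y \<in> F" "\<And>X. X \<in> F \<Longrightarrow> star X \<in> F"
  shows "centreless (F \<times> F)" "centreless (real_embed ` F)" "real_form_of_type A (real_embed ` F)" "real_subalgebra (real_embed ` F)"
proof -
  have c: "is_real_form (F \<times> F) (real_embed ` F)" "real_subalgebra (real_embed ` F)"
    using complexify_real_form(1,2)[OF F(1)] F(2) by blast+
  show cc: "centreless (F \<times> F)"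
  proof (rule cartan_type_centreless[OF assms(1,2) herm_inner])
    show "herm (cbracket Z W) V = herm W (cbracket (dagger Z) V)" for Z W V by (rule herm_bracket)
    show "dagger Z \<in> F \<times> F" if "Z \<in> F \<times> F" for Z
      using that F by (auto simp: dagger_def subspace_neg)
  qed
  show "centreless (real_embed ` F)" by (rule real_form_centreless[OF c(1) cc])
  show "real_form_of_type A (real_embed ` F)" unfolding real_form_of_type_def using assms(1) c(1) by blast
  show "real_subalgebra (real_embed ` F)" by (rule c(2))
qed

lemma cartan_diagonal: "i < length cartan_A1 \<Longrightarrow> cartan_A1 ! i ! i = 2" "i < length cartan_A5 \<Longrightarrow> cartan_A5 ! i ! i = 2"
  "i < length cartan_C4 \<Longrightarrow> cartan_C4 ! i ! i = 2" "i < length cartan_F4 \<Longrightarrow> cartan_F4 ! i ! i = 2"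
  "i < length cartan_E6 \<Longrightarrow> cartan_E6 ! i ! i = 2"
  by (auto simp: cartan_A1_def cartan_A5_def cartan_C4_def cartan_F4_def cartan_E6_def less_Suc_eq)

lemma g_cx_centreless: "centreless g_cx"
  using type_centreless(1)[OF E6_type[unfolded g_cx_square] cartan_diagonal(5) sl3O_subspace] sl3O_commutator sl3O_star
  unfolding g_cx_square by blast

lemma twisted_centreless: "centreless (twisted (inv8 a b c))"
  by (rule real_form_centreless[OF twisted_facts(3)[OF inv8_good] g_cx_centreless])

lemma twisted_id: "twisted (inv8 False False False) = g_re"
proof -
  have n: "X = - X \<longleftrightarrow> X = 0" for X :: endo
    by (metis add.right_inverse neg_equal_0_iff_equal scaleR_2 scaleR_eq_0_iff zero_neq_numeral)
  have "Z \<in> twisted id \<longleftrightarrow> fst Z \<in> sl3O \<and> snd Z = 0" for Z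
    unfolding twisted_def g_cx_iff mem_Collect_eq id_apply n using sl3O_closed(5) by auto
  moreover have "Z \<in> g_re \<longleftrightarrow> fst Z \<in> sl3O \<and> snd Z = 0" for Z
    by (cases Z) (simp add: g_re_def real_embed_def image_iff)
  ultimately show ?thesis unfolding inv8_values by blast
qed

lemma signature_P:
  "signature (twisted (inv8 a b c)) (real_embed ` fixed (inv8 a b c)) = (count_rot a b c, count_boost a b c)"
  "signature g_re (real_embed ` fixed (inv8 a b c)) = (count_rot a b c, count_boost a b c)"
proof -
  note f = fixed_facts[OF inv8_good[of a b c]]
  have sig: "signature (twisted (inv8 a' b' c')) (real_embed ` fixed (inv8 a b c)) = (count_rot a b c, count_boost a b c)"
    if "real_embed ` fixed (inv8 a b c) \<subseteq> twisted (inv8 a' b' c')" for a' b' c'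
    using signature_embed[OF twisted_facts(1)[OF inv8_good] twisted_centreless twisted_facts(2)[OF inv8_good] f(1,3,4) that]
    unfolding dim_theta_parts .
  show "signature (twisted (inv8 a b c)) (real_embed ` fixed (inv8 a b c)) = (count_rot a b c, count_boost a b c)"
    by (rule sig) (auto simp: twisted_def fixed_def real_embed_def g_cx_iff sl3O_closed good_invD[OF inv8_good])
  show "signature g_re (real_embed ` fixed (inv8 a b c)) = (count_rot a b c, count_boost a b c)"
    unfolding twisted_id[symmetric]
    by (rule sig) (auto simp: twisted_id g_re_def fixed_def)
qed

text \<open>Multiplying the odd part by \<open>\<surd>(-1)\<close> exchanges the compact and noncompact generators in it.\<close>

lemma signature_twisted:
  "signature (twisted (inv8 a b c)) (twisted (inv8 a b c)) =
     (dim (fixed (inv8 (\<not> a) b c)), 78 - dim (fixed (inv8 (\<not> a) b c)))"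
proof -
  let ?s = "inv8 a b c" and ?t = "inv8 (\<not> a) b c"
  note s = good_invD[OF inv8_good[of a b c]] and t = good_invD[OF inv8_good[of "\<not> a" b c]]
  have ts: "?t X = theta (?s X)" for X
    using inv8_compose[of True False False a b c X] by (simp add: inv8_values)
  define f where "f X = ((1/2) *\<^sub>R (X + ?s X), (1/2) *\<^sub>R (X - ?s X))" for X
  have lf: "linear f" unfolding f_def linear_iff by (simp add: s algebra_simps)
  have finj: "X = 0" if "f X = 0" for X
  proof -
    have "fst (f X) + snd (f X) = X" unfolding f_def by (simp add: scaleR_add_right scaleR_diff_right flip: scaleR_add_left)
    then show ?thesis using that by simp
  qed
  have half: "(1/2) *\<^sub>R (X + X) = X" for X :: endo by (simp flip: scaleR_2)
  have theta: "theta (X + Y) = theta X + theta Y" "theta (X - Y) = theta X - theta Y" "theta (r *\<^sub>R X) = r *\<^sub>R theta X" for X Y r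
    using linear_add[OF theta_linear] linear_diff[OF theta_linear] linear_scale[OF theta_linear] by auto
  have dag: "dagger Z = - d *\<^sub>R Z \<longleftrightarrow> theta (fst Z) = d *\<^sub>R fst Z \<and> theta (snd Z) = - d *\<^sub>R snd Z" if "d = 1 \<or> d = -1" for Z d
    using that by (auto simp: dagger_def theta_def prod_eq_iff minus_equation_iff)
  have eig: "{Z \<in> twisted ?s. dagger Z = - d *\<^sub>R Z} = f ` {X \<in> sl3O. ?t X = d *\<^sub>R X}" if d: "d = 1 \<or> d = -1" for d :: real
  proof (intro equalityI subsetI)
    fix Z assume "Z \<in> {Z \<in> twisted ?s. dagger Z = - d *\<^sub>R Z}"
    then have Z: "fst Z \<in> sl3O" "snd Z \<in> sl3O" "?s (fst Z) = fst Z" "?s (snd Z) = - snd Z"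
      "theta (fst Z) = d *\<^sub>R fst Z" "theta (snd Z) = - d *\<^sub>R snd Z"
      using dag[OF d, of Z] unfolding twisted_def g_cx_iff by auto
    have "f (fst Z + snd Z) = Z" unfolding f_def using Z by (simp add: s half prod_eq_iff)
    moreover have "?t (fst Z + snd Z) = d *\<^sub>R (fst Z + snd Z)" unfolding ts using Z by (simp add: s theta algebra_simps)
    ultimately show "Z \<in> f ` {X \<in> sl3O. ?t X = d *\<^sub>R X}" using Z by (metis (mono_tags, lifting) image_eqI mem_Collect_eq sl3O_closed(1))
  next
    fix Z assume "Z \<in> f ` {X \<in> sl3O. ?t X = d *\<^sub>R X}"
    then obtain X where X: "X \<in> sl3O" "?t X = d *\<^sub>R X" "Z = f X" by blast
    have "theta (?s X) = d *\<^sub>R X" using X(2) ts by simp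
    then have sX: "?s X = d *\<^sub>R theta X" using s(5)[of X] arg_cong[OF X(2), of theta] ts[of X] involutive(1)[of "?s X"] theta(3) by simp
    have dd: "d * d = 1" using d by auto
    have th: "theta X = d *\<^sub>R ?s X" unfolding sX by (simp add: dd)
    have "theta (fst Z) = d *\<^sub>R fst Z" "theta (snd Z) = - d *\<^sub>R snd Z"
      unfolding X(3) f_def fst_conv snd_conv theta \<open>theta (?s X) = d *\<^sub>R X\<close> th by (simp_all add: algebra_simps)
    moreover have "Z \<in> twisted ?s" unfolding X(3) f_def twisted_def g_cx_iff using X(1) by (simp add: s sl3O_closed algebra_simps)
    ultimately show "Z \<in> {Z \<in> twisted ?s. dagger Z = - d *\<^sub>R Z}" using dag[OF d, of Z] by blast
  qed
  have sp: "{X \<in> sl3O. ?t X = d *\<^sub>R X} = gen_span {l \<in> basis_labels. eps8 (\<not> a) b c l = d}" if "d = 1 \<or> d = -1" for d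
    using eigen_space[OF inv8_eigen that subset_refl] unfolding sl3O_span .
  have dimf: "dim (f ` gen_span {l \<in> basis_labels. P l}) = card {l \<in> basis_labels. P l}" for P
  proof -
    have "gen_span {l \<in> basis_labels. P l} \<subseteq> span (case_prod dot ` basis_labels)"
      unfolding gen_span_alt by (intro span_mono) blast
    then have "dim (f ` gen_span {l \<in> basis_labels. P l}) = dim (gen_span {l \<in> basis_labels. P l})"
      by (intro dim_linear_image[OF lf gen_span_subspace sl3O_finite(1)] finj) auto
    then show ?thesis using dim_gen_span[of "{l \<in> basis_labels. P l}"] by auto
  qed
  have n: "dim {Z \<in> twisted ?s. dagger Z = - Z} = card {l \<in> basis_labels. eps8 (\<not> a) b c l = 1}"
    using eig[of 1] sp[of 1] dimf by simp
  have p: "dim {Z \<in> twisted ?s. dagger Z = Z} = card {l \<in> basis_labels. eps8 (\<not> a) b c l = -1}"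
    using eig[of "-1"] sp[of "-1"] dimf by simp
  have "length (filter (\<lambda>l. eps8 a b c l = -1) L) + length (filter (\<lambda>l. eps8 a b c l = 1) L) = length L" for L a
    by (induction L) (auto simp: eps8_def sgn_of_def split: if_splits)
  then have "card {l \<in> basis_labels. eps8 (\<not> a) b c l = -1} + card {l \<in> basis_labels. eps8 (\<not> a) b c l = 1} = 78"
    unfolding card_labels using label_list_distinct(2) by simp
  moreover have "dim (fixed ?t) = card {l \<in> basis_labels. eps8 (\<not> a) b c l = 1}"
    unfolding fixed_inv8 by (rule dim_gen_span) blast
  ultimately show ?thesis
    using signature_dagger[OF twisted_facts(1)[OF inv8_good[of a b c]] twisted_centreless[of a b c] twisted_facts(2)[OF inv8_good[of a b c]]
        twisted_facts(2)[OF inv8_good[of a b c]] subset_refl] n p by simp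
qed

section \<open>The maps \<open>\<phi>\<^sup>*\<close>\<close>

text \<open>The complex-linear map that is \<open>1\<close> where \<open>s = 1\<close> and \<open>\<surd>(-1)\<close> where \<open>s = -1\<close>, written with the eigenspace
  projections \<open>(1 \<plusminus> s) / 2\<close>.\<close>

definition psi :: "(endo \<Rightarrow> endo) \<Rightarrow> h3o cend \<Rightarrow> h3o cend" where
  "psi s Z = ((1/2) *\<^sub>R (fst Z + s (fst Z)) - (1/2) *\<^sub>R (snd Z - s (snd Z)),
              (1/2) *\<^sub>R (fst Z - s (fst Z)) + (1/2) *\<^sub>R (snd Z + s (snd Z)))"

lemma phi_star_psi:
  assumes s: "good_inv s" and Z: "Z \<in> g_cx"
  shows "phi_star {X \<in> sl3O. s X = X} {X \<in> sl3O. s X = - X} Z = psi s Z"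
proof -
  note g = good_invD[OF s]
  have n: "X = 0" if "X = - X" for X :: endo using that
    by (metis add.right_inverse scaleR_2 scaleR_eq_0_iff zero_neq_numeral)
  have half: "X - (1/2) *\<^sub>R (X + Y) = (1/2) *\<^sub>R (X - Y)" "X - (1/2) *\<^sub>R (X - Y) = (1/2) *\<^sub>R (X + Y)" for X Y :: endo
  proof -
    have "X = (1/2) *\<^sub>R X + (1/2) *\<^sub>R X" by (simp flip: scaleR_add_left)
    then have "X - (1/2) *\<^sub>R (X + Y) = ((1/2) *\<^sub>R X + (1/2) *\<^sub>R X) - (1/2) *\<^sub>R (X + Y)"
      "X - (1/2) *\<^sub>R (X - Y) = ((1/2) *\<^sub>R X + (1/2) *\<^sub>R X) - (1/2) *\<^sub>R (X - Y)" by simp_all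
    then show "X - (1/2) *\<^sub>R (X + Y) = (1/2) *\<^sub>R (X - Y)" "X - (1/2) *\<^sub>R (X - Y) = (1/2) *\<^sub>R (X + Y)"
      by (simp_all add: scaleR_add_right scaleR_diff_right)
  qed
  have cancel: "(X - Y) - (X - Z) = Z - Y" for X Y Z :: endo by simp
  let ?U = "{X \<in> sl3O. s X = X}" and ?V = "{X \<in> sl3O. s X = - X}"
  have disj: "X = 0" if "X \<in> ?U" "X \<in> ?V" for X using that n by auto
  have P: "(1/2) *\<^sub>R (X + s X) \<in> ?U" "(1/2) *\<^sub>R (X - s X) \<in> ?V" if "X \<in> sl3O" for X
    using that by (simp_all add: g sl3O_closed algebra_simps)
  have sub: "subspace ?U" "subspace ?V" using sl3O_subspace by (simp_all add: subspace_def g)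
  have cU: "component ?U ?V X = (1/2) *\<^sub>R (X + s X)" if "X \<in> sl3O" for X
    unfolding component_def
  proof (rule the_equality)
    show "(1/2) *\<^sub>R (X + s X) \<in> ?U \<and> X - (1/2) *\<^sub>R (X + s X) \<in> ?V" using P[OF that] unfolding half by blast
    fix u assume u: "u \<in> ?U \<and> X - u \<in> ?V"
    have p: "u - (1/2) *\<^sub>R (X + s X) \<in> ?U" using u P(1)[OF that] subspace_diff[OF sub(1)] by blast
    have "(X - (1/2) *\<^sub>R (X + s X)) - (X - u) \<in> ?V" using u P(2)[OF that] subspace_diff[OF sub(2)] unfolding half by blast
    then have q: "u - (1/2) *\<^sub>R (X + s X) \<in> ?V" by (simp only: cancel)
    have "u - (1/2) *\<^sub>R (X + s X) = 0" by (rule disj[OF p q])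
    then show "u = (1/2) *\<^sub>R (X + s X)" by simp
  qed
  have cV: "component ?V ?U X = (1/2) *\<^sub>R (X - s X)" if "X \<in> sl3O" for X
    unfolding component_def
  proof (rule the_equality)
    show "(1/2) *\<^sub>R (X - s X) \<in> ?V \<and> X - (1/2) *\<^sub>R (X - s X) \<in> ?U" using P[OF that] unfolding half by blast
    fix u assume u: "u \<in> ?V \<and> X - u \<in> ?U"
    have p: "u - (1/2) *\<^sub>R (X - s X) \<in> ?V" using u P(2)[OF that] subspace_diff[OF sub(2)] by blast
    have "(X - (1/2) *\<^sub>R (X - s X)) - (X - u) \<in> ?U" using u P(1)[OF that] subspace_diff[OF sub(1)] unfolding half by blast
    then have q: "u - (1/2) *\<^sub>R (X - s X) \<in> ?U" by (simp only: cancel)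
    have "u - (1/2) *\<^sub>R (X - s X) = 0" by (rule disj[OF q p])
    then show "u = (1/2) *\<^sub>R (X - s X)" by simp
  qed
  show ?thesis using Z unfolding phi_star_def psi_def g_cx_iff
    by (cases Z) (simp add: cU cV imul_def)
qed

text \<open>A composition of the basic maps is the map of the product involution, up to a sign on the
  common eigenspaces where the factors \<open>\<surd>(-1)\<close> multiply to \<open>-1\<close>.\<close>

definition realizes :: "(h3o cend \<Rightarrow> h3o cend) \<Rightarrow> bool \<Rightarrow> bool \<Rightarrow> bool \<Rightarrow> (endo \<Rightarrow> endo) \<Rightarrow> bool" where
  "realizes \<phi> a b c \<kappa> \<longleftrightarrow> linear \<kappa> \<and> (\<forall>X. \<kappa> (\<kappa> X) = X) \<and> (\<forall>a b c X. \<kappa> (inv8 a b c X) = inv8 a b c (\<kappa> X)) \<and>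
     (\<forall>X\<in>sl3O. \<kappa> X \<in> sl3O) \<and> (\<forall>Z\<in>g_cx. \<phi> Z = psi (inv8 a b c) (\<kappa> (fst Z), \<kappa> (snd Z)))"

lemma endo_eqI: "(\<And>x b. blinfun_apply X x \<bullet> b = blinfun_apply Y x \<bullet> b) \<Longrightarrow> X = (Y :: endo)"
  by (rule blinfun_eqI, rule inner_commute[THEN trans, THEN vector_eq_rdot[THEN iffD1, rule_format, rotated]]) (auto simp: inner_commute)

lemma realizes_basic:
  "realizes id False False False id" "realizes phi_t True False False id" "realizes phi_23 False True False id" "realizes phi_H False False True id"
proof -
  have k: "linear (id :: endo \<Rightarrow> endo)" by (simp add: linear_iff)
  have "psi id Z = Z" for Z by (simp add: psi_def flip: scaleR_2)
  then show "realizes id False False False id" unfolding realizes_def inv8_values using k by simp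
  have "\<forall>Z\<in>g_cx. phi_t Z = psi theta Z" "\<forall>Z\<in>g_cx. phi_23 Z = psi sigma Z" "\<forall>Z\<in>g_cx. phi_H Z = psi hflip Z"
    unfolding phi_t_def phi_23_def phi_H_def spaces_eigen
    using phi_star_psi[OF inv8_good[of True False False]] phi_star_psi[OF inv8_good[of False True False]] phi_star_psi[OF inv8_good[of False False True]]
    unfolding inv8_values by blast+
  then show "realizes phi_t True False False id" "realizes phi_23 False True False id" "realizes phi_H False False True id"
    unfolding realizes_def inv8_values using k by simp_all
qed

text \<open>On the common eigenspaces of \<open>s\<close> and \<open>t\<close> this is \<open>-1\<close> where both eigenvalues are \<open>-1\<close>, and \<open>1\<close>
  elsewhere: it corrects \<open>\<surd>(-1) \<cdot> \<surd>(-1) = -1\<close> against the factor \<open>1\<close> that \<open>s \<circ> t\<close> prescribes.\<close>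

definition mix :: "(endo \<Rightarrow> endo) \<Rightarrow> (endo \<Rightarrow> endo) \<Rightarrow> endo \<Rightarrow> endo" where
  "mix s t X = (1/2) *\<^sub>R (X + s X + t X - s (t X))"

lemma psi_psi:
  assumes s: "good_inv s" and t: "good_inv t" and c: "\<And>X. t (s X) = s (t X)"
  shows "psi s (psi t Z) = psi (s \<circ> t) (mix s t (fst Z), mix s t (snd Z))"
proof -
  note S = good_invD[OF s] and T = good_invD[OF t]
  have "fst (psi s (psi t Z)) = fst (psi (s \<circ> t) (mix s t (fst Z), mix s t (snd Z)))"
    unfolding psi_def mix_def fst_conv snd_conv o_apply S(7-10) T(7-10) S(2) T(2) c
    by (rule endo_eqI) (simp add: blinfun.bilinear_simps inner_simps field_simps)
  moreover have "snd (psi s (psi t Z)) = snd (psi (s \<circ> t) (mix s t (fst Z), mix s t (snd Z)))"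
    unfolding psi_def mix_def fst_conv snd_conv o_apply S(7-10) T(7-10) S(2) T(2) c
    by (rule endo_eqI) (simp add: blinfun.bilinear_simps inner_simps field_simps)
  ultimately show ?thesis by (rule prod_eqI)
qed

lemma mix_mix:
  assumes s: "good_inv s" and t: "good_inv t" and c: "\<And>X. t (s X) = s (t X)"
  shows "mix s t (mix s t X) = X"
proof -
  note S = good_invD[OF s] and T = good_invD[OF t]
  show ?thesis unfolding mix_def S(7-10) T(7-10) S(2) T(2) c
    by (rule endo_eqI) (simp add: blinfun.bilinear_simps inner_simps field_simps S(2) T(2))
qed

lemma psi_g_cx: "good_inv s \<Longrightarrow> Z \<in> g_cx \<Longrightarrow> psi s Z \<in> g_cx"
  by (simp add: psi_def g_cx_iff sl3O_closed good_invD)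

lemma realizes_compose:
  assumes p: "realizes \<psi> a b c id" and q: "realizes \<phi> a' b' c' \<kappa>"
  shows "realizes (\<psi> \<circ> \<phi>) (a \<noteq> a') (b \<noteq> b') (c \<noteq> c') (mix (inv8 a b c) (inv8 a' b' c') \<circ> \<kappa>)"
proof -
  let ?s = "inv8 a b c" and ?t = "inv8 a' b' c'"
  let ?K = "mix ?s ?t"
  note s = inv8_good[of a b c] and t = inv8_good[of a' b' c']
  note S = good_invD[OF s] and T = good_invD[OF t]
  have com: "?t (?s X) = ?s (?t X)" for X by (rule inv8_commute)
  have k: "linear \<kappa>" "\<And>X. \<kappa> (\<kappa> X) = X" "\<And>a b c X. \<kappa> (inv8 a b c X) = inv8 a b c (\<kappa> X)"
    "\<And>X. X \<in> sl3O \<Longrightarrow> \<kappa> X \<in> sl3O" "\<And>Z. Z \<in> g_cx \<Longrightarrow> \<phi> Z = psi ?t (\<kappa> (fst Z), \<kappa> (snd Z))"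
    using q unfolding realizes_def by blast+
  have p': "\<And>Z. Z \<in> g_cx \<Longrightarrow> \<psi> Z = psi ?s Z" using p unfolding realizes_def by simp
  have st: "?s \<circ> ?t = inv8 (a \<noteq> a') (b \<noteq> b') (c \<noteq> c')" by (rule ext) (simp add: inv8_compose)
  have K: "linear ?K" unfolding mix_def linear_iff by (simp add: S(7-9) T(7-9) algebra_simps)
  have Ki: "?K (inv8 x y z X) = inv8 x y z (?K X)" for x y z X
  proof -
    note I = good_invD[OF inv8_good[of x y z]]
    show ?thesis unfolding mix_def I(7-9) inv8_commute[of a b c x y z] inv8_commute[of a' b' c' x y z] by (rule refl)
  qed
  have Kk: "?K (\<kappa> X) = \<kappa> (?K X)" for X
    unfolding mix_def k(3) linear_scale[OF k(1)] linear_diff[OF k(1)] linear_add[OF k(1)] by (rule refl)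
  have K0: "?K X \<in> sl3O" if "X \<in> sl3O" for X unfolding mix_def using that by (simp add: sl3O_closed S(6) T(6))
  have "(\<psi> \<circ> \<phi>) Z = psi (?s \<circ> ?t) (?K (\<kappa> (fst Z)), ?K (\<kappa> (snd Z)))" if Z: "Z \<in> g_cx" for Z
  proof -
    have kz: "(\<kappa> (fst Z), \<kappa> (snd Z)) \<in> g_cx" using Z k(4) by (simp add: g_cx_iff)
    show ?thesis unfolding o_apply[of \<psi>] k(5)[OF Z] p'[OF psi_g_cx[OF t kz]] psi_psi[OF s t com] fst_conv snd_conv ..
  qed
  moreover have "(?K \<circ> \<kappa>) ((?K \<circ> \<kappa>) X) = X" for X
    unfolding o_apply Kk k(2) mix_mix[OF s t com] by (rule refl)
  ultimately show ?thesis unfolding realizes_def st using linear_compose[OF k(1) K] Ki k(3,4) K0 by simp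
qed

text \<open>The sign correction \<open>\<kappa>\<close> permutes the real form, so it disappears from the image.  If \<open>\<phi> (X + \<surd>(-1) Y)\<close>
  lies in the twisted form, then \<open>\<kappa> Y\<close> is both even and odd for the involution, whence \<open>Y = 0\<close>; and \<open>\<phi> X\<close> is
  compact exactly if \<open>\<theta>\<close> agrees with the involution on \<open>\<kappa> X\<close>, equivalently on \<open>X\<close>.\<close>

lemma realized_spaces:
  assumes r: "realizes \<phi> a b c \<kappa>"
  shows "g' \<phi> = twisted (inv8 a b c)" "P_sub \<phi> = real_embed ` fixed (inv8 a b c)"
    "g'_c \<phi> = {Z \<in> twisted (inv8 a b c). dagger Z = - Z}"
    "preimage_c \<phi> = real_embed ` fixed (inv8 (\<not> a) b c)"
proof -
  let ?s = "inv8 a b c"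
  note S = good_invD[OF inv8_good[of a b c]]
  have k: "linear \<kappa>" "\<And>X. \<kappa> (\<kappa> X) = X" "\<And>a b c X. \<kappa> (inv8 a b c X) = inv8 a b c (\<kappa> X)"
    "\<And>X. X \<in> sl3O \<Longrightarrow> \<kappa> X \<in> sl3O" "\<And>Z. Z \<in> g_cx \<Longrightarrow> \<phi> Z = psi ?s (\<kappa> (fst Z), \<kappa> (snd Z))"
    using r unfolding realizes_def by blast+
  have k0: "\<kappa> 0 = 0" by (rule linear_0[OF k(1)])
  have half: "(1/2) *\<^sub>R (X + X) = X" for X :: endo by (simp flip: scaleR_2)
  have re: "\<phi> (real_embed X) = ((1/2) *\<^sub>R (\<kappa> X + ?s (\<kappa> X)), (1/2) *\<^sub>R (\<kappa> X - ?s (\<kappa> X)))" if "X \<in> sl3O" for X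
  proof -
    have "real_embed X \<in> g_cx" using that by (simp add: g_cx_iff real_embed_def sl3O_closed)
    from k(5)[OF this] show ?thesis by (simp add: psi_def real_embed_def k0 S(11))
  qed
  show g: "g' \<phi> = twisted ?s"
  proof (intro equalityI subsetI)
    fix Z assume "Z \<in> g' \<phi>"
    then obtain X where X: "X \<in> sl3O" "Z = \<phi> (real_embed X)" unfolding g'_def g_re_def by blast
    show "Z \<in> twisted ?s" unfolding X(2) re[OF X(1)] twisted_def g_cx_iff
      using k(4)[OF X(1)] by (simp add: S sl3O_closed algebra_simps)
  next
    fix Z assume "Z \<in> twisted ?s"
    then have Z: "fst Z \<in> sl3O" "snd Z \<in> sl3O" "?s (fst Z) = fst Z" "?s (snd Z) = - snd Z"
      unfolding twisted_def g_cx_iff by auto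
    let ?X = "\<kappa> (fst Z + snd Z)"
    have X: "?X \<in> sl3O" by (intro k(4) sl3O_closed(1) Z(1,2))
    have "\<phi> (real_embed ?X) = Z" unfolding re[OF X] k(2) by (rule prod_eqI) (simp_all add: S(7) Z(3,4) half)
    then show "Z \<in> g' \<phi>" unfolding g'_def g_re_def using X by (metis image_eqI)
  qed
  show P: "P_sub \<phi> = real_embed ` fixed ?s"
    unfolding P_sub_def g twisted_def g_re_def fixed_def
    by (auto simp: g_cx_iff real_embed_def S(11) sl3O_closed(5))
  show gc: "g'_c \<phi> = {Z \<in> twisted ?s. dagger Z = - Z}"
  proof -
    have "Z \<in> R_space \<times> B_space \<longleftrightarrow> dagger Z = - Z" if "Z \<in> twisted ?s" for Z
      using that unfolding twisted_def spaces_eigen g_cx_iff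
      by (cases Z) (auto simp: dagger_def theta_def minus_equation_iff)
    then show ?thesis unfolding g'_c_def g by blast
  qed
  have t: "inv8 (\<not> a) b c X = theta (?s X)" for X
    using inv8_compose[of True False False a b c X] by (simp add: inv8_values)
  have ts: "?s (theta X) = theta (?s X)" for X by (rule S(5))
  have th: "theta (X + Y) = theta X + theta Y" "theta (X - Y) = theta X - theta Y" "theta (r *\<^sub>R X) = r *\<^sub>R theta X" for X Y r
    using linear_add[OF theta_linear] linear_diff[OF theta_linear] linear_scale[OF theta_linear] by auto
  have dag: "dagger Z = - Z \<longleftrightarrow> theta (fst Z) = fst Z \<and> theta (snd Z) = - snd Z" for Z
    by (auto simp: dagger_def theta_def prod_eq_iff minus_equation_iff)
  have cr: "X \<in> sl3O \<Longrightarrow> \<phi> (real_embed X) \<in> g'_c \<phi> \<longleftrightarrow> theta (?s X) = X" for X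
  proof -
    assume X: "X \<in> sl3O"
    let ?Y = "\<kappa> X"
    have "\<phi> (real_embed X) \<in> twisted ?s" unfolding g[symmetric] g'_def g_re_def using X by blast
    then have "\<phi> (real_embed X) \<in> g'_c \<phi> \<longleftrightarrow>
      theta ((1/2) *\<^sub>R (?Y + ?s ?Y)) = (1/2) *\<^sub>R (?Y + ?s ?Y) \<and> theta ((1/2) *\<^sub>R (?Y - ?s ?Y)) = - ((1/2) *\<^sub>R (?Y - ?s ?Y))"
      unfolding gc mem_Collect_eq dag re[OF X] fst_conv snd_conv by blast
    also have "\<dots> \<longleftrightarrow> theta (?s ?Y) = ?Y"
    proof
      assume *: "theta ((1/2) *\<^sub>R (?Y + ?s ?Y)) = (1/2) *\<^sub>R (?Y + ?s ?Y) \<and> theta ((1/2) *\<^sub>R (?Y - ?s ?Y)) = - ((1/2) *\<^sub>R (?Y - ?s ?Y))"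
      have "theta (?s ?Y) = theta ((1/2) *\<^sub>R (?Y + ?s ?Y)) - theta ((1/2) *\<^sub>R (?Y - ?s ?Y))"
        unfolding th by (simp flip: scaleR_add_left add: scaleR_add_right scaleR_diff_right)
      also have "\<dots> = (1/2) *\<^sub>R (?Y + ?s ?Y) - (- ((1/2) *\<^sub>R (?Y - ?s ?Y)))" using * by simp
      also have "\<dots> = ?Y" by (simp flip: scaleR_add_left add: scaleR_add_right scaleR_diff_right)
      finally show "theta (?s ?Y) = ?Y" .
    next
      assume *: "theta (?s ?Y) = ?Y"
      have "theta ?Y = ?s ?Y" using arg_cong[OF *, of theta] involutive(1)[of "?s ?Y"] by simp
      then show "theta ((1/2) *\<^sub>R (?Y + ?s ?Y)) = (1/2) *\<^sub>R (?Y + ?s ?Y) \<and> theta ((1/2) *\<^sub>R (?Y - ?s ?Y)) = - ((1/2) *\<^sub>R (?Y - ?s ?Y))"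
        unfolding th using * by (simp add: algebra_simps)
    qed
    also have "\<dots> \<longleftrightarrow> theta (?s X) = X"
      using k(3)[of "\<not> a" b c X] k(2) unfolding t by metis
    finally show "\<phi> (real_embed X) \<in> g'_c \<phi> \<longleftrightarrow> theta (?s X) = X" .
  qed
  show "preimage_c \<phi> = real_embed ` fixed (inv8 (\<not> a) b c)"
  proof (intro equalityI subsetI)
    fix Z assume "Z \<in> preimage_c \<phi>"
    then have Z: "Z \<in> g_cx" "\<phi> Z \<in> g'_c \<phi>" unfolding preimage_c_def by auto
    let ?X = "\<kappa> (fst Z)" and ?Y = "\<kappa> (snd Z)"
    have "\<phi> Z \<in> twisted ?s" using Z(2) unfolding gc by blast
    then have e: "?s (fst (psi ?s (?X, ?Y))) = fst (psi ?s (?X, ?Y))" "?s (snd (psi ?s (?X, ?Y))) = - snd (psi ?s (?X, ?Y))"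
      unfolding k(5)[OF Z(1)] twisted_def by auto
    have n: "V = 0" if "V = - V" for V :: endo using that
      by (metis add.right_inverse scaleR_2 scaleR_eq_0_iff zero_neq_numeral)
    have "?Y - ?s ?Y = 0" "?Y + ?s ?Y = 0" 
    proof -
      have "?s (fst (psi ?s (?X, ?Y))) - fst (psi ?s (?X, ?Y)) = ?Y - ?s ?Y"
        unfolding psi_def fst_conv snd_conv S(7-9) S(2)
        by (rule endo_eqI) (simp add: blinfun.bilinear_simps inner_simps field_simps)
      then show "?Y - ?s ?Y = 0" unfolding e(1) by simp
      have "?s (snd (psi ?s (?X, ?Y))) + snd (psi ?s (?X, ?Y)) = ?Y + ?s ?Y"
        unfolding psi_def fst_conv snd_conv S(7-9) S(2)
        by (rule endo_eqI) (simp add: blinfun.bilinear_simps inner_simps field_simps)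
      then show "?Y + ?s ?Y = 0" unfolding e(2) by simp
    qed
    then have "?Y = 0" using n by (metis eq_neg_iff_add_eq_0 right_minus_eq)
    then have "snd Z = 0" using k(2)[of "snd Z"] k0 by simp
    then have "Z = real_embed (fst Z)" by (simp add: real_embed_def prod_eq_iff)
    moreover have f: "fst Z \<in> sl3O" using Z(1) by (simp add: g_cx_iff)
    ultimately have "theta (?s (fst Z)) = fst Z" using Z(2) cr by metis
    then show "Z \<in> real_embed ` fixed (inv8 (\<not> a) b c)"
      unfolding fixed_def t using \<open>Z = real_embed (fst Z)\<close> f by blast
  next
    fix Z assume "Z \<in> real_embed ` fixed (inv8 (\<not> a) b c)"
    then obtain X where X: "X \<in> sl3O" "theta (?s X) = X" "Z = real_embed X" unfolding fixed_def t by blast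
    then have "\<phi> Z \<in> g'_c \<phi>" using cr by metis
    moreover have "Z \<in> g_cx" unfolding X(3) using X(1) by (simp add: g_cx_iff real_embed_def sl3O_closed)
    ultimately show "Z \<in> preimage_c \<phi>" unfolding preimage_c_def by blast
  qed
qed

lemma fixed_embed: "real_subalgebra (real_embed ` fixed (inv8 a b c))" "real_embed ` fixed (inv8 a b c) \<subseteq> g_re"
proof -
  note f = fixed_facts[OF inv8_good[of a b c]]
  show "real_subalgebra (real_embed ` fixed (inv8 a b c))"
    using complexify_real_form(1)[OF f(1)] f(2) by blast
  show "real_embed ` fixed (inv8 a b c) \<subseteq> g_re" unfolding g_re_def using f(3) by blast
qed

lemma realized_facts:
  assumes r: "realizes \<phi> a b c \<kappa>"
  shows "is_real_form g_cx (g' \<phi>)" "maximal_compact_subalgebra (g' \<phi>) (g'_c \<phi>)"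
    "real_subalgebra (P_sub \<phi>)" "P_sub \<phi> \<subseteq> g_re" "real_subalgebra (preimage_c \<phi>)" "preimage_c \<phi> \<subseteq> g_re"
    "signature (g' \<phi>) (P_sub \<phi>) = signature g_re (P_sub \<phi>)"
  unfolding realized_spaces[OF r]
  by (rule twisted_facts(3)[OF inv8_good] maximal_compact_dagger[OF twisted_facts(1)[OF inv8_good] twisted_centreless twisted_facts(2)[OF inv8_good]]
      fixed_embed signature_P(1)[THEN trans, OF signature_P(2)[symmetric]])+

section \<open>The subalgebras of type \<open>F\<^sub>4\<close> and \<open>C\<^sub>4\<close>\<close>

lemma op_fixed:
  assumes c: "list_all cubic_ok Ls" and f: "list_all (\<lambda>L. list_equiv (g L) L) Ls"
    and g: "\<And>L. in_range L \<Longrightarrow> on_pairs s (op_of L) = op_of (g L)"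
  shows "list_all (\<lambda>L. in_range L \<and> op_of L \<in> fixed s \<times> fixed s) Ls"
  unfolding list_all_iff
proof (intro ballI conjI)
  fix L assume L: "L \<in> set Ls"
  have k: "cubic_ok L" "list_equiv (g L) L" using c f L unfolding list_all_iff by blast+
  show r: "in_range L" by (rule cubic_ok_g_cx(1)[OF k(1)])
  have "on_pairs s (op_of L) = op_of L" unfolding g[OF r] by (rule list_val_equiv[OF k(2)])
  then have "s (fst (op_of L)) = fst (op_of L)" "s (snd (op_of L)) = snd (op_of L)"
    unfolding on_pairs_def by (metis fst_conv, metis snd_conv)
  then show "op_of L \<in> fixed s \<times> fixed s"
    using cubic_ok_g_cx(2)[OF k(1)] unfolding fixed_def g_cx_iff mem_Times_iff by blast
qed

lemma theta_sigma_op: "in_range L \<Longrightarrow> on_pairs (inv8 True True False) (op_of L) = op_of (theta_list (sign_list sigma_weight L))"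
  and theta_flip_op: "in_range L \<Longrightarrow> on_pairs (inv8 True False True) (op_of L) = op_of (theta_list (sign_list flip_weight L))"
  and sigma_flip_op: "in_range L \<Longrightarrow> on_pairs (inv8 False True True) (op_of L) = op_of (sign_list sigma_weight (sign_list flip_weight L))"
  and theta_sigma_flip_op: "in_range L \<Longrightarrow> on_pairs (inv8 True True True) (op_of L) = op_of (theta_list (sign_list sigma_weight (sign_list flip_weight L)))"
  by (simp_all add: theta_op[symmetric] sigma_op[symmetric] flip_op[symmetric] sign_list_range on_pairs_def inv8_def)

lemma fixed_type:
  assumes ch: "chevalley_ok A es fs hs" and hr: "list_all in_range hs" and sp: "spans_ok (es @ fs) ws ps"
    and c: "list_all cubic_ok (es @ fs)" and f: "list_all (\<lambda>L. list_equiv (g L) L) (es @ fs)"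
    and g: "\<And>L. in_range L \<Longrightarrow> on_pairs (inv8 x y z) (op_of L) = op_of (g L)"
    and d: "dim (fixed (inv8 x y z)) \<le> length ps" and A: "\<And>i. i < length A \<Longrightarrow> A ! i ! i = 2"
  shows "centreless (real_embed ` fixed (inv8 x y z))" "real_form_of_type A (real_embed ` fixed (inv8 x y z))"
    "signature (real_embed ` fixed (inv8 x y z)) (real_embed ` fixed (inv8 x y z)) = (count_rot x y z, count_boost x y z)"
proof -
  note F = fixed_facts[OF inv8_good[of x y z]]
  have "has_cartan_type A (fixed (inv8 x y z) \<times> fixed (inv8 x y z))"
    by (rule cartan_typeI(1)[OF ch hr F(1-3) sp op_fixed[OF c f g] d])
  note t = type_centreless[OF this A F(1,2,4)]
  show "centreless (real_embed ` fixed (inv8 x y z))" by (rule t(2))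
  show "real_form_of_type A (real_embed ` fixed (inv8 x y z))" by (rule t(3))
  show "signature (real_embed ` fixed (inv8 x y z)) (real_embed ` fixed (inv8 x y z)) = (count_rot x y z, count_boost x y z)"
    using signature_embed[OF t(4,2) embed_dag_closed[OF F(1,3,4)] F(1,3,4) subset_refl] unfolding dim_theta_parts .
qed

lemma in_range_lists: "list_all in_range F4_h" "list_all in_range F4s_h" "list_all in_range C4h_h" "list_all in_range C4hs_h"
  "list_all in_range A5h_h" "list_all in_range A5hs_h" "list_all in_range A1h_h" "list_all in_range A1hs_h"
  by (simp_all add: F4_h_def F4s_h_def C4h_h_def C4hs_h_def A5h_h_def A5hs_h_def A1h_h_def A1hs_h_def in_range_def in_idx_def)

lemma F4_compact: "compact_real_form_of_type cartan_F4 (real_embed ` fixed (inv8 True False False))"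
proof -
  let ?s = "inv8 True False False"
  note F = fixed_facts[OF inv8_good[of True False False]]
  have "dim (fixed ?s) \<le> length F4_pivots" unfolding dim_fixed counts by (simp add: F4_pivots_def)
  note t = fixed_type[OF F4_chevalley in_range_lists(1) F4_spans F4_cubic F4_fixed theta_op[folded inv8_values(2)] this cartan_diagonal(4)]
  have "killing (real_embed ` fixed ?s) x x < 0" if x: "x \<in> real_embed ` fixed ?s" "x \<noteq> 0" for x
  proof (rule killing_dagger(1)[OF fixed_embed(1) t(1) embed_dag_closed[OF F(1,3,4)] x])
    show "dagger x = - x" using x(1) unfolding inv8_values fixed_def using dagger_embed(1) by blast
  qed
  then show ?thesis unfolding compact_real_form_of_type_def using t(2) by blast
qed

lemma F4_split:
  "real_form_of_type cartan_F4 (real_embed ` fixed (inv8 True True False))"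
  "signature (real_embed ` fixed (inv8 True True False)) (real_embed ` fixed (inv8 True True False)) = (36, 16)"
proof -
  have "dim (fixed (inv8 True True False)) \<le> length F4s_pivots" unfolding dim_fixed counts by (simp add: F4s_pivots_def)
  note t = fixed_type[OF F4s_chevalley in_range_lists(2) F4s_spans F4s_cubic F4s_fixed theta_sigma_op this cartan_diagonal(4)]
  show "real_form_of_type cartan_F4 (real_embed ` fixed (inv8 True True False))"
    "signature (real_embed ` fixed (inv8 True True False)) (real_embed ` fixed (inv8 True True False)) = (36, 16)"
    using t(2,3) unfolding counts by auto
qed

lemma C4_first:
  "real_form_of_type cartan_C4 (real_embed ` fixed (inv8 True False True))"
  "signature (real_embed ` fixed (inv8 True False True)) (real_embed ` fixed (inv8 True False True)) = (24, 12)"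
proof -
  have "dim (fixed (inv8 True False True)) \<le> length C4h_pivots" unfolding dim_fixed counts by (simp add: C4h_pivots_def)
  note t = fixed_type[OF C4h_chevalley in_range_lists(3) C4h_spans C4h_cubic C4h_fixed theta_flip_op this cartan_diagonal(3)]
  show "real_form_of_type cartan_C4 (real_embed ` fixed (inv8 True False True))"
    "signature (real_embed ` fixed (inv8 True False True)) (real_embed ` fixed (inv8 True False True)) = (24, 12)"
    using t(2,3) unfolding counts by auto
qed

lemma C4_second:
  "real_form_of_type cartan_C4 (real_embed ` fixed (inv8 True True True))"
  "signature (real_embed ` fixed (inv8 True True True)) (real_embed ` fixed (inv8 True True True)) = (24, 12)"
proof -
  have "dim (fixed (inv8 True True True)) \<le> length C4hs_pivots" unfolding dim_fixed counts by (simp add: C4hs_pivots_def)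
  note t = fixed_type[OF C4hs_chevalley in_range_lists(4) C4hs_spans C4hs_cubic C4hs_fixed theta_sigma_flip_op this cartan_diagonal(3)]
  show "real_form_of_type cartan_C4 (real_embed ` fixed (inv8 True True True))"
    "signature (real_embed ` fixed (inv8 True True True)) (real_embed ` fixed (inv8 True True True)) = (24, 12)"
    using t(2,3) unfolding counts by auto
qed

lemma real_embed_inj: "real_embed ` U = real_embed ` V \<longleftrightarrow> U = V"
  by (rule inj_image_eq_iff) (simp add: inj_on_def real_embed_def)

lemma Btx_eigen: "theta (dot Btx Two) = - dot Btx Two" "sigma (dot Btx Two) = - dot Btx Two" "hflip (dot Btx Two) = dot Btx Two"
  "dot Btx Two \<noteq> 0" "dot Btx Two \<in> sl3O"
proof -
  have l: "(Btx, Two) \<in> basis_labels" by (simp add: basis_label_iff)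
  show "theta (dot Btx Two) = - dot Btx Two" using theta_dot[OF l] by (simp add: boost_label_iff)
  show "sigma (dot Btx Two) = - dot Btx Two" using sigma_dot[OF l] by (simp add: T23_label_iff)
  show "hflip (dot Btx Two) = dot Btx Two" using hflip_dot[OF l] by (simp add: Hperp_label_iff)
  show "dot Btx Two \<in> sl3O" by (rule dot_in_sl3O[OF l])
  have "case_prod dot (Btx, Two) \<in> case_prod dot ` basis_labels" using l by blast
  then show "dot Btx Two \<noteq> 0" using generators_independent(2) dependent_zero[of "case_prod dot ` basis_labels"]
    unfolding case_prod_conv by metis
qed

lemma Btx_neg: "dot Btx Two \<noteq> - dot Btx Two"
  using Btx_eigen(4) by (metis add.right_inverse scaleR_2 scaleR_eq_0_iff zero_neq_numeral)

lemma C4_different: "real_embed ` fixed (inv8 True False True) \<noteq> real_embed ` fixed (inv8 True True True)"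
proof -
  let ?X = "dot Btx Two"
  have th: "theta (- X) = - theta X" "sigma (- X) = - sigma X" for X
    using linear_neg[OF theta_linear] linear_neg[OF sigma_linear] by blast+
  have "?X \<in> fixed (inv8 True True True)" unfolding fixed_def inv8_def by (simp add: Btx_eigen th)
  moreover have "?X \<notin> fixed (inv8 True False True)" unfolding fixed_def inv8_def using Btx_neg by (simp add: Btx_eigen th)
  ultimately show ?thesis unfolding real_embed_inj by blast
qed

section \<open>Direct sums of subspaces and of ideals\<close>

lemma dim_disjoint_sum:
  fixes U V F :: "'a::real_vector set"
  assumes F: "subspace F" "finite C" "F \<subseteq> span C" and U: "subspace U" "U \<subseteq> F" and V: "subspace V" "V \<subseteq> F"
    and disj: "U \<inter> V = {0}"
  shows "dim U + dim V \<le> dim F" "dim F \<le> dim U + dim V \<Longrightarrow> F = set_sum U V"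
    "F = set_sum U V \<Longrightarrow> dim F = dim U + dim V"
proof -
  obtain bU where bU: "independent bU" "span bU = U" "finite bU" "bU \<subseteq> U" "card bU = dim U"
    by (rule finite_basis[OF U(1) F(2) subset_trans[OF U(2) F(3)]])
  obtain bV where bV: "independent bV" "span bV = V" "finite bV" "bV \<subseteq> V" "card bV = dim V"
    by (rule finite_basis[OF V(1) F(2) subset_trans[OF V(2) F(3)]])
  have n0: "0 \<notin> bU" using bU(1) dependent_zero by metis
  have "bU \<inter> bV \<subseteq> {0}" using Int_mono[OF bU(4) bV(4)] unfolding disj .
  then have d: "bU \<inter> bV = {}" using n0 by blast
  have fin: "finite (bU \<union> bV)" using bU(3) bV(3) by simp
  have ind: "independent (bU \<union> bV)"
  proof
    assume "dependent (bU \<union> bV)"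
    then obtain u where u: "\<exists>v\<in>bU \<union> bV. u v \<noteq> 0" "(\<Sum>v\<in>bU \<union> bV. u v *\<^sub>R v) = 0"
      unfolding dependent_finite[OF fin] by blast
    let ?x = "\<Sum>v\<in>bU. u v *\<^sub>R v" and ?y = "\<Sum>v\<in>bV. u v *\<^sub>R v"
    have xy: "?x + ?y = 0" using u(2) sum.union_disjoint[OF bU(3) bV(3) d] by metis
    have x: "?x \<in> U" by (intro subspace_sum[OF U(1)] subspace_scale[OF U(1)]) (use bU(4) in blast)
    have y: "?y \<in> V" by (intro subspace_sum[OF V(1)] subspace_scale[OF V(1)]) (use bV(4) in blast)
    have "?x = - ?y" using xy by (simp add: eq_neg_iff_add_eq_0)
    then have "?x \<in> V" using subspace_neg[OF V(1) y] by simp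
    then have x0: "?x = 0" using x disj by blast
    then have y0: "?y = 0" using xy by simp
    have "\<forall>v\<in>bU. u v = 0" using bU(1) x0 unfolding dependent_finite[OF bU(3)] by blast
    moreover have "\<forall>v\<in>bV. u v = 0" using bV(1) y0 unfolding dependent_finite[OF bV(3)] by blast
    ultimately show False using u(1) by blast
  qed
  have sub: "bU \<union> bV \<subseteq> F" using bU(4) bV(4) U(2) V(2) by blast
  have c: "card (bU \<union> bV) = dim U + dim V" using card_Un_disjoint[OF bU(3) bV(3) d] bU(5) bV(5) by simp
  show "dim U + dim V \<le> dim F" using dim_independent_le(2)[OF F(2,3,1) ind sub] c by simp
  have s: "span (bU \<union> bV) = set_sum U V" unfolding span_Un bU(2) bV(2) set_sum_def by blast
  show "F = set_sum U V \<Longrightarrow> dim F = dim U + dim V"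
    using dim_span_eq_card_independent[OF ind] c unfolding s by simp
  assume "dim F \<le> dim U + dim V"
  then have "span (bU \<union> bV) = F" using independent_full_span[OF F(2,3,1) ind sub] c by simp
  then show "F = set_sum U V" unfolding s by simp
qed

lemma embed_lie_direct_sum:
  fixes F U V :: "('v::real_normed_vector \<Rightarrow>\<^sub>L 'v) set"
  assumes U: "subspace U" "\<forall>X\<in>U. \<forall>Y\<in>U. commutator X Y \<in> U"
    and V: "subspace V" "\<forall>X\<in>V. \<forall>Y\<in>V. commutator X Y \<in> V"
    and disj: "U \<inter> V = {0}" and sum: "F = set_sum U V" and com: "\<forall>X\<in>U. \<forall>Y\<in>V. commutator X Y = 0"
  shows "lie_direct_sum (real_embed ` F) (real_embed ` U) (real_embed ` V)"
  unfolding lie_direct_sum_def direct_sum_def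
proof (intro conjI ballI)
  have add: "real_embed (X + Y) = real_embed X + real_embed Y" for X Y :: "'v \<Rightarrow>\<^sub>L 'v"
    by (rule linear_add[OF real_embed_linear])
  have inj: "inj (real_embed :: ('v \<Rightarrow>\<^sub>L 'v) \<Rightarrow> _)" by (simp add: inj_on_def real_embed_def)
  show "subspace (real_embed ` U)" "subspace (real_embed ` V)"
    by (intro linear_subspace_image[OF real_embed_linear] U(1) V(1))+
  show "real_embed ` U \<inter> real_embed ` V = {0}"
    unfolding image_Int[OF inj, symmetric] disj by (simp add: real_embed_def zero_prod_def)
  show "real_embed ` F = set_sum (real_embed ` U) (real_embed ` V)"
  proof (intro equalityI subsetI)
    fix Z assume "Z \<in> real_embed ` F"
    then obtain l s where "l \<in> U" "s \<in> V" "Z = real_embed l + real_embed s"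
      unfolding sum set_sum_def using add by blast
    then show "Z \<in> set_sum (real_embed ` U) (real_embed ` V)" unfolding set_sum_def by blast
  next
    fix Z assume "Z \<in> set_sum (real_embed ` U) (real_embed ` V)"
    then obtain l s where "l \<in> U" "s \<in> V" "Z = real_embed (l + s)"
      unfolding set_sum_def add by blast
    then show "Z \<in> real_embed ` F" unfolding sum set_sum_def by blast
  qed
  show "real_subalgebra (real_embed ` U)" using complexify_real_form(1)[OF U(1)] U(2) by blast
  show "real_subalgebra (real_embed ` V)" using complexify_real_form(1)[OF V(1)] V(2) by blast
  fix u v assume "u \<in> real_embed ` U" "v \<in> real_embed ` V"
  then obtain X Y where "X \<in> U" "Y \<in> V" "u = (X, 0)" "v = (Y, 0)" unfolding real_embed_def by blast
  then show "cbracket u v = 0" using com by (simp add: cbracket_def commutator_simps zero_prod_def)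
qed

lemma span_commutator:
  assumes "\<And>x y. x \<in> G \<Longrightarrow> y \<in> G \<Longrightarrow> commutator x y \<in> span G"
  shows "\<forall>X\<in>span G. \<forall>Y\<in>span G. commutator X Y \<in> span G"
proof -
  have lin: "linear (\<lambda>Y. commutator X Y)" "linear (\<lambda>Y. commutator Y X)" for X :: "'a \<Rightarrow>\<^sub>L 'a"
    by (simp_all add: linear_iff commutator_simps)
  have 1: "commutator x Y \<in> span G" if "x \<in> G" "Y \<in> span G" for x Y
  proof -
    have "subspace {Y. commutator x Y \<in> span G}" using linear_subspace_vimage[OF lin(1) subspace_span] by (simp add: vimage_def)
    then have "span G \<subseteq> {Y. commutator x Y \<in> span G}" using assms that(1) by (intro span_minimal) auto
    then show ?thesis using that(2) by blast
  qed
  have "commutator X Y \<in> span G" if "X \<in> span G" "Y \<in> span G" for X Y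
  proof -
    have "subspace {X. commutator X Y \<in> span G}" using linear_subspace_vimage[OF lin(2) subspace_span] by (simp add: vimage_def)
    then have "span G \<subseteq> {X. commutator X Y \<in> span G}" using 1 that(2) by (intro span_minimal) auto
    then show ?thesis using that(1) by blast
  qed
  then show ?thesis by blast
qed

section \<open>The subalgebras of type \<open>A\<^sub>1\<close>\<close>

text \<open>The relations \<open>[e, f] = h\<close>, \<open>[h, e] = 2 e\<close> of a pair of complex root vectors
  \<open>\<mp>\<alpha> X\<^sub>1 + \<surd>(-1) \<beta> X\<^sub>2\<close> say how the real elements multiply.\<close>

lemma root_pair_products:
  assumes g: "\<alpha> \<noteq> 0" "\<beta> \<noteq> 0" "\<gamma> \<noteq> 0"
    and ef: "cbracket (- (\<alpha> *\<^sub>R X1), \<beta> *\<^sub>R X2) (\<alpha> *\<^sub>R X1, \<beta> *\<^sub>R X2) = (0, \<gamma> *\<^sub>R X3)"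
    and he: "cbracket (0, \<gamma> *\<^sub>R X3) (- (\<alpha> *\<^sub>R X1), \<beta> *\<^sub>R X2) = 2 *\<^sub>R (- (\<alpha> *\<^sub>R X1), \<beta> *\<^sub>R X2)"
  shows "commutator X1 X2 \<in> span {X1, X2, X3}" "commutator X3 X1 \<in> span {X1, X2, X3}" "commutator X3 X2 \<in> span {X1, X2, X3}"
proof -
  have scale: "V \<in> span {X1, X2, X3}" if "r *\<^sub>R V = W" "r \<noteq> 0" "W \<in> span {X1, X2, X3}" for r :: real and V W
  proof -
    have "V = (1 / r) *\<^sub>R W" using that(1,2) by auto
    then show ?thesis using span_scale[OF that(3)] by simp
  qed
  have b: "X1 \<in> span {X1, X2, X3}" "X2 \<in> span {X1, X2, X3}" "X3 \<in> span {X1, X2, X3}" by (simp_all add: span_base)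
  have a: "commutator X2 X1 = - commutator X1 X2" by (rule commutator_anti)
  have "- (2 * \<alpha> * \<beta>) *\<^sub>R commutator X1 X2 = \<gamma> *\<^sub>R X3"
    using arg_cong[OF ef, of snd] unfolding cbracket_def fst_conv snd_conv commutator_simps a
    by (simp flip: scaleR_add_left scaleR_minus_left add: algebra_simps)
  then show "commutator X1 X2 \<in> span {X1, X2, X3}" by (rule scale) (use g b(3) span_scale in auto)
  have "- (\<gamma> * \<beta>) *\<^sub>R commutator X3 X2 = - (2 * \<alpha>) *\<^sub>R X1"
    using arg_cong[OF he, of fst] unfolding cbracket_def fst_conv snd_conv commutator_simps by (simp add: algebra_simps)
  then show "commutator X3 X2 \<in> span {X1, X2, X3}" by (rule scale) (use g b(1) in \<open>auto intro!: span_neg span_scale\<close>)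
  have "- (\<gamma> * \<alpha>) *\<^sub>R commutator X3 X1 = (2 * \<beta>) *\<^sub>R X2"
    using arg_cong[OF he, of snd] unfolding cbracket_def fst_conv snd_conv commutator_simps by (simp add: algebra_simps)
  then show "commutator X3 X1 \<in> span {X1, X2, X3}" by (rule scale) (use g b(2) span_scale in auto)
qed

lemma su2_type:
  assumes ch: "chevalley_ok cartan_A1 es fs hs" and hr: "list_all in_range hs" and sp: "spans_ok (es @ fs) ws ps"
    and c: "list_all cubic_ok (es @ fs)" and ps: "length ps = 3"
    and g: "\<alpha> \<noteq> 0" "\<beta> \<noteq> 0" "\<gamma> \<noteq> 0"
    and e: "op_of (es ! 0) = (- (\<alpha> *\<^sub>R X1), \<beta> *\<^sub>R X2)" and f: "op_of (fs ! 0) = (\<alpha> *\<^sub>R X1, \<beta> *\<^sub>R X2)"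
    and h: "op_of (hs ! 0) = (0, \<gamma> *\<^sub>R X3)"
    and X: "\<And>X. X \<in> {X1, X2, X3} \<Longrightarrow> X \<in> sl3O \<and> theta X = X"
  shows "span {X1, X2, X3} \<subseteq> sl3O" "\<forall>X\<in>span {X1, X2, X3}. theta X = X" "dim (span {X1, X2, X3}) = 3"
    "centreless (real_embed ` span {X1, X2, X3})" "\<forall>X\<in>span {X1, X2, X3}. \<forall>Y\<in>span {X1, X2, X3}. commutator X Y \<in> span {X1, X2, X3}"
    "compact_real_form_of_type cartan_A1 (real_embed ` span {X1, X2, X3})"
    "Z \<in> span {X1, X2, X3} \<times> span {X1, X2, X3} \<Longrightarrow> complex_subalgebra K \<Longrightarrow> \<forall>L\<in>set (es @ fs). op_of L \<in> K \<Longrightarrow> Z \<in> K"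
proof -
  let ?S = "span {X1, X2, X3}"
  have len: "length es = 1" "length fs = 1" "length hs = 1" and rel: "rel_ok 2 (es ! 0) (fs ! 0) (hs ! 0) (es ! 0) (fs ! 0) (hs ! 0) True"
    using ch by (simp_all add: chevalley_ok_def cartan_A1_def)
  have sets: "set es = {es ! 0}" "set fs = {fs ! 0}" "set hs = {hs ! 0}"
    using len by (auto simp: set_conv_nth)
  have r: "in_range (es ! 0)" "in_range (fs ! 0)" "in_range (hs ! 0)"
    using c hr sets cubic_ok_g_cx(1) unfolding list_all_iff by auto
  have "list_equiv (smat_bracket (es ! 0) (fs ! 0)) (hs ! 0)" "list_equiv (smat_bracket (hs ! 0) (es ! 0)) (smat_scale 2 (es ! 0))"
    using rel unfolding rel_ok_def by simp_all
  from list_val_equiv[OF this(1), of "case_prod EU"] list_val_equiv[OF this(2), of "case_prod EU"]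
  have rels: "cbracket (op_of (es ! 0)) (op_of (fs ! 0)) = op_of (hs ! 0)" "cbracket (op_of (hs ! 0)) (op_of (es ! 0)) = 2 *\<^sub>R op_of (es ! 0)"
    unfolding smat_bracket_val(1)[OF r(1,2)] smat_bracket_val(1)[OF r(3,1)] list_val_scale by simp_all
  note pr = root_pair_products[OF g rels[unfolded e f h]]
  show cl: "\<forall>X\<in>?S. \<forall>Y\<in>?S. commutator X Y \<in> ?S"
  proof (rule span_commutator)
    fix x y assume xy: "x \<in> {X1, X2, X3}" "y \<in> {X1, X2, X3}"
    have n: "commutator X2 X1 \<in> ?S" "commutator X1 X3 \<in> ?S" "commutator X2 X3 \<in> ?S"
      using pr span_neg commutator_anti by metis+
    have z: "commutator V V = 0" for V :: endo by (simp add: commutator_def)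
    show "commutator x y \<in> ?S" using xy pr n z span_zero by auto
  qed
  show S: "?S \<subseteq> sl3O" by (rule span_minimal[OF _ sl3O_subspace]) (use X in blast)
  have "?S \<subseteq> {X. theta X = X}"
    by (rule span_minimal) (use X in \<open>auto simp: subspace_def linear_add[OF theta_linear] linear_scale[OF theta_linear] linear_0[OF theta_linear]\<close>)
  then show th: "\<forall>X\<in>?S. theta X = X" by blast
  have b: "r *\<^sub>R X1 \<in> ?S" "r *\<^sub>R X2 \<in> ?S" "- (r *\<^sub>R X1) \<in> ?S" for r by (simp_all add: span_base span_scale span_neg)
  have gens: "list_all (\<lambda>L. in_range L \<and> op_of L \<in> ?S \<times> ?S) (es @ fs)"
    unfolding list_all_iff set_append sets using r e f b by simp
  have "dim ?S \<le> card {X1, X2, X3}" by (rule dim_span_le_card) simp_all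
  also have "\<dots> \<le> length ps" unfolding ps by (simp add: card_insert_if)
  finally have d: "dim ?S \<le> length ps" .
  note ct = cartan_typeI[OF ch hr subspace_span cl S sp gens d]
  show "dim ?S = 3" using ct(2) ps by simp
  have st: "star X \<in> ?S" if "X \<in> ?S" for X
  proof -
    have "star X = - X" using th that unfolding theta_def by (metis minus_equation_iff)
    then show ?thesis using that span_neg by metis
  qed
  have "?S \<times> ?S \<subseteq> K" if "complex_subalgebra K" "\<forall>L\<in>set (es @ fs). op_of L \<in> K"
    by (rule chevalley_span(2)[OF subspace_span cl S sp gens d that])
  then show "Z \<in> ?S \<times> ?S \<Longrightarrow> complex_subalgebra K \<Longrightarrow> \<forall>L\<in>set (es @ fs). op_of L \<in> K \<Longrightarrow> Z \<in> K" by blast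
  note t = type_centreless[OF ct(1) cartan_diagonal(1) subspace_span cl st]
  show tr: "centreless (real_embed ` ?S)" by (rule t(2))
  note ts = t(4)
  have rf: "real_form_of_type cartan_A1 (real_embed ` ?S)" by (rule t(3))
  have "killing (real_embed ` ?S) x x < 0" if x: "x \<in> real_embed ` ?S" "x \<noteq> 0" for x
  proof (rule killing_dagger(1)[OF ts tr embed_dag_closed[OF subspace_span S st] x])
    show "dagger x = - x" using x(1) th dagger_embed(1) by blast
  qed
  then show "compact_real_form_of_type cartan_A1 (real_embed ` ?S)" unfolding compact_real_form_of_type_def using rf by blast
qed

lemma A1h_ops:
  "op_of (A1h_e ! 0) = (- ((1/2) *\<^sub>R dot (Aq Uk) One), (1/2) *\<^sub>R dot (Aq Ukl) One)"
  "op_of (A1h_f ! 0) = ((1/2) *\<^sub>R dot (Aq Uk) One, (1/2) *\<^sub>R dot (Aq Ukl) One)"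
  "op_of (A1h_h ! 0) = (0, 1 *\<^sub>R dot (Aq Ul) One)"
  unfolding A1h_e_def A1h_f_def A1h_h_def dot_Aq pair1.simps pair2.simps
  by (simp add: prod_eq_iff, intro conjI; rule blinfun_eqI;
      simp add: EU_apply cscale_def wcoord_simps wvec_simps Rot_apply blinfun.bilinear_simps h3o_eq_iff oct_eq_iff oct_comp inner_ounit)+

lemma A1hs_ops:
  "op_of (A1hs_e ! 0) = (- ((1/6) *\<^sub>R (dot (Gq Uk) One + 2 *\<^sub>R dot (Sq Uk) One)), (-1/6) *\<^sub>R (dot (Gq Ukl) One + 2 *\<^sub>R dot (Sq Ukl) One))"
  "op_of (A1hs_f ! 0) = ((1/6) *\<^sub>R (dot (Gq Uk) One + 2 *\<^sub>R dot (Sq Uk) One), (-1/6) *\<^sub>R (dot (Gq Ukl) One + 2 *\<^sub>R dot (Sq Ukl) One))"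
  "op_of (A1hs_h ! 0) = (0, (1/3) *\<^sub>R (dot (Gq Ul) One + 2 *\<^sub>R dot (Sq Ul) One))"
  unfolding A1hs_e_def A1hs_f_def A1hs_h_def dot_Gq dot_Sq pair1.simps pair2.simps pair3.simps
  by (simp add: prod_eq_iff, intro conjI; rule blinfun_eqI;
      simp add: EU_apply cscale_def wcoord_simps wvec_simps Rot_apply blinfun.bilinear_simps h3o_eq_iff oct_eq_iff oct_comp inner_ounit algebra_simps)+

section \<open>The subalgebras of type \<open>A\<^sub>5\<close>\<close>

lemma centralizer_complex_subalgebra: "complex_subalgebra {Z. cbracket Z W = 0}"
proof -
  have lin: "cbracket (Z + Z') W = cbracket Z W + cbracket Z' W" "cbracket (r *\<^sub>R Z) W = r *\<^sub>R cbracket Z W" "cbracket 0 W = 0" for Z Z' :: "'a cend" and r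
    using linear_add[OF cbracket_linear(1)] linear_scale[OF cbracket_linear(1)] linear_0[OF cbracket_linear(1)] by blast+
  have lin2: "cbracket Z 0 = 0" for Z :: "'a cend" using linear_0[OF cbracket_linear(2)] by blast
  have "cbracket (cbracket Z Z') W = 0" if "cbracket Z W = 0" "cbracket Z' W = 0" for Z Z'
    using cbracket_jacobi[of Z Z' W] that lin2 by simp
  moreover have "cbracket (imul Z) W = 0" if "cbracket Z W = 0" for Z
    unfolding cbracket_imul that by (simp add: imul_def zero_prod_def)
  ultimately show ?thesis unfolding complex_subalgebra_def real_subalgebra_def
    by (auto simp: subspace_def lin)
qed

text \<open>The centralizer meets \<open>S\<close> in the centre of \<open>S\<close>, which is zero, so its dimension is at most \<open>38 - 3\<close>.
  The 35 root brackets found in it give equality, and \<open>F\<close> is the sum.  As \<open>\<theta>\<close> fixes \<open>S\<close> pointwise, all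
  noncompact generators of \<open>F\<close> lie in the centralizer.\<close>

lemma A5_type:
  fixes S and x y z :: bool
  defines "F \<equiv> fixed (inv8 x y z)"
  defines "L \<equiv> {X \<in> F. \<forall>Y\<in>S. commutator X Y = 0}"
  assumes ch: "chevalley_ok cartan_A5 es fs hs" and hr: "list_all in_range hs" and sp: "spans_ok (es @ fs) ws ps"
    and c: "list_all cubic_ok (es @ fs)" and f: "list_all (\<lambda>L. list_equiv (g L) L) (es @ fs)"
    and g: "\<And>L. in_range L \<Longrightarrow> on_pairs (inv8 x y z) (op_of L) = op_of (g L)" and ps: "length ps = 35"
    and com: "list_all (\<lambda>L. list_all (\<lambda>M. smat_bracket M L = []) gens) (es @ fs)" and gr: "list_all in_range gens"
    and n: "count_rot x y z = 24" "count_boost x y z = 14"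
    and S: "subspace S" "S \<subseteq> F" "dim S = 3" "\<forall>X\<in>S. theta X = X" "centreless (real_embed ` S)" "\<forall>X\<in>S. \<forall>Y\<in>S. commutator X Y \<in> S"
    and SK: "\<And>Z K. Z \<in> S \<times> S \<Longrightarrow> complex_subalgebra K \<Longrightarrow> \<forall>L\<in>set gens. op_of L \<in> K \<Longrightarrow> Z \<in> K"
  shows "lie_direct_sum (real_embed ` F) (real_embed ` L) (real_embed ` S)"
    "real_form_of_type cartan_A5 (real_embed ` L)"
    "signature (real_embed ` L) (real_embed ` L) = (21, 14)"
    "{X \<in> F. theta X = - X} \<subseteq> L"
proof -
  note FF = fixed_facts[OF inv8_good[of x y z], folded F_def]
  have dF: "dim F = 38" unfolding F_def dim_fixed n by simp
  have Lsub: "subspace L" unfolding L_def using FF(1) by (simp add: subspace_def commutator_simps)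
  have Ls: "L \<subseteq> F" unfolding L_def by blast
  have Lcl: "\<forall>X\<in>L. \<forall>Y\<in>L. commutator X Y \<in> L"
  proof (intro ballI)
    fix X Y assume XY: "X \<in> L" "Y \<in> L"
    have "commutator (commutator X Y) V = 0" if "V \<in> S" for V
    proof -
      have "commutator X V = 0" "commutator Y V = 0" using XY that unfolding L_def by blast+
      then show ?thesis using commutator_jacobi[of X Y V] by (simp add: commutator_simps)
    qed
    then show "commutator X Y \<in> L" using XY FF(2) unfolding L_def by blast
  qed
  have Lstar: "star X \<in> L" if X: "X \<in> L" for X
  proof -
    have "commutator (star X) Y = 0" if Y: "Y \<in> S" for Y
    proof -
      have "star Y = - Y" using S(4) Y unfolding theta_def by (metis minus_equation_iff)
      then have "commutator (star X) Y = star (commutator X Y)"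
        unfolding star_commutator using commutator_anti[of "star X" Y] by (simp add: commutator_simps)
      also have "commutator X Y = 0" using X Y unfolding L_def by blast
      finally show ?thesis using linear_0[OF star_linear] by simp
    qed
    then show ?thesis using X FF(4) unfolding L_def by blast
  qed
  have disj: "L \<inter> S = {0}"
  proof -
    have "X = 0" if X: "X \<in> L" "X \<in> S" for X
    proof -
      have "cbracket (real_embed X) W = 0" if "W \<in> real_embed ` S" for W
        using that X(1) unfolding L_def by (auto simp: cbracket_def real_embed_def commutator_simps zero_prod_def)
      then have "real_embed X = 0" using S(5) X(2) unfolding centreless_def by blast
      then show "X = 0" by (simp add: real_embed_eq_0)
    qed
    then show ?thesis using subspace_0[OF Lsub] subspace_0[OF S(1)] by blast
  qed
  have fin: "finite (case_prod dot ` basis_labels)" "F \<subseteq> span (case_prod dot ` basis_labels)"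
    using sl3O_finite FF(3) by auto
  note ds = dim_disjoint_sum[OF FF(1) fin Lsub Ls S(1,2) disj]
  have dL: "dim L \<le> length ps" using ds(1) unfolding dF S(3) ps by simp
  have gensF: "list_all (\<lambda>L. in_range L \<and> op_of L \<in> F \<times> F) (es @ fs)"
    unfolding F_def by (rule op_fixed[OF c f g])
  have gensL: "list_all (\<lambda>M. in_range M \<and> op_of M \<in> L \<times> L) (es @ fs)"
    unfolding list_all_iff
  proof (intro ballI conjI)
    fix M assume M: "M \<in> set (es @ fs)"
    show r: "in_range M" using gensF M unfolding list_all_iff by blast
    have "\<forall>N\<in>set gens. cbracket (op_of N) (op_of M) = 0"
    proof
      fix N assume N: "N \<in> set gens"
      then have "in_range N" "smat_bracket N M = []" using com gr M unfolding list_all_iff by blast+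
      then show "cbracket (op_of N) (op_of M) = 0" using smat_bracket_val(1)[OF _ r, of N] by simp
    qed
    then have "cbracket (Y, 0) (op_of M) = 0" if "Y \<in> S" for Y
      using SK[OF _ centralizer_complex_subalgebra[of "op_of M"], of "(Y, 0)"] that subspace_0[OF S(1)] by simp
    then have "commutator Y (fst (op_of M)) = 0 \<and> commutator Y (snd (op_of M)) = 0" if "Y \<in> S" for Y
      using that by (simp add: cbracket_def commutator_simps prod_eq_iff)
    then have "commutator (fst (op_of M)) Y = 0 \<and> commutator (snd (op_of M)) Y = 0" if "Y \<in> S" for Y
      using that commutator_anti[of _ Y] by simp
    moreover have "op_of M \<in> F \<times> F" using gensF M unfolding list_all_iff by blast
    ultimately show "op_of M \<in> L \<times> L" unfolding L_def mem_Times_iff by blast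
  qed
  have LO: "L \<subseteq> sl3O" using Ls FF(3) by blast
  note ct = cartan_typeI[OF ch hr Lsub Lcl LO sp gensL dL]
  have FLS: "F = set_sum L S" by (rule ds(2)) (simp add: dF S(3) ct(2) ps)
  note t = type_centreless[OF ct(1) cartan_diagonal(2) Lsub Lcl Lstar]
  show "real_form_of_type cartan_A5 (real_embed ` L)" by (rule t(3))
  have "\<forall>X\<in>L. \<forall>Y\<in>S. commutator X Y = 0" unfolding L_def by blast
  then show "lie_direct_sum (real_embed ` F) (real_embed ` L) (real_embed ` S)"
    by (rule embed_lie_direct_sum[OF Lsub Lcl S(1) S(6) disj FLS])
  have th: "theta (X + Y) = theta X + theta Y" for X Y using linear_add[OF theta_linear] by auto
  have thL: "theta X \<in> L" if "X \<in> L" for X unfolding theta_def using Lstar[OF that] subspace_neg[OF Lsub] by blast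
  show BL: "{X \<in> F. theta X = - X} \<subseteq> L"
  proof clarify
    fix X assume X: "X \<in> F" "theta X = - X"
    obtain l s where ls: "l \<in> L" "s \<in> S" "X = l + s" using X(1) unfolding FLS set_sum_def by blast
    have "theta l + s = - l - s" using X(2) S(4) ls(2) unfolding ls(3) th by simp
    then have "2 *\<^sub>R s = - l - theta l" by (simp add: scaleR_2 algebra_simps)
    moreover have "- l - theta l \<in> L" using ls(1) thL subspace_neg[OF Lsub] subspace_diff[OF Lsub] by blast
    ultimately have "2 *\<^sub>R s \<in> L" by simp
    then have "2 *\<^sub>R s \<in> L \<inter> S" using subspace_scale[OF S(1) ls(2)] by blast
    then have "s = 0" unfolding disj by simp
    then show "X \<in> L" using ls by simp
  qed
  have RL: "{X \<in> F. theta X = X} = set_sum {X \<in> L. theta X = X} S"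
  proof (intro equalityI subsetI)
    fix X assume X: "X \<in> {X \<in> F. theta X = X}"
    then have "X \<in> F" by blast
    then obtain l s where ls: "l \<in> L" "s \<in> S" "X = l + s" unfolding FLS set_sum_def by blast
    have "theta (l + s) = l + s" using X unfolding ls(3) by blast
    then have "theta l + s = l + s" unfolding th using S(4) ls(2) by simp
    then show "X \<in> set_sum {X \<in> L. theta X = X} S" unfolding set_sum_def using ls by auto
  next
    fix X assume "X \<in> set_sum {X \<in> L. theta X = X} S"
    then obtain l s where ls: "l \<in> L" "theta l = l" "s \<in> S" "X = l + s" unfolding set_sum_def by blast
    then have "l \<in> F" "s \<in> F" using Ls S(2) by blast+
    then show "X \<in> {X \<in> F. theta X = X}" using subspace_add[OF FF(1)] ls S(4) by (simp add: th)
  qed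
  have "dim {X \<in> F. theta X = X} = dim {X \<in> L. theta X = X} + dim S"
  proof (rule dim_disjoint_sum(3)[OF theta_eigen_subspace(1)[OF FF(1)] fin(1) _ theta_eigen_subspace(1)[OF Lsub] _ S(1) _ _ RL])
    show "{X \<in> F. theta X = X} \<subseteq> span (case_prod dot ` basis_labels)" using fin(2) by blast
    show "{X \<in> L. theta X = X} \<subseteq> {X \<in> F. theta X = X}" using Ls by blast
    show "S \<subseteq> {X \<in> F. theta X = X}" using S(2,4) by blast
    show "{X \<in> L. theta X = X} \<inter> S = {0}"
      using disj subspace_0[OF theta_eigen_subspace(1)[OF Lsub]] subspace_0[OF S(1)] by blast
  qed
  then have d1: "dim {X \<in> L. theta X = X} = 21" unfolding F_def dim_theta_parts n S(3) by simp
  have "{X \<in> L. theta X = - X} = {X \<in> F. theta X = - X}" using BL Ls by blast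
  moreover have "dim {X \<in> F. theta X = - X} = 14" unfolding F_def dim_theta_parts n by (rule refl)
  ultimately have d2: "dim {X \<in> L. theta X = - X} = 14" by simp
  show "signature (real_embed ` L) (real_embed ` L) = (21, 14)"
    using signature_embed[OF t(4,2) embed_dag_closed[OF Lsub LO Lstar] Lsub LO Lstar subset_refl] unfolding d1 d2 .
qed

definition centralizer_in :: "endo set \<Rightarrow> endo set \<Rightarrow> endo set" where
  "centralizer_in F S = {X \<in> F. \<forall>Y\<in>S. commutator X Y = 0}"

definition su2C_span :: "endo set" where
  "su2C_span = span {dot (Aq Uk) One, dot (Aq Ukl) One, dot (Aq Ul) One}"

definition su2_2_span :: "endo set" where
  "su2_2_span = span {dot (Gq Uk) One + 2 *\<^sub>R dot (Sq Uk) One, dot (Gq Ukl) One + 2 *\<^sub>R dot (Sq Ukl) One,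
     dot (Gq Ul) One + 2 *\<^sub>R dot (Sq Ul) One}"

lemma su2_spans: "su2C = real_embed ` su2C_span" "su2_2 = real_embed ` su2_2_span"
proof -
  have e: "{f q | q. q \<in> {Uk, Ukl, Ul}} = {f Uk, f Ukl, f Ul}" for f :: "iunit \<Rightarrow> endo" by auto
  show "su2C = real_embed ` su2C_span" "su2_2 = real_embed ` su2_2_span"
    unfolding su2C_def su2_2_def su2C_span_def su2_2_span_def
    by (simp_all only: e[of "\<lambda>q. dot (Aq q) One"] e[of "\<lambda>q. dot (Gq q) One + 2 *\<^sub>R dot (Sq q) One"])
qed

lemma rot_dots:
  assumes q: "q \<in> {Uk, Ukl, Ul}" and F: "F \<in> {Aq q, Gq q, Sq q}"
  shows "dot F One \<in> sl3O" "theta (dot F One) = dot F One" "sigma (dot F One) = dot F One" "hflip (dot F One) = dot F One"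
proof -
  have b: "(F, One) \<in> basis_labels" using F by (auto simp: basis_label_iff)
  show "dot F One \<in> sl3O" by (rule dot_in_sl3O[OF b])
  have "(F, One) \<notin> boost_labels" using F by (auto simp: boost_label_iff)
  then show "theta (dot F One) = dot F One" using theta_dot[OF b] by simp
  have "(F, One) \<notin> T23_labels" using F by (auto simp: T23_label_iff)
  then show "sigma (dot F One) = dot F One" using sigma_dot[OF b] by simp
  have "carried_unit F \<notin> Some ` {Ui, Uj, Uil, Ujl}" using F q by auto
  then have "(F, One) \<notin> Hperp_labels" unfolding Hperp_label_iff by blast
  then show "hflip (dot F One) = dot F One" using hflip_dot[OF b] by simp
qed

lemma su2_generators:
  assumes q: "q \<in> {Uk, Ukl, Ul}"
  shows "dot (Aq q) One \<in> fixed hflip" "theta (dot (Aq q) One) = dot (Aq q) One"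
    "dot (Gq q) One + 2 *\<^sub>R dot (Sq q) One \<in> fixed (inv8 False True True)"
    "theta (dot (Gq q) One + 2 *\<^sub>R dot (Sq q) One) = dot (Gq q) One + 2 *\<^sub>R dot (Sq q) One"
proof -
  note r = rot_dots[OF q]
  show "dot (Aq q) One \<in> fixed hflip" "theta (dot (Aq q) One) = dot (Aq q) One" using r[of "Aq q"] by (simp_all add: fixed_def)
  show "theta (dot (Gq q) One + 2 *\<^sub>R dot (Sq q) One) = dot (Gq q) One + 2 *\<^sub>R dot (Sq q) One"
    using r(2)[of "Gq q"] r(2)[of "Sq q"] by (simp add: linear_add[OF theta_linear] linear_scale[OF theta_linear])
  show "dot (Gq q) One + 2 *\<^sub>R dot (Sq q) One \<in> fixed (inv8 False True True)"
    using r[of "Gq q"] r[of "Sq q"]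
    by (simp add: fixed_def inv8_def sl3O_closed linear_add[OF sigma_linear] linear_scale[OF sigma_linear] linear_add[OF hflip_linear] linear_scale[OF hflip_linear])
qed

lemma sl3H_facts:
  "compact_real_form_of_type cartan_A1 su2C"
  "lie_direct_sum (real_embed ` fixed hflip) (real_embed ` centralizer_in (fixed hflip) su2C_span) su2C"
  "real_form_of_type cartan_A5 (real_embed ` centralizer_in (fixed hflip) su2C_span)"
  "signature (real_embed ` centralizer_in (fixed hflip) su2C_span) (real_embed ` centralizer_in (fixed hflip) su2C_span) = (21, 14)"
  "{X \<in> fixed hflip. theta X = - X} \<subseteq> centralizer_in (fixed hflip) su2C_span"
proof -
  have X: "X \<in> sl3O \<and> theta X = X" if "X \<in> {dot (Aq Uk) One, dot (Aq Ukl) One, dot (Aq Ul) One}" for X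
    using that su2_generators(1,2)[of Uk] su2_generators(1,2)[of Ukl] su2_generators(1,2)[of Ul] unfolding fixed_def by auto
  have ps: "length A1h_pivots = 3" by (simp add: A1h_pivots_def)
  have nz: "(1/2::real) \<noteq> 0" "(1::real) \<noteq> 0" by simp_all
  note t = su2_type[OF A1h_chevalley in_range_lists(7) A1h_spans A1h_cubic ps nz(1) nz(1) nz(2) A1h_ops X, folded su2C_span_def]
  show "compact_real_form_of_type cartan_A1 su2C" unfolding su2_spans by (rule t(6))
  have sub: "su2C_span \<subseteq> fixed hflip" unfolding su2C_span_def
    by (rule span_minimal[OF _ fixed_facts(1)[OF inv8_good[of False False True], unfolded inv8_values]])
       (use su2_generators(1) in auto)
  have gr: "list_all in_range (A1h_e @ A1h_f)" using A1h_cubic cubic_ok_g_cx(1) unfolding list_all_iff by blast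
  have ss: "subspace su2C_span" unfolding su2C_span_def by (rule subspace_span)
  have p5: "length A5h_pivots = 35" by (simp add: A5h_pivots_def)
  note a = A5_type[OF A5h_chevalley in_range_lists(5) A5h_spans A5h_cubic A5h_fixed flip_op[folded inv8_values(4)] p5 A5h_commute gr
      counts(7,8) ss sub[folded inv8_values(4)] t(3,2,4,5,7), unfolded inv8_values, folded centralizer_in_def su2_spans]
  show "lie_direct_sum (real_embed ` fixed hflip) (real_embed ` centralizer_in (fixed hflip) su2C_span) su2C"
    by (rule a(1))
  show "real_form_of_type cartan_A5 (real_embed ` centralizer_in (fixed hflip) su2C_span)" by (rule a(2))
  show "signature (real_embed ` centralizer_in (fixed hflip) su2C_span) (real_embed ` centralizer_in (fixed hflip) su2C_span) = (21, 14)"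
    by (rule a(3))
  show "{X \<in> fixed hflip. theta X = - X} \<subseteq> centralizer_in (fixed hflip) su2C_span" by (rule a(4))
qed

lemma sl21H_facts:
  defines "F \<equiv> fixed (inv8 False True True)"
  shows "compact_real_form_of_type cartan_A1 su2_2"
    "lie_direct_sum (real_embed ` F) (real_embed ` centralizer_in F su2_2_span) su2_2"
    "real_form_of_type cartan_A5 (real_embed ` centralizer_in F su2_2_span)"
    "signature (real_embed ` centralizer_in F su2_2_span) (real_embed ` centralizer_in F su2_2_span) = (21, 14)"
proof -
  let ?X = "\<lambda>q. dot (Gq q) One + 2 *\<^sub>R dot (Sq q) One"
  have X: "X \<in> sl3O \<and> theta X = X" if "X \<in> {?X Uk, ?X Ukl, ?X Ul}" for X
    using that su2_generators(3,4)[of Uk] su2_generators(3,4)[of Ukl] su2_generators(3,4)[of Ul] unfolding fixed_def by auto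
  have ps: "length A1hs_pivots = 3" by (simp add: A1hs_pivots_def)
  have nz: "(1/6::real) \<noteq> 0" "(-1/6::real) \<noteq> 0" "(1/3::real) \<noteq> 0" by simp_all
  note t = su2_type[OF A1hs_chevalley in_range_lists(8) A1hs_spans A1hs_cubic ps nz A1hs_ops X, folded su2_2_span_def]
  show "compact_real_form_of_type cartan_A1 su2_2" unfolding su2_spans by (rule t(6))
  have sub: "su2_2_span \<subseteq> F" unfolding su2_2_span_def F_def
    by (rule span_minimal[OF _ fixed_facts(1)[OF inv8_good]])
       (use su2_generators(3) in auto)
  have gr: "list_all in_range (A1hs_e @ A1hs_f)" using A1hs_cubic cubic_ok_g_cx(1) unfolding list_all_iff by blast
  have ss: "subspace su2_2_span" unfolding su2_2_span_def by (rule subspace_span)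
  have p5: "length A5hs_pivots = 35" by (simp add: A5hs_pivots_def)
  note a = A5_type[OF A5hs_chevalley in_range_lists(6) A5hs_spans A5hs_cubic A5hs_fixed sigma_flip_op p5 A5hs_commute gr
      counts(13,14) ss sub[unfolded F_def] t(3,2,4,5,7), folded F_def centralizer_in_def su2_spans]
  show "lie_direct_sum (real_embed ` F) (real_embed ` centralizer_in F su2_2_span) su2_2" by (rule a(1))
  show "real_form_of_type cartan_A5 (real_embed ` centralizer_in F su2_2_span)" by (rule a(2))
  show "signature (real_embed ` centralizer_in F su2_2_span) (real_embed ` centralizer_in F su2_2_span) = (21, 14)" by (rule a(3))
qed

lemma A5_different: "real_embed ` centralizer_in (fixed hflip) su2C_span \<noteq> real_embed ` centralizer_in (fixed (inv8 False True True)) su2_2_span"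
proof -
  let ?X = "dot Btx Two"
  have "?X \<in> centralizer_in (fixed hflip) su2C_span" using sl3H_facts(5) Btx_eigen unfolding fixed_def by blast
  moreover have "?X \<notin> centralizer_in (fixed (inv8 False True True)) su2_2_span"
    unfolding centralizer_in_def fixed_def inv8_def using Btx_neg by (simp add: Btx_eigen)
  ultimately show ?thesis unfolding real_embed_inj by blast
qed

section \<open>The subalgebra \<open>so(9,1)\<close>\<close>

lemma tau_sym_e3: "tau_sym x y e3 = hp x * hm y + hp y * hm x - 2 * (ha x \<bullet> ha y)"
  by (simp add: tau_sym_def tau_def inner_commute)

text \<open>On the hermitian \<open>2 \<times> 2\<close> matrices in the upper left corner the determinant is, up to sign, the
  Minkowski form of ten-dimensional space-time.\<close>

lemma minkowski_coordinates:
  obtains \<pi> :: "h3o \<Rightarrow> (real ^ 9) \<times> real" and \<iota> :: "(real ^ 9) \<times> real \<Rightarrow> h3o"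
  where "linear \<pi>" "linear \<iota>" "\<And>u. \<pi> (\<iota> u) = u" "\<And>x. \<iota> (\<pi> x) = (hp x, hm x, 0, ha x, 0, 0)"
    "\<And>x y. minkowski (\<pi> x) (\<pi> y) = - (1/2) * tau_sym x y e3"
proof -
  have d: "dim (UNIV :: (oct \<times> real) set) = dim (UNIV :: (real ^ 9) set)"
    by (simp add: dim_UNIV UNIV_iunit)
  obtain J :: "oct \<times> real \<Rightarrow> real ^ 9" and K where J: "linear J" "linear K" "\<And>x. norm (J x) = norm x" "\<And>x. K (J x) = x" "\<And>y. J (K y) = y"
    using isometries_subspaces[OF subspace_UNIV subspace_UNIV d] by (metis UNIV_I)
  have Ji: "J x \<bullet> J y = x \<bullet> y" for x y
    unfolding dot_norm[of "J x"] dot_norm[of x] linear_add[OF J(1), symmetric] J(3) ..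
  define q where "q x = (ha x, (1/2) * (hp x - hm x))" for x :: h3o
  have q: "q (x + y) = q x + q y" "q (c *\<^sub>R x) = c *\<^sub>R q x" for x y c by (simp_all add: q_def field_simps)
  define \<pi> where "\<pi> x = (J (q x), (1/2) * (hp x + hm x))" for x :: h3o
  define \<iota> :: "(real ^ 9) \<times> real \<Rightarrow> h3o" where "\<iota> u = (snd u + snd (K (fst u)), snd u - snd (K (fst u)), 0, fst (K (fst u)), 0, 0)" for u
  show thesis
  proof
    show "linear \<pi>"
    proof (rule linearI)
      show "\<pi> (x + y) = \<pi> x + \<pi> y" for x y
        unfolding \<pi>_def q linear_add[OF J(1)] by (simp add: algebra_simps)
      show "\<pi> (c *\<^sub>R x) = c *\<^sub>R \<pi> x" for c x
        unfolding \<pi>_def q linear_scale[OF J(1)] by (simp add: algebra_simps)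
    qed
    show "linear \<iota>" unfolding \<iota>_def by (rule linearI) (simp_all add: linear_add[OF J(2)] linear_scale[OF J(2)] algebra_simps)
    show "\<pi> (\<iota> u) = u" for u unfolding \<pi>_def \<iota>_def by (simp add: q_def J(5) algebra_simps)
    show "\<iota> (\<pi> x) = (hp x, hm x, 0, ha x, 0, 0)" for x unfolding \<pi>_def \<iota>_def by (simp add: q_def J(4) field_simps)
    show "minkowski (\<pi> x) (\<pi> y) = - (1/2) * tau_sym x y e3" for x y
      unfolding minkowski_def tau_sym_e3 \<pi>_def fst_conv snd_conv Ji q_def by (simp add: field_simps)
  qed
qed

definition sl2O_lin :: "endo set" where
  "sl2O_lin = {X \<in> sl3O. sigma X = X \<and> X e3 = 0}"

lemma sigma_fixed_apply: "sigma X = X \<Longrightarrow> X (sigma_map x) = sigma_map (X x)"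
  using conj_by_apply[OF sigma_map_props(1), of X "sigma_map x"] sigma_map_props(2) by metis

lemma sigma_fixed_parity:
  assumes "sigma X = X"
  shows "hb x = 0 \<Longrightarrow> hc x = 0 \<Longrightarrow> hb (X x) = 0 \<and> hc (X x) = 0"
    "hp x = 0 \<Longrightarrow> hm x = 0 \<Longrightarrow> hn x = 0 \<Longrightarrow> ha x = 0 \<Longrightarrow> hp (X x) = 0 \<and> hm (X x) = 0 \<and> hn (X x) = 0 \<and> ha (X x) = 0"
proof -
  have n: "v = 0" if "v = - v" for v :: oct using that
    by (metis add.right_inverse scaleR_2 scaleR_eq_0_iff zero_neq_numeral)
  assume "hb x = 0" "hc x = 0"
  then have "sigma_map x = x" by (cases x) (simp add: sigma_map_def)
  then have "X x = sigma_map (X x)" using sigma_fixed_apply[OF assms, of x] by simp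
  then have "hb (X x) = - hb (X x)" "hc (X x) = - hc (X x)" unfolding sigma_map_def by (metis fst_conv snd_conv)+
  then show "hb (X x) = 0 \<and> hc (X x) = 0" using n by blast
next
  have n: "v = 0" if "v = - v" for v :: oct using that
    by (metis add.right_inverse scaleR_2 scaleR_eq_0_iff zero_neq_numeral)
  assume "hp x = 0" "hm x = 0" "hn x = 0" "ha x = 0"
  then have "sigma_map x = - x" by (cases x) (simp add: sigma_map_def)
  then have "- X x = sigma_map (X x)" using sigma_fixed_apply[OF assms, of x] by (simp add: blinfun.minus_right)
  then have e: "X x = - sigma_map (X x)" by (metis minus_equation_iff)
  have "hp (X x) = - hp (X x)" "hm (X x) = - hm (X x)" "hn (X x) = - hn (X x)" "ha (X x) = - ha (X x)"
    using arg_cong[OF e, of fst] arg_cong[OF e, of "\<lambda>x. hm x"] arg_cong[OF e, of "\<lambda>x. hn x"] arg_cong[OF e, of "\<lambda>x. ha x"]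
    unfolding sigma_map_def by (simp_all only: fst_uminus snd_uminus fst_conv snd_conv)
  then show "hp (X x) = 0 \<and> hm (X x) = 0 \<and> hn (X x) = 0 \<and> ha (X x) = 0" using n by simp
qed

lemma sl3O_hn_ea:
  assumes "X \<in> sl3O" shows "hn (X (ea a)) = 0"
proof -
  have "tau_sym x e2 (ea a) = 0" "tau_sym e1 x (ea a) = 0" "tau_sym e1 e2 x = hn x" for x
    by (simp_all add: tau_sym_def tau_def)
  then show ?thesis using polar[OF assms, of e1 e2 "ea a"] by simp
qed

lemma h3o_split: "x = hp x *\<^sub>R e1 + hm x *\<^sub>R e2 + hn x *\<^sub>R e3 + ea (ha x) + (0, 0, 0, 0, hb x, hc x)"
  by (cases x) simp

lemma sigma_fixed_hn:
  assumes "X \<in> sl3O" "sigma X = X" "X e3 = 0"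
  shows "hn (X x) = 0"
proof -
  have "hn (X (0, 0, 0, 0, hb x, hc x)) = 0" using sigma_fixed_parity(2)[OF assms(2), of "(0, 0, 0, 0, hb x, hc x)"] by simp
  moreover have "X x = hp x *\<^sub>R X e1 + hm x *\<^sub>R X e2 + hn x *\<^sub>R X e3 + X (ea (ha x)) + X (0, 0, 0, 0, hb x, hc x)"
    by (subst h3o_split) (simp only: blinfun.add_right blinfun.scaleR_right)
  ultimately show ?thesis using sl3O_idem(2,5)[OF assms(1)] sl3O_hn_ea[OF assms(1)] assms(3) by simp
qed

lemma sl2O_corner:
  assumes "X \<in> sl2O_lin" and "hb x = 0" "hc x = 0"
  shows "X x = (hp (X x), hm (X x), 0, ha (X x), 0, 0)"
proof -
  have X: "X \<in> sl3O" "sigma X = X" "X e3 = 0" using assms(1) unfolding sl2O_lin_def by auto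
  show ?thesis using sigma_fixed_hn[OF X] sigma_fixed_parity(1)[OF X(2) assms(2,3)] by (simp add: h3o_eq_iff)
qed

lemma sl2O_skew:
  assumes "X \<in> sl2O_lin"
  shows "tau_sym (X x) y e3 + tau_sym x (X y) e3 = 0"
proof -
  have X: "X \<in> sl3O" "X e3 = 0" using assms unfolding sl2O_lin_def by auto
  have "tau_sym x y 0 = 0" by (simp add: tau_sym_def tau_def)
  then show ?thesis using polar[OF X(1), of x y e3] X(2) by simp
qed

lemma sl2O_subspace: "subspace sl2O_lin"
  unfolding sl2O_lin_def using sl3O_subspace
  by (simp add: subspace_def linear_add[OF sigma_linear] linear_scale[OF sigma_linear] linear_0[OF sigma_linear] blinfun.bilinear_simps)

lemma sl2O_commutator:
  assumes "X \<in> sl2O_lin" "Y \<in> sl2O_lin"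
  shows "commutator X Y \<in> sl2O_lin"
proof -
  have X: "X \<in> sl3O" "sigma X = X" "X e3 = 0" and Y: "Y \<in> sl3O" "sigma Y = Y" "Y e3 = 0"
    using assms unfolding sl2O_lin_def by auto
  have "sigma (commutator X Y) = commutator X Y" unfolding lie_involutionD(3)[OF lie_involution_sigma] X Y ..
  moreover have "commutator X Y e3 = 0" by (simp add: commutator_def blinfun.bilinear_simps X Y)
  ultimately show ?thesis unfolding sl2O_lin_def using sl3O_commutator[OF X(1) Y(1)] by blast
qed

lemma rot_of_sl2O:
  assumes "linear f" "\<And>x y. f x \<bullet> y = - (x \<bullet> f y)"
  shows "rot_of f \<in> sl2O_lin"
proof -
  have "rot_of f \<in> sl3O" unfolding sl3O_span by (rule rot_of_in_span)
  moreover have "sigma (rot_of f) = rot_of f"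
    unfolding rot_of_def linear_sum[OF sigma_linear] linear_add[OF sigma_linear] linear_diff[OF sigma_linear]
      linear_scale[OF sigma_linear] sigma_Rot by (rule refl)
  ultimately show ?thesis unfolding sl2O_lin_def using rot_of(4)[OF assms] by simp
qed

text \<open>A skew endomorphism is matched on the two idempotents by elementary generators, and what
  remains rotates the octonion entry.\<close>

lemma sl2O_surjective:
  assumes Y: "linear Y" and skew: "\<And>x y. tau_sym (Y x) y e3 + tau_sym x (Y y) e3 = 0"
  shows "\<exists>X\<in>sl2O_lin. \<forall>x. hp (X x) = hp (Y x) \<and> hm (X x) = hm (Y x) \<and> ha (X x) = ha (Y x)"
proof -
  have y1: "hm (Y e1) = 0" using skew[of e1 e1] unfolding tau_sym_e3 by simp
  have y2: "hp (Y e2) = 0" using skew[of e2 e2] unfolding tau_sym_e3 by simp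
  have y12: "hm (Y e2) = - hp (Y e1)" using skew[of e1 e2] unfolding tau_sym_e3 by simp
  obtain X1 where X1: "X1 \<in> sl2O_lin"
    and X1e: "hp (X1 e1) = hp (Y e1)" "hm (X1 e1) = 0" "ha (X1 e1) = ha (Y e1)"
      "hp (X1 e2) = 0" "hm (X1 e2) = - hp (Y e1)" "ha (X1 e2) = ha (Y e2)"
  proof
    let ?Z = "Dn One (ha (Y e1)) + Up One (oconj (ha (Y e2))) + Scal (hp (Y e1) / 2) (- (hp (Y e1) / 2)) 0"
    have "?Z \<in> sl3O" by (intro sl3O_closed(1) elementary_sl3O) simp_all
    moreover have "sigma ?Z = ?Z"
      by (simp add: linear_add[OF sigma_linear] sigma_Up sigma_Dn sigma_Scal)
    moreover have "?Z e3 = 0" by (simp add: blinfun.bilinear_simps scal_def slot_zero)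
    ultimately show "?Z \<in> sl2O_lin" unfolding sl2O_lin_def by simp
    show "hp (?Z e1) = hp (Y e1)" "hm (?Z e1) = 0" "ha (?Z e1) = ha (Y e1)"
      "hp (?Z e2) = 0" "hm (?Z e2) = - hp (Y e1)" "ha (?Z e2) = ha (Y e2)"
      by (simp_all add: blinfun.bilinear_simps scal_def)
  qed
  define g where "g a = ha (Y (ea a)) - ha (X1 (ea a))" for a
  have eal: "ea (a + b) = ea a + ea b" "ea (r *\<^sub>R a) = r *\<^sub>R ea a" for a b r by simp_all
  have glin: "linear g" unfolding g_def
    by (rule linearI) (simp_all only: eal linear_add[OF Y] linear_scale[OF Y] blinfun.add_right blinfun.scaleR_right fst_add snd_add fst_scaleR snd_scaleR scaleR_diff_right, simp_all)
  have gskew: "g a \<bullet> b = - (a \<bullet> g b)" for a b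
  proof -
    have "ha (Z (ea a)) \<bullet> b = - (a \<bullet> ha (Z (ea b)))" if "\<And>x y. tau_sym (Z x) y e3 + tau_sym x (Z y) e3 = 0" for Z
      using that[of "ea a" "ea b"] unfolding tau_sym_e3 by (simp add: inner_commute)
    from this[of Y, OF skew] this[of X1, OF sl2O_skew[OF X1]]
    show ?thesis unfolding g_def by (simp add: inner_diff_left inner_diff_right)
  qed
  let ?X = "X1 + rot_of g"
  note rg = rot_of[OF glin gskew]
  have X: "?X \<in> sl2O_lin" by (rule subspace_add[OF sl2O_subspace X1 rot_of_sl2O[OF glin gskew]])
  have Xa: "blinfun_apply ?X x = X1 x + rot_of g x" for x by (rule blinfun.add_left)
  have Xe: "hp (?X e1) = hp (Y e1)" "hm (?X e1) = hm (Y e1)" "ha (?X e1) = ha (Y e1)"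
    "hp (?X e2) = hp (Y e2)" "hm (?X e2) = hm (Y e2)" "ha (?X e2) = ha (Y e2)"
    unfolding Xa rg(2,3) by (simp_all add: X1e y1 y2 y12)
  have Xea: "ha (?X (ea a)) = ha (Y (ea a))" for a
  proof -
    have "ha (rot_of g (ea a)) = g a" using rg(1)[of "ea a"] by simp
    then show ?thesis unfolding Xa fst_add snd_add by (simp add: g_def[of a])
  qed
  have Xpm: "hp (?X (ea a)) = hp (Y (ea a))" "hm (?X (ea a)) = hm (Y (ea a))" for a
  proof -
    have v: "hm (Z (ea a)) = 2 * (a \<bullet> ha (Z e1))" "hp (Z (ea a)) = 2 * (a \<bullet> ha (Z e2))"
      if "\<And>x y. tau_sym (Z x) y e3 + tau_sym x (Z y) e3 = 0" for Z
      using that[of "ea a" e1] that[of "ea a" e2] unfolding tau_sym_e3 by simp_all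
    note v1 = v[of Y, OF skew] and v2 = v[of ?X, OF sl2O_skew[OF X]]
    show "hp (?X (ea a)) = hp (Y (ea a))" "hm (?X (ea a)) = hm (Y (ea a))" unfolding v1 v2 Xe by (rule refl)+
  qed
  have rest: "hp (Z x) = 0 \<and> hm (Z x) = 0 \<and> ha (Z x) = 0"
    if s: "\<And>x y. tau_sym (Z x) y e3 + tau_sym x (Z y) e3 = 0" and z: "hp x = 0" "hm x = 0" "ha x = 0" for Z x
  proof -
    have "hm (Z x) = 0" using s[of x e1] z unfolding tau_sym_e3 by simp
    moreover have "hp (Z x) = 0" using s[of x e2] z unfolding tau_sym_e3 by simp
    moreover have "ha (Z x) \<bullet> y = 0" for y using s[of x "ea y"] z unfolding tau_sym_e3 by simp
    ultimately show ?thesis using inner_all_0 by blast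
  qed
  have "hp (?X x) = hp (Y x) \<and> hm (?X x) = hm (Y x) \<and> ha (?X x) = ha (Y x)" for x
  proof -
    let ?o = "(0, 0, hn x, 0, hb x, hc x) :: h3o"
    have sp: "x = hp x *\<^sub>R e1 + hm x *\<^sub>R e2 + ea (ha x) + ?o" by (cases x) simp
    have 1: "?X x = hp x *\<^sub>R ?X e1 + hm x *\<^sub>R ?X e2 + ?X (ea (ha x)) + ?X ?o"
      by (subst sp) (simp only: blinfun.add_right blinfun.scaleR_right)
    have 2: "Y x = hp x *\<^sub>R Y e1 + hm x *\<^sub>R Y e2 + Y (ea (ha x)) + Y ?o"
      by (subst sp) (simp only: linear_add[OF Y] linear_scale[OF Y])
    have 3: "hp (?X ?o) = 0 \<and> hm (?X ?o) = 0 \<and> ha (?X ?o) = 0" by (rule rest[OF sl2O_skew[OF X]]) simp_all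
    have 4: "hp (Y ?o) = 0 \<and> hm (Y ?o) = 0 \<and> ha (Y ?o) = 0" by (rule rest[OF skew]) simp_all
    show ?thesis unfolding 1 2 using 3 4 Xe Xea[of "ha x"] Xpm[of "ha x"]
      by (simp only: fst_add snd_add fst_scaleR snd_scaleR)
  qed
  then show ?thesis using X by blast
qed

lemma sl2O_iso: "iso_so91 (real_embed ` sl2O_lin)"
proof -
  obtain \<pi> :: "h3o \<Rightarrow> (real ^ 9) \<times> real" and \<iota> :: "(real ^ 9) \<times> real \<Rightarrow> h3o"
    where p: "linear \<pi>" "linear \<iota>" "\<And>u. \<pi> (\<iota> u) = u" "\<And>x. \<iota> (\<pi> x) = (hp x, hm x, 0, ha x, 0, 0)"
      "\<And>x y. minkowski (\<pi> x) (\<pi> y) = - (1/2) * tau_sym x y e3"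
    using minkowski_coordinates by blast
  define f where "f Z = Blinfun (\<pi> \<circ> blinfun_apply (fst Z) \<circ> \<iota>)" for Z :: "h3o cend"
  have fa: "blinfun_apply (f Z) u = \<pi> (fst Z (\<iota> u))" for Z u
  proof -
    have "linear (\<pi> \<circ> blinfun_apply (fst Z) \<circ> \<iota>)" by (intro linear_compose p(1,2) blinfun_linear)
    then show ?thesis unfolding f_def by (simp add: Blinfun_linear_apply)
  qed
  have flin: "linear f"
    by (rule linearI; rule blinfun_eqI) (simp_all add: fa blinfun.bilinear_simps linear_add[OF p(1)] linear_scale[OF p(1)])
  have io: "hb (\<iota> u) = 0" "hc (\<iota> u) = 0" for u using p(4)[of "\<iota> u"] unfolding p(3) by (metis fst_conv snd_conv)+
  have ip: "\<iota> (\<pi> (X (\<iota> u))) = X (\<iota> u)" if "X \<in> sl2O_lin" for X u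
    unfolding p(4) by (rule sl2O_corner[OF that io, symmetric])
  have into: "f (real_embed X) \<in> so91" if X: "X \<in> sl2O_lin" for X
  proof -
    have "minkowski (f (real_embed X) u) v + minkowski u (f (real_embed X) v) = 0" for u v
    proof -
      have "minkowski (\<pi> (X (\<iota> u))) (\<pi> (\<iota> v)) + minkowski (\<pi> (\<iota> u)) (\<pi> (X (\<iota> v)))
        = - (1/2) * (tau_sym (X (\<iota> u)) (\<iota> v) e3 + tau_sym (\<iota> u) (X (\<iota> v)) e3)" unfolding p(5) by (simp add: algebra_simps)
      then show ?thesis unfolding sl2O_skew[OF X] by (simp add: fa real_embed_def p(3))
    qed
    then show ?thesis unfolding so91_def by blast
  qed
  have inj: "X = 0" if X: "X \<in> sl2O_lin" "f (real_embed X) = 0" for X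
  proof -
    have "X (\<iota> u) = 0" for u
    proof -
      have "\<pi> (X (\<iota> u)) = 0" using arg_cong[OF X(2), of "\<lambda>Z. blinfun_apply Z u"] by (simp add: fa real_embed_def)
      then show ?thesis using ip[OF X(1), of u] linear_0[OF p(2)] by metis
    qed
    then have 0: "X (hp x, hm x, 0, ha x, 0, 0) = 0" for x using p(4) by metis
    have "X e1 = 0" "X e2 = 0" "X (ea a) = 0" for a using 0[of e1] 0[of e2] 0[of "ea a"] by simp_all
    then show ?thesis using sl3O_kernel[of X] X(1) unfolding sl2O_lin_def by simp
  qed
  have surj: "\<exists>X\<in>sl2O_lin. f (real_embed X) = T" if T: "T \<in> so91" for T
  proof -
    let ?Y = "\<lambda>x. \<iota> (T (\<pi> x))"
    have Y: "linear ?Y" by (rule linearI) (simp_all add: linear_add[OF p(1)] linear_scale[OF p(1)] linear_add[OF p(2)] linear_scale[OF p(2)] blinfun.bilinear_simps)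
    have m: "tau_sym x y e3 = - 2 * minkowski (\<pi> x) (\<pi> y)" for x y unfolding p(5) by simp
    have "tau_sym (?Y x) y e3 + tau_sym x (?Y y) e3 = 0" for x y
      using T unfolding so91_def m p(3) mem_Collect_eq by (metis mult_zero_right ring_class.ring_distribs(1))
    then obtain X where X: "X \<in> sl2O_lin" "\<And>x. hp (X x) = hp (?Y x) \<and> hm (X x) = hm (?Y x) \<and> ha (X x) = ha (?Y x)"
      using sl2O_surjective[OF Y] by blast
    have "f (real_embed X) u = T u" for u
    proof -
      have "\<iota> (\<pi> (X (\<iota> u))) = \<iota> (\<pi> (?Y (\<iota> u)))" unfolding p(4) using X(2)[of "\<iota> u"] by simp
      then have "\<pi> (X (\<iota> u)) = T u" using p(3) by metis
      then show ?thesis by (simp add: fa real_embed_def)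
    qed
    then show ?thesis using X(1) blinfun_eqI by blast
  qed
  have hom: "f (cbracket Z W) = commutator (f Z) (f W)" if "Z \<in> real_embed ` sl2O_lin" "W \<in> real_embed ` sl2O_lin" for Z W
  proof -
    obtain X Y where XY: "X \<in> sl2O_lin" "Y \<in> sl2O_lin" "Z = real_embed X" "W = real_embed Y" using \<open>Z \<in> _\<close> \<open>W \<in> _\<close> by blast
    have z: "commutator (0 :: endo) V = 0" "commutator V (0 :: endo) = 0" for V by (simp_all add: commutator_simps)
    have "f (cbracket Z W) u = commutator (f Z) (f W) u" for u
      unfolding fa XY(3,4) cbracket_def real_embed_def fst_conv snd_conv z
      by (simp add: commutator_def blinfun.bilinear_simps fa ip[OF XY(1)] ip[OF XY(2)] linear_diff[OF p(1)])
    then show ?thesis by (rule blinfun_eqI)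
  qed
  have bij: "bij_betw f (real_embed ` sl2O_lin) so91"
    unfolding bij_betw_def
  proof
    show "inj_on f (real_embed ` sl2O_lin)"
    proof (rule inj_onI)
      fix Z W assume ZW: "Z \<in> real_embed ` sl2O_lin" "W \<in> real_embed ` sl2O_lin" "f Z = f W"
      then obtain X Y where XY: "X \<in> sl2O_lin" "Y \<in> sl2O_lin" "Z = real_embed X" "W = real_embed Y" by blast
      have "f (real_embed (X - Y)) = f Z - f W" unfolding XY(3,4) linear_diff[OF real_embed_linear] linear_diff[OF flin] ..
      then have "X - Y = 0" using inj[OF subspace_diff[OF sl2O_subspace XY(1,2)]] ZW(3) by simp
      then show "Z = W" using XY by simp
    qed
    show "f ` real_embed ` sl2O_lin = so91" using into surj by blast
  qed
  have "real_subalgebra (real_embed ` sl2O_lin)"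
    using complexify_real_form(1)[OF sl2O_subspace] sl2O_commutator by blast
  then show ?thesis unfolding iso_so91_def using flin bij hom by blast
qed

section \<open>The one-dimensional centre\<close>

lemma dilation: "dot Btz Two - dot Btz Three = Scal (1/2) (1/2) (-1)"
  unfolding dot_Btz by (rule blinfun_eqI) (simp add: blinfun.bilinear_simps scal_def flip: scaleR_add_left)

lemma u1_embed: "u1 = real_embed ` span {Scal (1/2) (1/2) (-1)}" unfolding u1_def dilation ..

lemma dilation_nonzero: "Scal (1/2) (1/2) (-1) \<noteq> 0"
proof
  assume "Scal (1/2) (1/2) (-1) = 0"
  then have "blinfun_apply (Scal (1/2) (1/2) (-1)) e1 = 0" by simp
  then show False by (simp add: scal_def zero_prod_def)
qed

lemma dilation_fixed: "Scal (1/2) (1/2) (-1) \<in> fixed sigma"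
  unfolding fixed_def using elementary_sl3O(4)[of "1/2" "1/2" "-1"] by (simp add: sigma_Scal)

lemma dim_u1: "dim u1 = 1"
proof -
  have s: "span {Scal (1/2) (1/2) (-1)} \<subseteq> sl3O"
    by (rule span_minimal[OF _ sl3O_subspace]) (use dilation_fixed in \<open>simp add: fixed_def\<close>)
  have "dim (span {Scal (1/2) (1/2) (-1)}) = card {Scal (1/2) (1/2) (-1)}"
    by (rule dim_span_eq_card_independent) (simp add: dilation_nonzero)
  then show ?thesis unfolding u1_embed dim_real_embed[OF subspace_span s] by simp
qed

text \<open>The dilation is scalar on the three pieces into which \<open>sl(2,O)\<close> decomposes the hermitian
  matrices: vectors, scalars and spinors of \<open>so(9,1)\<close>.\<close>

lemma dilation_central:
  assumes "X \<in> sl2O_lin"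
  shows "commutator X (Scal (1/2) (1/2) (-1)) = 0"
proof -
  have X: "X \<in> sl3O" "sigma X = X" "X e3 = 0" using assms unfolding sl2O_lin_def by auto
  let ?D = "Scal (1/2) (1/2) (-1)"
  have "X (?D x) = ?D (X x)" for x
  proof -
    let ?w = "(hp x, hm x, 0, ha x, 0, 0) :: h3o" and ?o = "(0, 0, 0, 0, hb x, hc x) :: h3o"
    have x: "x = ?w + hn x *\<^sub>R e3 + ?o" by (cases x) simp
    have Dx: "?D x = ?w - (2 * hn x) *\<^sub>R e3 - (1/2) *\<^sub>R ?o" by (cases x) (simp add: scal_def)
    have 1: "X (?D x) = X ?w - (1/2) *\<^sub>R X ?o"
      unfolding Dx by (simp only: blinfun.diff_right blinfun.scaleR_right X(3) scaleR_zero_right diff_zero)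
    have 2: "X x = X ?w + X ?o"
      by (subst x) (simp only: blinfun.add_right blinfun.scaleR_right X(3) scaleR_zero_right add_0_right)
    have w: "X ?w = (hp (X ?w), hm (X ?w), 0, ha (X ?w), 0, 0)" by (rule sl2O_corner[OF assms]) simp_all
    have Dw: "?D (X ?w) = X ?w" by (subst (1 2) w) (simp add: scal_def)
    have Do: "?D (X ?o) = - (1/2) *\<^sub>R X ?o" 
      using sigma_fixed_parity(2)[OF X(2), of ?o] by (simp add: h3o_eq_iff scal_def)
    show ?thesis unfolding 1 2 blinfun.add_right Dw Do by simp
  qed
  then show ?thesis by (intro blinfun_eqI) (simp add: commutator_def blinfun.bilinear_simps)
qed

lemma sl2O_direct_sum: "lie_direct_sum (real_embed ` fixed sigma) (real_embed ` sl2O_lin) u1"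
proof -
  let ?D = "Scal (1/2) (1/2) (-1)"
  let ?U = "span {?D}"
  have U: "subspace ?U" by (rule subspace_span)
  have el: "Y \<in> ?U \<longleftrightarrow> (\<exists>r. Y = r *\<^sub>R ?D)" for Y by (auto simp: span_singleton)
  have Fsub: "subspace (fixed sigma)" using fixed_facts(1)[OF inv8_good[of False True False]] unfolding inv8_values .
  have De: "blinfun_apply ?D e3 = - 2 *\<^sub>R e3" by (simp add: scal_def)
  have disj: "X = 0" if X: "X \<in> sl2O_lin" "X \<in> ?U" for X
  proof -
    obtain r where r: "X = r *\<^sub>R ?D" using X(2) el by blast
    have "X e3 = 0" using X(1) unfolding sl2O_lin_def by blast
    then have "r = 0" unfolding r blinfun.scaleR_left De by (simp add: zero_prod_def)
    then show ?thesis using r by simp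
  qed
  have sum: "fixed sigma = set_sum sl2O_lin ?U"
  proof (intro equalityI subsetI)
    fix X assume "X \<in> fixed sigma"
    then have X: "X \<in> sl3O" "sigma X = X" unfolding fixed_def by auto
    have Xe: "X e3 = hn (X e3) *\<^sub>R e3"
      using sl3O_idem(7-9)[OF X(1)] sigma_fixed_parity(1)[OF X(2), of e3] by (simp add: h3o_eq_iff)
    let ?c = "- hn (X e3) / 2"
    have e: "(X - ?c *\<^sub>R ?D) e3 = 0"
    proof -
      have "(X - ?c *\<^sub>R ?D) e3 = X e3 - ?c *\<^sub>R (- 2 *\<^sub>R e3)" unfolding blinfun.diff_left blinfun.scaleR_left De ..
      also have "\<dots> = X e3 - hn (X e3) *\<^sub>R e3" by simp
      also have "\<dots> = 0" using Xe by (metis diff_self)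
      finally show ?thesis .
    qed
    have "X - ?c *\<^sub>R ?D \<in> fixed sigma"
      using subspace_diff[OF Fsub \<open>X \<in> fixed sigma\<close> subspace_scale[OF Fsub dilation_fixed]] .
    then have "X - ?c *\<^sub>R ?D \<in> sl2O_lin" using e unfolding sl2O_lin_def fixed_def by blast
    moreover have "?c *\<^sub>R ?D \<in> ?U" using el by blast
    moreover have "X = (X - ?c *\<^sub>R ?D) + ?c *\<^sub>R ?D" by simp
    ultimately show "X \<in> set_sum sl2O_lin ?U" unfolding set_sum_def by blast
  next
    fix X assume "X \<in> set_sum sl2O_lin ?U"
    then obtain Y Z where YZ: "Y \<in> sl2O_lin" "Z \<in> ?U" "X = Y + Z" unfolding set_sum_def by blast
    then obtain r where Y: "Y \<in> sl2O_lin" "X = Y + r *\<^sub>R ?D" using el[of Z] by blast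
    have "Y \<in> fixed sigma" using Y(1) unfolding sl2O_lin_def fixed_def by blast
    then show "X \<in> fixed sigma" unfolding Y(2) by (intro subspace_add[OF Fsub] subspace_scale[OF Fsub] dilation_fixed)
  qed
  have "\<forall>X\<in>?U. \<forall>Y\<in>?U. commutator X Y \<in> ?U"
  proof (rule span_commutator)
    show "commutator x y \<in> ?U" if "x \<in> {?D}" "y \<in> {?D}" for x y
      using that by (simp add: commutator_def span_zero)
  qed
  moreover have "\<forall>X\<in>sl2O_lin. \<forall>Y\<in>?U. commutator X Y = 0"
  proof (intro ballI)
    fix X Y assume X: "X \<in> sl2O_lin" and "Y \<in> ?U"
    then obtain r where "Y = r *\<^sub>R ?D" using el[of Y] by blast
    then show "commutator X Y = 0" by (simp add: commutator_simps dilation_central[OF X])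
  qed
  moreover have "sl2O_lin \<inter> ?U = {0}" using disj subspace_0[OF sl2O_subspace] subspace_0[OF U] by blast
  ultimately show ?thesis unfolding u1_embed
    using embed_lie_direct_sum[OF sl2O_subspace _ U _ _ sum] sl2O_commutator by blast
qed

section \<open>The eight real forms\<close>

lemma phi_realized:
  shows "\<exists>\<kappa>. realizes id False False False \<kappa>" "\<exists>\<kappa>. realizes phi_t True False False \<kappa>"
    "\<exists>\<kappa>. realizes phi_23 False True False \<kappa>" "\<exists>\<kappa>. realizes phi_H False False True \<kappa>"
    "\<exists>\<kappa>. realizes (phi_23 \<circ> phi_t) True True False \<kappa>" "\<exists>\<kappa>. realizes (phi_H \<circ> phi_t) True False True \<kappa>"
    "\<exists>\<kappa>. realizes (phi_23 \<circ> phi_H) False True True \<kappa>" "\<exists>\<kappa>. realizes (phi_23 \<circ> phi_H \<circ> phi_t) True True True \<kappa>"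
proof -
  show "\<exists>\<kappa>. realizes id False False False \<kappa>" "\<exists>\<kappa>. realizes phi_t True False False \<kappa>"
    "\<exists>\<kappa>. realizes phi_23 False True False \<kappa>" "\<exists>\<kappa>. realizes phi_H False False True \<kappa>"
    using realizes_basic by blast+
  note 23 = realizes_compose[OF realizes_basic(3)] and H = realizes_compose[OF realizes_basic(4)]
  show "\<exists>\<kappa>. realizes (phi_23 \<circ> phi_t) True True False \<kappa>" using 23[OF realizes_basic(2)] by auto
  show "\<exists>\<kappa>. realizes (phi_H \<circ> phi_t) True False True \<kappa>" using H[OF realizes_basic(2)] by auto
  show "\<exists>\<kappa>. realizes (phi_23 \<circ> phi_H) False True True \<kappa>" using 23[OF realizes_basic(4)] by auto
  show "\<exists>\<kappa>. realizes (phi_23 \<circ> phi_H \<circ> phi_t) True True True \<kappa>"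
    using 23[OF H[OF realizes_basic(2)]] unfolding comp_assoc by auto
qed

lemma realized_signatures:
  assumes "\<exists>\<kappa>. realizes \<phi> a b c \<kappa>"
  shows "signature (g' \<phi>) (g' \<phi>) = (count_rot (\<not> a) b c + count_boost (\<not> a) b c, 78 - (count_rot (\<not> a) b c + count_boost (\<not> a) b c))"
    "signature g_re (P_sub \<phi>) = (count_rot a b c, count_boost a b c)"
    "signature g_re (preimage_c \<phi>) = (count_rot (\<not> a) b c, count_boost (\<not> a) b c)"
proof -
  obtain \<kappa> where r: "realizes \<phi> a b c \<kappa>" using assms by blast
  show "signature (g' \<phi>) (g' \<phi>) = (count_rot (\<not> a) b c + count_boost (\<not> a) b c, 78 - (count_rot (\<not> a) b c + count_boost (\<not> a) b c))"
    unfolding realized_spaces[OF r] signature_twisted dim_fixed ..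
  show "signature g_re (P_sub \<phi>) = (count_rot a b c, count_boost a b c)"
    "signature g_re (preimage_c \<phi>) = (count_rot (\<not> a) b c, count_boost (\<not> a) b c)"
    unfolding realized_spaces[OF r] by (rule signature_P(2))+
qed

lemma realized_embed:
  assumes "\<exists>\<kappa>. realizes \<phi> a b c \<kappa>"
  shows "P_sub \<phi> = real_embed ` fixed (inv8 a b c)" "preimage_c \<phi> = real_embed ` fixed (inv8 (\<not> a) b c)"
  using assms realized_spaces(2,4) by blast+

lemma decompositions: "direct_sum sl3O R_space B_space" "direct_sum sl3O T1_space T23_space" "direct_sum sl3O H_space Hperp_space"
  unfolding spaces_eigen
  by (rule direct_sum_eigen[OF eigen_basic(1) involutive(1)] direct_sum_eigen[OF eigen_basic(2) involutive(2)]
      direct_sum_eigen[OF eigen_basic(3) involutive(3)])+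

theorem mainTheorem1:
  shows "direct_sum sl3O R_space B_space \<and>
         direct_sum sl3O T1_space T23_space \<and>
         direct_sum sl3O H_space Hperp_space \<and>
         has_cartan_type cartan_E6 g_cx \<and>
         (\<forall>\<phi> \<in> {id, phi_t, phi_23, phi_H, phi_23 \<circ> phi_t, phi_H \<circ> phi_t,
                phi_23 \<circ> phi_H, phi_23 \<circ> phi_H \<circ> phi_t}.
           is_real_form g_cx (g' \<phi>) \<and>
           maximal_compact_subalgebra (g' \<phi>) (g'_c \<phi>) \<and>
           real_subalgebra (P_sub \<phi>) \<and> P_sub \<phi> \<subseteq> g_re \<and>
           real_subalgebra (preimage_c \<phi>) \<and> preimage_c \<phi> \<subseteq> g_re \<and>
           signature (g' \<phi>) (P_sub \<phi>) = signature g_re (P_sub \<phi>)) \<and>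
         (\<exists>su3O su21O sl2O sl3H sl21H su31H1 su31H2.
           compact_real_form_of_type cartan_F4 su3O \<and>
           real_form_of_type cartan_F4 su21O \<and> signature su21O su21O = (36, 16) \<and>
           iso_so91 sl2O \<and>
           real_form_of_type cartan_A5 sl3H \<and> signature sl3H sl3H = (21, 14) \<and>
           real_form_of_type cartan_A5 sl21H \<and> signature sl21H sl21H = (21, 14) \<and>
           sl3H \<noteq> sl21H \<and>
           real_form_of_type cartan_C4 su31H1 \<and> signature su31H1 su31H1 = (24, 12) \<and>
           real_form_of_type cartan_C4 su31H2 \<and> signature su31H2 su31H2 = (24, 12) \<and>
           su31H1 \<noteq> su31H2 \<and>
           compact_real_form_of_type cartan_A1 su2C \<and>
           compact_real_form_of_type cartan_A1 su2_2 \<and>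
           dim u1 = 1 \<and>
           (let \<phi> = id in
              signature (g' \<phi>) (g' \<phi>) = (52, 26) \<and>
              P_sub \<phi> = g_re \<and> signature g_re (P_sub \<phi>) = (52, 26) \<and>
              preimage_c \<phi> = su3O \<and> signature g_re (preimage_c \<phi>) = (52, 0)) \<and>
           (let \<phi> = phi_t in
              signature (g' \<phi>) (g' \<phi>) = (78, 0) \<and>
              P_sub \<phi> = su3O \<and> signature g_re (P_sub \<phi>) = (52, 0) \<and>
              preimage_c \<phi> = g_re \<and> signature g_re (preimage_c \<phi>) = (52, 26)) \<and>
           (let \<phi> = phi_23 in
              signature (g' \<phi>) (g' \<phi>) = (52, 26) \<and>
              lie_direct_sum (P_sub \<phi>) sl2O u1 \<and> signature g_re (P_sub \<phi>) = (36, 10) \<and>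
              preimage_c \<phi> = su21O \<and> signature g_re (preimage_c \<phi>) = (36, 16)) \<and>
           (let \<phi> = phi_H in
              signature (g' \<phi>) (g' \<phi>) = (36, 42) \<and>
              lie_direct_sum (P_sub \<phi>) sl3H su2C \<and> signature g_re (P_sub \<phi>) = (24, 14) \<and>
              preimage_c \<phi> = su31H1 \<and> signature g_re (preimage_c \<phi>) = (24, 12)) \<and>
           (let \<phi> = phi_23 \<circ> phi_t in
              signature (g' \<phi>) (g' \<phi>) = (46, 32) \<and>
              P_sub \<phi> = su21O \<and> signature g_re (P_sub \<phi>) = (36, 16) \<and>
              lie_direct_sum (preimage_c \<phi>) sl2O u1 \<and> signature g_re (preimage_c \<phi>) = (36, 10)) \<and>
           (let \<phi> = phi_H \<circ> phi_t in
              signature (g' \<phi>) (g' \<phi>) = (38, 40) \<and>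
              P_sub \<phi> = su31H1 \<and> signature g_re (P_sub \<phi>) = (24, 12) \<and>
              lie_direct_sum (preimage_c \<phi>) sl3H su2C \<and> signature g_re (preimage_c \<phi>) = (24, 14)) \<and>
           (let \<phi> = phi_23 \<circ> phi_H in
              signature (g' \<phi>) (g' \<phi>) = (36, 42) \<and>
              lie_direct_sum (P_sub \<phi>) sl21H su2_2 \<and> signature g_re (P_sub \<phi>) = (24, 14) \<and>
              preimage_c \<phi> = su31H2 \<and> signature g_re (preimage_c \<phi>) = (24, 12)) \<and>
           (let \<phi> = phi_23 \<circ> phi_H \<circ> phi_t in
              signature (g' \<phi>) (g' \<phi>) = (38, 40) \<and>
              P_sub \<phi> = su31H2 \<and> signature g_re (P_sub \<phi>) = (24, 12) \<and>
              lie_direct_sum (preimage_c \<phi>) sl21H su2_2 \<and> signature g_re (preimage_c \<phi>) = (24, 14)))"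
proof -
  define su3O where "su3O = real_embed ` fixed (inv8 True False False)"
  define su21O where "su21O = real_embed ` fixed (inv8 True True False)"
  define sl2O where "sl2O = real_embed ` sl2O_lin"
  define sl3H where "sl3H = real_embed ` centralizer_in (fixed hflip) su2C_span"
  define sl21H where "sl21H = real_embed ` centralizer_in (fixed (inv8 False True True)) su2_2_span"
  define su31H1 where "su31H1 = real_embed ` fixed (inv8 True False True)"
  define su31H2 where "su31H2 = real_embed ` fixed (inv8 True True True)"
  note names = su3O_def su21O_def sl2O_def sl3H_def sl21H_def su31H1_def su31H2_def
  have g0: "real_embed ` fixed (inv8 False False False) = g_re"
    unfolding inv8_values fixed_def g_re_def by simp
  have sums: "lie_direct_sum (real_embed ` fixed (inv8 False True False)) sl2O u1"
    "lie_direct_sum (real_embed ` fixed (inv8 False False True)) sl3H su2C"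
    "lie_direct_sum (real_embed ` fixed (inv8 False True True)) sl21H su2_2"
    unfolding names inv8_values by (rule sl2O_direct_sum sl3H_facts(2) sl21H_facts(2))+
  have types: "compact_real_form_of_type cartan_F4 su3O"
    "real_form_of_type cartan_F4 su21O" "signature su21O su21O = (36, 16)"
    "iso_so91 sl2O"
    "real_form_of_type cartan_A5 sl3H" "signature sl3H sl3H = (21, 14)"
    "real_form_of_type cartan_A5 sl21H" "signature sl21H sl21H = (21, 14)" "sl3H \<noteq> sl21H"
    "real_form_of_type cartan_C4 su31H1" "signature su31H1 su31H1 = (24, 12)"
    "real_form_of_type cartan_C4 su31H2" "signature su31H2 su31H2 = (24, 12)" "su31H1 \<noteq> su31H2"
    "compact_real_form_of_type cartan_A1 su2C" "compact_real_form_of_type cartan_A1 su2_2"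
    unfolding names
    by (rule F4_compact F4_split sl2O_iso sl3H_facts sl21H_facts A5_different C4_first C4_second C4_different)+
  note em = realized_embed[OF phi_realized(1), unfolded not_False_eq_True not_True_eq_False g0, folded names]
    realized_embed[OF phi_realized(2), unfolded not_False_eq_True not_True_eq_False g0, folded names]
    realized_embed[OF phi_realized(3), unfolded not_False_eq_True not_True_eq_False g0, folded names]
    realized_embed[OF phi_realized(4), unfolded not_False_eq_True not_True_eq_False g0, folded names]
    realized_embed[OF phi_realized(5), unfolded not_False_eq_True not_True_eq_False g0, folded names]
    realized_embed[OF phi_realized(6), unfolded not_False_eq_True not_True_eq_False g0, folded names]
    realized_embed[OF phi_realized(7), unfolded not_False_eq_True not_True_eq_False g0, folded names]
    realized_embed[OF phi_realized(8), unfolded not_False_eq_True not_True_eq_False g0, folded names]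
  note sg = phi_realized[THEN realized_signatures(1), unfolded not_False_eq_True not_True_eq_False counts, simplified]
    phi_realized[THEN realized_signatures(2), unfolded not_False_eq_True not_True_eq_False counts]
    phi_realized[THEN realized_signatures(3), unfolded not_False_eq_True not_True_eq_False counts]
  have all: "\<forall>\<phi> \<in> {id, phi_t, phi_23, phi_H, phi_23 \<circ> phi_t, phi_H \<circ> phi_t,
                phi_23 \<circ> phi_H, phi_23 \<circ> phi_H \<circ> phi_t}.
           is_real_form g_cx (g' \<phi>) \<and>
           maximal_compact_subalgebra (g' \<phi>) (g'_c \<phi>) \<and>
           real_subalgebra (P_sub \<phi>) \<and> P_sub \<phi> \<subseteq> g_re \<and>
           real_subalgebra (preimage_c \<phi>) \<and> preimage_c \<phi> \<subseteq> g_re \<and>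
           signature (g' \<phi>) (P_sub \<phi>) = signature g_re (P_sub \<phi>)"
  proof
    fix \<phi> assume "\<phi> \<in> {id, phi_t, phi_23, phi_H, phi_23 \<circ> phi_t, phi_H \<circ> phi_t,
                phi_23 \<circ> phi_H, phi_23 \<circ> phi_H \<circ> phi_t}"
    moreover have "\<forall>\<phi> \<in> {id, phi_t, phi_23, phi_H, phi_23 \<circ> phi_t, phi_H \<circ> phi_t,
                phi_23 \<circ> phi_H, phi_23 \<circ> phi_H \<circ> phi_t}. \<exists>a b c \<kappa>. realizes \<phi> a b c \<kappa>"
      unfolding ball_simps by (intro conjI TrueI; rule exI, rule exI, rule exI, rule phi_realized)
    ultimately have "\<exists>a b c \<kappa>. realizes \<phi> a b c \<kappa>" by (rule bspec[rotated])
    then obtain a b c \<kappa> where r: "realizes \<phi> a b c \<kappa>" by blast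
    show "is_real_form g_cx (g' \<phi>) \<and> maximal_compact_subalgebra (g' \<phi>) (g'_c \<phi>) \<and>
           real_subalgebra (P_sub \<phi>) \<and> P_sub \<phi> \<subseteq> g_re \<and>
           real_subalgebra (preimage_c \<phi>) \<and> preimage_c \<phi> \<subseteq> g_re \<and>
           signature (g' \<phi>) (P_sub \<phi>) = signature g_re (P_sub \<phi>)"
      by (intro conjI realized_facts[OF r])
  qed
  show ?thesis unfolding Let_def
    by (intro conjI decompositions E6_type all;
        (rule exI[of _ su3O], rule exI[of _ su21O], rule exI[of _ sl2O], rule exI[of _ sl3H],
         rule exI[of _ sl21H], rule exI[of _ su31H1], rule exI[of _ su31H2],
         intro conjI; (rule types dim_u1 sg | simp only: em sums)))
qed

end
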